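(* Let $p\ge 5$ be a prime and let $k$ be a finite field with $q$ elements, $q$ a power of $p$. For $g\ge 1$ put $$Z_g(q)=\sum_{[(C,\iota)]} \frac{1}{|\mathrm{Cent}_{\mathrm{Aut}_k(C)}\langle\iota\rangle|},$$ the sum running over the $k$-isomorphism classes of Artin--Schreier curves with automorphism $(C,\iota)$ over $k$ such that $C$ has genus $g$. Then $$Z_g(q)=\begin{cases} 1 & \text{if } g=1\cdot(p-1)/2,\\ 2q-1 & \text{if } g=2(p-1)/2,\\ 2q^2-q & \text{if } g=3(p-1)/2,\\ 3q^3-3q^2 & \text{if } g=4(p-1)/2,\ p=5,\\ 4q^3-3q^2 & \text{if } g=4(p-1)/2,\ p\ge 7,\\ 3q^4-3q^3+q^2 & \text{if } g=5(p-1)/2,\ p=5,\\ 4q^4-4q^3+q^2 & \text{if } g=5(p-1)/2,\ p\ge 7. \end{cases}$$ More precisely, writing $Z_R(q)$ for the same sum restricted to classes with ramification data $R$, the possible ramification data and their contributions are: for $g=(p-1)/2$: $Z_{\{3\}}=1$; for $g=2(p-1)/2$: $Z_{\{2,2\}}=q-1$, $Z_{\{4\}}=q$; for $g=3(p-1)/2$: $Z_{\{2,3\}}=q^2-q$, $Z_{\{5\}}=q^2$; for $g=4(p-1)/2$: $Z_{\{2,2,2\}}=Z_{\{2,4\}}=Z_{\{3,3\}}=q^3-q^2$, and (only if $p\ge7$) $Z_{\{6\}}=q^3$; for $g=5(p-1)/2$: $Z_{\{2,2,3\}}=q^4-2q^3+q^2$, $Z_{\{2,5\}}=Z_{\{3,4\}}=q^4-q^3$,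 and $Z_{\{7\}}=q^3$ if $p=5$, $Z_{\{7\}}=q^4$ if $p\ge 7$.
   Context: Let $\mathrm{AS}(k(x))=\{z^p-z: z\in k(x)\}$. An Artin--Schreier curve with automorphism over $k$ is a pair $(C,\iota)$ where $C$ is the smooth projective geometrically irreducible curve over $k$ with affine equation $y^p-y=u(x)$ for some $u(x)\in k(x)\setminus \mathrm{AS}(k(x))$, and $\iota$ is the order-$p$ automorphism $(x,y)\mapsto(x,y+1)$; the map $\pi:(x,y)\mapsto x$ is a Galois degree-$p$ cover $C\to\mathbb P^1$. Two such pairs $(C_1,\iota_1),(C_2,\iota_2)$ are $k$-isomorphic if there is a $k$-isomorphism $\varphi:C_1\to C_2$ with $\iota_2\circ\varphi=\varphi\circ\iota_1$ (equivalently $u_2(x)\equiv u_1(\gamma(x)) \bmod \mathrm{AS}(k(x))$ for some $\gamma\in\mathrm{PGL}_2(k)$ acting on $x$ by a fractional linear transformation). $\mathrm{Cent}_{\mathrm{Aut}_k(C)}\langle\iota\rangle$ is the centralizer of $\langle\iota\rangle$ in the group of $k$-automorphisms of $C$. Ramification data: after replacing $u$ by an $\mathrm{AS}(k(x))$-equivalent function one may assume every pole of $u$ in $\mathbb P^1(\bar k)$ has order prime to $p$; if $e_Q$ is the order of the pole at $Q$, the ramification data is the multiset $R=\{e_Q+1\}$ over the poles $Q$; its entries are $\ge2$ and $\not\equiv 1 \bmod p$, and the genus is $g=(p-1)(\sum_{\epsilon\in R}\epsilon-2)/2$. *)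

theory Defs
  imports
    "HOL-Algebra.Algebra"
    "HOL-Algebra.Algebraic_Closure_Type"
    "HOL-Computational_Algebra.Computational_Algebra"
begin

section \<open>Function fields of one variable and their curves\<close>

text \<open>
  A smooth projective curve over a field \<open>k\<close> is given by its function field \<open>K\<close>, a ring in the
  sense of HOL-Algebra whose carrier contains the constants \<open>k\<close>. Morphisms of curves correspond
  contravariantly to homomorphisms of function fields over \<open>k\<close>, and the closed points of the curve
  are the valuation rings of \<open>K\<close> over \<open>k\<close>.
\<close>

definition closed_points :: "'a set \<Rightarrow> 'a ring \<Rightarrow> 'a set set" where
  "closed_points k K =
     {V. subring V K \<and> k \<subseteq> V \<and> V \<noteq> carrier K \<and>
         (\<forall>f\<in>carrier K - {\<zero>\<^bsub>K\<^esub>}. f \<in> V \<or> inv\<^bsub>K\<^esub> f \<in> V)}"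

text \<open>
  Repartitions (pre-adeles): families of functions indexed by the closed points, regular at almost
  all of them.
\<close>

definition repartitions :: "'a set \<Rightarrow> 'a ring \<Rightarrow> ('a set \<Rightarrow> 'a) set" where
  "repartitions k K =
     {r \<in> closed_points k K \<rightarrow> carrier K. finite {V \<in> closed_points k K. r V \<notin> V}}"

text \<open>
  The genus is the \<open>k\<close>-dimension of \<open>H\<^sup>1(C, \<O>\<^sub>C) = A / (A(0) + K)\<close> (Weil, Serre), where \<open>A\<close> is
  the space of repartitions, \<open>A(0)\<close> the subspace of everywhere regular ones, and \<open>K\<close> is embedded
  diagonally. Below, \<open>\<omega> 0, \<dots>, \<omega> (g - 1)\<close> represent a \<open>k\<close>-basis of that quotient: every
  repartition is congruent modulo \<open>A(0) + K\<close> to exactly one \<open>k\<close>-linear combination of them.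
\<close>

definition has_genus :: "'a set \<Rightarrow> 'a ring \<Rightarrow> nat \<Rightarrow> bool" where
  "has_genus k K g \<longleftrightarrow>
     (\<exists>\<omega>. (\<forall>i<g. \<omega> i \<in> repartitions k K) \<and>
        (\<forall>r\<in>repartitions k K. \<exists>!c. c \<in> {..<g} \<rightarrow>\<^sub>E k \<and>
           (\<exists>f\<in>carrier K. \<forall>V\<in>closed_points k K.
              r V \<ominus>\<^bsub>K\<^esub> (\<Oplus>\<^bsub>K\<^esub>i\<in>{..<g}. c i \<otimes>\<^bsub>K\<^esub> \<omega> i V) \<ominus>\<^bsub>K\<^esub> f \<in> V)))"

text \<open>
  \<open>Aut\<^sub>k(C)\<close>, written through the action on functions (hence with the opposite multiplication, which
  affects neither centralizers nor their orders).
\<close>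

definition aut_group :: "'a set \<Rightarrow> 'a ring \<Rightarrow> ('a \<Rightarrow> 'a) monoid" where
  "aut_group k K =
     \<lparr>carrier = {\<phi> \<in> ring_iso K K. \<phi> \<in> extensional (carrier K) \<and> (\<forall>c\<in>k. \<phi> c = c)},
      monoid.mult = FuncSet.compose (carrier K),
      monoid.one = (\<lambda>f\<in>carrier K. f)\<rparr>"

definition centralizer :: "('a, 'b) monoid_scheme \<Rightarrow> 'a set \<Rightarrow> 'a set" where
  "centralizer G H = {a \<in> carrier G. \<forall>h\<in>H. a \<otimes>\<^bsub>G\<^esub> h = h \<otimes>\<^bsub>G\<^esub> a}"

text \<open>
  A curve with automorphism is a pair of a function field and the pullback \<open>\<iota>\<^sup>*\<close>. An isomorphism
  \<open>C\<^sub>1 \<rightarrow> C\<^sub>2\<close> is an isomorphism \<open>\<phi>\<close> of function fields in the other direction.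
\<close>

type_synonym 'a curve_aut = "'a ring \<times> ('a \<Rightarrow> 'a)"

definition curve_aut_isomorphic :: "'a set \<Rightarrow> 'a curve_aut \<Rightarrow> 'a curve_aut \<Rightarrow> bool" where
  "curve_aut_isomorphic k C1 C2 \<longleftrightarrow>
     (\<exists>\<phi>\<in>ring_iso (fst C2) (fst C1).
        (\<forall>c\<in>k. \<phi> c = c) \<and>
        (\<forall>f\<in>carrier (fst C2). \<phi> (snd C2 f) = snd C1 (\<phi> f)))"


section \<open>Rational functions\<close>

type_synonym 'k ratfun = "'k poly fract"

definition num_den :: "'k::field ratfun \<Rightarrow> 'k poly \<times> 'k poly" where
  "num_den u =
     (SOME (a, b). b \<noteq> 0 \<and> Rings.coprime a b \<and> u = Fraction_Field.Fract a b)"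

definition base_change :: "'k::field ratfun \<Rightarrow> 'k alg_closure ratfun" where
  "base_change u =
     Fraction_Field.Fract (map_poly to_ac (fst (num_den u))) (map_poly to_ac (snd (num_den u)))"

text \<open>The projective line is the option type, with \<open>None\<close> the point at infinity.\<close>

fun pole_order :: "'k::field option \<Rightarrow> 'k ratfun \<Rightarrow> nat" where
  "pole_order (Some a) u = Polynomial.order a (snd (num_den u))"
| "pole_order None u = Polynomial.degree (fst (num_den u)) - Polynomial.degree (snd (num_den u))"

definition AS :: "'a::field set" where
  "AS = {z ^ CHAR('a) - z | z. True}"


section \<open>Artin--Schreier curves\<close>

definition AS_poly :: "'a::field \<Rightarrow> 'a poly" where
  "AS_poly u = Polynomial.monom 1 CHAR('a) - Polynomial.monom 1 1 - [:u:]"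

text \<open>
  The function field \<open>k(x)[Y] / (Y\<^sup>p - Y - u)\<close>, realised on the polynomials in \<open>Y\<close> of degree less
  than \<open>p\<close>.
\<close>

definition AS_field :: "'k::field ratfun \<Rightarrow> 'k ratfun poly ring" where
  "AS_field u =
     \<lparr>carrier = {f. Polynomial.degree f < CHAR('k)},
      monoid.mult = (\<lambda>f g. (f * g) mod AS_poly u),
      monoid.one = 1,
      ring.zero = 0,
      ring.add = (+)\<rparr>"

definition constants :: "'k::field ratfun poly set" where
  "constants = range (\<lambda>c. [:Fraction_Field.Fract [:c:] 1:])"

definition AS_aut :: "'k::field ratfun poly \<Rightarrow> 'k ratfun poly" where
  "AS_aut = (\<lambda>f\<in>{f. Polynomial.degree f < CHAR('k)}. f \<circ>\<^sub>p [:1, 1:])"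

definition AS_curve :: "'k::field ratfun \<Rightarrow> 'k ratfun poly curve_aut" where
  "AS_curve u = (AS_field u, AS_aut)"

text \<open>
  The second condition is geometric irreducibility; it excludes precisely the \<open>u\<close> that are
  congruent to a constant modulo \<open>AS\<close>.
\<close>

definition AS_curves :: "'k::field ratfun poly curve_aut set" where
  "AS_curves =
     {AS_curve u | u. u \<notin> AS \<and> Factorial_Ring.irreducible (AS_poly (base_change u))}"

definition has_ramification_data :: "'k::field ratfun poly curve_aut \<Rightarrow> nat multiset \<Rightarrow> bool" where
  "has_ramification_data C R \<longleftrightarrow>
     (\<exists>u v. C = AS_curve u \<and> v - u \<in> AS \<and>
        (\<forall>Q. pole_order Q (base_change v) > 0 \<longrightarrow>
           Rings.coprime (pole_order Q (base_change v)) CHAR('k)) \<and>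
        R = image_mset (\<lambda>Q. pole_order Q (base_change v) + 1)
              (mset_set {Q. pole_order Q (base_change v) > 0}))"


section \<open>Weighted counts\<close>

definition iso_classes :: "'k::field ratfun poly curve_aut set \<Rightarrow> 'k ratfun poly curve_aut set set"
  where
  "iso_classes A =
     A // {(C, D). C \<in> AS_curves \<and> D \<in> AS_curves \<and> curve_aut_isomorphic constants C D}"

definition weight :: "'k::field ratfun poly curve_aut \<Rightarrow> real" where
  "weight C =
     (let G = aut_group constants (fst C)
      in 1 / real (card (centralizer G (generate G {snd C}))))"

definition weighted_count :: "'k::field ratfun poly curve_aut set \<Rightarrow> real" where
  "weighted_count A = (\<Sum>c\<in>iso_classes A. weight (SOME C. C \<in> c))"

definition Z_genus :: "'k::field itself \<Rightarrow> nat \<Rightarrow> real" where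
  "Z_genus _ g =
     weighted_count {C \<in> (AS_curves :: 'k ratfun poly curve_aut set). has_genus constants (fst C) g}"

definition Z_ram :: "'k::field itself \<Rightarrow> nat multiset \<Rightarrow> real" where
  "Z_ram _ R =
     weighted_count {C \<in> (AS_curves :: 'k ratfun poly curve_aut set). has_ramification_data C R}"

definition ramification_data_of_genus :: "'k::field itself \<Rightarrow> nat \<Rightarrow> nat multiset set" where
  "ramification_data_of_genus _ g =
     {R. \<exists>C \<in> (AS_curves :: 'k ratfun poly curve_aut set).
           has_genus constants (fst C) g \<and> has_ramification_data C R}"

end

theory Submission
  imports Defs
begin

text \<open>
  Over the algebraic closure every rational function is a constant plus its principal parts, and
  subtracting elements \<open>z ^ p - z\<close> removes the terms whose exponent is divisible by \<open>p\<close>. So, modulo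
  constants, the classes of \<open>k(x)\<close> modulo \<open>AS\<close> correspond to the finite families of such reduced
  principal parts that are equivariant under Frobenius. An isomorphism between two pairs is a
  substitution from \<open>PGL\<^sub>2(k)\<close> matching the classes together with a translation of \<open>y\<close>; by
  orbit counting, the weighted number of curves with given ramification data is the number of
  equivariant families of that type divided by \<open>q ^ 3 - q\<close>. The families are counted by
  splitting off one Frobenius orbit of poles at a time.

  For the genus, an element \<open>a\<^sub>0 + \<dots> + a\<^sub>p\<^sub>-\<^sub>1 y ^ (p - 1)\<close> is integral above \<open>Q\<close> iff \<open>a\<^sub>i\<close> vanishes
  at \<open>Q\<close> to order at least \<open>i e / p\<close>, where \<open>e\<close> is the order of the pole of the reduced \<open>u\<close>. Hence
  \<open>H\<^sup>1\<close> of the curve is a direct sum of groups \<open>H\<^sup>1(P\<^sup>1, \<O>(- D\<^sub>i))\<close>, whose dimensions are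
  \<open>deg D\<^sub>i - 1\<close> for \<open>i > 0\<close> and \<open>0\<close> for \<open>i = 0\<close>.
\<close>

hide_const (open) Polynomials.degree Polynomials.lead_coeff Divisibility.prime Divisibility.irreducible
 Coset.order Multiset.mult up_ring.coeff up_ring.monom module.smult

section \<open>Rational functions and their valuations\<close>

text \<open>The prime p enters the weights twice and cancels. The centralizer of
  \<open>\<iota>\<close> consists of pairs \<open>(\<gamma>, b)\<close> with p choices of
  \<open>b\<close> for each stabilizing \<open>\<gamma>\<close>; on the other hand each equivariant
  family stands for p classes modulo \<open>AS\<close>, its twists by constants, because
  \<open>z \<mapsto> z^p - z\<close> has a kernel of order p on k. Only the order q^3 - q of
  PGL_2(k) is left as denominator. Poles need not be rational, and this shapes the count: an orbit
  of m conjugate poles carries one principal part with coefficients in the field of q^m elements,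
  and poles of equal order can be interchanged, so what is counted are pairs of a family and one of
  its poles. The genus is defined through all valuation rings of the function field, so these have
  to be found. The field is realised inside an algebraic closure of k(x); every closed point is
  shown to lie above a point of the line, and existence, finiteness and weak approximation are
  proved for the closed points above a given one. The genus formula then results from pairing i with
  p - i, since the divisors D_i and D_(p-i) together have multiplicity e + 1 at each pole.\<close>

locale fhom =
 fixes h :: "'a::field \<Rightarrow> 'b::field"
 assumes h_1 [simp]: "h 1 = 1"
  and h_add [simp]: "h (x + y) = h x + h y"
  and h_mult [simp]: "h (x * y) = h x * h y"
begin

lemma h_0 [simp]: "h 0 = 0" using h_add[of 0 0] by (metis add_0 add_cancel_right_right)

lemma h_uminus [simp]: "h (- x) = - h x"
 using h_add[of x "- x"] by (simp add: eq_neg_iff_add_eq_0 add.commute)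

lemma h_diff [simp]: "h (x - y) = h x - h y" using h_add[of x "- y"] by simp

lemma h_eq_0_iff [simp]: "h x = 0 \<longleftrightarrow> x = 0"
proof
 assume "h x = 0"
 then show "x = 0" using h_mult[of x "inverse x"] h_1 by (metis mult_zero_left right_inverse zero_neq_one)
qed simp

lemma h_eq_iff [simp]: "h x = h y \<longleftrightarrow> x = y" using h_eq_0_iff[of "x - y"] by simp

lemma h_inverse [simp]: "h (inverse x) = inverse (h x)"
 by (metis h_0 h_1 h_eq_0_iff h_mult inverse_unique inverse_zero right_inverse)

lemma h_divide [simp]: "h (x / y) = h x / h y" by (simp add: divide_inverse)

lemma h_power [simp]: "h (x ^ n) = h x ^ n" by (induction n) auto

lemma h_sum: "h (sum f A) = (\<Sum>i\<in>A. h (f i))" by (induction A rule: infinite_finite_induct) auto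

lemma h_of_nat [simp]: "h (of_nat n) = of_nat n" by (induction n) auto

lemma map_add [simp]: "map_poly h (P + Q) = map_poly h P + map_poly h Q"
 by (rule poly_eqI) (simp add: coeff_map_poly)

lemma map_diff [simp]: "map_poly h (P - Q) = map_poly h P - map_poly h Q"
 by (rule poly_eqI) (simp add: coeff_map_poly)

lemma map_uminus [simp]: "map_poly h (- P) = - map_poly h P" by (rule poly_eqI) (simp add: coeff_map_poly)

lemma map_pCons [simp]: "map_poly h (pCons a P) = pCons (h a) (map_poly h P)" by (simp add: map_poly_pCons)

lemma map_smult [simp]: "map_poly h (smult a P) = smult (h a) (map_poly h P)"
 by (rule poly_eqI) (simp add: coeff_map_poly)

lemma map_mult [simp]: "map_poly h (P * Q) = map_poly h P * map_poly h Q" by (induction P) auto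

lemma map_power [simp]: "map_poly h (P ^ n) = map_poly h P ^ n" by (induction n) auto

lemma map_monom [simp]: "map_poly h (monom a n) = monom (h a) n" by (simp add: map_poly_monom)

lemma map_sum: "map_poly h (sum f A) = (\<Sum>i\<in>A. map_poly h (f i))"
 by (induction A rule: infinite_finite_induct) auto

lemma map_prod: "map_poly h (prod f A) = (\<Prod>i\<in>A. map_poly h (f i))"
 by (induction A rule: infinite_finite_induct) auto

lemma map_eq_0_iff [simp]: "map_poly h P = 0 \<longleftrightarrow> P = 0"
 by (simp add: poly_eq_iff coeff_map_poly)

lemma map_eq_iff [simp]: "map_poly h P = map_poly h Q \<longleftrightarrow> P = Q"
 by (simp add: poly_eq_iff coeff_map_poly)

lemma degree_map [simp]: "degree (map_poly h P) = degree P" by (rule degree_map_poly) simp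

lemma coeff_map [simp]: "coeff (map_poly h P) n = h (coeff P n)" by (simp add: coeff_map_poly)

lemma h_poly: "h (poly P x) = poly (map_poly h P) (h x)" by (induction P) auto

lemma map_pcompose: "map_poly h (P \<circ>\<^sub>p Q) = map_poly h P \<circ>\<^sub>p map_poly h Q"
 by (induction P) (auto simp: pcompose_pCons)

lemma char_eq: "CHAR('b) = CHAR('a)"
proof (rule CHAR_eqI)
 show "of_nat CHAR('a) = (0::'b)" by (metis h_of_nat h_0 of_nat_CHAR)
 show "CHAR('a) dvd n" if "of_nat n = (0::'b)" for n
  using that by (metis h_of_nat h_eq_0_iff of_nat_eq_0_iff_char_dvd)
qed

end

lemma fhom_comp: "fhom g \<Longrightarrow> fhom h \<Longrightarrow> fhom (\<lambda>x. g (h x))"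
 by (simp add: fhom_def)

lemma fhom_id: "fhom (\<lambda>x. x)" by (simp add: fhom_def)

lemma fhom_to_ac: "fhom to_ac" by (simp add: fhom_def)

section \<open>The field k(x): constants, the variable, fractions in lowest terms\<close>

definition cst :: "'a::field \<Rightarrow> 'a ratfun" where
 "cst c = to_fract [:c:]"

definition ratX :: "'a::field ratfun" where
 "ratX = to_fract [:0, 1:]"

interpretation cst: fhom "cst :: 'a::field \<Rightarrow> 'a ratfun"
proof
 fix x y :: 'a
 show "cst (x + y) = cst x + cst y" unfolding cst_def to_fract_add[symmetric] by simp
 show "cst (x * y) = cst x * cst y" unfolding cst_def to_fract_mult[symmetric] by simp
 show "cst 1 = (1 :: 'a ratfun)" unfolding cst_def by (simp flip: one_pCons)
qed

lemma CHAR_ratfun [simp]: "CHAR('a::field ratfun) = CHAR('a)" by (rule cst.char_eq)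

lemma poly_map_cst [simp]: "poly (map_poly cst P) ratX = to_fract P"
proof (induction P)
 case (pCons a P)
 have "to_fract (pCons a P) = to_fract ([:a:] + [:0, 1:] * P)" by simp
 also have "\<dots> = cst a + ratX * to_fract P" unfolding to_fract_add to_fract_mult cst_def ratX_def ..
 finally show ?case using pCons by simp
qed simp

text \<open>Euclid's algorithm, passing from \<open>(a, b)\<close> to \<open>(b, a mod b)\<close>.
  It yields a common divisor that is a combination of \<open>a\<close> and \<open>b\<close>; over an
  arbitrary field this serves as the gcd.\<close>

lemma poly_bezout_aux:
 fixes a b :: "'a::field poly"
 shows "\<exists>u v. (u * a + v * b) dvd a \<and> (u * a + v * b) dvd b"
\<comment> \<open>The measure separates \<open>b = 0\<close> from a nonzero constant
  \<open>b\<close>, since both have degree 0.\<close>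
proof (induction "if b = 0 then 0 else Suc (degree b)" arbitrary: a b rule: less_induct)
 case less
 show ?case
 proof (cases "b = 0")
  case True
  then show ?thesis by (intro exI[of _ 1]) auto
 next
  case False
  have "a mod b = 0 \<or> degree (a mod b) < degree b" using False by (rule degree_mod_less)
  then have "\<exists>u v. (u * b + v * (a mod b)) dvd b \<and> (u * b + v * (a mod b)) dvd (a mod b)"
   using less[of "a mod b" b] False by auto
  then obtain u v where uv: "(u * b + v * (a mod b)) dvd b" "(u * b + v * (a mod b)) dvd (a mod b)" by blast
  have "u * b + v * (a mod b) = v * a + (u - v * (a div b)) * b"
   by (simp add: minus_mult_div_eq_mod[symmetric] algebra_simps)
  moreover have "(u * b + v * (a mod b)) dvd a" using uv by (metis dvd_add dvd_mult2 mult_div_mod_eq)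
  ultimately show ?thesis using uv by metis
 qed
qed

lemma poly_bezout:
 fixes a b :: "'a::field poly"
 assumes "coprime a b"
 obtains u v where "u * a + v * b = 1"
proof -
 obtain u v where "(u * a + v * b) dvd a" "(u * a + v * b) dvd b" using poly_bezout_aux by blast
 with assms have "(u * a + v * b) dvd 1" by (meson not_coprimeE coprime_common_divisor)
 then obtain c where "1 = (u * a + v * b) * c" by (elim dvdE)
 then have "(c * u) * a + (c * v) * b = 1" by (simp add: algebra_simps)
 then show ?thesis using that by blast
qed

lemma poly_gcd_exists:
 fixes a b :: "'a::field poly"
 assumes "b \<noteq> 0"
 obtains g a' b' u v where "a = g * a'" "b = g * b'" "u * a' + v * b' = 1" "g \<noteq> 0"
proof -
 obtain u v where uv: "(u * a + v * b) dvd a" "(u * a + v * b) dvd b" using poly_bezout_aux by blast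
 define g where "g = u * a + v * b"
 obtain a' b' where ab: "a = g * a'" "b = g * b'" using uv unfolding g_def by (elim dvdE)
 have "g \<noteq> 0" using ab assms by auto
 moreover have "g * (u * a' + v * b') = g * 1"
 proof -
  have "g * (u * a' + v * b') = u * (g * a') + v * (g * b')" by (simp add: algebra_simps)
  then show ?thesis unfolding ab[symmetric] g_def[symmetric] by simp
 qed
 ultimately have "u * a' + v * b' = 1" by (metis mult_left_cancel)
 then show ?thesis using that ab \<open>g \<noteq> 0\<close> by blast
qed

lemma coprime_if_bezout:
 fixes a b :: "'a::field poly"
 assumes "u * a + v * b = 1" shows "coprime a b"
proof (rule coprimeI)
 fix c assume "c dvd a" "c dvd b"
 then have "c dvd u * a + v * b" by simp
 then show "is_unit c" using assms by simp
qed

lemma ratfun_eq_fract: "\<exists>a b. b \<noteq> 0 \<and> coprime a b \<and> u = Fraction_Field.Fract a (b :: 'a::field poly)"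
proof -
 obtain c d where u: "u = Fraction_Field.Fract c d" "d \<noteq> 0" by (rule Fract_cases)
 obtain g a b s t where g: "c = g * a" "d = g * b" "s * a + t * b = 1" "g \<noteq> 0"
  using poly_gcd_exists[OF u(2)] .
 then have "u = Fraction_Field.Fract a b" "b \<noteq> 0" using u by (auto simp: mult_fract_cancel)
 then show ?thesis using coprime_if_bezout[OF g(3)] by blast
qed

abbreviation num :: "'a::field ratfun \<Rightarrow> 'a poly" where "num u \<equiv> fst (num_den u)"
abbreviation den :: "'a::field ratfun \<Rightarrow> 'a poly" where "den u \<equiv> snd (num_den u)"

lemma num_den:
 shows den_nonzero [simp]: "den u \<noteq> 0"
  and coprime_num_den: "coprime (num u) (den u)"
  and Fract_num_den: "Fraction_Field.Fract (num u) (den u) = u"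
proof -
 have "\<exists>x. case x of (a, b) \<Rightarrow> b \<noteq> 0 \<and> coprime a b \<and> u = Fraction_Field.Fract a b"
  using ratfun_eq_fract[of u] by auto
 from someI_ex[OF this] have "case num_den u of (a, b) \<Rightarrow> b \<noteq> 0 \<and> coprime a b \<and> u = Fraction_Field.Fract a b"
  unfolding num_den_def .
 then show "den u \<noteq> 0" "coprime (num u) (den u)" "Fraction_Field.Fract (num u) (den u) = u"
  by (auto split: prod.splits)
qed

lemma ratfun_eq_div: "to_fract (num u) / to_fract (den u) = u"
 by (simp add: Fract_num_den flip: Fract_conv_to_fract)

lemma ratfun_cases:
 fixes u :: "'a::field ratfun"
 obtains a b where "b \<noteq> 0" "u = to_fract a / to_fract b"
 using ratfun_eq_div[of u] den_nonzero[of u] by metis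

lemma num_eq_0_iff [simp]: "num u = 0 \<longleftrightarrow> u = 0"
 by (metis ratfun_eq_div den_nonzero divide_eq_0_iff to_fract_eq_0_iff)

lemma num_0 [simp]: "num 0 = 0" by (metis num_eq_0_iff)

lemma cross_mult:
 assumes "u = to_fract a / to_fract b" "b \<noteq> 0"
 shows "num u * b = a * den u"
proof -
 have "to_fract (num u) / to_fract (den u) = to_fract a / to_fract b"
  using assms by (simp add: ratfun_eq_div)
 then have "to_fract (num u) * to_fract b = to_fract a * to_fract (den u)"
  using assms(2) by (subst (asm) frac_eq_eq) auto
 then have "to_fract (num u * b) = to_fract (a * den u)" by simp
 then show ?thesis unfolding to_fract_eq_iff .
qed

lemma ratfun_hom_unique:
 assumes "fhom g" "fhom h" "\<And>c. g (cst c) = h (cst c)" "g ratX = h ratX"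
 shows "g u = h u"
proof -
 interpret g: fhom g by fact
 interpret h: fhom h by fact
 have *: "g (to_fract P) = h (to_fract P)" for P
 proof -
  have "g (poly (map_poly cst P) ratX) = h (poly (map_poly cst P) ratX)"
   using assms(3,4) by (induction P) auto
  then show ?thesis by simp
 qed
 show ?thesis by (metis * g.h_divide h.h_divide ratfun_eq_div)
qed

text \<open>Substitution of \<open>t\<close> for the variable, with the coefficients moved by
  \<open>h\<close>. Base change, Frobenius on coefficients and Moebius substitutions are all of this
  form; it is a homomorphism once \<open>t\<close> satisfies no polynomial relation.\<close>

definition rmap :: "('a::field \<Rightarrow> 'b::field) \<Rightarrow> 'b \<Rightarrow> 'a ratfun \<Rightarrow> 'b" where
 "rmap h t u = poly (map_poly h (num u)) t / poly (map_poly h (den u)) t"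

locale ratfun_hom = fhom h for h :: "'a::field \<Rightarrow> 'b::field" +
 fixes t :: 'b
 assumes transcendental: "poly (map_poly h P) t = 0 \<Longrightarrow> P = 0"
begin

lemma rmap_frac:
 assumes "b \<noteq> 0"
 shows "rmap h t (to_fract a / to_fract b) = poly (map_poly h a) t / poly (map_poly h b) t"
proof -
 let ?u = "to_fract a / to_fract b"
 have "poly (map_poly h (num ?u * b)) t = poly (map_poly h (a * den ?u)) t"
  using cross_mult[OF refl assms] by simp
 moreover have "poly (map_poly h b) t \<noteq> 0" "poly (map_poly h (den ?u)) t \<noteq> 0"
  using transcendental assms den_nonzero by blast+
 ultimately show ?thesis unfolding rmap_def by (simp add: field_simps)
qed

lemma rmap_to_fract: "rmap h t (to_fract a) = poly (map_poly h a) t" using rmap_frac[of 1 a] by simp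

lemma rmap_cst [simp]: "rmap h t (cst c) = h c" by (simp add: cst_def rmap_to_fract)

lemma rmap_X [simp]: "rmap h t ratX = t" by (simp add: ratX_def rmap_to_fract)

lemma rmap_fhom: "fhom (rmap h t)"
proof
 show "rmap h t 1 = 1" using rmap_to_fract[of 1] by simp
 fix u v :: "'a ratfun"
 obtain a b where u: "b \<noteq> 0" "u = to_fract a / to_fract b" by (rule ratfun_cases)
 obtain c d where v: "d \<noteq> 0" "v = to_fract c / to_fract d" by (rule ratfun_cases)
 have nz: "poly (map_poly h b) t \<noteq> 0" "poly (map_poly h d) t \<noteq> 0"
  using transcendental u v by auto
 have "u + v = to_fract (a * d + c * b) / to_fract (b * d)" "u * v = to_fract (a * c) / to_fract (b * d)"
  using u v by (simp_all add: field_simps)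
 then have e1: "rmap h t (u + v) = poly (map_poly h (a * d + c * b)) t / poly (map_poly h (b * d)) t"
  "rmap h t (u * v) = poly (map_poly h (a * c)) t / poly (map_poly h (b * d)) t"
  using rmap_frac u v by (metis mult_eq_0_iff)+
 have e2: "rmap h t u = poly (map_poly h a) t / poly (map_poly h b) t"
  "rmap h t v = poly (map_poly h c) t / poly (map_poly h d) t" using u v rmap_frac by simp_all
 show "rmap h t (u + v) = rmap h t u + rmap h t v" "rmap h t (u * v) = rmap h t u * rmap h t v"
  unfolding e1 e2 using nz by (simp_all add: field_simps)
qed

sublocale rm: fhom "rmap h t" by (rule rmap_fhom)

end

lemma ratfun_hom_ratX:
 assumes "fhom h" shows "ratfun_hom (\<lambda>c. cst (h c)) ratX"
proof -
 interpret h: fhom h by fact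
 interpret ch: fhom "\<lambda>c. cst (h c)" by (rule fhom_comp[OF cst.fhom_axioms assms])
 show ?thesis
 proof
  fix P assume "poly (map_poly (\<lambda>c. cst (h c)) P) ratX = 0"
  moreover have "map_poly (\<lambda>c. cst (h c)) P = map_poly cst (map_poly h P)" by (rule poly_eqI) simp
  ultimately show "P = 0" by simp
 qed
qed

text \<open>The valuation at a point of the projective line; its value at 0 is junk.\<close>

fun val :: "'a::field option \<Rightarrow> 'a ratfun \<Rightarrow> int" where
 "val (Some a) u = int (order a (num u)) - int (order a (den u))"
| "val None u = int (degree (den u)) - int (degree (num u))"

text \<open>Orders and degrees are additive on products, so cross-multiplying with the fraction in
  lowest terms gives the same difference. Any representation as a fraction may be used from here
  on.\<close>

lemma val_frac:
 assumes "a \<noteq> 0" "b \<noteq> 0"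
 shows "val (Some z) (to_fract a / to_fract b) = int (order z a) - int (order z b)"
  and "val None (to_fract a / to_fract b) = int (degree b) - int (degree a)"
proof -
 let ?u = "to_fract a / to_fract b"
 have *: "num ?u * b = a * den ?u" by (rule cross_mult[OF refl assms(2)])
 have "?u \<noteq> 0" using assms by simp
 then have "num ?u \<noteq> 0" by (metis num_eq_0_iff)
 then have "order z (num ?u) + order z b = order z a + order z (den ?u)"
  "degree (num ?u) + degree b = degree a + degree (den ?u)"
  using assms arg_cong[OF *, of "order z"] arg_cong[OF *, of degree]
  by (simp_all add: order_mult degree_mult_eq)
 then show "val (Some z) ?u = int (order z a) - int (order z b)"
  "val None ?u = int (degree b) - int (degree a)" by simp_all
qed

lemma val_to_fract:
 assumes "a \<noteq> 0"
 shows "val (Some z) (to_fract a) = int (order z a)"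
  and "val None (to_fract a) = - int (degree a)" using val_frac[OF assms, of 1] by simp_all

declare val.simps [simp del]

lemma val_mult: "u \<noteq> 0 \<Longrightarrow> v \<noteq> 0 \<Longrightarrow> val Q (u * v) = val Q u + val Q v"
proof -
 assume "u \<noteq> 0" "v \<noteq> 0"
 moreover obtain a b where u: "b \<noteq> 0" "u = to_fract a / to_fract b" by (rule ratfun_cases)
 moreover obtain c d where v: "d \<noteq> 0" "v = to_fract c / to_fract d" by (rule ratfun_cases)
 ultimately have nz: "a \<noteq> 0" "c \<noteq> 0" "b \<noteq> 0" "d \<noteq> 0" by auto
 have "u * v = to_fract (a * c) / to_fract (b * d)" using u v by simp
 then show ?thesis using nz u(2) v(2) val_frac[of "a * c" "b * d"] val_frac[of a b] val_frac[of c d]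
  by (cases Q) (simp_all add: order_mult degree_mult_eq)
qed

lemma val_cst [simp]: "c \<noteq> 0 \<Longrightarrow> val Q (cst c) = 0"
 unfolding cst_def by (cases Q) (simp_all add: val_to_fract order_0I)

lemma val_1 [simp]: "val Q (1::'a::field ratfun) = 0" using val_cst[of 1 Q] by simp

lemma val_inverse: "u \<noteq> 0 \<Longrightarrow> val Q (inverse u) = - val Q u"
 using val_mult[of u "inverse u" Q] by simp

lemma val_divide: "u \<noteq> 0 \<Longrightarrow> v \<noteq> 0 \<Longrightarrow> val Q (u / v) = val Q u - val Q v"
 by (simp add: divide_inverse val_mult val_inverse)

lemma val_power: "u \<noteq> 0 \<Longrightarrow> val Q (u ^ n) = int n * val Q u"
 by (induction n) (auto simp: val_mult algebra_simps)

lemma val_uminus [simp]: "u \<noteq> 0 \<Longrightarrow> val Q (- u) = val Q u"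
 using val_mult[of "cst (-1)" u Q] val_cst[of "-1" Q] by simp

text \<open>Valuation at least \<open>n\<close>, with \<open>0\<close> having infinite valuation;
  this keeps the junk value of \<open>val\<close> at \<open>0\<close> out of the ultrametric
  inequalities.\<close>

definition vge :: "'a::field option \<Rightarrow> int \<Rightarrow> 'a ratfun \<Rightarrow> bool" where
 "vge Q n u \<longleftrightarrow> u = 0 \<or> val Q u \<ge> n"

lemma vge_0 [simp]: "vge Q n 0" by (simp add: vge_def)

lemma vge_mult: "vge Q m u \<Longrightarrow> vge Q n v \<Longrightarrow> vge Q (m + n) (u * v)"
 by (auto simp: vge_def val_mult)

lemma vge_mono: "vge Q m u \<Longrightarrow> n \<le> m \<Longrightarrow> vge Q n u" by (auto simp: vge_def)

lemma vge_add: assumes "vge Q n u" "vge Q n v" shows "vge Q n (u + v)"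
proof (cases "u = 0 \<or> v = 0 \<or> u + v = 0")
 case False
 obtain a b where u: "b \<noteq> 0" "u = to_fract a / to_fract b" by (rule ratfun_cases)
 obtain c d where v: "d \<noteq> 0" "v = to_fract c / to_fract d" by (rule ratfun_cases)
 have nz: "a \<noteq> 0" "c \<noteq> 0" using False u v by auto
 have uv: "u + v = to_fract (a * d + c * b) / to_fract (b * d)" using u v by (simp add: field_simps)
 have nz': "a * d + c * b \<noteq> 0" using False uv by (metis divide_eq_0_iff to_fract_0)
 show ?thesis
 proof (cases Q)
  case (Some z)
  have "min (order z (a * d)) (order z (c * b)) \<le> order z (a * d + c * b)"
  proof -
   define m where "m = min (order z (a * d)) (order z (c * b))"
   have "[:- z, 1:] ^ m dvd a * d" "[:- z, 1:] ^ m dvd c * b"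
    unfolding m_def by (simp_all add: order_divides)
   then have "[:- z, 1:] ^ m dvd a * d + c * b" by simp
   then show ?thesis using nz' by (simp add: order_divides flip: m_def)
  qed
  moreover have "val Q u = int (order z a) - int (order z b)"
   "val Q v = int (order z c) - int (order z d)" using u v nz val_frac Some by auto
  moreover have "val Q (u + v) = int (order z (a * d + c * b)) - int (order z (b * d))"
   unfolding uv Some using u v nz' by (intro val_frac) auto
  ultimately show ?thesis using assms nz u(1) v(1) False by (auto simp: vge_def order_mult)
 next
  case None
  have "degree (a * d + c * b) \<le> max (degree (a * d)) (degree (c * b))" by (rule degree_add_le_max)
  moreover have "val Q u = int (degree b) - int (degree a)"
   "val Q v = int (degree d) - int (degree c)" using u v nz val_frac None by auto
  moreover have "val Q (u + v) = int (degree (b * d)) - int (degree (a * d + c * b))"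
   unfolding uv None using u v nz' by (intro val_frac) auto
  ultimately show ?thesis using assms nz u(1) v(1) False by (auto simp: vge_def degree_mult_eq)
 qed
qed (use assms in auto)

lemma vge_uminus [simp]: "vge Q n (- u) \<longleftrightarrow> vge Q n u"
 by (cases "u = 0") (auto simp: vge_def)

lemma vge_diff: "vge Q n u \<Longrightarrow> vge Q n v \<Longrightarrow> vge Q n (u - v)"
 using vge_add[of Q n u "- v"] by simp

lemma vge_sum: "(\<And>i. i \<in> A \<Longrightarrow> vge Q n (f i)) \<Longrightarrow> vge Q n (sum f A)"
 by (induction A rule: infinite_finite_induct) (auto simp: vge_add)

lemma vge_cst: "n \<le> 0 \<Longrightarrow> vge Q n (cst c)" by (cases "c = 0") (auto simp: vge_def)

lemma vge_prod: "(\<And>i. i \<in> A \<Longrightarrow> vge Q 0 (f i)) \<Longrightarrow> vge Q 0 (prod f A)"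
proof (induction A rule: infinite_finite_induct)
 case (insert x F)
 then show ?case using vge_mult[of Q 0 "f x" 0 "prod f F"] by simp
qed (auto simp: vge_def)

lemma vge_power: "vge Q 0 u \<Longrightarrow> vge Q 0 (u ^ n)"
 using vge_prod[of "{..<n}" Q "\<lambda>_. u"] by simp

text \<open>Were the valuation of the sum larger, so would be that of
  \<open>u = (u + v) - v\<close>. This sharp case of the ultrametric inequality is what reads off
  pole orders.\<close>

lemma val_add_dominant:
 assumes "u \<noteq> 0" "vge Q (val Q u + 1) v"
 shows "u + v \<noteq> 0" "val Q (u + v) = val Q u"
proof -
 show nz: "u + v \<noteq> 0"
 proof
  assume "u + v = 0"
  then have "v = - u" by (simp add: eq_neg_iff_add_eq_0 add.commute)
  then show False using assms by (auto simp: vge_def)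
 qed
 have "vge Q (val Q u) (u + v)" using vge_add[of Q "val Q u" u v] assms by (auto simp: vge_def)
 moreover have "\<not> vge Q (val Q u + 1) (u + v)"
  using vge_diff[of Q "val Q u + 1" "u + v" v] assms by (auto simp: vge_def)
 ultimately show "val Q (u + v) = val Q u" using nz by (auto simp: vge_def)
qed

text \<open>In lowest terms numerator and denominator have no common zero, so at a finite point at
  most one of the two orders in \<open>val\<close> is nonzero. At infinity the truncated difference
  of degrees is already the negative part of the valuation.\<close>

lemma pole_order_eq:
 fixes u :: "'a::field ratfun"
 shows "pole_order Q u = (if u = 0 then 0 else nat (- val Q u))"
proof (cases Q)
 case None
 have "degree (num (0 :: 'a ratfun)) = 0" by (metis num_eq_0_iff degree_0)
 then show ?thesis using None by (auto simp: nat_diff_distrib val.simps)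
next
 case (Some z)
 show ?thesis
 proof (cases "poly (den u) z = 0")
  case True
  obtain s t where "s * num u + t * den u = 1" using poly_bezout[OF coprime_num_den] .
  then have "poly (s * num u + t * den u) z = 1" by simp
  then have "poly (num u) z \<noteq> 0" using True by auto
  then show ?thesis using Some order_0I[of "num u" z] by (auto simp: val.simps)
 next
  case False
  then show ?thesis using Some order_0I[of "den u" z] by (auto simp: val.simps)
 qed
qed

lemma pole_order_0_iff: "pole_order Q u = 0 \<longleftrightarrow> vge Q 0 u"
 by (auto simp: pole_order_eq vge_def)

lemma val_linear:
 "val (Some b) (ratX - cst a) = (if a = b then 1 else 0)" "val None (ratX - cst a) = -1"
 "ratX - cst a \<noteq> (0 :: 'a::field ratfun)" "val None (ratX::'a ratfun) = -1" "ratX \<noteq> (0::'a ratfun)"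
 "vge (Some b) 0 ratX"
proof -
 have e: "ratX - cst a = to_fract [:-a, 1:]" for a :: 'a by (simp add: ratX_def cst_def flip: to_fract_diff)
 show "val None (ratX - cst a) = -1" "ratX - cst a \<noteq> (0 :: 'a ratfun)"
  unfolding e by (subst val_to_fract) simp_all
 have "order b [:-a, 1:] = (if a = b then 1 else 0)"
 proof (cases "a = b")
  case True
  then show ?thesis using order_power_n_n[of b 1] by simp
 qed (simp add: order_0I)
 then show "val (Some b) (ratX - cst a) = (if a = b then 1 else 0)"
  unfolding e by (subst val_to_fract) simp_all
 show nz: "ratX \<noteq> (0::'a ratfun)" by (simp add: ratX_def)
 show "val None (ratX::'a ratfun) = -1" "vge (Some b) 0 ratX"
  using nz unfolding ratX_def by (simp_all add: val_to_fract vge_def)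
qed

text \<open>A nonconstant denominator would have a root, and in lowest terms a root is a pole.
  Infinity is left unconstrained, so a polynomial of any degree may remain.\<close>

lemma const_if_no_poles:
 assumes "\<And>z. vge (Some z) 0 (u :: 'a::alg_closed_field ratfun)"
 obtains P where "u = to_fract P"
proof -
 have "degree (den u) = 0"
 proof (rule ccontr)
  assume "degree (den u) \<noteq> 0"
  then obtain z where "poly (den u) z = 0" using alg_closed_imp_poly_has_root by blast
  then have "pole_order (Some z) u > 0" using order_gt_0_iff[of "den u" z] by simp
  then show False using assms[of z] by (metis pole_order_0_iff less_irrefl)
 qed
 then obtain c where c: "den u = [:c:]" by (elim degree_eq_zeroE)
 then have "c \<noteq> 0" using den_nonzero[of u] by auto
 have "u = to_fract (num u) / cst c" using ratfun_eq_div[of u] c by (simp add: cst_def)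
 also have "\<dots> = to_fract (smult (inverse c) (num u))"
 proof -
  have "to_fract (smult (inverse c) (num u)) = to_fract ([:inverse c:] * num u)" by simp
  also have "\<dots> = cst (inverse c) * to_fract (num u)" unfolding to_fract_mult cst_def ..
  finally show ?thesis by (simp add: field_simps)
 qed
 finally show ?thesis by (rule that)
qed

section \<open>Partial fractions over an algebraically closed field\<close>

lemma ratX_neq_cst [simp]: "ratX \<noteq> cst a" "cst a \<noteq> ratX" using val_linear(3)[of a] by auto

text \<open>The inverse of a uniformizer: a simple pole at \<open>Q\<close> and no pole elsewhere. A
  principal part at \<open>Q\<close> is a polynomial in \<open>local_gen Q\<close>; at infinity this
  is a polynomial in the variable.\<close>

fun local_gen :: "'a::field option \<Rightarrow> 'a ratfun" where
 "local_gen (Some a) = inverse (ratX - cst a)"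
| "local_gen None = ratX"

definition local_term :: "'a::field option \<Rightarrow> 'a poly \<Rightarrow> 'a ratfun" where
 "local_term Q f = poly (map_poly cst f) (local_gen Q)"

lemma local_term_simps [simp]:
 "local_term Q 0 = 0" "local_term Q (f + g) = local_term Q f + local_term Q g"
 "local_term Q (f - g) = local_term Q f - local_term Q g"
 "local_term Q (f ^ n) = local_term Q f ^ n"
 "local_term Q (pCons a f) = cst a + local_gen Q * local_term Q f"
 "local_term Q (monom a n) = cst a * local_gen Q ^ n" by (simp_all add: local_term_def poly_monom)

lemma local_term_None: "local_term None f = to_fract f" by (simp add: local_term_def)

lemma local_gen_nonzero [simp]: "local_gen Q \<noteq> 0" by (cases Q) (simp_all add: val_linear)

lemma val_local_gen: "val Q (local_gen Q) = -1" by (cases Q) (simp_all add: val_linear val_inverse)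

lemma vge_local_gen_other: "Q' \<noteq> Q \<Longrightarrow> vge Q' 0 (local_gen Q)"
 by (cases Q; cases Q') (auto simp: val_linear val_inverse vge_def[of _ _ "inverse _"])

lemma val_local_term:
 "f \<noteq> 0 \<Longrightarrow> local_term Q f \<noteq> 0 \<and> val Q (local_term Q f) = - int (degree f)"
proof (induction f)
 case (pCons a g)
 show ?case
 proof (cases "g = 0")
  case True
  then show ?thesis using pCons by simp
 next
  case False
  then have g: "local_term Q g \<noteq> 0" "val Q (local_term Q g) = - int (degree g)" using pCons by auto
  define w where "w = local_gen Q * local_term Q g"
  have w: "w \<noteq> 0" "val Q w = - int (degree g) - 1"
   using g by (simp_all add: w_def val_mult val_local_gen)
  have "vge Q (val Q w + 1) (cst a)" using w by (intro vge_cst) simp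
  from val_add_dominant[OF w(1) this] show ?thesis using w False by (simp add: w_def add.commute)
 qed
qed simp

lemma vge_local_term_other: "Q' \<noteq> Q \<Longrightarrow> vge Q' 0 (local_term Q f)"
proof (induction f)
 case (pCons a g)
 then have "vge Q' (0 + 0) (local_gen Q * local_term Q g)" by (intro vge_mult vge_local_gen_other) auto
 then show ?case by (auto intro: vge_add vge_cst)
qed simp

text \<open>Zero constant coefficients force all constants into one separate summand, which makes
  the partial fraction expansion unique.\<close>

definition principal_parts :: "('a::field option \<Rightarrow> 'a poly) set" where
 "principal_parts = {c. finite {Q. c Q \<noteq> 0} \<and> (\<forall>Q. coeff (c Q) 0 = 0)}"

definition pp_sum :: "('a::field option \<Rightarrow> 'a poly) \<Rightarrow> 'a ratfun" where
 "pp_sum c = (\<Sum>Q | c Q \<noteq> 0. local_term Q (c Q))"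

lemma pp_sum_superset: "finite S \<Longrightarrow> {Q. c Q \<noteq> 0} \<subseteq> S \<Longrightarrow> pp_sum c = (\<Sum>Q\<in>S. local_term Q (c Q))"
 unfolding pp_sum_def by (rule sum.mono_neutral_left) auto

lemma pp_sum_combine:
 assumes "c \<in> principal_parts" "d \<in> principal_parts"
 shows "(\<lambda>Q. c Q + d Q) \<in> principal_parts" "pp_sum (\<lambda>Q. c Q + d Q) = pp_sum c + pp_sum d"
  and "(\<lambda>Q. c Q - d Q) \<in> principal_parts" "pp_sum (\<lambda>Q. c Q - d Q) = pp_sum c - pp_sum d"
proof -
 define S where "S = {Q. c Q \<noteq> 0} \<union> {Q. d Q \<noteq> 0}"
 have S: "finite S" using assms by (simp add: S_def principal_parts_def)
 have sub: "{Q. c Q + d Q \<noteq> 0} \<subseteq> S" "{Q. c Q - d Q \<noteq> 0} \<subseteq> S" "{Q. c Q \<noteq> 0} \<subseteq> S" "{Q. d Q \<noteq> 0} \<subseteq> S"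
  by (auto simp: S_def)
 show "(\<lambda>Q. c Q + d Q) \<in> principal_parts" "(\<lambda>Q. c Q - d Q) \<in> principal_parts"
  using assms finite_subset[OF sub(1) S] finite_subset[OF sub(2) S] by (auto simp: principal_parts_def)
 show "pp_sum (\<lambda>Q. c Q + d Q) = pp_sum c + pp_sum d" "pp_sum (\<lambda>Q. c Q - d Q) = pp_sum c - pp_sum d"
  unfolding pp_sum_superset[OF S sub(1)] pp_sum_superset[OF S sub(2)] pp_sum_superset[OF S sub(3)]
   pp_sum_superset[OF S sub(4)] by (simp_all add: sum.distrib sum_subtractf)
qed

lemma pp_zero [simp]: "(\<lambda>_. 0) \<in> principal_parts" "pp_sum (\<lambda>_. 0) = 0"
 by (simp_all add: principal_parts_def pp_sum_def)

lemma pp_single: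
 assumes "coeff f 0 = 0"
 shows "(\<lambda>_. 0)(Q := f) \<in> principal_parts" "pp_sum ((\<lambda>_. 0)(Q := f)) = local_term Q f"
proof -
 have fin: "finite {R. ((\<lambda>_. 0)(Q := f)) R \<noteq> 0}" by (rule finite_subset[of _ "{Q}"]) auto
 then show "(\<lambda>_. 0)(Q := f) \<in> principal_parts" using assms by (simp add: principal_parts_def)
 show "pp_sum ((\<lambda>_. 0)(Q := f)) = local_term Q f" by (subst pp_sum_superset[of "{Q}"]) auto
qed

text \<open>The constant and the terms attached to other points are regular at \<open>Q\<close>, so
  the term at \<open>Q\<close> dominates as soon as it is nonzero.\<close>

lemma pole_order_pp:
 assumes "c \<in> principal_parts"
 shows "pole_order Q (cst e + pp_sum c) = degree (c Q)"
proof -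
 have fin: "finite {Q. c Q \<noteq> 0}" using assms by (simp add: principal_parts_def)
 define w where "w = cst e + (\<Sum>R\<in>{Q. c Q \<noteq> 0} - {Q}. local_term R (c R))"
 have w: "vge Q 0 w" unfolding w_def by (intro vge_add vge_cst vge_sum vge_local_term_other) auto
 show ?thesis
 proof (cases "c Q = 0")
  case True
  then have "{Q. c Q \<noteq> 0} - {Q} = {Q. c Q \<noteq> 0}" by auto
  then have "cst e + pp_sum c = w" by (simp add: w_def pp_sum_def)
  then show ?thesis using w True by (simp add: pole_order_0_iff)
 next
  case False
  then have e: "cst e + pp_sum c = local_term Q (c Q) + w"
   unfolding pp_sum_def w_def using fin by (subst sum.remove[of _ Q]) (auto simp: algebra_simps)
  have "degree (c Q) > 0" using False assms unfolding principal_parts_def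
   by (metis (mono_tags, lifting) degree_eq_zeroE coeff_pCons_0 gr0I mem_Collect_eq pCons_0_0)
  then have "vge Q (val Q (local_term Q (c Q)) + 1) w"
   using val_local_term[OF False, of Q] by (intro vge_mono[OF w]) simp
  from val_add_dominant[OF _ this] show ?thesis
   unfolding e using val_local_term[OF False, of Q] by (simp add: pole_order_eq)
 qed
qed

lemma pp_zero_iff:
 assumes "c \<in> principal_parts" "cst e + pp_sum c = 0"
 shows "c = (\<lambda>_. 0)" "e = 0"
proof -
 have "c Q = 0" for Q
 proof -
  have "degree (c Q) = 0" using pole_order_pp[OF assms(1), of Q e] assms(2) by (simp add: pole_order_eq)
  moreover have "coeff (c Q) 0 = 0" using assms(1) by (simp add: principal_parts_def)
  ultimately show ?thesis by (metis degree_eq_zeroE coeff_pCons_0 pCons_0_0)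
 qed
 then show "c = (\<lambda>_. 0)" by auto
 then show "e = 0" using assms by simp
qed

lemma pp_unique:
 assumes "c \<in> principal_parts" "d \<in> principal_parts" "cst e + pp_sum c = cst e' + pp_sum d"
 shows "c = d" "e = e'"
proof -
 have "cst (e - e') + pp_sum (\<lambda>Q. c Q - d Q) = 0"
  using assms by (simp add: pp_sum_combine algebra_simps)
 from pp_zero_iff[OF pp_sum_combine(3)[OF assms(1,2)] this] show "c = d" "e = e'" by (auto simp: fun_eq_iff)
qed

text \<open>Induction on the degree of the denominator: at a root \<open>a\<close> of multiplicity
  \<open>m\<close> one multiple of \<open>1 / (x - a)^m\<close> is split off, after which numerator
  and denominator share a factor \<open>x - a\<close>. Once the denominator is constant, the
  polynomial left over is the part at infinity plus a constant.\<close>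

lemma pp_exists_aux:
 fixes N D :: "'a::alg_closed_field poly"
 assumes "D \<noteq> 0"
 shows "\<exists>e. \<exists>c\<in>principal_parts. to_fract N / to_fract D = cst e + pp_sum c" using assms
proof (induction "degree D" arbitrary: N D rule: less_induct)
 case less
 show ?case
 proof (cases "degree D = 0")
  case True
  then obtain d where d: "D = [:d:]" by (elim degree_eq_zeroE)
  then have "d \<noteq> 0" using less by auto
  define P where "P = smult (inverse d) N"
  have "N = [:d:] * P" using \<open>d \<noteq> 0\<close> by (simp add: P_def)
  then have *: "to_fract N / to_fract D = to_fract P"
   using d \<open>d \<noteq> 0\<close> by (simp only: to_fract_mult) simp
  obtain p0 P' where P: "P = pCons p0 P'" by (cases P)
  have "to_fract P = local_term None (pCons p0 P')" by (simp only: local_term_None P)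
  also have "\<dots> = cst p0 + local_term None (pCons 0 P')" by simp
  also have "local_term None (pCons 0 P') = pp_sum ((\<lambda>_. 0)(None := pCons 0 P'))"
   by (rule pp_single(2)[symmetric]) simp
  finally show ?thesis using pp_single(1)[of "pCons 0 P'" None] * by (metis coeff_pCons_0)
 next
  case False
  then obtain a where a: "poly D a = 0" using alg_closed_imp_poly_has_root by blast
  define m where "m = order a D"
  have m: "m > 0" using a less.prems by (simp add: m_def order_gt_0_iff)
  obtain D' where D: "D = [:- a, 1:] ^ m * D'" "\<not> [:- a, 1:] dvd D'"
   using order_decomp[OF less.prems, of a] unfolding m_def by blast
  have D'a: "poly D' a \<noteq> 0" using D(2) by (simp add: poly_eq_0_iff_dvd)
  then have D'0: "D' \<noteq> 0" by auto
  \<comment> \<open>The value that makes \<open>N - k D'\<close> vanish at \<open>a\<close>, so that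
    one factor of the denominator cancels.\<close>
  define k where "k = poly N a / poly D' a"
  have "poly (N - smult k D') a = 0" using D'a by (simp add: k_def)
  then have "[:- a, 1:] dvd N - smult k D'" by (simp only: poly_eq_0_iff_dvd)
  then obtain M where M: "N - smult k D' = [:- a, 1:] * M" by (rule dvdE)
  define D2 where "D2 = [:- a, 1:] ^ (m - 1) * D'"
  have DD2: "D = [:- a, 1:] * D2" using D(1) m by (simp add: D2_def flip: power_Suc mult.assoc)
  have "D2 \<noteq> 0" using DD2 less.prems by auto
  then have "degree D2 < degree D" unfolding DD2 by (subst degree_mult_eq) auto
  from less.hyps[OF this \<open>D2 \<noteq> 0\<close>, of M] obtain e c where c: "c \<in> principal_parts"
   "to_fract M / to_fract D2 = cst e + pp_sum c" by blast
  define L where "L = ratX - cst a"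
  have L: "L \<noteq> 0" "to_fract [:-a, 1:] = L"
   unfolding L_def by (simp_all add: val_linear(3) ratX_def cst_def flip: to_fract_diff)
  have L': "to_fract ([:-a, 1:] ^ n) = L ^ n" for n
   by (induction n) (simp_all only: power_0 power_Suc to_fract_1 to_fract_mult L(2))
  have "N = smult k D' + [:- a, 1:] * M" using M by (simp add: algebra_simps)
  then have "N = [:k:] * D' + [:- a, 1:] * M" by simp
  then have "to_fract N = cst k * to_fract D' + L * to_fract M"
   by (simp only: to_fract_add to_fract_mult L(2) cst_def)
  moreover have eD: "to_fract D = L ^ m * to_fract D'" "to_fract D = L * to_fract D2"
   unfolding D(1) by (simp only: to_fract_mult L') (simp only: to_fract_mult L' L(2) DD2 flip: D(1))
  ultimately have "to_fract N / to_fract D = cst k * to_fract D' / (L ^ m * to_fract D') + L * to_fract M / (L * to_fract D2)"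
   by (simp add: add_divide_distrib)
  also have "\<dots> = cst k * inverse L ^ m + to_fract M / to_fract D2"
   using L D'0 by (simp add: field_simps)
  also have "\<dots> = local_term (Some a) (monom k m) + (cst e + pp_sum c)" using c by (simp add: L_def)
  also have "local_term (Some a) (monom k m) = pp_sum ((\<lambda>_. 0)(Some a := monom k m))"
   using m by (intro pp_single(2)[symmetric]) simp
  finally have "to_fract N / to_fract D =
   cst e + pp_sum (\<lambda>Q. ((\<lambda>_. 0)(Some a := monom k m)) Q + c Q)"
   using c m by (subst pp_sum_combine) (auto intro: pp_single simp del: fun_upd_apply)
  then show ?thesis using pp_sum_combine(1)[OF pp_single(1)[of "monom k m" "Some a"] c(1)] m by auto
 qed
qed

lemma pp_exists:
 obtains e c where "c \<in> principal_parts" "u = cst e + pp_sum (c :: 'a::alg_closed_field option \<Rightarrow> 'a poly)"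
 using pp_exists_aux[OF den_nonzero, of "num u" u] unfolding ratfun_eq_div by blast

section \<open>Reducing principal parts modulo \<open>z^p - z\<close>\<close>

definition no_p_terms :: "'a::field poly set" where
 "no_p_terms = {g. \<forall>i. CHAR('a) dvd i \<longrightarrow> coeff g i = 0}"

lemma no_p_terms_0 [simp]: "0 \<in> no_p_terms" by (simp add: no_p_terms_def)

lemma no_p_terms_diff: "f \<in> no_p_terms \<Longrightarrow> g \<in> no_p_terms \<Longrightarrow> f - g \<in> no_p_terms"
 by (simp add: no_p_terms_def)

text \<open>The index 0 is divisible by every characteristic, so \<open>no_p_terms\<close> excludes
  the constant coefficient as well.\<close>

lemma no_p_terms_coeff_0: "g \<in> no_p_terms \<Longrightarrow> coeff g 0 = 0" by (simp add: no_p_terms_def)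

lemma no_p_terms_degree: "(g :: 'a::field poly) \<in> no_p_terms \<Longrightarrow> g \<noteq> 0 \<Longrightarrow> \<not> CHAR('a) dvd degree g"
 by (auto simp: no_p_terms_def)

text \<open>Terms are treated from the top down. A term \<open>a T^(p m)\<close> is the p-th power
  of \<open>b T^m\<close> with \<open>b^p = a\<close>, so modulo \<open>z^p - z\<close> it may be
  replaced by the lower term \<open>b T^m\<close>; every other term goes into \<open>g\<close>. The
  root \<open>b\<close> exists because the field is algebraically closed.\<close>

lemma reduce_poly_aux:
 fixes f :: "'a::alg_closed_field poly"
 assumes p: "prime CHAR('a)" and f: "\<And>i. i \<ge> n \<Longrightarrow> coeff f i = 0" "coeff f 0 = 0"
 shows "\<exists>g z. g \<in> no_p_terms \<and> coeff z 0 = 0 \<and> f = g + z ^ CHAR('a) - z" using f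
proof (induction n arbitrary: f)
 case 0
 then have "f = 0" by (simp add: poly_eq_iff)
 then show ?case using p prime_gt_0_nat[OF p] by (intro exI[of _ 0]) (auto simp: power_0_left)
next
 case (Suc n)
 define p where "p = CHAR('a)"
 have p1: "p > 1" using assms(1) prime_gt_1_nat p_def by blast
 define a where "a = coeff f n"
 have fr: "(x + y) ^ p = x ^ p + y ^ p" for x y :: "'a poly"
  using assms(1) by (intro freshmans_dream) (auto simp: p_def)
 show ?case
 proof (cases "n = 0 \<or> \<not> p dvd n")
  case True
  define f' where "f' = f - monom a n"
  have "coeff f' i = 0" if "i \<ge> n" for i
   using Suc.prems(1)[of i] that unfolding f'_def by (cases "i = n") (simp_all add: a_def)
  moreover have "coeff f' 0 = 0"
   using Suc.prems(2) unfolding f'_def by (cases "n = 0") (simp_all add: a_def)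
  ultimately have "\<And>i. i \<ge> n \<Longrightarrow> coeff f' i = 0" "coeff f' 0 = 0" by blast+
  from Suc.IH[OF this] obtain g z where gz: "g \<in> no_p_terms" "coeff z 0 = 0" "f' = g + z ^ CHAR('a) - z"
   by blast
  have "g + monom a n \<in> no_p_terms"
   using gz(1) True Suc.prems(2) by (auto simp: no_p_terms_def p_def a_def)
  moreover have "f = (g + monom a n) + z ^ CHAR('a) - z"
  proof -
   have "f = f' + monom a n" by (simp add: f'_def)
   then show ?thesis by (simp add: gz(3))
  qed
  ultimately show ?thesis using gz(2) by blast
 next
  case False
  then obtain m where m: "n = p * m" "m > 0" by (auto elim: dvdE)
  obtain b where b: "b ^ p = a" using nth_root_exists[of p a] p1 by auto
  have mn: "m < n" using m p1 by simp
  define f' where "f' = f - monom b m ^ p + monom b m"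
  have bp: "monom b m ^ p = monom a n" by (simp add: monom_power b m mult.commute)
  have "coeff f' i = 0" if "i \<ge> n" for i using Suc.prems(1)[of i] that mn unfolding f'_def bp
   by (cases "i = n") (simp_all add: a_def)
  moreover have "coeff f' 0 = 0" using Suc.prems(2) m mn unfolding f'_def bp by simp
  ultimately have "\<And>i. i \<ge> n \<Longrightarrow> coeff f' i = 0" "coeff f' 0 = 0" by blast+
  from Suc.IH[OF this] obtain g z where gz: "g \<in> no_p_terms" "coeff z 0 = 0" "f' = g + z ^ CHAR('a) - z"
   by blast
  have "f = g + (z + monom b m) ^ CHAR('a) - (z + monom b m)"
  proof -
   have "f = (g + z ^ p - z) + monom b m ^ p - monom b m"
   proof -
    have "f = f' + monom b m ^ p - monom b m" by (simp add: f'_def)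
    then show ?thesis by (simp add: gz(3) p_def)
   qed
   also have "\<dots> = g + (z + monom b m) ^ p - (z + monom b m)"
    unfolding fr by (simp only: algebra_simps)
   finally show ?thesis by (simp add: p_def)
  qed
  moreover have "coeff (z + monom b m) 0 = 0" using gz(2) m by simp
  ultimately show ?thesis using gz(1) by blast
 qed
qed

text \<open>If \<open>z\<close> had degree \<open>n > 0\<close>, the coefficient of
  \<open>z^p\<close> at \<open>p n\<close> would survive: \<open>g\<close> has no term there, and
  \<open>z\<close> has lower degree.\<close>

lemma reduce_poly_unique_0:
 fixes g z :: "'a::field poly"
 assumes p: "prime CHAR('a)" and "g \<in> no_p_terms" "coeff z 0 = 0" "g + z ^ CHAR('a) - z = 0"
 shows "z = 0" "g = 0"
proof -
 define p where "p = CHAR('a)"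
 have p1: "p > 1" using assms(1) prime_gt_1_nat p_def by blast
 show z: "z = 0"
 proof (rule ccontr)
  assume "z \<noteq> 0"
  define n where "n = degree z"
  have "n > 0"
  proof (rule ccontr)
   assume "\<not> n > 0"
   then have "lead_coeff z = 0" using assms(3) by (simp add: n_def)
   then show False using \<open>z \<noteq> 0\<close> by simp
  qed
  have "coeff (g + z ^ p - z) (p * n) = 0" using assms(4) by (simp add: p_def)
  moreover have "coeff z (p * n) = 0" using \<open>n > 0\<close> p1 by (intro coeff_eq_0) (simp add: n_def)
  moreover have "coeff g (p * n) = 0" using assms(2) by (simp add: no_p_terms_def p_def)
  moreover have "coeff (z ^ p) (p * n) = lead_coeff z ^ p"
   using lead_coeff_power[of z p] by (simp add: n_def degree_power_eq \<open>z \<noteq> 0\<close>)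
  ultimately show False using \<open>z \<noteq> 0\<close> by simp
 qed
 show "g = 0" using assms(4) z p1 by (simp add: power_0_left p_def)
qed

lemma power_CHAR_diff:
 fixes x y :: "'a::comm_ring_1"
 assumes "prime CHAR('a)" shows "(x - y) ^ CHAR('a) = x ^ CHAR('a) - y ^ CHAR('a)"
 using freshmans_dream[OF assms refl, of "x - y" y] by (simp add: algebra_simps)

lemma reduce_poly_unique:
 fixes g z :: "'a::field poly"
 assumes p: "prime CHAR('a)" and "g \<in> no_p_terms" "coeff z 0 = 0"
  and "g' \<in> no_p_terms" "coeff z' 0 = 0"
  and "g + z ^ CHAR('a) - z = g' + z' ^ CHAR('a) - z'"
 shows "z = z'" "g = g'"
proof -
 have "(g - g') + (z - z') ^ CHAR('a) - (z - z') = 0"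
  using assms(6) power_CHAR_diff[of z z'] p by (simp only: semiring_char_poly) (simp add: algebra_simps)
 moreover have "coeff (z - z') 0 = 0" using assms by simp
 ultimately show "z = z'" "g = g'"
  using reduce_poly_unique_0[OF p no_p_terms_diff[OF assms(2,4)], of "z - z'"] by simp_all
qed

definition reduced_parts :: "('a::field option \<Rightarrow> 'a poly) set" where
 "reduced_parts = {c \<in> principal_parts. \<forall>Q. c Q \<in> no_p_terms}"

lemma reduced_parts_diff:
 "c \<in> reduced_parts \<Longrightarrow> d \<in> reduced_parts \<Longrightarrow> (\<lambda>Q. c Q - d Q) \<in> reduced_parts"
 by (simp add: reduced_parts_def pp_sum_combine no_p_terms_diff)

lemma reduced_parts_pp: "c \<in> reduced_parts \<Longrightarrow> c \<in> principal_parts"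
 by (simp add: reduced_parts_def)

lemma reduce_pp:
 fixes c :: "'a::alg_closed_field option \<Rightarrow> 'a poly"
 assumes p: "prime CHAR('a)" and c: "c \<in> principal_parts"
 obtains d z where "d \<in> reduced_parts" "z \<in> principal_parts"
  "\<And>Q. c Q = d Q + z Q ^ CHAR('a) - z Q"
  "pp_sum c = pp_sum d + pp_sum z ^ CHAR('a) - pp_sum z"
proof -
 have "\<forall>Q. \<exists>gz. fst gz \<in> no_p_terms \<and> coeff (snd gz) 0 = 0 \<and> c Q = fst gz + snd gz ^ CHAR('a) - snd gz"
 proof
  fix Q
  have "coeff (c Q) 0 = 0" using c by (simp add: principal_parts_def)
  moreover have "\<And>i. i \<ge> Suc (degree (c Q)) \<Longrightarrow> coeff (c Q) i = 0"
   by (simp add: coeff_eq_0)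
  ultimately show "\<exists>gz. fst gz \<in> no_p_terms \<and> coeff (snd gz) 0 = 0 \<and> c Q = fst gz + snd gz ^ CHAR('a) - snd gz"
   using reduce_poly_aux[OF p, of "Suc (degree (c Q))" "c Q"] by auto
 qed
 then obtain gz where gz: "\<And>Q. fst (gz Q) \<in> no_p_terms" "\<And>Q. coeff (snd (gz Q)) 0 = 0"
  "\<And>Q. c Q = fst (gz Q) + snd (gz Q) ^ CHAR('a) - snd (gz Q)" by metis
 define d z where "d Q = fst (gz Q)" and "z Q = snd (gz Q)" for Q
 define S where "S = {Q. c Q \<noteq> 0}"
 have S: "finite S" using c by (simp add: S_def principal_parts_def)
 \<comment> \<open>Uniqueness of the reduction of 0 makes \<open>d\<close> and \<open>z\<close>
   vanish off the support of \<open>c\<close>, so both stay finitely supported.\<close>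
 have "d Q = 0 \<and> z Q = 0" if "c Q = 0" for Q
  using reduce_poly_unique_0[OF p gz(1,2), of Q Q] gz(3)[of Q] that by (simp add: d_def z_def)
 then have sub: "{Q. d Q \<noteq> 0} \<subseteq> S" "{Q. z Q \<noteq> 0} \<subseteq> S" "{Q. c Q \<noteq> 0} \<subseteq> S"
  by (auto simp: S_def)
 have fin: "finite {Q. d Q \<noteq> 0}" "finite {Q. z Q \<noteq> 0}" using sub S finite_subset by blast+
 show ?thesis
 proof (rule that)
  show "d \<in> reduced_parts" "z \<in> principal_parts"
   using fin gz by (auto simp: reduced_parts_def principal_parts_def d_def z_def no_p_terms_coeff_0)
  show "c Q = d Q + z Q ^ CHAR('a) - z Q" for Q using gz by (simp add: d_def z_def)
  then have "local_term Q (c Q) = local_term Q (d Q) + local_term Q (z Q) ^ CHAR('a) - local_term Q (z Q)" for Q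
   by simp
  moreover have "(\<Sum>Q\<in>S. local_term Q (z Q)) ^ CHAR('a) = (\<Sum>Q\<in>S. local_term Q (z Q) ^ CHAR('a))"
   by (rule freshmans_dream_sum) (simp_all add: p)
  ultimately show "pp_sum c = pp_sum d + pp_sum z ^ CHAR('a) - pp_sum z"
   unfolding pp_sum_superset[OF S sub(1)] pp_sum_superset[OF S sub(2)] pp_sum_superset[OF S sub(3)]
   by (simp add: sum.distrib sum_subtractf)
 qed
qed

section \<open>Pole orders of elements of \<open>AS\<close>\<close>

lemma AS_diff:
 fixes u v :: "'a::field"
 assumes "prime CHAR('a)" "u \<in> AS" "v \<in> AS" shows "u - v \<in> AS"
proof -
 obtain a b where "u = a ^ CHAR('a) - a" "v = b ^ CHAR('a) - b" using assms by (auto simp: AS_def)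
 then have "u - v = (a - b) ^ CHAR('a) - (a - b)" by (simp add: power_CHAR_diff[OF assms(1)])
 then show ?thesis by (auto simp: AS_def)
qed

lemma AS_0: fixes z :: "'a::field" assumes "prime CHAR('a)" shows "0 \<in> (AS :: 'a set)"
 using prime_gt_0_nat[OF assms] unfolding AS_def by (auto intro!: exI[of _ 0] simp: power_0_left)

lemma AS_uminus: fixes u :: "'a::field" shows "prime CHAR('a) \<Longrightarrow> u \<in> AS \<Longrightarrow> - u \<in> AS"
 using AS_diff[OF _ AS_0, of u] by simp

lemma AS_add: fixes u :: "'a::field" shows "prime CHAR('a) \<Longrightarrow> u \<in> AS \<Longrightarrow> v \<in> AS \<Longrightarrow> u + v \<in> AS"
 using AS_diff[of u "- v"] AS_uminus[of v] by simp

text \<open>At a pole of \<open>z\<close> the power \<open>z^p\<close> dominates; elsewhere both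
  terms are regular.\<close>

lemma pole_order_AS:
 fixes z :: "'a::field ratfun"
 assumes "prime CHAR('a)"
 shows "pole_order Q (z ^ CHAR('a) - z) = CHAR('a) * pole_order Q z"
proof (cases "vge Q 0 z")
 case True
 then have "vge Q 0 (z ^ CHAR('a) - z)" by (intro vge_diff vge_power)
 then show ?thesis using True by (simp flip: pole_order_0_iff)
next
 case False
 define p where "p = CHAR('a)"
 have p1: "p > 1" using assms prime_gt_1_nat p_def by blast
 have z: "z \<noteq> 0" "val Q z < 0" using False by (auto simp: vge_def)
 have v: "val Q (z ^ p) = int p * val Q z" using z by (simp add: val_power)
 have "int p * val Q z < 1 * val Q z" using z(2) p1 by (intro mult_strict_right_mono_neg) auto
 then have "val Q (z ^ p) + 1 \<le> val Q (- z)" unfolding v val_uminus[OF z(1)] by linarith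
 then have "vge Q (val Q (z ^ p) + 1) (- z)" unfolding vge_def ..
 from val_add_dominant[OF _ this] show ?thesis
  using z v by (simp add: pole_order_eq p_def nat_mult_distrib flip: mult_minus_right)
qed

text \<open>Pole orders of an element of \<open>AS\<close> are multiples of p, whereas no pole order
  of a reduced function is.\<close>

lemma reduced_not_AS:
 fixes c :: "'a::alg_closed_field option \<Rightarrow> 'a poly"
 assumes p: "prime CHAR('a)" and c: "c \<in> reduced_parts" "cst e + pp_sum c \<in> AS"
 shows "c = (\<lambda>_. 0)"
proof -
 obtain z where z: "cst e + pp_sum c = z ^ CHAR('a) - z" using c by (auto simp: AS_def)
 have "c Q = 0" for Q
 proof (rule ccontr)
  assume "c Q \<noteq> 0"
  then have "\<not> CHAR('a) dvd degree (c Q)"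
   using c(1) by (intro no_p_terms_degree) (auto simp: reduced_parts_def)
  moreover have "degree (c Q) = CHAR('a) * pole_order Q z"
   using pole_order_pp[OF reduced_parts_pp[OF c(1)], of Q e] pole_order_AS[OF p, of Q z] z by simp
  ultimately show False by simp
 qed
 then show ?thesis by auto
qed

text \<open>If the orders differed, the larger one would be the pole order of \<open>u - v\<close>
  and hence divisible by p. This is why the ramification data do not depend on the representative
  with pole orders prime to p.\<close>

lemma pole_order_reduced_unique:
 fixes u v :: "'a::field ratfun"
 assumes p: "prime CHAR('a)" and "u - v \<in> AS"
  and "pole_order Q u > 0 \<Longrightarrow> \<not> CHAR('a) dvd pole_order Q u"
  and "pole_order Q v > 0 \<Longrightarrow> \<not> CHAR('a) dvd pole_order Q v"
 shows "pole_order Q u = pole_order Q v"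
proof (rule ccontr)
 assume ne: "pole_order Q u \<noteq> pole_order Q v"
 obtain z where z: "u - v = z ^ CHAR('a) - z" using assms(2) by (auto simp: AS_def)
 have *: "pole_order Q (a - b) = pole_order Q a" if "pole_order Q b < pole_order Q a" for a b :: "'a ratfun"
 proof -
  have a: "a \<noteq> 0" "val Q a < 0" using that by (auto simp: pole_order_eq split: if_splits)
  have "vge Q (val Q a + 1) (- b)" using that a by (auto simp: pole_order_eq vge_def split: if_splits)
  from val_add_dominant[OF a(1) this] show ?thesis using a by (simp add: pole_order_eq)
 qed
 have sym: "pole_order Q (u - v) = pole_order Q (v - u)"
  by (cases "u = v") (auto simp: pole_order_eq, metis minus_diff_eq right_minus_eq val_uminus)
 have "pole_order Q (u - v) = max (pole_order Q u) (pole_order Q v)"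
  using ne *[of v u] *[of u v] sym by (auto simp: max_def)
 moreover have "CHAR('a) dvd pole_order Q (u - v)" unfolding z pole_order_AS[OF p] by simp
 ultimately show False using assms(3,4) ne by (auto simp: max_def split: if_splits)
qed

section \<open>Artin--Schreier polynomials\<close>

lemma prod_mset_linear_coeffs:
 fixes A :: "'a::field multiset"
 defines "P \<equiv> \<lambda>A. \<Prod>x\<in>#A. [:- x, 1:]"
 shows "degree (P A) = size A" "coeff (P A) (size A) = 1"
  "A \<noteq> {#} \<Longrightarrow> coeff (P A) (size A - 1) = - (\<Sum>x\<in>#A. x)"
proof -
 have "degree (P A) = size A \<and> coeff (P A) (size A) = 1 \<and>
  (A \<noteq> {#} \<longrightarrow> coeff (P A) (size A - 1) = - (\<Sum>x\<in>#A. x))"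
 proof (induction A)
  case empty
  then show ?case by (simp add: P_def)
 next
  case (add x A)
  have e: "P (add_mset x A) = smult (- x) (P A) + pCons 0 (P A)" by (simp add: P_def)
  have nz: "P A \<noteq> 0" using add by auto
  have "degree (P (add_mset x A)) = Suc (size A)"
   using add nz unfolding P_def by (simp add: degree_mult_eq del: mult_pCons_left)
  moreover have "coeff (P A) (Suc (size A)) = 0" using add by (intro coeff_eq_0) simp
  ultimately show ?case using add e by (cases "A = {#}") (auto simp: coeff_pCons P_def split: nat.splits)
 qed
 then show "degree (P A) = size A" "coeff (P A) (size A) = 1"
  "A \<noteq> {#} \<Longrightarrow> coeff (P A) (size A - 1) = - (\<Sum>x\<in>#A. x)" by auto
qed

lemma of_nat_power_CHAR:
 assumes "prime CHAR('a::comm_ring_1)" shows "of_nat d ^ CHAR('a) = (of_nat d :: 'a)"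
 using prime_gt_0_nat[OF assms] by (induction d) (simp_all add: freshmans_dream[OF assms refl] power_0_left)

lemma degree_AS_poly:
 assumes "prime CHAR('a::field)"
 shows "degree (AS_poly (w :: 'a)) = CHAR('a)" "AS_poly w \<noteq> 0"
  "lead_coeff (AS_poly w) = 1"
proof -
 have p: "CHAR('a) > 1" using assms prime_gt_1_nat by blast
 have "degree (- (monom 1 1 + [:w:])) < CHAR('a)"
  unfolding degree_minus using p by (intro degree_add_less) (simp_all add: degree_monom_eq)
 then have "degree (monom 1 CHAR('a) + (- (monom 1 1 + [:w:]))) = CHAR('a)"
  by (subst degree_add_eq_left) (simp_all add: degree_monom_eq)
 moreover have e: "AS_poly w = monom 1 CHAR('a) + (- (monom 1 1 + [:w:]))" by (simp add: AS_poly_def)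
 ultimately show d: "degree (AS_poly w) = CHAR('a)" by simp
 then show "AS_poly w \<noteq> 0" using p by auto
 show "lead_coeff (AS_poly w) = 1"
  unfolding d using p by (simp add: AS_poly_def coeff_pCons split: nat.splits)
qed

lemma poly_AS_poly: "poly (AS_poly w) z = z ^ CHAR('a::field) - z - (w :: 'a)"
 by (simp add: AS_poly_def poly_monom)

text \<open>The sum of the roots of a factor of degree \<open>d\<close> is an Artin--Schreier root of \<open>d * w\<close>.\<close>

lemma irreducible_AS_poly_iff:
 fixes w :: "'a::field"
 assumes p: "prime CHAR('a)"
 shows "irreducible (AS_poly w) \<longleftrightarrow> w \<notin> AS"
proof
 have p1: "CHAR('a) > 1" using p prime_gt_1_nat by blast
 assume irr: "irreducible (AS_poly w)"
 show "w \<notin> AS"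
 proof
  assume "w \<in> AS"
  then obtain z where "w = z ^ CHAR('a) - z" by (auto simp: AS_def)
  then have "poly (AS_poly w) z = 0" by (simp add: poly_AS_poly)
  then obtain g where g: "AS_poly w = [:- z, 1:] * g" by (auto simp only: poly_eq_0_iff_dvd elim: dvdE)
  have "g \<noteq> 0" using g degree_AS_poly(2)[OF p, of w] by auto
  then have "CHAR('a) = 1 + degree g"
   using degree_AS_poly(1)[OF p, of w] unfolding g by (subst (asm) degree_mult_eq) auto
  then have "degree g > 0" using p1 by simp
  moreover have "is_unit [:- z, 1:] \<or> is_unit g" using Factorial_Ring.irreducibleD[OF irr g] .
  moreover have "\<not> is_unit [:- z, 1:]" by (simp add: is_unit_iff_degree)
  ultimately show False by (auto simp: is_unit_iff_degree \<open>g \<noteq> 0\<close>)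
 qed
next
 have p1: "CHAR('a) > 1" using p prime_gt_1_nat by blast
 assume w: "w \<notin> AS"
 show "irreducible (AS_poly w)"
 proof (rule Factorial_Ring.irreducibleI)
  show "AS_poly w \<noteq> 0" using degree_AS_poly(2)[OF p] .
  show "\<not> is_unit (AS_poly w)" using degree_AS_poly[OF p, of w] p1 by (simp add: is_unit_iff_degree)
  fix f g assume fg: "AS_poly w = f * g"
  then have nz: "f \<noteq> 0" "g \<noteq> 0" using degree_AS_poly(2)[OF p, of w] by auto
  show "is_unit f \<or> is_unit g"
  proof (rule ccontr)
   assume "\<not> (is_unit f \<or> is_unit g)"
   then have "degree f > 0" "degree g > 0" using nz by (auto simp: is_unit_iff_degree)
   moreover have "CHAR('a) = degree f + degree g"
    using degree_AS_poly(1)[OF p, of w] nz unfolding fg by (simp add: degree_mult_eq)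
   ultimately have d: "0 < degree f" "degree f < CHAR('a)" by auto
   define d where "d = degree f"
   interpret ac: fhom "to_ac :: 'a \<Rightarrow> 'a alg_closure" by (rule fhom_to_ac)
   define F where "F = map_poly to_ac f"
   have "F \<noteq> 0" using nz by (simp add: F_def)
   then obtain A where A: "size A = degree F"
     "F = smult (lead_coeff F) (\<Prod>x\<in>#A. [:- x, 1:])" using alg_closed_imp_factorization by blast
   have sA: "size A = d" using A by (simp add: F_def d_def)
   have root: "x ^ CHAR('a) = x + to_ac w" if "x \<in># A" for x
   proof -
    have "poly (\<Prod>x\<in>#A. [:- x, 1:]) x = 0" using that by (induction A) auto
    then have "poly F x = 0" by (subst A(2)) simp
    then have "poly (map_poly to_ac (AS_poly w)) x = 0" by (simp add: fg F_def)
    then show ?thesis by (simp add: AS_poly_def poly_monom algebra_simps)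
   qed
   define s where "s = (\<Sum>x\<in>#A. x)"
   have sp: "s ^ CHAR('a) = s + of_nat d * to_ac w"
   proof -
    have "B \<subseteq># A \<Longrightarrow> (\<Sum>x\<in>#B. x) ^ CHAR('a) = (\<Sum>x\<in>#B. x) + of_nat (size B) * to_ac w" for B
    proof (induction B)
     case empty
     then show ?case using p1 by (simp add: power_0_left)
    next
     case (add x B)
     have c: "prime CHAR('a alg_closure)" using p by simp
     have "x \<in># A" using add.prems by (meson mset_subset_eq_insertD)
     moreover have "B \<subseteq># A" using add.prems by (meson mset_subset_eq_insertD subset_mset.less_imp_le)
     ultimately show ?case
      using add.IH root[of x] freshmans_dream[OF c refl, of x "\<Sum>x\<in>#B. x"] by (simp add: algebra_simps)
    qed
    then show ?thesis using sA by (simp add: s_def)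
   qed
   have "coeff F (d - 1) = - lead_coeff F * s"
   proof -
    have "A \<noteq> {#}" using sA d by (auto simp: d_def)
    have "coeff F (d - 1) = lead_coeff F * coeff (\<Prod>x\<in>#A. [:- x, 1:]) (d - 1)"
     by (subst A(2)) (simp only: coeff_smult)
    then show ?thesis
     using prod_mset_linear_coeffs(3)[OF \<open>A \<noteq> {#}\<close>] by (simp add: sA s_def)
   qed
   then have "to_ac (coeff f (d - 1)) = - to_ac (lead_coeff f) * s" by (simp add: F_def)
   then have "to_ac (coeff f (d - 1) / - lead_coeff f) = s" using nz by (simp add: field_simps)
   then obtain s' where s': "s = to_ac s'" by metis
   have "to_ac (s' ^ CHAR('a)) = to_ac (s' + of_nat d * w)" using sp s' by simp
   then have s'p: "s' ^ CHAR('a) = s' + of_nat d * w" by (simp only: ac.h_eq_iff)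
   have dnz: "of_nat d \<noteq> (0 :: 'a)"
    using d by (auto simp: of_nat_eq_0_iff_char_dvd d_def dest: dvd_imp_le)
   \<comment> \<open>By Fermat \<open>d^p = d\<close> in the field, and \<open>d\<close> is
     invertible because \<open>0 < d < p\<close>; so dividing a solution for \<open>d * w\<close> by
     \<open>d\<close> gives one for \<open>w\<close>.\<close>
   have "(s' / of_nat d) ^ CHAR('a) - s' / of_nat d = w"
    using dnz s'p of_nat_power_CHAR[OF p, of d] by (simp add: power_divide field_simps)
   then have "w \<in> AS" by (auto simp: AS_def)
   then show False using w by simp
  qed
 qed
qed

text \<open>In the function field the product of \<open>Y^(p - 1)\<close> and \<open>Y\<close> is
  \<open>Y + u\<close>, so the multiplication remembers \<open>u\<close>. Hence each element of
  \<open>AS_curves\<close> comes from one equation only.\<close>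

lemma AS_field_inject:
 assumes p: "prime CHAR('k::field)" and "AS_field u = AS_field (v :: 'k ratfun)"
 shows "u = v"
proof -
 define p where "p = CHAR('k)"
 have p1: "p > 1" using assms prime_gt_1_nat p_def by blast
 have pr: "prime CHAR('k ratfun)" using assms by simp
 have *: "monom 1 p mod AS_poly u = monom 1 1 + [:u:]" for u :: "'k ratfun"
 proof -
  have "monom 1 p mod AS_poly u = (AS_poly u + (monom 1 1 + [:u:])) mod AS_poly u"
   by (simp add: AS_poly_def p_def)
  also have "\<dots> = (monom 1 1 + [:u:]) mod AS_poly u" by simp
  also have "\<dots> = monom 1 1 + [:u:]" using p1 degree_AS_poly(1)[OF pr, of u]
   by (intro mod_poly_less) (simp add: degree_add_less degree_monom_eq p_def)
  finally show ?thesis .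
 qed
 have e: "(monom 1 (p - 1) * monom 1 1 :: 'k ratfun poly) = monom 1 p" using p1 by (simp add: mult_monom)
 have "monoid.mult (AS_field u) (monom 1 (p - 1)) (monom 1 1)
   = monoid.mult (AS_field v) (monom 1 (p - 1)) (monom 1 1)" using assms(2) by simp
 then have "monom 1 1 + [:u:] = monom 1 1 + [:v:]" unfolding AS_field_def monoid.simps e * .
 then show ?thesis by simp
qed

section \<open>Frobenius and descent\<close>

text \<open>The translation \<open>x \<mapsto> x + 1\<close> permutes the field, so summing over all
  elements shows that their number is zero in the field.\<close>

lemma finite_field_CHAR:
 assumes "card (UNIV :: 'k set) = p ^ n" "prime p"
 shows "CHAR('k::{field,finite}) = p"
proof -
 have "(\<Sum>x\<in>UNIV. x + 1) = (\<Sum>x\<in>UNIV. x :: 'k)"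
  by (rule sum.reindex_bij_witness[of _ "\<lambda>x. x - 1" "\<lambda>x. x + 1"]) auto
 then have "of_nat (card (UNIV :: 'k set)) = (0 :: 'k)" by (simp add: sum.distrib)
 then have "CHAR('k) dvd p ^ n" using assms by (simp only: of_nat_eq_0_iff_char_dvd)
 moreover have "prime CHAR('k)" using finite_imp_CHAR_pos[where ?'a = 'k] prime_CHAR_semidom by simp
 ultimately show ?thesis using assms(2) by (meson prime_dvd_power primes_dvd_imp_eq)
qed

locale finite_base =
 fixes k :: "'k::{field,finite} itself" and p n q :: nat
 assumes prime_p: "prime p" and card_k: "card (UNIV :: 'k set) = q" and q_pow: "q = p ^ n"
begin

lemma char_k: "CHAR('k) = p" using finite_field_CHAR card_k q_pow prime_p by metis

lemma q_gt_1: "q > 1" using card_mono[of "UNIV :: 'k set" "{0, 1}"] card_k by simp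

lemma p_gt_1: "p > 1" using prime_p prime_gt_1_nat by blast

lemma prime_CHAR [simp]: "prime CHAR('k)" using char_k prime_p by simp

lemma power_q_k: "(x :: 'k) ^ q = x"
proof (cases "x = 0")
 case True
 then show ?thesis using q_gt_1 by (simp add: power_0_left)
next
 case False
 define S where "S = UNIV - {0 :: 'k}"
 have "(\<Prod>y\<in>S. x * y) = \<Prod>S"
  by (rule prod.reindex_bij_witness[of _ "\<lambda>y. y / x" "\<lambda>y. x * y"]) (use False in \<open>auto simp: S_def\<close>)
 moreover have "(\<Prod>y\<in>S. x * y) = x ^ card S * \<Prod>S" by (simp add: prod.distrib)
 moreover have "\<Prod>S \<noteq> 0" by (simp add: S_def)
 moreover have "card S = q - 1" using card_k by (simp add: S_def card_Diff_singleton)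
 ultimately have "x ^ (q - 1) = 1" by simp
 then have "x * x ^ (q - 1) = x" by simp
 then show ?thesis using q_gt_1 by (simp flip: power_Suc)
qed

definition frob :: "'k alg_closure \<Rightarrow> 'k alg_closure" where
 "frob z = z ^ q"

sublocale frob: fhom frob
proof
 have "(x + y) ^ q = x ^ q + y ^ q" for x y :: "'k alg_closure"
  by (rule freshmans_dream') (use prime_p in \<open>auto simp: q_pow char_k\<close>)
 then show "frob (x + y) = frob x + frob y" for x y by (simp add: frob_def)
qed (simp_all add: frob_def power_mult_distrib)

sublocale ac: fhom "to_ac :: 'k \<Rightarrow> 'k alg_closure" by (rule fhom_to_ac)

lemma bij_frob: "bij frob"
proof (rule bijI)
 show "inj frob" by (rule injI) simp
 show "surj frob" using nth_root_exists[of q] q_gt_1 unfolding frob_def surj_def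
  by (metis gr_implies_not0 neq0_conv)
qed

lemma finite_roots_power:
 fixes N :: nat assumes "N > 1"
 shows "finite {z :: 'a::field. z ^ N = z}" "card {z :: 'a. z ^ N = z} \<le> N"
proof -
 define P where "P = monom (1 :: 'a) N - monom 1 1"
 have d: "degree P = N" unfolding P_def diff_conv_add_uminus using assms
  by (subst degree_add_eq_left) (simp_all add: degree_monom_eq)
 then have "P \<noteq> 0" using assms by auto
 moreover have "{z. z ^ N = z} = {z. poly P z = 0}" by (auto simp: P_def poly_monom)
 ultimately show "finite {z :: 'a. z ^ N = z}" "card {z :: 'a. z ^ N = z} \<le> N"
  using poly_roots_finite[of P] card_poly_roots_bound[of P] d by auto
qed

text \<open>The q elements of k already exhaust the roots of \<open>z^q - z\<close>.\<close>

lemma frob_fixed_iff: "frob z = z \<longleftrightarrow> z \<in> range to_ac"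
proof -
 have "range to_ac \<subseteq> {z :: 'k alg_closure. z ^ q = z}"
  using power_q_k by (auto simp flip: to_ac_power)
 moreover have "card (range (to_ac :: 'k \<Rightarrow> _)) = q"
  using card_k by (simp add: card_image inj_to_ac)
 ultimately have "range to_ac = {z :: 'k alg_closure. z ^ q = z}"
  using finite_roots_power[of q] q_gt_1 by (intro card_seteq) auto
 then show ?thesis by (auto simp: frob_def)
qed

text \<open>Frobenius acts on the coefficients and fixes the variable; this is not the q-th power
  map of the function field. Its fixed elements are the functions defined over k.\<close>

definition frobX :: "'k alg_closure ratfun \<Rightarrow> 'k alg_closure ratfun" where
 "frobX = rmap (\<lambda>c. cst (frob c)) ratX"

sublocale FX: ratfun_hom "\<lambda>c. cst (frob c)" ratX by (rule ratfun_hom_ratX[OF frob.fhom_axioms])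

sublocale frobX: fhom frobX unfolding frobX_def by (rule FX.rmap_fhom)

sublocale BC: ratfun_hom "\<lambda>c. cst (to_ac c)" "ratX :: 'k alg_closure ratfun"
 by (rule ratfun_hom_ratX[OF fhom_to_ac])

lemma base_change_eq: "base_change = rmap (\<lambda>c. cst (to_ac c)) (ratX :: 'k alg_closure ratfun)"
proof
 fix u :: "'k ratfun"
 have "map_poly (\<lambda>c. cst (to_ac c)) P = map_poly cst (map_poly to_ac P)" for P :: "'k poly"
  by (rule poly_eqI) simp
 then show "base_change u = rmap (\<lambda>c. cst (to_ac c)) ratX u"
  by (simp add: base_change_def rmap_def Fract_conv_to_fract)
qed

sublocale bc: fhom "base_change :: 'k ratfun \<Rightarrow> _" unfolding base_change_eq by (rule BC.rmap_fhom)

lemma base_change_cst [simp]: "base_change (cst (c::'k)) = cst (to_ac c)" by (simp add: base_change_eq)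

lemma base_change_X [simp]: "base_change (ratX :: 'k ratfun) = ratX" by (simp add: base_change_eq)

lemma base_change_to_fract [simp]: "base_change (to_fract P) = to_fract (map_poly to_ac (P :: 'k poly))"
proof -
 have "map_poly (\<lambda>c. cst (to_ac c)) P = map_poly cst (map_poly to_ac P)" by (rule poly_eqI) simp
 then show ?thesis by (simp add: base_change_eq BC.rmap_to_fract)
qed

lemma frobX_cst [simp]: "frobX (cst c) = cst (frob c)" by (simp add: frobX_def)

lemma frobX_X [simp]: "frobX ratX = ratX" by (simp add: frobX_def)

lemma frobX_to_fract [simp]: "frobX (to_fract P) = to_fract (map_poly frob P)"
proof -
 have "map_poly (\<lambda>c. cst (frob c)) P = map_poly cst (map_poly frob P)" by (rule poly_eqI) simp
 then show ?thesis by (simp add: frobX_def FX.rmap_to_fract)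
qed

lemma frobX_base_change [simp]: "frobX (base_change u) = base_change u"
proof -
 have f: "frob (to_ac c) = to_ac c" for c :: 'k by (simp add: frob_fixed_iff)
 show ?thesis by (rule ratfun_hom_unique[OF fhom_comp[OF frobX.fhom_axioms bc.fhom_axioms] bc.fhom_axioms])
   (simp_all add: f)
qed

lemma descend_poly:
 assumes "map_poly frob P = P"
 obtains P' where "P = map_poly to_ac P'"
proof -
 have "coeff P i \<in> range to_ac" for i
  using assms frob_fixed_iff[of "coeff P i"] by (metis frob.coeff_map)
 then have "map_poly to_ac (map_poly of_ac P) = P"
  by (intro poly_eqI) (auto simp: coeff_map_poly to_ac_of_ac)
 then show ?thesis using that by metis
qed

text \<open>Once the denominator is monic, lowest terms are unique, so Frobenius has to fix
  numerator and denominator separately.\<close>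

lemma descend:
 assumes "frobX w = w"
 obtains u where "w = base_change u"
proof -
 define l where "l = lead_coeff (den w)"
 have l: "l \<noteq> 0" by (simp add: l_def)
 define N D where "N = smult (inverse l) (num w)" and "D = smult (inverse l) (den w)"
 have D: "D \<noteq> 0" "lead_coeff D = 1" using l by (auto simp: D_def l_def)
 have w: "w = to_fract N / to_fract D"
 proof -
  have s: "to_fract (smult c P) = cst c * to_fract P" for c and P :: "'k alg_closure poly"
  proof -
   have "smult c P = [:c:] * P" by simp
   then show ?thesis by (simp only: to_fract_mult cst_def)
  qed
  show ?thesis using l by (simp add: N_def D_def s ratfun_eq_div)
 qed
 obtain a b where ab: "a * num w + b * den w = 1" using poly_bezout[OF coprime_num_den] .
 have "smult l a * N + smult l b * D = 1" using ab l by (simp add: N_def D_def)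
 then have cop: "coprime N D" by (rule coprime_if_bezout)
 have "to_fract (map_poly frob N) / to_fract (map_poly frob D) = to_fract N / to_fract D"
  using assms w by (metis frobX.h_divide frobX_to_fract)
 then have "to_fract (map_poly frob N) * to_fract D = to_fract N * to_fract (map_poly frob D)"
  using D by (subst (asm) frac_eq_eq) auto
 then have e: "map_poly frob N * D = N * map_poly frob D" by (simp flip: to_fract_mult)
 then have "D dvd N * map_poly frob D" by (metis dvd_triv_right)
 then have "D dvd map_poly frob D" using cop by (metis coprime_commute coprime_dvd_mult_right_iff)
 then obtain c where c: "map_poly frob D = D * c" by (elim dvdE)
 then have "c \<noteq> 0" using D by auto
 then have "degree c = 0" using arg_cong[OF c, of degree] D by (simp add: degree_mult_eq)
 then obtain c0 where "c = [:c0:]" by (elim degree_eq_zeroE)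
 moreover from this have "c0 \<noteq> 0" using \<open>c \<noteq> 0\<close> by simp
 moreover have "lead_coeff (map_poly frob D) = 1" using D by simp
 ultimately have "c0 = 1" using c D by simp
 then have DD: "map_poly frob D = D" using c \<open>c = [:c0:]\<close> by simp
 then have "map_poly frob N = N" using e D by simp
 then obtain N' where N': "N = map_poly to_ac N'" by (rule descend_poly)
 obtain D' where D': "D = map_poly to_ac D'" using DD by (rule descend_poly)
 have "w = base_change (to_fract N' / to_fract D')" by (simp add: w N' D')
 then show ?thesis by (rule that)
qed

definition frobQ :: "'k alg_closure option \<Rightarrow> 'k alg_closure option" where
 "frobQ = map_option frob"

lemma frobQ_simps [simp]: "frobQ None = None" "frobQ (Some z) = Some (frob z)" by (simp_all add: frobQ_def)

lemma bij_frobQ: "bij frobQ"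
proof (rule bijI)
 show "inj frobQ" unfolding frobQ_def by (rule option.inj_map) (rule bij_is_inj[OF bij_frob])
 show "surj frobQ"
 proof -
  have "\<exists>Q. frobQ Q = Q'" for Q'
  proof (cases Q')
   case (Some z)
   obtain y where "frob y = z" using bij_is_surj[OF bij_frob] by (metis surjD)
   then show ?thesis using Some by (intro exI[of _ "Some y"]) simp
  qed (auto intro: exI[of _ None])
  then show ?thesis by (metis surjI)
 qed
qed

lemma frobX_local_gen: "frobX (local_gen Q) = local_gen (frobQ Q)" by (cases Q) simp_all

lemma frobX_local_term: "frobX (local_term Q f) = local_term (frobQ Q) (map_poly frob f)"
 by (induction f) (simp_all add: frobX_local_gen)

definition equivariant :: "('k alg_closure option \<Rightarrow> 'k alg_closure poly) \<Rightarrow> bool" where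
 "equivariant c \<longleftrightarrow> (\<forall>Q. c (frobQ Q) = map_poly frob (c Q))"

lemma frobX_pp:
 assumes c: "c \<in> principal_parts"
 obtains d where "d \<in> principal_parts" "\<And>Q. d (frobQ Q) = map_poly frob (c Q)"
  "frobX (pp_sum c) = pp_sum d"
proof -
 define d where "d = (\<lambda>Q. map_poly frob (c (inv_into UNIV frobQ Q)))"
 have d: "d (frobQ Q) = map_poly frob (c Q)" for Q by (simp add: d_def inv_into_f_f bij_is_inj[OF bij_frobQ])
 have sup: "{Q. d Q \<noteq> 0} = frobQ ` {Q. c Q \<noteq> 0}"
 proof (intro equalityI subsetI)
  fix Q assume "Q \<in> {Q. d Q \<noteq> 0}"
  moreover obtain Q' where "Q = frobQ Q'" using bij_is_surj[OF bij_frobQ] by (metis surjD)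
  ultimately show "Q \<in> frobQ ` {Q. c Q \<noteq> 0}" using d by auto
 qed (use d in auto)
 have "\<forall>Q. coeff (d Q) 0 = 0" using c by (simp add: d_def principal_parts_def)
 then have pp: "d \<in> principal_parts" using c sup by (simp add: principal_parts_def)
 have "pp_sum d = (\<Sum>Q\<in>frobQ ` {Q. c Q \<noteq> 0}. local_term Q (d Q))" unfolding pp_sum_def sup ..
 also have "\<dots> = (\<Sum>Q | c Q \<noteq> 0. local_term (frobQ Q) (d (frobQ Q)))"
  by (rule sum.reindex_cong[OF inj_on_subset[OF bij_is_inj[OF bij_frobQ]]]) auto
 also have "\<dots> = frobX (pp_sum c)" by (simp add: pp_sum_def frobX.h_sum frobX_local_term d)
 finally show ?thesis using that pp d by metis
qed

text \<open>By uniqueness of partial fractions, comparing a function with its Frobenius conjugate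
  amounts to comparing principal parts at conjugate points.\<close>

lemma frobX_fixed_iff:
 assumes c: "c \<in> principal_parts"
 shows "frobX (cst e + pp_sum c) = cst e + pp_sum c \<longleftrightarrow> frob e = e \<and> equivariant c"
proof -
 obtain d where d: "d \<in> principal_parts" "\<And>Q. d (frobQ Q) = map_poly frob (c Q)"
  "frobX (pp_sum c) = pp_sum d" using frobX_pp[OF c] by blast
 have "d = c" if eq: "equivariant c"
 proof
  fix Q
  obtain Q' where Q': "Q = frobQ Q'" using bij_is_surj[OF bij_frobQ] by (metis surjD)
  have "c (frobQ Q') = map_poly frob (c Q')" using eq unfolding equivariant_def by blast
  then show "d Q = c Q" unfolding Q' d(2) by simp
 qed
 moreover have "equivariant c" if "d = c" using d(2) unfolding that equivariant_def by blast
 moreover have "frobX (cst e + pp_sum c) = cst (frob e) + pp_sum d" using d(3) by simp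
 ultimately show ?thesis using pp_unique[OF d(1) c, of "frob e" e] by metis
qed

section \<open>Canonical representatives over k modulo \<open>AS\<close>\<close>

definition CR :: "('k alg_closure option \<Rightarrow> 'k alg_closure poly) set" where
 "CR = {c \<in> reduced_parts. equivariant c}"

lemma CR_D: "d \<in> CR \<Longrightarrow> d \<in> reduced_parts" "d \<in> CR \<Longrightarrow> d \<in> principal_parts" "d \<in> CR \<Longrightarrow> equivariant d"
 by (auto simp: CR_def reduced_parts_def)

text \<open>For an equivariant family such a function over k exists by descent, and it is unique
  because \<open>base_change\<close> is injective.\<close>

definition rep :: "('k alg_closure option \<Rightarrow> 'k alg_closure poly) \<Rightarrow> 'k ratfun" where
 "rep d = (SOME w. base_change w = pp_sum d)"

lemma base_change_rep:
 assumes "d \<in> principal_parts" "equivariant d" shows "base_change (rep d) = pp_sum d"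
proof -
 have "frobX (cst 0 + pp_sum d) = cst 0 + pp_sum d" using frobX_fixed_iff[OF assms(1), of 0] assms(2) by simp
 then have "\<exists>w. base_change w = pp_sum d" using descend by (metis add_0 cst.h_0)
 then show ?thesis unfolding rep_def by (rule someI_ex)
qed

lemma pp_of_ratfun:
 fixes u :: "'k ratfun"
 obtains e c where "c \<in> principal_parts" "equivariant c" "base_change u = cst (to_ac e) + pp_sum c"
proof -
 obtain e c where ec: "c \<in> principal_parts" "base_change u = cst e + pp_sum c" by (rule pp_exists)
 then have "frob e = e" "equivariant c" using frobX_fixed_iff[OF ec(1), of e] frobX_base_change[of u] by auto
 then show ?thesis using that ec frob_fixed_iff by auto
qed

text \<open>The reduction takes p-th roots in the algebraic closure, but it is unique at each point.
  It therefore commutes with Frobenius, and both the reduced family \<open>d\<close> and the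
  correcting family \<open>z\<close> descend to k.\<close>

lemma canonical_exists:
 fixes u :: "'k ratfun"
 obtains d e where "d \<in> CR" "u - (cst e + rep d) \<in> AS"
proof -
 obtain e c where c: "c \<in> principal_parts" "equivariant c" "base_change u = cst (to_ac e) + pp_sum c"
  by (rule pp_of_ratfun)
 have pr: "prime CHAR('k alg_closure)" by simp
 obtain d z where dz: "d \<in> reduced_parts" "z \<in> principal_parts"
  "\<And>Q. c Q = d Q + z Q ^ CHAR('k alg_closure) - z Q"
  "pp_sum c = pp_sum d + pp_sum z ^ CHAR('k alg_closure) - pp_sum z" using reduce_pp[OF pr c(1)] by metis
 have eq: "d (frobQ Q) = map_poly frob (d Q) \<and> z (frobQ Q) = map_poly frob (z Q)" for Q
 proof -
  have "d (frobQ Q) + z (frobQ Q) ^ CHAR('k alg_closure) - z (frobQ Q)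
    = map_poly frob (d Q) + map_poly frob (z Q) ^ CHAR('k alg_closure) - map_poly frob (z Q)"
   using c(2) dz(3)[of "frobQ Q"] dz(3)[of Q] unfolding equivariant_def
   by (metis frob.map_add frob.map_diff frob.map_power)
  moreover have "d (frobQ Q) \<in> no_p_terms" "map_poly frob (d Q) \<in> no_p_terms"
   "coeff (z (frobQ Q)) 0 = 0" "coeff (map_poly frob (z Q)) 0 = 0"
   using dz(1,2) by (auto simp: reduced_parts_def principal_parts_def no_p_terms_def)
  ultimately show ?thesis using reduce_poly_unique[OF pr] by metis
 qed
 then have "d \<in> CR" "equivariant z" using dz by (auto simp: CR_def equivariant_def)
 then have "base_change (u - (cst e + rep d)) = base_change (rep z ^ CHAR('k ratfun) - rep z)"
  using c(3) dz(2,4) base_change_rep CR_D by simp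
 then have "u - (cst e + rep d) \<in> AS" unfolding bc.h_eq_iff AS_def by blast
 then show ?thesis using that \<open>d \<in> CR\<close> by blast
qed

lemma base_change_AS: "(u :: 'k ratfun) \<in> AS \<Longrightarrow> base_change u \<in> AS"
proof -
 assume "u \<in> AS"
 then obtain z where z: "u = z ^ CHAR('k ratfun) - z" by (auto simp: AS_def)
 show "base_change u \<in> AS" unfolding z AS_def by auto
qed

text \<open>Equality of the families can be seen over the algebraic closure. The claim about
  constants has to be settled over k: the witness in k(x) has no poles, since p times its pole
  orders vanish, and is therefore an element of k.\<close>

lemma canonical_unique:
 assumes "d \<in> CR" "d' \<in> CR" "(cst e + rep d) - (cst e' + rep d') \<in> AS"
 shows "d = d'" "e - e' \<in> AS"
proof -
 have "base_change ((cst e + rep d) - (cst e' + rep d')) \<in> AS" using assms(3) by (rule base_change_AS)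
 then have "cst (to_ac (e - e')) + pp_sum (\<lambda>Q. d Q - d' Q) \<in> AS"
  using assms(1,2) CR_D by (simp add: base_change_rep pp_sum_combine algebra_simps)
 then have "(\<lambda>Q. d Q - d' Q) = (\<lambda>_. 0)"
  using reduced_not_AS[of "\<lambda>Q. d Q - d' Q" "to_ac (e - e')"] reduced_parts_diff assms(1,2) CR_D by auto
 then show d: "d = d'" by (auto simp: fun_eq_iff)
 then have "cst (e - e') \<in> (AS :: 'k ratfun set)" using assms(3) by (simp add: algebra_simps)
 then obtain z where z: "cst (e - e') = z ^ CHAR('k ratfun) - (z :: 'k ratfun)" by (auto simp: AS_def)
 obtain f c where fc: "c \<in> principal_parts" "base_change z = cst (to_ac f) + pp_sum c"
  using pp_of_ratfun[of z] by metis
 have "c Q = 0" for Q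
 proof -
  have "pole_order Q (base_change z ^ CHAR('k alg_closure) - base_change z) = 0"
  proof -
   have "base_change z ^ CHAR('k alg_closure) - base_change z = cst (to_ac (e - e'))"
    using arg_cong[OF z, of base_change] by simp
   then show ?thesis by (simp only: pole_order_0_iff vge_cst)
  qed
  then have "pole_order Q (base_change z) = 0"
   using pole_order_AS[of Q "base_change z"] p_gt_1 by (simp add: char_k prime_p)
  then have "degree (c Q) = 0" using pole_order_pp[OF fc(1)] fc(2) by simp
  moreover have "coeff (c Q) 0 = 0" using fc(1) by (simp add: principal_parts_def)
  ultimately show ?thesis by (metis degree_eq_zeroE coeff_pCons_0 pCons_0_0)
 qed
 then have "c = (\<lambda>_. 0)" by auto
 then have "base_change z = base_change (cst f)" using fc by simp
 then have "z = cst f" by (simp only: bc.h_eq_iff)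
 then have "cst (e - e') = (cst (f ^ CHAR('k) - f) :: 'k ratfun)" using z by simp
 then have "e - e' = f ^ CHAR('k) - f" by (simp only: cst.h_eq_iff)
 then show "e - e' \<in> AS" by (auto simp: AS_def)
qed

definition canon :: "'k ratfun \<Rightarrow> 'k alg_closure option \<Rightarrow> 'k alg_closure poly" where
 "canon u = (THE d. d \<in> CR \<and> (\<exists>e. u - (cst e + rep d) \<in> AS))"

lemma canon_eqI:
 assumes "d \<in> CR" "u - (cst e + rep d) \<in> AS"
 shows "canon u = d" unfolding canon_def
proof (rule the_equality)
 show "d \<in> CR \<and> (\<exists>e. u - (cst e + rep d) \<in> AS)" using assms by blast
 fix d' assume d': "d' \<in> CR \<and> (\<exists>e. u - (cst e + rep d') \<in> AS)"
 then obtain e' where e': "u - (cst e' + rep d') \<in> AS" by blast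
 have "(u - (cst e + rep d)) - (u - (cst e' + rep d')) \<in> AS" by (rule AS_diff) (use assms e' in auto)
 also have "(u - (cst e + rep d)) - (u - (cst e' + rep d')) = (cst e' + rep d') - (cst e + rep d)" by simp
 finally have "(cst e' + rep d') - (cst e + rep d) \<in> AS" .
 then show "d' = d" using canonical_unique(1) assms d' by blast
qed

lemma canon:
 obtains e where "u - (cst e + rep (canon u)) \<in> AS" "canon u \<in> CR"
 by (metis canon_eqI canonical_exists)

text \<open>Over the algebraic closure every constant has the form \<open>z^p - z\<close>, so
  geometric irreducibility sees only the principal parts; constants merely twist the curve.\<close>

lemma AS_curves_iff: "AS_curve u \<in> AS_curves \<longleftrightarrow> canon u \<noteq> (\<lambda>_. 0)"
proof -
 have inj: "AS_curve u = AS_curve v \<longleftrightarrow> v = u" for v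
  using AS_field_inject[of v u] by (auto simp: AS_curve_def)
 obtain e where e: "u - (cst e + rep (canon u)) \<in> AS" "canon u \<in> CR" by (rule canon)
 have pr: "prime CHAR('k alg_closure ratfun)" by simp
 have "base_change u \<notin> AS \<longleftrightarrow> canon u \<noteq> (\<lambda>_. 0)"
 proof
  assume *: "base_change u \<notin> AS"
  show "canon u \<noteq> (\<lambda>_. 0)"
  proof
   assume 0: "canon u = (\<lambda>_. 0)"
   define P where "P = AS_poly (to_ac e)"
   have "degree P > 0" using degree_AS_poly(1)[of "to_ac e"] p_gt_1 by (simp add: P_def char_k prime_p)
   then obtain z where "poly P z = 0" using alg_closed_imp_poly_has_root by blast
   then have "to_ac e = z ^ p - z" by (simp add: P_def poly_AS_poly char_k)
   then have "cst (to_ac e) = cst z ^ p - cst z" by (simp flip: cst.h_power cst.h_diff)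
   then have "cst (to_ac e) \<in> AS" unfolding AS_def by (auto simp: char_k)
   moreover have "base_change u - cst (to_ac e) \<in> AS"
    using base_change_AS[OF e(1)] 0 e(2) base_change_rep[of "\<lambda>_. 0"] by (simp add: CR_D)
   ultimately have "(base_change u - cst (to_ac e)) + cst (to_ac e) \<in> AS" by (intro AS_add[OF pr])
   then show False using * by simp
  qed
 next
  assume *: "canon u \<noteq> (\<lambda>_. 0)"
  show "base_change u \<notin> AS"
  proof
   assume "base_change u \<in> AS"
   then have "base_change u - base_change (u - (cst e + rep (canon u))) \<in> AS"
    using base_change_AS[OF e(1)] by (intro AS_diff[OF pr])
   then have "cst (to_ac e) + pp_sum (canon u) \<in> AS" using e(2) by (simp add: base_change_rep CR_D)
   then show False using * reduced_not_AS[of "canon u"] e(2) CR_D by auto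
  qed
 qed
 moreover have "base_change u \<notin> AS \<Longrightarrow> u \<notin> AS" using base_change_AS by blast
 ultimately show ?thesis unfolding AS_curves_def by (auto simp: irreducible_AS_poly_iff[OF pr] inj)
qed

definition ram_type :: "('k alg_closure option \<Rightarrow> 'k alg_closure poly) \<Rightarrow> nat multiset" where
 "ram_type d = image_mset (\<lambda>Q. degree (d Q) + 1) (mset_set {Q. d Q \<noteq> 0})"

lemma degree_pos_pp:
 assumes "d \<in> principal_parts" shows "degree (d Q) > 0 \<longleftrightarrow> d Q \<noteq> 0"
proof -
 have "coeff (d Q) 0 = 0" using assms by (simp add: principal_parts_def)
 then show ?thesis by (metis degree_eq_zeroE coeff_pCons_0 pCons_0_0 degree_0 gr0I less_irrefl)
qed

text \<open>The definition admits any representative whose pole orders are prime to p, and all of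
  these share the pole orders of the canonical one.\<close>

lemma has_ramification_data_iff: "has_ramification_data (AS_curve u) R \<longleftrightarrow> R = ram_type (canon u)"
proof -
 have inj: "AS_curve u = AS_curve v \<longleftrightarrow> v = u" for v
  using AS_field_inject[of v u] by (auto simp: AS_curve_def)
 obtain e where e: "u - (cst e + rep (canon u)) \<in> AS" "canon u \<in> CR" by (rule canon)
 define d where "d = canon u"
 define v where "v = cst e + rep d"
 have bv: "base_change v = cst (to_ac e) + pp_sum d"
  using e(2) by (simp add: v_def d_def base_change_rep CR_D)
 have po: "pole_order Q (base_change v) = degree (d Q)" for Q
  unfolding bv using e(2) by (intro pole_order_pp) (simp add: d_def CR_D)
 have dv: "\<not> CHAR('k) dvd pole_order Q (base_change v)" if "pole_order Q (base_change v) > 0" for Q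
 proof -
  have "d Q \<in> no_p_terms" using e(2) by (auto simp: d_def CR_def reduced_parts_def)
  then have "\<not> CHAR('k alg_closure) dvd degree (d Q)" using that po by (intro no_p_terms_degree) auto
  then show ?thesis using po by simp
 qed
 have co: "coprime m CHAR('k) \<longleftrightarrow> \<not> CHAR('k) dvd m" for m :: nat
 proof
  assume co: "coprime m CHAR('k)"
  show "\<not> CHAR('k) dvd m"
  proof
   assume "CHAR('k) dvd m"
   then have "is_unit CHAR('k)" by (rule coprime_common_divisor[OF co]) simp
   then show False using not_prime_unit[of "CHAR('k)"] prime_CHAR by blast
  qed
 next
  assume "\<not> CHAR('k) dvd m"
  then have "coprime CHAR('k) m" using prime_imp_coprime[OF prime_CHAR] by blast
  then show "coprime m CHAR('k)" by (simp add: coprime_commute)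
 qed
 have same: "pole_order Q (base_change w) = pole_order Q (base_change v)"
  if w: "w - u \<in> AS" "\<forall>Q. pole_order Q (base_change w) > 0 \<longrightarrow> coprime (pole_order Q (base_change w)) CHAR('k)" for w Q
 proof (rule pole_order_reduced_unique)
  have "(w - u) + (u - v) \<in> AS" by (rule AS_add) (use w e in \<open>auto simp: v_def d_def\<close>)
  then show "base_change w - base_change v \<in> AS" using base_change_AS[of "w - v"] by simp
 qed (use w dv co in \<open>simp_all\<close>)
 have R: "ram_type d = image_mset (\<lambda>Q. pole_order Q (base_change v) + 1) (mset_set {Q. pole_order Q (base_change v) > 0})"
  unfolding ram_type_def po using degree_pos_pp[OF CR_D(2)[OF e(2)]] by (simp add: d_def)
 have "v - u \<in> AS" using AS_uminus[OF _ e(1)] by (simp add: v_def d_def)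
 show ?thesis
 proof
  assume "has_ramification_data (AS_curve u) R"
  then obtain w where w: "w - u \<in> AS" "\<forall>Q. pole_order Q (base_change w) > 0 \<longrightarrow> coprime (pole_order Q (base_change w)) CHAR('k)"
   "R = image_mset (\<lambda>Q. pole_order Q (base_change w) + 1) (mset_set {Q. pole_order Q (base_change w) > 0})"
   unfolding has_ramification_data_def inj by blast
  then show "R = ram_type (canon u)" using R unfolding same[OF w(1,2)] d_def by simp
 next
  assume "R = ram_type (canon u)"
  then have "R = image_mset (\<lambda>Q. pole_order Q (base_change v) + 1) (mset_set {Q. pole_order Q (base_change v) > 0})"
   using R d_def by simp
  then show "has_ramification_data (AS_curve u) R"
   unfolding has_ramification_data_def using \<open>v - u \<in> AS\<close> dv co by blast
 qed
qed

end

section \<open>Automorphisms of the rational function field\<close>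

lemma card_const_fibres:
 assumes "finite S" "\<And>y. y \<in> f ` S \<Longrightarrow> card {x \<in> S. f x = y} = m"
 shows "card S = m * card (f ` S)"
proof -
 have "card S = (\<Sum>x\<in>S. 1)" by simp
 also have "\<dots> = (\<Sum>y\<in>f ` S. \<Sum>x | x \<in> S \<and> f x = y. 1)"
  by (rule sum.image_gen[OF assms(1)])
 also have "\<dots> = (\<Sum>y\<in>f ` S. m)" using assms(2) by (intro sum.cong) simp_all
 finally show ?thesis by simp
qed

text \<open>At a pole of \<open>t\<close> the leading term of the polynomial dominates, so no
  polynomial relation holds. Having a pole is thus enough for \<open>t\<close> to be substituted
  into rational functions.\<close>

lemma val_poly_at_pole:
 assumes t: "t \<noteq> 0" "val Q t < 0"
 shows "P \<noteq> 0 \<Longrightarrow> poly (map_poly cst P) t \<noteq> 0 \<and> val Q (poly (map_poly cst P) t) = int (degree P) * val Q t"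
proof (induction P)
 case (pCons a P)
 show ?case
 proof (cases "P = 0")
  case True
  then show ?thesis using pCons by simp
 next
  case False
  then have P: "poly (map_poly cst P) t \<noteq> 0" "val Q (poly (map_poly cst P) t) = int (degree P) * val Q t"
   using pCons by auto
  define w where "w = t * poly (map_poly cst P) t"
  have w: "w \<noteq> 0" "val Q w = int (Suc (degree P)) * val Q t"
   using P t by (simp_all add: w_def val_mult algebra_simps)
  have "int (Suc (degree P)) * val Q t < 0" using t(2) by (intro mult_pos_neg) auto
  then have "vge Q (val Q w + 1) (cst a)" using w by (intro vge_cst) simp
  from val_add_dominant[OF w(1) this] show ?thesis using w False by (simp add: w_def add.commute)
 qed
qed simp

lemma ratfun_hom_pole:
 assumes "t \<noteq> 0" "val Q t < 0" shows "ratfun_hom cst t"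
 by unfold_locales (use val_poly_at_pole[OF assms] in blast)

text \<open>Normal forms of fractional linear functions: affine, or with a finite pole at
  \<open>-d\<close>. Each function arises from exactly one choice of parameters, so a field of q
  elements has \<open>(q - 1) q + (q - 1) q^2\<close> of them.\<close>

definition moebius :: "'k::field ratfun set" where
 "moebius = {cst a * ratX + cst b | a b. a \<noteq> 0} \<union> {cst a + cst b / (ratX + cst d) | a b d. b \<noteq> 0}"

text \<open>Field homomorphisms are injective, so surjectivity is all that has to be asked
  for.\<close>

definition rat_auts :: "('k::field ratfun \<Rightarrow> 'k ratfun) set" where
 "rat_auts = {\<gamma>. fhom \<gamma> \<and> (\<forall>c. \<gamma> (cst c) = cst c) \<and> surj \<gamma>}"

lemma ratX_plus_nonzero: "ratX + cst d \<noteq> 0" "val (Some (- d)) (ratX + cst d) = 1"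
 using val_linear(3)[of "- d"] val_linear(1)[of "- d" "- d"] by simp_all

lemma moebius_pole:
 assumes "t \<in> moebius" obtains Q where "t \<noteq> 0" "val Q t = -1"
proof -
 consider a b where "a \<noteq> 0" "t = cst a * ratX + cst b" | a b d where "b \<noteq> 0" "t = cst a + cst b / (ratX + cst d)"
  using assms by (auto simp: moebius_def)
 then show ?thesis
 proof cases
  case 1
  have "cst a * ratX \<noteq> 0" "val None (cst a * ratX) = -1"
   using 1 by (simp_all add: val_mult val_linear)
  with val_add_dominant[of "cst a * ratX" None "cst b"] 1 show ?thesis
   by (intro that[of None]) (simp_all add: vge_cst)
 next
  case 2
  have "cst b / (ratX + cst d) \<noteq> 0" "val (Some (- d)) (cst b / (ratX + cst d)) = -1"
   using 2 ratX_plus_nonzero[of d] by (simp_all add: val_divide)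
  with val_add_dominant[of "cst b / (ratX + cst d)" "Some (- d)" "cst a"] 2 show ?thesis
   by (intro that[of "Some (- d)"]) (simp_all add: vge_cst add.commute)
 qed
qed

lemma moebius_hom: "t \<in> moebius \<Longrightarrow> ratfun_hom cst t"
 by (metis moebius_pole ratfun_hom_pole neg_less_0_iff_less zero_less_one)

lemma moebius_inverse:
 assumes "t \<in> moebius" obtains s where "s \<in> moebius" "rmap cst t s = ratX"
proof -
 interpret ratfun_hom cst t by (rule moebius_hom[OF assms])
 consider a b where "a \<noteq> 0" "t = cst a * ratX + cst b" | a b d where "b \<noteq> 0" "t = cst a + cst b / (ratX + cst d)"
  using assms by (auto simp: moebius_def)
 then show ?thesis
 proof cases
  case 1
  define s where "s = cst (1 / a) * ratX + cst (- b / a)"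
  have "rmap cst t s = cst (1 / a) * t + cst (- b / a)"
   unfolding s_def by (simp only: rm.h_add rm.h_mult rmap_cst rmap_X)
  also have "\<dots> = ratX" using 1 by (simp add: field_simps)
  finally have "rmap cst t s = ratX" .
  moreover have "1 / a \<noteq> 0" using 1 by simp
  then have "s \<in> moebius" unfolding moebius_def s_def by blast
  ultimately show ?thesis by (intro that)
 next
  case 2
  define s where "s = cst (- d) + cst b / (ratX + cst (- a))"
  have "rmap cst t s = cst (- d) + cst b / (t + cst (- a))"
   unfolding s_def by (simp only: rm.h_add rm.h_divide rmap_cst rmap_X)
  also have "t + cst (- a) = cst b / (ratX + cst d)" using 2(2) by simp
  also have "cst (- d) + cst b / (cst b / (ratX + cst d)) = ratX"
   using 2(1) ratX_plus_nonzero(1)[of d] by simp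
  finally have "rmap cst t s = ratX" .
  moreover have "s \<in> moebius" unfolding moebius_def s_def using 2(1) by blast
  ultimately show ?thesis by (intro that)
 qed
qed

lemma moebius_aut: assumes "t \<in> moebius" shows "rmap cst t \<in> rat_auts"
proof -
 interpret t: ratfun_hom cst t by (rule moebius_hom[OF assms])
 obtain s where s: "s \<in> moebius" "rmap cst t s = ratX" using moebius_inverse[OF assms] .
 interpret s: ratfun_hom cst s by (rule moebius_hom[OF s(1)])
 have "rmap cst t (rmap cst s f) = f" for f
  by (rule ratfun_hom_unique[OF fhom_comp[OF t.rmap_fhom s.rmap_fhom] fhom_id]) (use s in auto)
 then have "surj (rmap cst t)" by (metis surjI)
 then show ?thesis using t.rmap_fhom by (simp add: rat_auts_def)
qed

section \<open>Automorphisms of k(x) over k are fractional linear\<close>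

lemma coeff_mult_bounds:
 fixes f g :: "'a::field poly"
 assumes "degree f \<le> a" "degree g \<le> b"
 shows "coeff (f * g) (a + b) = coeff f a * coeff g b"
proof (cases "degree f = a \<and> degree g = b")
 case True
 then show ?thesis using coeff_mult_degree_sum[of f g] by auto
next
 case False
 have "degree (f * g) < a + b" using False assms degree_mult_le[of f g] by auto
 then have "coeff (f * g) (a + b) = 0" by (rule coeff_eq_0)
 moreover have "coeff f a * coeff g b = 0" using False assms by (auto simp: coeff_eq_0)
 ultimately show ?thesis by simp
qed

lemma coeff_power_bounds:
 fixes f :: "'a::field poly"
 assumes "degree f \<le> a"
 shows "degree (f ^ n) \<le> n * a" "coeff (f ^ n) (n * a) = coeff f a ^ n"
proof -
 have d: "degree (f ^ n) \<le> n * a" for n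
 proof -
  have "degree (f ^ n) \<le> degree f * n" by (rule degree_power_le)
  also have "\<dots> \<le> a * n" using assms by (rule mult_le_mono1)
  finally show ?thesis by (simp add: mult.commute)
 qed
 then show "degree (f ^ n) \<le> n * a" .
 show "coeff (f ^ n) (n * a) = coeff f a ^ n"
 proof (induction n)
  case (Suc n)
  then show ?case using coeff_mult_bounds[OF assms d[of n]] by simp
 qed simp
qed

lemma poly_coprime_mult:
 fixes a b c :: "'a::field poly"
 assumes "coprime a b" "coprime a c" shows "coprime a (b * c)"
proof -
 obtain u v where uv: "u * a + v * b = 1" using poly_bezout[OF assms(1)] .
 obtain w z where wz: "w * a + z * c = 1" using poly_bezout[OF assms(2)] .
 have "(u * a + v * b) * (w * a + z * c) = 1" using uv wz by simp
 then have "(u * w * a + u * z * c + v * b * w) * a + (v * z) * (b * c) = 1" by (simp add: algebra_simps)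
 then show ?thesis by (rule coprime_if_bezout)
qed

lemma poly_coprime_power:
 fixes a b :: "'a::field poly"
 shows "coprime a b \<Longrightarrow> coprime a (b ^ n)" by (induction n) (simp_all add: poly_coprime_mult)

text \<open>The homogenisation \<open>D ^ n * A (N / D)\<close>.\<close>

definition homog :: "'a::field poly \<Rightarrow> 'a poly \<Rightarrow> nat \<Rightarrow> 'a poly \<Rightarrow> 'a poly" where
 "homog N D n A = (\<Sum>i\<le>n. smult (coeff A i) (N ^ i * D ^ (n - i)))"

lemma to_fract_power [simp]: "to_fract (P ^ n) = to_fract P ^ n" by (induction n) auto

lemma to_fract_smult: "to_fract (smult c P) = cst c * to_fract P"
proof -
 have "smult c P = [:c:] * P" by simp
 then show ?thesis by (simp only: to_fract_mult cst_def)
qed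

lemma to_fract_homog:
 assumes "D \<noteq> 0" "degree A \<le> n"
 shows "to_fract (homog N D n A) = poly (map_poly cst A) (to_fract N / to_fract D) * to_fract D ^ n"
proof -
 have "poly (map_poly cst A) (to_fract N / to_fract D)
   = (\<Sum>i\<le>n. cst (coeff A i) * (to_fract N / to_fract D) ^ i)"
  unfolding poly_altdef cst.degree_map cst.coeff_map using assms(2)
  by (intro sum.mono_neutral_left) (auto simp: coeff_eq_0)
 also have "\<dots> * to_fract D ^ n = (\<Sum>i\<le>n. cst (coeff A i) * (to_fract N ^ i * to_fract D ^ (n - i)))"
  unfolding sum_distrib_right
 proof (rule sum.cong[OF refl])
  fix i assume "i \<in> {..n}"
  then have "to_fract D ^ n = to_fract D ^ i * to_fract D ^ (n - i)" by (simp flip: power_add)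
  then show "cst (coeff A i) * (to_fract N / to_fract D) ^ i * to_fract D ^ n =
   cst (coeff A i) * (to_fract N ^ i * to_fract D ^ (n - i))" using assms(1) by (simp add: power_divide)
 qed
 finally show ?thesis by (simp add: homog_def to_fract_smult)
qed

lemma homog_mod: "D dvd homog N D n A - smult (coeff A n) (N ^ n)"
proof -
 have "homog N D n A - smult (coeff A n) (N ^ n)
   = (\<Sum>i\<in>{..n} - {n}. smult (coeff A i) (N ^ i * D ^ (n - i)))"
  unfolding homog_def by (subst sum.remove[of _ n]) auto
 also have "D dvd \<dots>"
 proof (rule dvd_sum)
  fix i assume "i \<in> {..n} - {n}"
  then have "D dvd D ^ (n - i)" by (intro dvd_power) auto
  then show "D dvd smult (coeff A i) (N ^ i * D ^ (n - i))" by (intro dvd_smult dvd_mult)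
 qed
 finally show ?thesis .
qed

lemma coeff_homog:
 assumes "degree N \<le> d" "degree D \<le> d"
 shows "coeff (homog N D n A) (n * d)
  = (\<Sum>i\<le>n. coeff A i * (coeff N d ^ i * coeff D d ^ (n - i)))"
 unfolding homog_def coeff_sum coeff_smult
proof (rule sum.cong[OF refl])
 fix i assume "i \<in> {..n}"
 then have "n * d = i * d + (n - i) * d" by (simp flip: add_mult_distrib)
 then show "coeff A i * coeff (N ^ i * D ^ (n - i)) (n * d) =
   coeff A i * (coeff N d ^ i * coeff D d ^ (n - i))"
  using coeff_mult_bounds[OF coeff_power_bounds(1)[OF assms(1), of i] coeff_power_bounds(1)[OF assms(2), of "n - i"]]
   coeff_power_bounds(2)[OF assms(1)] coeff_power_bounds(2)[OF assms(2)] by simp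
qed

lemma rat_aut_unique: "\<gamma> \<in> rat_auts \<Longrightarrow> \<delta> \<in> rat_auts \<Longrightarrow> \<gamma> ratX = \<delta> ratX \<Longrightarrow> \<gamma> = \<delta>"
 using ratfun_hom_unique[of \<gamma> \<delta>] by (auto simp: rat_auts_def)

text \<open>Degrees multiply under substitution. Surjectivity gives \<open>s = A / B\<close> with
  \<open>A(t) = x B(t)\<close>; clearing denominators in \<open>t = N / D\<close> turns this into
  \<open>A' = x B'\<close>, where \<open>B'\<close> divides a power of \<open>D\<close> and is prime
  to \<open>D\<close>, hence constant. One of \<open>A'\<close>, \<open>B'\<close> has a nonzero
  coefficient at \<open>n d\<close>, the product of the degrees of \<open>s\<close> and
  \<open>t\<close>, so \<open>n d \<le> 1\<close>.\<close>

lemma rat_aut_degree: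
 assumes g: "\<gamma> \<in> rat_auts" and t: "t = \<gamma> ratX"
 shows "max (degree (num t)) (degree (den t)) = 1"
proof -
 interpret g: fhom \<gamma> using g by (simp add: rat_auts_def)
 have gc [simp]: "\<gamma> (cst c) = cst c" for c using g by (simp add: rat_auts_def)
 have gP: "\<gamma> (to_fract P) = poly (map_poly cst P) t" for P
 proof -
  have "\<gamma> (poly (map_poly cst P) ratX) = poly (map_poly cst P) t" using t by (induction P) auto
  then show ?thesis by simp
 qed
 define N D where "N = num t" and "D = den t"
 have D0: "D \<noteq> 0" and tND: "to_fract N / to_fract D = t" by (simp_all add: N_def D_def ratfun_eq_div)
 obtain s where s: "\<gamma> s = ratX" using g unfolding rat_auts_def by (metis (mono_tags) mem_Collect_eq surjD)
 define A B where "A = num s" and "B = den s"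
 have B0: "B \<noteq> 0" by (simp add: B_def)
 have "\<gamma> (to_fract A / to_fract B) = ratX" using s by (simp add: A_def B_def ratfun_eq_div)
 then have AB: "poly (map_poly cst A) t = ratX * poly (map_poly cst B) t"
  using B0 by (simp flip: gP add: field_simps)
 obtain u v where uv: "u * A + v * B = 1" using poly_bezout[OF coprime_num_den] unfolding A_def B_def .
 obtain w z where wz: "w * N + z * D = 1" using poly_bezout[OF coprime_num_den] unfolding N_def D_def .
 define n where "n = max (degree A) (degree B)"
 define m where "m = max (degree u) (degree v)"
 define d where "d = max (degree N) (degree D)"
 define A' B' where "A' = homog N D n A" and "B' = homog N D n B"
 have hA: "to_fract A' = poly (map_poly cst A) t * to_fract D ^ n"
  and hB: "to_fract B' = poly (map_poly cst B) t * to_fract D ^ n"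
  unfolding A'_def B'_def using D0 by (simp_all add: to_fract_homog n_def tND)
 have hu: "to_fract (homog N D m u) = poly (map_poly cst u) t * to_fract D ^ m"
  and hv: "to_fract (homog N D m v) = poly (map_poly cst v) t * to_fract D ^ m"
  using D0 by (simp_all add: to_fract_homog m_def tND)
 have "to_fract A' = to_fract ([:0, 1:] * B')" unfolding to_fract_mult hA hB AB by (simp add: ratX_def)
 then have A'B': "A' = [:0, 1:] * B'" by (simp only: to_fract_eq_iff)
 have "poly (map_poly cst (u * A + v * B)) t = 1" using uv by simp
 then have one: "poly (map_poly cst u) t * poly (map_poly cst A) t + poly (map_poly cst v) t * poly (map_poly cst B) t = 1"
  by simp
 \<comment> \<open>The Bezout identity for \<open>A\<close> and \<open>B\<close>, evaluated at
   \<open>t\<close> and multiplied by \<open>D^(m + n)\<close>.\<close>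
 have "to_fract (homog N D m u * A' + homog N D m v * B') = to_fract (D ^ (m + n))"
 proof -
  have "to_fract (homog N D m u * A' + homog N D m v * B') =
   (poly (map_poly cst u) t * poly (map_poly cst A) t + poly (map_poly cst v) t * poly (map_poly cst B) t) * to_fract D ^ (m + n)"
   unfolding to_fract_add to_fract_mult hA hB hu hv by (simp add: algebra_simps power_add)
  then show ?thesis using one by simp
 qed
 then have "homog N D m u * A' + homog N D m v * B' = D ^ (m + n)" by (simp only: to_fract_eq_iff)
 moreover have "B' dvd A'" unfolding A'B' by (rule dvd_triv_right)
 ultimately have B'D: "B' dvd D ^ (m + n)" by (metis dvd_add dvd_mult dvd_refl)
 have nz: "coeff A n \<noteq> 0 \<or> coeff B n \<noteq> 0"
 proof (cases "degree B \<ge> degree A")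
  case True
  then have "n = degree B" by (simp add: n_def)
  then show ?thesis using B0 by simp
 next
  case False
  then have "n = degree A" "A \<noteq> 0" by (auto simp: n_def)
  then show ?thesis by simp
 qed
 \<comment> \<open>A common factor of \<open>B'\<close> and \<open>D\<close> also divides
   \<open>A'\<close>. Modulo \<open>D\<close> only the top terms, multiples of \<open>N^n\<close> by
   the n-th coefficients of \<open>A\<close> and \<open>B\<close>, remain; these coefficients are
   not both zero, and \<open>N\<close> is prime to \<open>D\<close>.\<close>
 have "coprime B' D"
 proof (rule coprimeI)
  fix c assume c: "c dvd B'" "c dvd D"
  then have cA: "c dvd A'" using \<open>B' dvd A'\<close> dvd_trans by blast
  have A1: "c dvd A' - smult (coeff A n) (N ^ n)" unfolding A'_def using c(2) homog_mod dvd_trans by blast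
  have A2: "c dvd smult (coeff A n) (N ^ n)" using dvd_diff[OF cA A1] by simp
  have B1: "c dvd B' - smult (coeff B n) (N ^ n)" unfolding B'_def using c(2) homog_mod dvd_trans by blast
  have B2: "c dvd smult (coeff B n) (N ^ n)" using dvd_diff[OF c(1) B1] by simp
  have "c dvd N ^ n" using nz A2 B2 by (auto simp: dvd_smult_iff)
  moreover have "coprime c N"
  proof (rule coprimeI)
   fix e assume "e dvd c" "e dvd N"
   then have "e dvd w * N + z * D" using c(2) dvd_trans by (intro dvd_add dvd_mult) auto
   then show "is_unit e" using wz by simp
  qed
  then have "coprime c (N ^ n)" by (rule poly_coprime_power)
  ultimately show "is_unit c" using coprime_common_divisor[of c "N ^ n" c] by simp
 qed
 then have "coprime B' (D ^ (m + n))" by (rule poly_coprime_power)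
 then have "is_unit B'" using coprime_common_divisor[OF _ _ B'D] by simp
 then obtain \<beta> where \<beta>: "B' = [:\<beta>:]" "\<beta> \<noteq> 0"
  by (metis degree_eq_zeroE is_unit_iff_degree pCons_0_0 dvd_0_left_iff zero_neq_one)
 define nd dd where "nd = coeff N d" and "dd = coeff D d"
 have ndd: "nd \<noteq> 0 \<or> dd \<noteq> 0"
 proof (cases "degree D \<ge> degree N")
  case True
  then have "d = degree D" by (simp add: d_def)
  then show ?thesis using D0 by (simp add: dd_def)
 next
  case False
  then have "d = degree N" "N \<noteq> 0" by (auto simp: d_def)
  then show ?thesis by (simp add: nd_def)
 qed
 have co: "coeff (homog N D n P) (n * d) = (\<Sum>i\<le>n. coeff P i * (nd ^ i * dd ^ (n - i)))" for P
  unfolding nd_def dd_def by (rule coeff_homog) (simp_all add: d_def)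
 \<comment> \<open>The coefficients at \<open>n d\<close> are the homogenised \<open>A\<close> and
   \<open>B\<close> evaluated at \<open>(nd, dd)\<close>, the value of \<open>t\<close> at infinity
   in homogeneous coordinates. \<open>A\<close> and \<open>B\<close> have no common zero there; for
   \<open>dd = 0\<close> it is the point at infinity, where \<open>nz\<close> applies.\<close>
 have top: "coeff A' (n * d) \<noteq> 0 \<or> coeff B' (n * d) \<noteq> 0"
 proof (cases "dd = 0")
  case True
  have "(\<Sum>i\<le>n. coeff P i * (nd ^ i * dd ^ (n - i))) = coeff P n * nd ^ n" for P
  proof -
   have "(\<Sum>i\<le>n. coeff P i * (nd ^ i * dd ^ (n - i))) = (\<Sum>i\<in>{n}. coeff P i * (nd ^ i * dd ^ (n - i)))"
    using True by (intro sum.mono_neutral_right) (auto simp: power_0_left)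
   then show ?thesis by simp
  qed
  then show ?thesis using nz ndd True unfolding A'_def B'_def co by simp
 next
  case False
  have *: "(\<Sum>i\<le>n. coeff P i * (nd ^ i * dd ^ (n - i))) = poly P (nd / dd) * dd ^ n"
   if "degree P \<le> n" for P
  proof -
   have "poly P (nd / dd) = (\<Sum>i\<le>n. coeff P i * (nd / dd) ^ i)"
    unfolding poly_altdef using that by (intro sum.mono_neutral_left) (auto simp: coeff_eq_0)
   also have "\<dots> * dd ^ n = (\<Sum>i\<le>n. coeff P i * (nd ^ i * dd ^ (n - i)))"
    unfolding sum_distrib_right
   proof (rule sum.cong[OF refl])
    fix i assume "i \<in> {..n}"
    then have "dd ^ n = dd ^ i * dd ^ (n - i)" by (simp flip: power_add)
    then show "coeff P i * (nd / dd) ^ i * dd ^ n = coeff P i * (nd ^ i * dd ^ (n - i))"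
     using False by (simp add: power_divide)
   qed
   finally show ?thesis by simp
  qed
  have "poly (u * A + v * B) (nd / dd) = 1" using uv by simp
  then have "poly A (nd / dd) \<noteq> 0 \<or> poly B (nd / dd) \<noteq> 0" by auto
  moreover have "degree A \<le> n" "degree B \<le> n" by (simp_all add: n_def)
  ultimately show ?thesis unfolding A'_def B'_def co using False by (simp add: *)
 qed
 have "n * d \<le> 1"
 proof (rule ccontr)
  assume "\<not> n * d \<le> 1"
  then have "coeff B' (n * d) = 0" "coeff A' (n * d) = 0"
   unfolding A'B' \<beta> by (auto simp: coeff_pCons split: nat.splits)
  then show False using top by blast
 qed
 moreover have "n > 0"
 proof (rule ccontr)
  assume "\<not> n > 0"
  then obtain a b where "A = [:a:]" "B = [:b:]" by (auto simp: n_def elim!: degree_eq_zeroE)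
  then have "s = cst (a / b)" using ratfun_eq_div[of s] by (simp add: A_def B_def flip: cst_def)
  then have "cst (a / b) = ratX" using s gc[of "a / b"] by metis
  then show False by (simp only: ratX_neq_cst)
 qed
 moreover have "d > 0"
 proof (rule ccontr)
  assume "\<not> d > 0"
  then obtain a b where "N = [:a:]" "D = [:b:]" by (auto simp: d_def elim!: degree_eq_zeroE)
  then have "t = cst (a / b)" using tND by (simp flip: cst_def)
  then have "\<gamma> ratX = \<gamma> (cst (a / b))" using t by simp
  then show False by (simp only: g.h_eq_iff ratX_neq_cst)
 qed
 ultimately have "n * d = 1" by (metis le_antisym One_nat_def Suc_leI nat_0_less_mult_iff)
 then show ?thesis by (simp add: d_def N_def D_def)
qed

lemma rat_aut_moebius: assumes g: "\<gamma> \<in> rat_auts" shows "\<gamma> ratX \<in> moebius"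
proof -
 define t where "t = \<gamma> ratX"
 interpret g: fhom \<gamma> using g by (simp add: rat_auts_def)
 have nc: "t \<noteq> cst c" for c
 proof
  assume "t = cst c"
  then have "\<gamma> ratX = \<gamma> (cst c)" using g by (simp add: t_def rat_auts_def)
  then show False by (simp only: g.h_eq_iff ratX_neq_cst)
 qed
 have deg: "degree (num t) \<le> 1" "degree (den t) \<le> 1" using rat_aut_degree[OF g t_def] by auto
 obtain n0 n1 where N: "num t = [:n0, n1:]"
  using deg(1) by (metis One_nat_def degree_0_id degree_pCons_eq le_SucE le_zero_eq nat.inject pCons_cases pCons_0_0 degree_eq_zeroE)
 obtain d0 d1 where D: "den t = [:d0, d1:]"
  using deg(2) by (metis One_nat_def degree_0_id degree_pCons_eq le_SucE le_zero_eq nat.inject pCons_cases pCons_0_0 degree_eq_zeroE)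
 have lin: "to_fract [:a, b:] = cst a + cst b * ratX" for a b :: 'a
 proof -
  have "[:a, b:] = [:a:] + [:b:] * [:0, 1:]" by simp
  then show ?thesis by (simp only: to_fract_add to_fract_mult cst_def ratX_def)
 qed
 have t: "t = (cst n0 + cst n1 * ratX) / (cst d0 + cst d1 * ratX)"
  using ratfun_eq_div[of t] unfolding N D lin by simp
 show ?thesis
 proof (cases "d1 = 0")
  case True
  then have d0: "d0 \<noteq> 0" using D den_nonzero[of t] by auto
  have "t = cst (n1 / d0) * ratX + cst (n0 / d0)" using t True d0 by (simp add: add_divide_distrib)
  moreover from this have "n1 / d0 \<noteq> 0" using nc[of "n0 / d0"] by auto
  ultimately show ?thesis unfolding moebius_def t_def[symmetric] by blast
 next
  case False
  \<comment> \<open>The pole is at \<open>-e\<close>, and \<open>b\<close> is the residue there: the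
    remainder of the numerator modulo \<open>x + e\<close>, divided by \<open>d1\<close>.\<close>
  define e where "e = d0 / d1"
  define b where "b = (n0 - n1 * e) / d1"
  have De: "cst d0 + cst d1 * ratX = cst d1 * (ratX + cst e)" using False by (simp add: e_def algebra_simps)
  have nz: "ratX + cst e \<noteq> 0" by (rule ratX_plus_nonzero)
  have "t = cst (n1 / d1) + cst b / (ratX + cst e)"
  proof -
   have "cst d1 * (ratX + cst e) * (cst (n1 / d1) + cst b / (ratX + cst e)) = cst n0 + cst n1 * ratX"
   proof -
    have "cst d1 * G * (cst (n1 / d1) + cst b / G) = cst n1 * G + cst d1 * cst b"
     if "G \<noteq> 0" for G using that False by (simp add: field_simps)
    from this[OF nz] have "cst d1 * (ratX + cst e) * (cst (n1 / d1) + cst b / (ratX + cst e))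
      = cst n1 * (ratX + cst e) + cst d1 * cst b" .
    moreover have "cst d1 * cst b = cst n0 - cst n1 * cst e" using False by (simp add: b_def)
    ultimately show ?thesis by (simp add: algebra_simps)
   qed
   from this[symmetric] show ?thesis unfolding t De using nz False by simp
  qed
  moreover from this have "b \<noteq> 0" using nc[of "n1 / d1"] by auto
  ultimately show ?thesis unfolding moebius_def t_def[symmetric] by blast
 qed
qed

lemma bij_betw_rat_auts: "bij_betw (\<lambda>\<gamma>. \<gamma> ratX) rat_auts (moebius :: 'a::field ratfun set)"
proof (rule bij_betw_imageI)
 show "inj_on (\<lambda>\<gamma>. \<gamma> ratX) (rat_auts :: ('a ratfun \<Rightarrow> _) set)" by (rule inj_onI) (rule rat_aut_unique)
 show "(\<lambda>\<gamma>. \<gamma> ratX) ` rat_auts = (moebius :: 'a ratfun set)"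
 proof (intro equalityI subsetI)
  fix t :: "'a ratfun" assume t: "t \<in> moebius"
  interpret ratfun_hom cst t by (rule moebius_hom[OF t])
  show "t \<in> (\<lambda>\<gamma>. \<gamma> ratX) ` rat_auts"
   using moebius_aut[OF t] by (intro image_eqI[of _ _ "rmap cst t"]) auto
 qed (auto intro: rat_aut_moebius)
qed

lemma card_moebius:
 assumes q: "card (UNIV :: 'k::{field,finite} set) = q"
 shows "finite (moebius :: 'k ratfun set)" "card (moebius :: 'k ratfun set) = q ^ 3 - q"
proof -
 define S where "S = (UNIV - {0 :: 'k})"
 define f where "f = (\<lambda>(a, b :: 'k). cst a * ratX + cst b)"
 define g where "g = (\<lambda>(b, a, d :: 'k). cst a + cst b / (ratX + cst d))"
 have M: "(moebius :: 'k ratfun set) = f ` (S \<times> UNIV) \<union> g ` (S \<times> UNIV \<times> UNIV)"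
 proof -
  have "{cst a * ratX + cst b | a b. a \<noteq> 0} = f ` (S \<times> UNIV)"
   unfolding f_def S_def by (auto simp: image_iff)
  moreover have "{cst a + cst b / (ratX + cst d) | a b d. b \<noteq> 0} = g ` (S \<times> UNIV \<times> UNIV)"
  proof (intro equalityI subsetI)
   fix x assume "x \<in> {cst a + cst b / (ratX + cst d) | a b d. b \<noteq> (0 :: 'k)}"
   then obtain a b d where "x = cst a + cst b / (ratX + cst d)" "b \<noteq> 0" by blast
   then show "x \<in> g ` (S \<times> UNIV \<times> UNIV)"
    by (intro image_eqI[of _ _ "(b, a, d)"]) (auto simp: g_def S_def)
  qed (auto simp: g_def S_def)
  ultimately show ?thesis unfolding moebius_def by simp
 qed
 have lin: "cst a * ratX + cst b = to_fract [:b, a:]" for a b :: 'k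
 proof -
  have "[:b, a:] = [:a:] * [:0, 1:] + [:b:]" by simp
  then show ?thesis by (simp only: to_fract_add to_fract_mult cst_def ratX_def)
 qed
 have gf: "g (b, a, d) = to_fract [:a * d + b, a:] / to_fract [:d, 1:]" for a b d
 proof -
  have "to_fract [:d, 1:] = ratX + cst d" using lin[of 1 d] by simp
  moreover have "to_fract [:a * d + b, a:] = cst a * (ratX + cst d) + cst b"
   using lin[of a "a * d + b"] by (simp add: algebra_simps)
  ultimately show ?thesis using ratX_plus_nonzero(1)[of d] by (simp add: g_def add_divide_distrib)
 qed
 have cross: "P * [:d', 1:] = P' * [:d, 1:]"
  if "to_fract P / to_fract [:d, 1:] = to_fract P' / to_fract [:d', 1:]" for P P' and d d' :: 'k
 proof -
  have "to_fract P * to_fract [:d', 1:] = to_fract P' * to_fract [:d, 1:]"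
   using that by (subst (asm) frac_eq_eq) auto
  then show ?thesis by (simp only: to_fract_eq_iff flip: to_fract_mult)
 qed
 have "inj_on f (S \<times> UNIV)" by (rule inj_onI) (auto simp: f_def lin)
 then have cf: "card (f ` (S \<times> UNIV)) = (q - 1) * q"
  using q by (simp add: card_image card_cartesian_product S_def card_Diff_singleton)
 have "inj_on g (S \<times> UNIV \<times> UNIV)"
 proof (rule inj_onI, clarsimp simp only: prod.inject split_paired_all)
  fix b a d b' a' d' assume S: "b \<in> S" "b' \<in> S" and e: "g (b, a, d) = g (b', a', d')"
  have e: "[:a * d + b, a:] * [:d', 1:] = [:a' * d' + b', a':] * [:d, 1:]"
   using e unfolding gf by (rule cross)
  then have 1: "a = a'" by simp
  then have 2: "b = b'" using e by (simp add: algebra_simps)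
  have "(a * d + b) * d' = (a * d' + b) * d" using e 1 2 by (simp add: algebra_simps)
  then have "b * d' = b * d" by (simp add: algebra_simps)
  then show "b = b' \<and> a = a' \<and> d = d'" using 1 2 S by (simp add: S_def)
 qed
 then have "card (g ` (S \<times> UNIV \<times> UNIV)) = card S * (card (UNIV :: 'k set) * card (UNIV :: 'k set))"
  by (simp only: card_image card_cartesian_product)
 then have cg: "card (g ` (S \<times> UNIV \<times> UNIV)) = (q - 1) * (q * q)"
  using q by (simp add: S_def card_Diff_singleton)
 have "f ` (S \<times> UNIV) \<inter> g ` (S \<times> UNIV \<times> UNIV) = {}"
 proof (rule ccontr)
  assume "f ` (S \<times> UNIV) \<inter> g ` (S \<times> UNIV \<times> UNIV) \<noteq> {}"
  then obtain a b b' a' d' where *: "a \<in> S" "f (a, b) = g (b', a', d')" by auto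
  then have "to_fract [:b, a:] = to_fract [:a' * d' + b', a':] / to_fract [:d', 1:]"
   unfolding gf by (simp add: f_def lin)
  then have "to_fract [:b, a:] * to_fract [:d', 1:] = to_fract [:a' * d' + b', a':]"
   by (simp add: field_simps)
  then have "[:b, a:] * [:d', 1:] = [:a' * d' + b', a':]"
   by (simp only: to_fract_eq_iff flip: to_fract_mult)
  then show False using * by (simp add: S_def)
 qed
 then have "card (moebius :: 'k ratfun set) = (q - 1) * q + (q - 1) * (q * q)"
  unfolding M using cf cg by (subst card_Un_disjoint) (auto simp: S_def)
 also have "\<dots> = q ^ 3 - q" by (cases q) (simp_all add: algebra_simps power3_eq_cube)
 finally show "card (moebius :: 'k ratfun set) = q ^ 3 - q" .
 show "finite (moebius :: 'k ratfun set)" unfolding M by (auto simp: S_def)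
qed

lemma card_rat_auts:
 assumes "card (UNIV :: 'k::{field,finite} set) = q"
 shows "finite (rat_auts :: ('k ratfun \<Rightarrow> _) set)" "card (rat_auts :: ('k ratfun \<Rightarrow> _) set) = q ^ 3 - q"
 using card_moebius[OF assms] bij_betw_finite[OF bij_betw_rat_auts[where 'a = 'k]]
  bij_betw_same_card[OF bij_betw_rat_auts[where 'a = 'k]] by auto

lemma rat_auts_id: "(\<lambda>x. x) \<in> rat_auts" by (simp add: rat_auts_def fhom_id)

lemma rat_auts_comp: "\<gamma> \<in> rat_auts \<Longrightarrow> \<delta> \<in> rat_auts \<Longrightarrow> (\<lambda>x. \<gamma> (\<delta> x)) \<in> rat_auts"
 using comp_surj[of \<delta> \<gamma>] unfolding rat_auts_def by (simp add: fhom_comp comp_def)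

lemma rat_auts_bij: "\<gamma> \<in> rat_auts \<Longrightarrow> bij \<gamma>"
 unfolding rat_auts_def by (auto intro!: bijI injI simp: fhom.h_eq_iff)

lemma rat_auts_inv:
 assumes "\<gamma> \<in> rat_auts"
 obtains \<delta> where "\<delta> \<in> rat_auts" "\<And>x. \<gamma> (\<delta> x) = x" "\<And>x. \<delta> (\<gamma> x) = x"
proof -
 interpret fhom \<gamma> using assms by (simp add: rat_auts_def)
 define \<delta> where "\<delta> = inv_into UNIV \<gamma>"
 have 1: "\<gamma> (\<delta> x) = x" for x
  unfolding \<delta>_def using rat_auts_bij[OF assms] by (simp add: bij_is_surj f_inv_into_f)
 have 2: "\<delta> (\<gamma> x) = x" for x using 1 h_eq_iff by blast
 have "\<delta> \<in> rat_auts"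
 proof -
  have "fhom \<delta>" by standard (simp_all add: 1 flip: h_eq_iff)
  moreover have "\<delta> (cst c) = cst c" for c using assms 2[of "cst c"] by (simp add: rat_auts_def)
  moreover have "surj \<delta>" using 2 by (metis surjI)
  ultimately show ?thesis by (simp add: rat_auts_def)
 qed
 then show ?thesis using that 1 2 by blast
qed

section \<open>Isomorphisms of Artin--Schreier curves\<close>

lemma AS_field_simps [simp]:
 "carrier (AS_field (u :: 'k::field ratfun)) = {f. degree f < CHAR('k)}"
 "monoid.mult (AS_field u) f g = (f * g) mod AS_poly u"
 "monoid.one (AS_field u) = 1" "ring.zero (AS_field u) = 0" "ring.add (AS_field u) = (+)"
 by (simp_all add: AS_field_def)

lemma pcompose_pow: "(f ^ n) \<circ>\<^sub>p g = (f \<circ>\<^sub>p g) ^ (n :: nat)" for f :: "'a::comm_ring_1 poly"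
 by (induction n) (simp_all add: pcompose_mult pcompose_1)

context finite_base
begin

lemma prime_CHAR_ratfun: "prime CHAR('k ratfun)" by simp

lemma degree_mod_AS: "degree (f mod AS_poly (u :: 'k ratfun)) < CHAR('k)"
 using degree_mod_less'[of "AS_poly u" f] degree_AS_poly[OF prime_CHAR_ratfun, of u] p_gt_1
 by (cases "f mod AS_poly u = 0") (auto simp: char_k)

lemma mod_AS_less: "degree f < CHAR('k) \<Longrightarrow> f mod AS_poly (u :: 'k ratfun) = f"
 using degree_AS_poly(1)[OF prime_CHAR_ratfun, of u] by (intro mod_poly_less) simp

lemma cring_AS_field: "cring (AS_field (u :: 'k ratfun))"
proof (rule cringI)
 show "abelian_group (AS_field u)"
 proof (rule abelian_groupI)
  fix f assume "f \<in> carrier (AS_field u)"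
  then show "\<exists>g\<in>carrier (AS_field u). g \<oplus>\<^bsub>AS_field u\<^esub> f = \<zero>\<^bsub>AS_field u\<^esub>"
   by (intro bexI[of _ "- f"]) simp_all
 qed (use p_gt_1 in \<open>auto simp: char_k degree_add_less\<close>)
 show "comm_monoid (AS_field u)"
 proof (rule comm_monoidI)
  fix f g h
  show "f \<otimes>\<^bsub>AS_field u\<^esub> g \<otimes>\<^bsub>AS_field u\<^esub> h = f \<otimes>\<^bsub>AS_field u\<^esub> (g \<otimes>\<^bsub>AS_field u\<^esub> h)"
   by (simp add: mod_mult_left_eq mod_mult_right_eq mult.assoc)
 qed (use p_gt_1 in \<open>auto simp: char_k degree_mod_AS[unfolded char_k] mod_AS_less mult.commute\<close>)
 fix f g h
 show "(f \<oplus>\<^bsub>AS_field u\<^esub> g) \<otimes>\<^bsub>AS_field u\<^esub> h = f \<otimes>\<^bsub>AS_field u\<^esub> h \<oplus>\<^bsub>AS_field u\<^esub> g \<otimes>\<^bsub>AS_field u\<^esub> h"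
  by (simp add: poly_mod_add_left distrib_right)
qed

lemma ring_AS_field: "ring (AS_field (u :: 'k ratfun))" using cring_AS_field by (rule cring.axioms)

definition shift :: "'k ratfun poly \<Rightarrow> 'k ratfun poly" where
 "shift f = f \<circ>\<^sub>p [:1, 1:]"

lemma shift_simps [simp]: "shift (f + g) = shift f + shift g" "shift (f - g) = shift f - shift g"
 "shift (f * g) = shift f * shift g" "shift [:c:] = [:c:]" "degree (shift f) = degree f"
 "shift 0 = 0" "shift (f ^ n) = shift f ^ n" "shift 1 = 1"
 by (simp_all add: shift_def pcompose_add pcompose_diff pcompose_mult pcompose_pow one_pCons degree_pcompose)

lemma AS_aut_eq: "degree f < CHAR('k) \<Longrightarrow> AS_aut f = shift f"
 by (simp add: AS_aut_def shift_def)

lemma shift_AS_poly [simp]: "shift (AS_poly u) = AS_poly (u :: 'k ratfun)"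
proof -
 have pr: "prime CHAR('k ratfun poly)" by simp
 have "shift (AS_poly u) = [:1, 1:] ^ p - [:1, 1:] - [:u:]"
  by (simp add: shift_def AS_poly_def char_k monom_altdef pcompose_diff pcompose_pow pcompose_pCons)
 also have "[:1, 1:] = [:0, 1:] + (1 :: 'k ratfun poly)" by (simp add: one_pCons)
 also have "([:0, 1:] + (1 :: 'k ratfun poly)) ^ p = [:0, 1:] ^ p + 1"
  using freshmans_dream[OF pr, of p "[:0, 1:]" 1] by (simp add: char_k)
 finally show ?thesis by (simp add: AS_poly_def char_k monom_altdef)
qed

text \<open>The coefficient of \<open>Y^(d - 1)\<close> in \<open>f(Y + 1) - f(Y)\<close> is
  \<open>d\<close> times the leading coefficient, which is nonzero for \<open>0 < d < p\<close>. So
  the fixed field of the automorphism is k(x).\<close>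

lemma shift_fixed:
 assumes "degree f < CHAR('k)" "shift f = f"
 shows "\<exists>r. f = [:r:]"
proof (rule ccontr)
 assume no: "\<nexists>r. f = [:r:]"
 define d where "d = degree f"
 have d: "d > 0" using no by (metis d_def degree_eq_zeroE gr0I)
 have "f = (\<Sum>i\<le>d. monom (coeff f i) i)" unfolding d_def by (simp add: poly_as_sum_of_monoms)
 then have "shift f = (\<Sum>i\<le>d. monom (coeff f i) i \<circ>\<^sub>p [:1, 1:])"
  unfolding shift_def pcompose_sum[symmetric] by simp
 also have "\<dots> = (\<Sum>i\<le>d. smult (coeff f i) ([:1, 1:] ^ i))"
  by (simp add: monom_altdef pcompose_smult pcompose_pow pcompose_pCons)
 finally have "shift f = (\<Sum>i\<le>d. smult (coeff f i) ([:1, 1:] ^ i))" .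
 then have "coeff (shift f) (d - 1) = (\<Sum>i\<le>d. coeff f i * coeff ([:1, 1:] ^ i) (d - 1))"
  by (simp add: coeff_sum)
 also have "\<dots> = (\<Sum>i\<in>{d - 1, d}. coeff f i * coeff ([:1, 1:] ^ i) (d - 1))"
 proof (intro sum.mono_neutral_right ballI)
  fix i assume "i \<in> {..d} - {d - 1, d}"
  then have "degree ([:1, 1:] ^ i :: 'k ratfun poly) < d - 1"
   using d by (simp add: degree_power_eq) linarith
  then show "coeff f i * coeff ([:1, 1:] ^ i) (d - 1) = 0" by (simp add: coeff_eq_0)
 qed auto
 also have "\<dots> = coeff f (d - 1) + coeff f d * of_nat d"
 proof -
  have c1: "coeff ([:1, 1:] ^ (d - 1)) (d - 1) = (1 :: 'k ratfun)"
   using lead_coeff_power[of "[:1, 1 :: 'k ratfun:]" "d - 1"] by (simp add: degree_power_eq)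
  have c2: "coeff ([:1, 1:] ^ m) (m - 1) = (of_nat m :: 'k ratfun)" if "m > 0" for m using that
  proof (induction m rule: nat_induct_non_zero)
   case (Suc m)
   have "coeff ([:1, 1:] ^ m) m = (1 :: 'k ratfun)"
    using lead_coeff_power[of "[:1, 1 :: 'k ratfun:]" m] by (simp add: degree_power_eq)
   then show ?case using Suc by (cases m) (simp_all add: coeff_pCons add.commute)
  qed simp
  show ?thesis using d c1 c2[OF d] by simp
 qed
 finally have "coeff f d * of_nat d = 0" using assms(2) by simp
 moreover have "coeff f d \<noteq> 0" using d by (auto simp: d_def)
 moreover have "of_nat d \<noteq> (0 :: 'k ratfun)"
  using d assms(1) by (auto simp: of_nat_eq_0_iff_char_dvd d_def dest: dvd_imp_le)
 ultimately show False by simp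
qed

text \<open>The isomorphism attached to \<open>x \<mapsto> \<gamma> x\<close>, \<open>y \<mapsto> y + b\<close>.\<close>

definition as_map :: "('k ratfun \<Rightarrow> 'k ratfun) \<Rightarrow> 'k ratfun \<Rightarrow> 'k ratfun poly \<Rightarrow> 'k ratfun poly" where
 "as_map \<gamma> b f = map_poly \<gamma> f \<circ>\<^sub>p [:b, 1:]"

lemma as_map_simps:
 assumes "fhom \<gamma>"
 shows "as_map \<gamma> b (f + g) = as_map \<gamma> b f + as_map \<gamma> b g"
  "as_map \<gamma> b (f * g) = as_map \<gamma> b f * as_map \<gamma> b g"
  "as_map \<gamma> b [:c:] = [:\<gamma> c:]" "as_map \<gamma> b [:0, 1:] = [:b, 1:]" "as_map \<gamma> b 1 = 1"
  "degree (as_map \<gamma> b f) = degree f"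
  "as_map \<gamma> b (shift f) = shift (as_map \<gamma> b f)"
proof -
 interpret fhom \<gamma> by fact
 show "as_map \<gamma> b (f + g) = as_map \<gamma> b f + as_map \<gamma> b g"
  "as_map \<gamma> b (f * g) = as_map \<gamma> b f * as_map \<gamma> b g"
  "as_map \<gamma> b [:c:] = [:\<gamma> c:]" "as_map \<gamma> b [:0, 1:] = [:b, 1:]" "as_map \<gamma> b 1 = 1"
  "degree (as_map \<gamma> b f) = degree f"
  by (simp_all add: as_map_def pcompose_add pcompose_mult pcompose_pCons one_pCons degree_pcompose)
 have "[:1, 1:] \<circ>\<^sub>p [:b, 1:] = [:b, 1:] \<circ>\<^sub>p [:1, 1:]" by (simp add: pcompose_pCons add.commute)
 then show "as_map \<gamma> b (shift f) = shift (as_map \<gamma> b f)"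
  by (simp add: as_map_def shift_def map_pcompose flip: pcompose_assoc)
qed

lemma as_map_AS_poly:
 assumes "fhom \<gamma>" "\<gamma> u2 = u1 + (b ^ CHAR('k) - b)"
 shows "as_map \<gamma> b (AS_poly u2) = AS_poly u1"
proof -
 interpret fhom \<gamma> by fact
 have pr: "prime CHAR('k ratfun poly)" by simp
 have "[:b, 1:] ^ p = [:0, 1:] ^ p + [:b:] ^ p"
  using freshmans_dream[OF pr, of p "[:0, 1:]" "[:b:]"] by (simp add: char_k)
 moreover have "[:b:] ^ m = [:b ^ m:]" for m :: nat by (induction m) (simp_all add: one_pCons mult.commute)
 ultimately show ?thesis
  using assms(2) by (simp add: as_map_def AS_poly_def char_k monom_altdef pcompose_diff pcompose_pow pcompose_pCons)
qed

lemma as_map_iso: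
 assumes "\<gamma> \<in> rat_auts" "\<gamma> u2 = u1 + (b ^ CHAR('k) - b)"
 shows "as_map \<gamma> b \<in> ring_iso (AS_field u2) (AS_field u1)"
proof -
 interpret fhom \<gamma> using assms by (simp add: rat_auts_def)
 note sm = as_map_simps[OF fhom_axioms]
 obtain \<delta> where \<delta>: "\<delta> \<in> rat_auts" "\<And>x. \<gamma> (\<delta> x) = x" "\<And>x. \<delta> (\<gamma> x) = x"
  using rat_auts_inv[OF assms(1)] by blast
 interpret d: fhom \<delta> using \<delta> by (simp add: rat_auts_def)
 have m: "as_map \<gamma> b (f mod AS_poly u2) = as_map \<gamma> b f mod AS_poly u1" for f
 proof -
  have "as_map \<gamma> b f = as_map \<gamma> b (f div AS_poly u2) * AS_poly u1 + as_map \<gamma> b (f mod AS_poly u2)"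
   by (metis div_mult_mod_eq as_map_AS_poly[OF fhom_axioms assms(2)] sm(1,2))
  then have "as_map \<gamma> b f mod AS_poly u1 = as_map \<gamma> b (f mod AS_poly u2) mod AS_poly u1" by simp
  then show ?thesis
   using mod_AS_less[of "as_map \<gamma> b (f mod AS_poly u2)" u1] degree_mod_AS by (simp add: sm)
 qed
 have hom: "as_map \<gamma> b \<in> ring_hom (AS_field u2) (AS_field u1)"
  by (rule ring_hom_memI) (simp_all add: m sm)
 have "bij_betw (as_map \<gamma> b) (carrier (AS_field u2)) (carrier (AS_field u1))"
 proof (rule bij_betwI)
  define \<psi> where "\<psi> g = map_poly \<delta> (g \<circ>\<^sub>p [:- b, 1:])" for g
  show "as_map \<gamma> b \<in> carrier (AS_field u2) \<rightarrow> carrier (AS_field u1)" by (simp add: sm)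
  show "\<psi> \<in> carrier (AS_field u1) \<rightarrow> carrier (AS_field u2)" by (auto simp: \<psi>_def degree_pcompose)
  have id1: "map_poly \<delta> (map_poly \<gamma> f) = f" "map_poly \<gamma> (map_poly \<delta> f) = f" for f
   by (simp_all add: poly_eq_iff \<delta>)
  show "\<psi> (as_map \<gamma> b f) = f" for f
   by (simp add: \<psi>_def as_map_def pcompose_pCons id1 flip: pcompose_assoc)
  show "as_map \<gamma> b (\<psi> f) = f" for f
   by (simp add: \<psi>_def as_map_def pcompose_pCons id1 flip: pcompose_assoc)
 qed
 then show ?thesis using hom by (simp add: ring_iso_def)
qed

text \<open>Commuting with \<open>y \<mapsto> y + 1\<close> forces fixed elements to fixed elements,
  which gives \<open>\<gamma>\<close> on k(x); and \<open>\<phi>(Y) - Y\<close> is again fixed,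
  which gives \<open>b\<close>. These two determine the map on all powers of
  \<open>Y\<close>.\<close>

lemma iso_is_as_map:
 assumes phi: "\<phi> \<in> ring_iso (AS_field u2) (AS_field u1)" and c: "\<forall>c\<in>constants. \<phi> c = c"
  and ct: "\<forall>f\<in>carrier (AS_field u2). \<phi> (AS_aut f) = AS_aut (\<phi> f)"
 obtains \<gamma> b where "\<gamma> \<in> rat_auts" "\<gamma> u2 = u1 + (b ^ CHAR('k) - b)"
  "\<forall>f\<in>carrier (AS_field u2). \<phi> f = as_map \<gamma> b f"
proof -
 have p0: "0 < CHAR('k)" "1 < CHAR('k)" using p_gt_1 by (simp_all add: char_k)
 have bij: "bij_betw \<phi> (carrier (AS_field u2)) (carrier (AS_field u1))"
  and hom: "\<phi> \<in> ring_hom (AS_field u2) (AS_field u1)" using phi by (auto simp: ring_iso_def)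
 have deg: "degree (\<phi> f) < CHAR('k)" if "degree f < CHAR('k)" for f using bij_betwE[OF bij] that by simp
 have add: "\<phi> (f + g) = \<phi> f + \<phi> g" if "degree f < CHAR('k)" "degree g < CHAR('k)" for f g
  using ring_hom_add[OF hom, of f g] that by simp
 have mult: "\<phi> ((f * g) mod AS_poly u2) = (\<phi> f * \<phi> g) mod AS_poly u1"
  if "degree f < CHAR('k)" "degree g < CHAR('k)" for f g using ring_hom_mult[OF hom, of f g] that by simp
 have one: "\<phi> 1 = 1" using ring_hom_one[OF hom] by simp
 have sh: "\<phi> (shift f) = shift (\<phi> f)" if "degree f < CHAR('k)" for f
  using ct that deg[OF that] by (simp add: AS_aut_eq)
 have "\<exists>s. \<phi> [:r:] = [:s:]" for r
  by (rule shift_fixed) (use sh[of "[:r:]"] deg[of "[:r:]"] p0 in auto)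
 then obtain \<gamma> where \<gamma>: "\<And>r. \<phi> [:r:] = [:\<gamma> r:]" by metis
 have g_fhom: "fhom \<gamma>"
 proof
  show "\<gamma> 1 = 1" using \<gamma>[of 1] one by (simp flip: one_pCons) (simp add: one_pCons)
  fix x y
  show "\<gamma> (x + y) = \<gamma> x + \<gamma> y" using add[of "[:x:]" "[:y:]"] p0 by (simp add: \<gamma>)
  show "\<gamma> (x * y) = \<gamma> x * \<gamma> y"
   using mult[of "[:y:]" "[:x:]"] p0 by (simp add: mod_AS_less \<gamma> mult.commute)
 qed
 interpret fhom \<gamma> by fact
 have "\<gamma> (cst c) = cst c" for c
  using c \<gamma>[of "cst c"] by (auto simp: constants_def cst_def to_fract_def)
 moreover have "surj \<gamma>"
 proof -
  have "\<exists>s. \<gamma> s = r" for r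
  proof -
   obtain f where f: "degree f < CHAR('k)" "\<phi> f = [:r:]"
    using bij_betw_imp_surj_on[OF bij] p0 by (metis (no_types, lifting) AS_field_simps(1) degree_pCons_0 image_iff mem_Collect_eq)
   have "\<phi> (shift f) = \<phi> f" using sh[OF f(1)] f(2) by simp
   then have "shift f = f" using inj_onD[OF bij_betw_imp_inj_on[OF bij], of "shift f" f] f(1) by simp
   then obtain s where "f = [:s:]" using shift_fixed f(1) by blast
   then show ?thesis using \<gamma>[of s] f(2) by auto
  qed
  then show ?thesis by (metis surjI)
 qed
 ultimately have g: "\<gamma> \<in> rat_auts" using g_fhom by (simp add: rat_auts_def)
 have degX: "degree [:0, 1 :: 'k ratfun:] < CHAR('k)" using p0 by simp
 have "shift (\<phi> [:0, 1:] - [:0, 1:]) = \<phi> [:0, 1:] - [:0, 1:]"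
 proof -
  have "shift [:0, 1 :: 'k ratfun:] = [:0, 1:] + 1" by (simp add: shift_def pcompose_pCons one_pCons)
  then have "shift (\<phi> [:0, 1:]) = \<phi> [:0, 1:] + 1" using sh[OF degX] add[OF degX, of 1] p0 one by simp
  then show ?thesis using \<open>shift [:0, 1 :: 'k ratfun:] = [:0, 1:] + 1\<close> by simp
 qed
 moreover have "degree (\<phi> [:0, 1:] - [:0, 1:]) < CHAR('k)"
  using deg[OF degX] degX by (intro degree_diff_less)
 ultimately obtain b where "\<phi> [:0, 1:] - [:0, 1:] = [:b:]" using shift_fixed by blast
 then have b: "\<phi> [:0, 1:] = [:b, 1:]" by (metis add.right_neutral add_0 add_pCons diff_add_cancel)
 have mon: "\<phi> (monom c i) = smult (\<gamma> c) ([:b, 1:] ^ i)" if "i < CHAR('k)" for c i using that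
 proof (induction i)
  case 0
  then show ?case using \<gamma>[of c] by (simp add: monom_0)
 next
  case (Suc i)
  have d1: "degree (monom c i) < CHAR('k)" using Suc.prems degree_monom_le[of c i] by linarith
  have d2: "degree (monom c (Suc i)) < CHAR('k)" using Suc.prems degree_monom_le[of c "Suc i"] by linarith
  have e: "monom c (Suc i) = monom c i * [:0, 1:]" by (simp add: monom_Suc mult.commute)
  have "\<phi> (monom c (Suc i)) = (smult (\<gamma> c) ([:b, 1:] ^ i) * [:b, 1:]) mod AS_poly u1"
   using mult[OF d1 degX] Suc b d2 by (simp only: e[symmetric] mod_AS_less[OF d2])
  also have "\<dots> = smult (\<gamma> c) ([:b, 1:] ^ Suc i)"
  proof -
   have "smult (\<gamma> c) ([:b, 1:] ^ i) * [:b, 1:] = smult (\<gamma> c) ([:b, 1:] ^ Suc i)"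
    by (simp only: power_Suc2 mult_smult_left)
   moreover have "degree (smult (\<gamma> c) ([:b, 1:] ^ Suc i)) < CHAR('k)"
    using Suc.prems degree_smult_le[of "\<gamma> c" "[:b, 1:] ^ Suc i"] degree_power_eq[of "[:b, 1:]" "Suc i"] by simp
   ultimately show ?thesis by (metis mod_AS_less)
  qed
  finally show ?case .
 qed
 have sums: "degree f < CHAR('k) \<Longrightarrow> \<phi> f = as_map \<gamma> b f" for f
 proof -
  assume f: "degree f < CHAR('k)"
  have "\<phi> (\<Sum>i<m. monom (coeff f i) i)
    = (\<Sum>i<m. smult (\<gamma> (coeff f i)) ([:b, 1:] ^ i))
    \<and> degree (\<Sum>i<m. monom (coeff f i) i) < CHAR('k)" if "m \<le> CHAR('k)" for m using that
  proof (induction m)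
   case 0
   then show ?case using \<gamma>[of 0] p0 by simp
  next
   case (Suc m)
   have "degree (monom (coeff f m) m) < CHAR('k)"
    using Suc.prems degree_monom_le[of "coeff f m" m] by linarith
   then show ?case using Suc mon[of m] by (simp add: add degree_add_less)
  qed
  from this[of "Suc (degree f)"] f
  have "\<phi> (\<Sum>i\<le>degree f. monom (coeff f i) i)
   = (\<Sum>i\<le>degree f. smult (\<gamma> (coeff f i)) ([:b, 1:] ^ i))"
   by (simp add: lessThan_Suc_atMost)
  also have "(\<Sum>i\<le>degree f. monom (coeff f i) i) = f" by (rule poly_as_sum_of_monoms)
  also have "(\<Sum>i\<le>degree f. smult (\<gamma> (coeff f i)) ([:b, 1:] ^ i)) = as_map \<gamma> b f"
   unfolding as_map_def pcompose_altdef poly_altdef by (simp add: degree_map_poly coeff_map_poly)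
  finally show ?thesis .
 qed
 \<comment> \<open>The product \<open>Y^(p - 1) * Y\<close> reduces to \<open>Y + u2\<close>; its
   image is computed before and after reduction.\<close>
 have "\<gamma> u2 = u1 + (b ^ CHAR('k) - b)"
 proof -
  have dm: "degree (monom (1 :: 'k ratfun) (CHAR('k) - 1)) < CHAR('k)"
   using p0 by (simp add: degree_monom_eq)
  have e: "monom 1 (CHAR('k) - 1) * [:0, 1:] = monom (1 :: 'k ratfun) CHAR('k)"
   using p0 monom_Suc[of "1 :: 'k ratfun" "CHAR('k) - 1"] by (simp add: mult.commute)
  have "(AS_poly u2 + [:u2, 1:]) mod AS_poly u2 = [:u2, 1:]" using p0 by (simp add: mod_AS_less)
  moreover have "AS_poly u2 + [:u2, 1:] = monom 1 CHAR('k)" by (simp add: AS_poly_def monom_altdef)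
  ultimately have "\<phi> [:u2, 1:] = (\<phi> (monom 1 (CHAR('k) - 1)) * [:b, 1:]) mod AS_poly u1"
   using mult[OF dm degX] unfolding e b by simp
  also have "\<phi> (monom 1 (CHAR('k) - 1)) * [:b, 1:] = [:b, 1:] ^ CHAR('k)"
  proof -
   have "\<phi> (monom 1 (CHAR('k) - 1)) = [:b, 1:] ^ (CHAR('k) - 1)"
    using mon[of "CHAR('k) - 1" 1] p0 by simp
   then show ?thesis using power_minus_mult[OF p0(1), of "[:b, 1:]"] by (simp only:)
  qed
  also have "[:b, 1:] ^ CHAR('k) = AS_poly u1 + [:u1 + b ^ CHAR('k), 1:]"
  proof -
   have pr: "prime CHAR('k ratfun poly)" by simp
   have "[:b, 1:] ^ p = [:0, 1:] ^ p + [:b:] ^ p"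
    using freshmans_dream[OF pr, of p "[:0, 1:]" "[:b:]"] by (simp add: char_k)
   moreover have "[:b:] ^ m = [:b ^ m:]" for m :: nat by (induction m) (simp_all add: one_pCons mult.commute)
   ultimately show ?thesis by (simp add: AS_poly_def monom_altdef char_k)
  qed
  also have "(AS_poly u1 + [:u1 + b ^ CHAR('k), 1:]) mod AS_poly u1 = [:u1 + b ^ CHAR('k), 1:]"
   using p0 by (simp add: mod_AS_less)
  finally have "as_map \<gamma> b [:u2, 1:] = [:u1 + b ^ CHAR('k), 1:]" using sums[of "[:u2, 1:]"] p0 by simp
  then have "\<gamma> u2 + b = u1 + b ^ CHAR('k)" by (simp add: as_map_def pcompose_pCons)
  then show ?thesis by (simp add: algebra_simps)
 qed
 then show ?thesis using that[OF g] sums by simp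
qed

lemma constants_eq: "constants = range (\<lambda>c. [:cst (c :: 'k):])"
 by (simp add: constants_def cst_def to_fract_def)

lemma as_map_constants:
 assumes "\<gamma> \<in> rat_auts" "c \<in> constants" shows "as_map \<gamma> b c = c"
 using assms as_map_simps(3)[of \<gamma>] by (auto simp: constants_eq rat_auts_def)

lemma curve_aut_isomorphic_iff:
 fixes u1 u2 :: "'k ratfun"
 shows "curve_aut_isomorphic constants (AS_curve u1) (AS_curve u2) \<longleftrightarrow> (\<exists>\<gamma>\<in>rat_auts. \<gamma> u2 - u1 \<in> AS)"
proof
 assume "curve_aut_isomorphic constants (AS_curve u1) (AS_curve u2)"
 then obtain \<phi> where "\<phi> \<in> ring_iso (AS_field u2) (AS_field u1)" "\<forall>c\<in>constants. \<phi> c = c"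
  "\<forall>f\<in>carrier (AS_field u2). \<phi> (AS_aut f) = AS_aut (\<phi> f)"
  by (auto simp: curve_aut_isomorphic_def AS_curve_def)
 then obtain \<gamma> b where "\<gamma> \<in> rat_auts" "\<gamma> u2 = u1 + (b ^ CHAR('k) - b)"
  using iso_is_as_map by metis
 moreover from this(2) have "\<gamma> u2 - u1 = b ^ CHAR('k ratfun) - b" by simp
 then have "\<gamma> u2 - u1 \<in> AS" unfolding AS_def by blast
 ultimately show "\<exists>\<gamma>\<in>rat_auts. \<gamma> u2 - u1 \<in> AS" by blast
next
 assume "\<exists>\<gamma>\<in>rat_auts. \<gamma> u2 - u1 \<in> AS"
 then obtain \<gamma> b where g: "\<gamma> \<in> rat_auts" "\<gamma> u2 - u1 = b ^ CHAR('k) - b" by (auto simp: AS_def)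
 then have "\<gamma> u2 = u1 + (b ^ CHAR('k) - b)" by (simp add: algebra_simps)
 note iso = as_map_iso[OF g(1) this]
 have f: "fhom \<gamma>" using g by (simp add: rat_auts_def)
 show "curve_aut_isomorphic constants (AS_curve u1) (AS_curve u2)"
  unfolding curve_aut_isomorphic_def AS_curve_def using iso as_map_constants[OF g(1)] as_map_simps[OF f]
  by (intro bexI[of _ "as_map \<gamma> b"]) (auto simp: AS_aut_eq)
qed

end

section \<open>The mass formula\<close>

lemma group_aut_group:
 assumes "ring K" "k \<subseteq> carrier K"
 shows "group (aut_group k K)"
proof (rule groupI)
 let ?G = "aut_group k K"
 have C: "\<phi> \<in> carrier ?G \<longleftrightarrow> \<phi> \<in> ring_iso K K \<and> \<phi> \<in> extensional (carrier K) \<and> (\<forall>c\<in>k. \<phi> c = c)" for \<phi>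
  by (simp add: aut_group_def)
 have into: "\<phi> x \<in> carrier K" if "\<phi> \<in> ring_iso K K" "x \<in> carrier K" for \<phi> x
  using that by (auto simp: ring_iso_def ring_hom_def)
 interpret ring K by fact
 have cong: "\<psi> \<in> ring_iso K K" if "\<phi> \<in> ring_iso K K" "\<And>x. x \<in> carrier K \<Longrightarrow> \<psi> x = \<phi> x" for \<phi> \<psi>
 proof -
  have "\<psi> \<in> ring_hom K K"
   using that by (intro ring_hom_memI) (auto simp: ring_iso_def ring_hom_def)
  moreover have "bij_betw \<psi> (carrier K) (carrier K)"
   using that bij_betw_cong[of "carrier K" \<psi> \<phi>] by (simp add: ring_iso_def)
  ultimately show ?thesis by (simp add: ring_iso_def)
 qed
 show "\<phi> \<otimes>\<^bsub>?G\<^esub> \<psi> \<in> carrier ?G" if "\<phi> \<in> carrier ?G" "\<psi> \<in> carrier ?G" for \<phi> \<psi>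
 proof -
  have "\<phi> \<circ> \<psi> \<in> ring_iso K K" using that C ring_iso_set_trans by blast
  then have "FuncSet.compose (carrier K) \<phi> \<psi> \<in> ring_iso K K"
   by (rule cong) (simp add: FuncSet.compose_def)
  then show ?thesis using that C assms(2) by (auto simp: aut_group_def FuncSet.compose_def)
 qed
 show one: "\<one>\<^bsub>?G\<^esub> \<in> carrier ?G"
  using cong[OF ring_iso_set_refl, of "\<lambda>f\<in>carrier K. f"] assms(2) by (auto simp: aut_group_def)
 show "\<phi> \<otimes>\<^bsub>?G\<^esub> \<psi> \<otimes>\<^bsub>?G\<^esub> \<chi> = \<phi> \<otimes>\<^bsub>?G\<^esub> (\<psi> \<otimes>\<^bsub>?G\<^esub> \<chi>)"
  if "\<phi> \<in> carrier ?G" "\<psi> \<in> carrier ?G" "\<chi> \<in> carrier ?G" for \<phi> \<psi> \<chi>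
  using that into by (auto simp: aut_group_def FuncSet.compose_def fun_eq_iff)
 show "\<one>\<^bsub>?G\<^esub> \<otimes>\<^bsub>?G\<^esub> \<phi> = \<phi>" if "\<phi> \<in> carrier ?G" for \<phi>
  using that into by (auto simp: aut_group_def FuncSet.compose_def fun_eq_iff extensional_def)
 show "\<exists>\<psi>\<in>carrier ?G. \<psi> \<otimes>\<^bsub>?G\<^esub> \<phi> = \<one>\<^bsub>?G\<^esub>" if phi: "\<phi> \<in> carrier ?G" for \<phi>
 proof -
  have iso: "\<phi> \<in> ring_iso K K" using phi C by blast
  define \<psi> where "\<psi> = (\<lambda>x\<in>carrier K. inv_into (carrier K) \<phi> x)"
  have "inv_into (carrier K) \<phi> \<in> ring_iso K K" by (rule ring_iso_set_sym[OF assms(1) iso])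
  then have "\<psi> \<in> ring_iso K K" by (rule cong) (simp add: \<psi>_def)
  have inj: "inj_on \<phi> (carrier K)" using iso by (auto simp: ring_iso_def bij_betw_def)
  then have *: "\<psi> (\<phi> x) = x" if "x \<in> carrier K" for x
   using that into[OF iso] by (simp add: \<psi>_def)
  have "\<psi> c = c" if "c \<in> k" for c using *[of c] that phi C assms(2) by auto
  then have "\<psi> \<in> carrier ?G" using \<open>\<psi> \<in> ring_iso K K\<close> C by (simp add: \<psi>_def)
  moreover have "\<psi> \<otimes>\<^bsub>?G\<^esub> \<phi> = \<one>\<^bsub>?G\<^esub>"
   using * by (auto simp: aut_group_def FuncSet.compose_def)
  ultimately show ?thesis by blast
 qed
qed

lemma ring_iso_restrict:
 assumes "ring R" "h \<in> ring_iso R S"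
 shows "restrict h (carrier R) \<in> ring_iso R S"
proof -
 interpret ring R by fact
 have "restrict h (carrier R) \<in> ring_hom R S"
  using assms(2) by (intro ring_hom_memI) (auto simp: ring_iso_def ring_hom_def)
 then show ?thesis using assms(2) by (simp add: ring_iso_def)
qed

lemma (in group) centralizer_generate:
 assumes "a \<in> carrier G"
 shows "centralizer G (generate G {a}) = {x \<in> carrier G. x \<otimes> a = a \<otimes> x}"
proof (intro equalityI subsetI)
 fix x assume "x \<in> centralizer G (generate G {a})"
 then show "x \<in> {x \<in> carrier G. x \<otimes> a = a \<otimes> x}"
  by (auto simp: centralizer_def intro: generate.incl)
next
 fix x assume "x \<in> {x \<in> carrier G. x \<otimes> a = a \<otimes> x}"
 then have x: "x \<in> carrier G" "x \<otimes> a = a \<otimes> x" by auto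
 have "h \<in> carrier G \<and> x \<otimes> h = h \<otimes> x" if "h \<in> generate G {a}" for h using that
 proof (induction rule: generate.induct)
  case one
  then show ?case using x by simp
 next
  case (incl h)
  then show ?case using x assms by simp
 next
  case (inv h)
  have "x \<otimes> inv a = inv a \<otimes> (a \<otimes> x) \<otimes> inv a"
   using x(1) assms by (simp add: m_assoc[symmetric])
  also have "\<dots> = inv a \<otimes> (x \<otimes> a) \<otimes> inv a" using x by simp
  also have "\<dots> = inv a \<otimes> x" using x(1) assms by (simp add: m_assoc)
  finally show ?case using inv assms by simp
 next
  case (eng h1 h2)
  then have "x \<otimes> (h1 \<otimes> h2) = h1 \<otimes> x \<otimes> h2" using x by (simp add: m_assoc[symmetric])
  also have "\<dots> = h1 \<otimes> h2 \<otimes> x" using x eng by (simp add: m_assoc)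
  finally show ?case using eng by simp
 qed
 then show "x \<in> centralizer G (generate G {a})" using x by (simp add: centralizer_def)
qed

context finite_base
begin

text \<open>The stabilizer in PGL_2(k) of the class of \<open>u\<close> modulo
  \<open>AS\<close>.\<close>

definition stab :: "'k ratfun \<Rightarrow> ('k ratfun \<Rightarrow> 'k ratfun) set" where
 "stab u = {\<gamma> \<in> rat_auts. \<gamma> u - u \<in> AS}"

lemma finite_rat_auts: "finite (rat_auts :: ('k ratfun \<Rightarrow> _) set)"
 and card_rat_auts: "card (rat_auts :: ('k ratfun \<Rightarrow> _) set) = q ^ 3 - q"
 using card_rat_auts[OF card_k] by auto

lemma card_power_fixed: "card {z :: 'a::field. z ^ CHAR('a) = z} = CHAR('a)"
 "finite {z :: 'a. z ^ CHAR('a) = z}" if pr: "prime CHAR('a)"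
proof -
 have g: "CHAR('a) > 1" using pr prime_gt_1_nat by blast
 show fin: "finite {z :: 'a. z ^ CHAR('a) = z}" using finite_roots_power[OF g] by blast
 have "inj_on (of_nat :: nat \<Rightarrow> 'a) {..<CHAR('a)}"
 proof (rule inj_onI)
  fix i j assume ij: "i \<in> {..<CHAR('a)}" "j \<in> {..<CHAR('a)}" "of_nat i = (of_nat j :: 'a)"
  have "CHAR('a) dvd (max i j - min i j)"
   using ij(3) by (simp add: of_nat_eq_0_iff_char_dvd[where ?'a = 'a, symmetric] of_nat_diff max_def min_def)
  then show "i = j" using ij(1,2) by (auto simp: max_def min_def dest: dvd_imp_le split: if_splits)
 qed
 then have c: "card (of_nat ` {..<CHAR('a)} :: 'a set) = CHAR('a)" by (simp add: card_image)
 have sub: "of_nat ` {..<CHAR('a)} \<subseteq> {z :: 'a. z ^ CHAR('a) = z}"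
  using of_nat_power_CHAR[OF pr] by auto
 show "card {z :: 'a. z ^ CHAR('a) = z} = CHAR('a)"
  using finite_roots_power(2)[OF g, where 'a = 'a] card_mono[OF fin sub] c by simp
qed

text \<open>The solutions form a coset of those of \<open>z^p = z\<close>, that is, of the prime
  field.\<close>

lemma card_AS_fibre:
 fixes w :: "'a::field"
 assumes pr: "prime CHAR('a)" and "w \<in> AS"
 shows "card {b. b ^ CHAR('a) - b = w} = CHAR('a)" "finite {b. b ^ CHAR('a) - b = w}"
proof -
 obtain b0 where b0: "w = b0 ^ CHAR('a) - b0" using assms(2) by (auto simp: AS_def)
 have "{b. b ^ CHAR('a) - b = w} = (\<lambda>z. b0 + z) ` {z. z ^ CHAR('a) = z}"
 proof (intro equalityI subsetI)
  fix b assume b: "b \<in> {b. b ^ CHAR('a) - b = w}"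
  have "(b - b0) ^ CHAR('a) = b - b0" using b b0 by (simp add: power_CHAR_diff[OF pr] algebra_simps)
  then show "b \<in> (\<lambda>z. b0 + z) ` {z. z ^ CHAR('a) = z}"
   by (intro image_eqI[of _ _ "b - b0"]) auto
 qed (auto simp: b0 freshmans_dream[OF pr refl])
 then show "card {b. b ^ CHAR('a) - b = w} = CHAR('a)" "finite {b. b ^ CHAR('a) - b = w}"
  using card_power_fixed[OF pr] by (simp_all add: card_image)
qed

lemma AS_aut_in: "AS_aut \<in> carrier (aut_group constants (AS_field (u :: 'k ratfun)))"
proof -
 have id: "(\<lambda>x. x) \<in> (rat_auts :: ('k ratfun \<Rightarrow> _) set)" by (rule rat_auts_id)
 have "as_map (\<lambda>x. x) 1 \<in> ring_iso (AS_field u) (AS_field u)" by (rule as_map_iso[OF id]) simp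
 then have "restrict (as_map (\<lambda>x. x) 1) (carrier (AS_field u)) \<in> ring_iso (AS_field u) (AS_field u)"
  by (rule ring_iso_restrict[OF ring_AS_field])
 moreover have "restrict (as_map (\<lambda>x. x) 1) (carrier (AS_field u)) = AS_aut"
  by (auto simp: AS_aut_def as_map_def restrict_def fun_eq_iff)
 moreover have "AS_aut c = (c :: 'k ratfun poly)" if "c \<in> constants" for c
  using that p_gt_1 by (auto simp: constants_eq AS_aut_eq char_k)
 ultimately show ?thesis by (simp add: aut_group_def AS_aut_def)
qed

lemma constants_subset: "constants \<subseteq> carrier (AS_field (u :: 'k ratfun))"
 using p_gt_1 by (auto simp: constants_eq char_k)

text \<open>The centralizer consists of the maps \<open>as_map \<gamma> b\<close> with
  \<open>b^p - b = \<gamma> u - u\<close>. For each stabilizing \<open>\<gamma>\<close> there are p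
  such \<open>b\<close>, differing by elements of the prime field.\<close>

lemma weight_AS_curve: "weight (AS_curve u) = 1 / real (p * card (stab u))"
proof -
 define K where "K = AS_field u"
 define G where "G = aut_group constants K"
 interpret group G unfolding G_def K_def using ring_AS_field constants_subset by (rule group_aut_group)
 have a: "AS_aut \<in> carrier G" unfolding G_def K_def by (rule AS_aut_in)
 define Z where "Z = centralizer G (generate G {AS_aut})"
 have Z: "Z = {x \<in> carrier G. x \<otimes>\<^bsub>G\<^esub> AS_aut = AS_aut \<otimes>\<^bsub>G\<^esub> x}"
  unfolding Z_def by (rule centralizer_generate[OF a])
 define S where "S = (SIGMA \<gamma>:stab u. {b. b ^ CHAR('k ratfun) - b = \<gamma> u - u})"
 define F where "F = (\<lambda>(\<gamma>, b). restrict (as_map \<gamma> b) (carrier K))"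
 have inC: "x f \<in> carrier K" if "x \<in> carrier G" "f \<in> carrier K" for x f
  using that by (auto simp: G_def aut_group_def ring_iso_def ring_hom_def)
 have sF: "fhom \<gamma>" if "\<gamma> \<in> stab u" for \<gamma> using that by (simp add: stab_def rat_auts_def)
 have "bij_betw F S Z"
 proof (rule bij_betw_imageI)
  show "inj_on F S"
  proof (rule inj_onI)
   fix x y assume xy: "x \<in> S" "y \<in> S" "F x = F y"
   obtain \<gamma> b \<delta> c where e: "x = (\<gamma>, b)" "y = (\<delta>, c)" by (cases x, cases y)
   have st: "\<gamma> \<in> stab u" "\<delta> \<in> stab u" using xy e by (auto simp: S_def)
   have *: "as_map \<gamma> b f = as_map \<delta> c f" if "f \<in> carrier K" for f
    using fun_cong[OF xy(3), of f] that by (simp add: F_def e)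
   have "[:\<gamma> r:] = [:\<delta> r:]" for r
    using *[of "[:r:]"] p_gt_1 by (simp add: K_def char_k as_map_simps sF st)
   moreover have "[:b, 1:] = [:c, 1 :: 'k ratfun:]"
    using *[of "[:0, 1:]"] p_gt_1 by (simp add: K_def char_k as_map_simps sF st)
   ultimately show "x = y" using e by auto
  qed
  show "F ` S = Z"
  proof (intro equalityI subsetI)
   fix \<phi> assume "\<phi> \<in> F ` S"
   then obtain \<gamma> b where gb: "\<gamma> \<in> stab u" "b ^ CHAR('k ratfun) - b = \<gamma> u - u"
    "\<phi> = restrict (as_map \<gamma> b) (carrier K)" by (auto simp: S_def F_def)
   have g: "\<gamma> \<in> rat_auts" using gb by (simp add: stab_def)
   have "\<gamma> u = u + (b ^ CHAR('k) - b)" using gb(2) by (simp add: algebra_simps)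
   from as_map_iso[OF g this] have "\<phi> \<in> ring_iso K K"
    unfolding gb(3) K_def by (rule ring_iso_restrict[OF ring_AS_field])
   moreover have "\<phi> c = c" if "c \<in> constants" for c
    using that gb(3) as_map_constants[OF g] constants_subset by (auto simp: K_def)
   ultimately have "\<phi> \<in> carrier G" by (simp add: G_def aut_group_def gb(3))
   moreover have "FuncSet.compose (carrier K) \<phi> AS_aut = FuncSet.compose (carrier K) AS_aut \<phi>"
    by (rule ext) (simp add: FuncSet.compose_def gb(3) K_def AS_aut_eq as_map_simps[OF sF[OF gb(1)]])
   ultimately show "\<phi> \<in> Z" unfolding Z by (simp add: G_def aut_group_def)
  next
   fix \<phi> assume "\<phi> \<in> Z"
   then have phi: "\<phi> \<in> carrier G" and com: "FuncSet.compose (carrier K) \<phi> AS_aut = FuncSet.compose (carrier K) AS_aut \<phi>"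
    unfolding Z by (simp_all add: G_def aut_group_def)
   have "\<phi> (AS_aut f) = AS_aut (\<phi> f)" if "f \<in> carrier K" for f
    using fun_cong[OF com, of f] that by (simp add: FuncSet.compose_def)
   moreover have "\<phi> \<in> ring_iso (AS_field u) (AS_field u)" "\<forall>c\<in>constants. \<phi> c = c" "\<phi> \<in> extensional (carrier K)"
    using phi by (simp_all add: G_def aut_group_def K_def)
   ultimately obtain \<gamma> b where gb: "\<gamma> \<in> rat_auts" "\<gamma> u = u + (b ^ CHAR('k) - b)"
    "\<forall>f\<in>carrier K. \<phi> f = as_map \<gamma> b f"
    unfolding K_def using iso_is_as_map[of \<phi> u u] by metis
   have gu: "b ^ CHAR('k ratfun) - b = \<gamma> u - u" using gb(2) by simp
   then have "\<gamma> u - u \<in> AS" unfolding AS_def using gu[symmetric] by blast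
   then have "\<gamma> \<in> stab u" using gb(1) by (simp add: stab_def)
   moreover have "\<phi> = restrict (as_map \<gamma> b) (carrier K)"
    using gb(3) \<open>\<phi> \<in> extensional (carrier K)\<close> by (auto simp: extensional_def restrict_def)
   ultimately show "\<phi> \<in> F ` S"
    using gu by (intro image_eqI[of _ _ "(\<gamma>, b)"]) (auto simp: S_def F_def)
  qed
 qed
 then have "card Z = card S" by (simp add: bij_betw_same_card)
 also have "\<dots> = (\<Sum>\<gamma>\<in>stab u. card {b. b ^ CHAR('k ratfun) - b = \<gamma> u - u})"
  unfolding S_def using finite_rat_auts card_AS_fibre[OF prime_CHAR_ratfun]
  by (intro card_SigmaI) (auto simp: stab_def)
 also have "\<dots> = (\<Sum>\<gamma>\<in>stab u. p)"
 proof (rule sum.cong[OF refl])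
  fix \<gamma> assume "\<gamma> \<in> stab u"
  then have "\<gamma> u - u \<in> AS" by (simp add: stab_def)
  from card_AS_fibre(1)[OF prime_CHAR_ratfun this]
  show "card {b. b ^ CHAR('k ratfun) - b = \<gamma> u - u} = p" by (simp add: char_k)
 qed
 finally have "card Z = p * card (stab u)" by simp
 then show ?thesis by (simp add: weight_def AS_curve_def Let_def Z_def G_def K_def)
qed

lemma rat_auts_AS: "\<gamma> \<in> rat_auts \<Longrightarrow> w \<in> AS \<Longrightarrow> \<gamma> w \<in> (AS :: 'k ratfun set)"
proof -
 assume g: "\<gamma> \<in> rat_auts" and "w \<in> AS"
 interpret fhom \<gamma> using g by (simp add: rat_auts_def)
 obtain z where z: "w = z ^ CHAR('k ratfun) - z" using \<open>w \<in> AS\<close> by (auto simp: AS_def)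
 have "\<gamma> w = \<gamma> z ^ CHAR('k ratfun) - \<gamma> z" unfolding z by simp
 then show "\<gamma> w \<in> AS" unfolding AS_def by blast
qed

section \<open>The action of PGL_2(k) on classes modulo \<open>AS\<close>\<close>

definition as_class :: "'k ratfun \<Rightarrow> 'k ratfun set" where
 "as_class u = {v. v - u \<in> AS}"

lemma as_class_eq_iff: "as_class u = as_class v \<longleftrightarrow> u - v \<in> AS"
proof
 assume "as_class u = as_class v"
 moreover have "u \<in> as_class u" using AS_0[OF prime_CHAR_ratfun] by (simp add: as_class_def)
 ultimately show "u - v \<in> AS" by (simp add: as_class_def)
next
 assume uv: "u - v \<in> AS"
 have "w - u \<in> AS \<longleftrightarrow> w - v \<in> AS" for w
  using AS_add[OF prime_CHAR_ratfun _ uv, of "w - u"] AS_diff[OF prime_CHAR_ratfun _ uv, of "w - v"] by auto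
 then show "as_class u = as_class v" by (simp add: as_class_def)
qed

definition equivalent :: "'k ratfun \<Rightarrow> 'k ratfun \<Rightarrow> bool" where
 "equivalent u v \<longleftrightarrow> (\<exists>\<gamma>\<in>rat_auts. \<gamma> v - u \<in> AS)"

lemma equivalent_refl: "equivalent u u"
 unfolding equivalent_def using rat_auts_id AS_0[OF prime_CHAR_ratfun] by (intro bexI[of _ "\<lambda>x. x"]) auto

lemma equivalent_sym: "equivalent u v \<Longrightarrow> equivalent v u"
proof -
 assume "equivalent u v"
 then obtain \<gamma> where g: "\<gamma> \<in> rat_auts" "\<gamma> v - u \<in> AS" by (auto simp: equivalent_def)
 obtain \<delta> where d: "\<delta> \<in> rat_auts" "\<And>x. \<gamma> (\<delta> x) = x" "\<And>x. \<delta> (\<gamma> x) = x"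
  using rat_auts_inv[OF g(1)] by blast
 interpret fhom \<delta> using d by (simp add: rat_auts_def)
 have "\<delta> (\<gamma> v - u) \<in> AS" using rat_auts_AS d g by blast
 then have "- (v - \<delta> u) \<in> AS" using d by (intro AS_uminus[OF prime_CHAR_ratfun]) simp
 then show "equivalent v u" using d by (auto simp: equivalent_def)
qed

lemma equivalent_trans: "equivalent u v \<Longrightarrow> equivalent v w \<Longrightarrow> equivalent u w"
proof -
 assume "equivalent u v" "equivalent v w"
 then obtain \<gamma> \<delta> where g: "\<gamma> \<in> rat_auts" "\<gamma> v - u \<in> AS" "\<delta> \<in> rat_auts" "\<delta> w - v \<in> AS"
  by (auto simp: equivalent_def)
 interpret fhom \<gamma> using g by (simp add: rat_auts_def)
 have "\<gamma> (\<delta> w - v) + (\<gamma> v - u) \<in> AS"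
  by (rule AS_add[OF prime_CHAR_ratfun rat_auts_AS[OF g(1,4)] g(2)])
 then have "\<gamma> (\<delta> w) - u \<in> AS" by simp
 then show "equivalent u w" using rat_auts_comp[OF g(1,3)] by (auto simp: equivalent_def)
qed

text \<open>Orbit and stabilizer: the fibres of
  \<open>\<gamma> \<mapsto> as_class (\<gamma> u)\<close> are cosets of
  \<open>stab u\<close>.\<close>

lemma card_orbit: "card (as_class ` {v. equivalent v u}) * card (stab u) = q ^ 3 - q"
proof -
 have img: "as_class ` {v. equivalent v u} = (\<lambda>\<gamma>. as_class (\<gamma> u)) ` rat_auts"
 proof (intro equalityI subsetI)
  fix x assume "x \<in> as_class ` {v. equivalent v u}"
  then obtain v \<gamma> where v: "x = as_class v" "\<gamma> \<in> rat_auts" "\<gamma> u - v \<in> AS" by (auto simp: equivalent_def)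
  then have "x = as_class (\<gamma> u)" using as_class_eq_iff by metis
  then show "x \<in> (\<lambda>\<gamma>. as_class (\<gamma> u)) ` rat_auts" using v by blast
 next
  fix x assume "x \<in> (\<lambda>\<gamma>. as_class (\<gamma> u)) ` rat_auts"
  then obtain \<gamma> where g: "\<gamma> \<in> rat_auts" "x = as_class (\<gamma> u)" by blast
  then have "equivalent (\<gamma> u) u"
   unfolding equivalent_def using AS_0[OF prime_CHAR_ratfun] by (intro bexI[of _ \<gamma>]) auto
  then show "x \<in> as_class ` {v. equivalent v u}" using g by blast
 qed
 have "card (rat_auts :: ('k ratfun \<Rightarrow> _) set) = card (stab u) * card ((\<lambda>\<gamma>. as_class (\<gamma> u)) ` rat_auts)"
 proof (rule card_const_fibres[OF finite_rat_auts])
  fix y assume "y \<in> (\<lambda>\<gamma>. as_class (\<gamma> u)) ` rat_auts"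
  then obtain \<gamma> where g: "\<gamma> \<in> rat_auts" "y = as_class (\<gamma> u)" by blast
  obtain \<delta> where d: "\<delta> \<in> rat_auts" "\<And>x. \<gamma> (\<delta> x) = x" "\<And>x. \<delta> (\<gamma> x) = x"
   using rat_auts_inv[OF g(1)] by blast
  interpret g: fhom \<gamma> using g by (simp add: rat_auts_def)
  interpret d: fhom \<delta> using d by (simp add: rat_auts_def)
  have "bij_betw (\<lambda>\<sigma> x. \<gamma> (\<sigma> x)) (stab u) {x \<in> rat_auts. as_class (x u) = y}"
  proof (rule bij_betwI[of _ _ _ "\<lambda>\<sigma> x. \<delta> (\<sigma> x)"])
   show "(\<lambda>\<sigma> x. \<gamma> (\<sigma> x)) \<in> stab u \<rightarrow> {x \<in> rat_auts. as_class (x u) = y}"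
   proof
    fix \<sigma> assume s: "\<sigma> \<in> stab u"
    then have "\<gamma> (\<sigma> u - u) \<in> AS" by (intro rat_auts_AS[OF g(1)]) (simp add: stab_def)
    then show "(\<lambda>x. \<gamma> (\<sigma> x)) \<in> {x \<in> rat_auts. as_class (x u) = y}"
     using s rat_auts_comp[OF g(1)] by (simp add: stab_def g(2) as_class_eq_iff)
   qed
   show "(\<lambda>\<sigma> x. \<delta> (\<sigma> x)) \<in> {x \<in> rat_auts. as_class (x u) = y} \<rightarrow> stab u"
   proof
    fix \<sigma> assume s: "\<sigma> \<in> {x \<in> rat_auts. as_class (x u) = y}"
    then have "\<delta> (\<sigma> u - \<gamma> u) \<in> AS"
     by (intro rat_auts_AS[OF d(1)]) (simp add: g(2) as_class_eq_iff)
    then show "(\<lambda>x. \<delta> (\<sigma> x)) \<in> stab u"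
     using s rat_auts_comp[OF d(1)] d(3) by (simp add: stab_def)
   qed
  qed (simp_all add: d)
  then show "card {x \<in> rat_auts. as_class (x u) = y} = card (stab u)" by (simp add: bij_betw_same_card)
 qed
 then show ?thesis using card_rat_auts img by (simp add: mult.commute)
qed

text \<open>The classes above one family form a copy of k modulo \<open>AS\<close>. This quotient
  has order p, because \<open>z \<mapsto> z^p - z\<close> on k has the prime field as its
  kernel.\<close>

lemma card_classes_of_canon:
 assumes "finite D" "D \<subseteq> CR"
 shows "card (as_class ` {u. canon u \<in> D}) = p * card D" "finite (as_class ` {u. canon u \<in> D})"
proof -
 define Cls where "Cls = as_class ` {u. canon u \<in> D}"
 define f where "f = (\<lambda>(e :: 'k, d). as_class (cst e + rep d))"
 have can: "canon (cst e + rep d) = d" if "d \<in> D" for e d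
  using that assms(2) AS_0[OF prime_CHAR_ratfun] by (intro canon_eqI[of _ _ e]) auto
 have fX: "f ` (UNIV \<times> D) = Cls"
 proof (intro equalityI subsetI)
  fix x assume "x \<in> Cls"
  then obtain u where u: "canon u \<in> D" "x = as_class u" by (auto simp: Cls_def)
  obtain e where "u - (cst e + rep (canon u)) \<in> AS" by (rule canon)
  then have "x = as_class (cst e + rep (canon u))" using u(2) as_class_eq_iff by metis
  then have "x = f (e, canon u)" by (simp add: f_def)
  then show "x \<in> f ` (UNIV \<times> D)" using u(1) by blast
 qed (use can in \<open>auto simp: Cls_def f_def\<close>)
 show "finite Cls" unfolding fX[symmetric] using assms(1) by auto
 define W where "W = (\<lambda>z :: 'k. z ^ CHAR('k) - z) ` UNIV"
 have WAS: "W = AS" by (auto simp: W_def AS_def)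
 have "card (UNIV :: 'k set) = p * card W" unfolding W_def
 proof (rule card_const_fibres)
  fix y :: 'k assume "y \<in> (\<lambda>z. z ^ CHAR('k) - z) ` UNIV"
  then have "y \<in> AS" by (auto simp: AS_def)
  from card_AS_fibre(1)[OF prime_CHAR this] show "card {x \<in> UNIV. x ^ CHAR('k) - x = y} = p"
   by (simp add: char_k)
 qed simp
 then have qW: "q = p * card W" using card_k by simp
 have "card ((UNIV :: 'k set) \<times> D) = card W * card (f ` (UNIV \<times> D))"
 proof (rule card_const_fibres)
  fix y assume "y \<in> f ` (UNIV \<times> D)"
  then obtain e d where ed: "d \<in> D" "y = as_class (cst e + rep d)" by (auto simp: f_def)
  have "{x \<in> UNIV \<times> D. f x = y} = (\<lambda>w. (e + w, d)) ` W"
  proof (intro equalityI subsetI)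
   fix x assume x: "x \<in> {x \<in> UNIV \<times> D. f x = y}"
   obtain e' d' where x': "x = (e', d')" by (cases x)
   have "(cst e' + rep d') - (cst e + rep d) \<in> AS" using x ed by (simp add: x' f_def as_class_eq_iff)
   then have "d' = d" "e' - e \<in> AS" using canonical_unique[of d' d e' e] x ed assms(2) x' by auto
   then show "x \<in> (\<lambda>w. (e + w, d)) ` W"
    unfolding x' WAS by (intro image_eqI[of _ _ "e' - e"]) auto
  next
   fix x assume "x \<in> (\<lambda>w. (e + w, d)) ` W"
   then obtain z where z: "x = (e + (z ^ CHAR('k) - z), d)" by (auto simp: W_def)
   have "cst (z ^ CHAR('k) - z) = (cst z ^ CHAR('k ratfun) - cst z :: 'k ratfun)" by simp
   then have "cst (z ^ CHAR('k) - z) \<in> (AS :: 'k ratfun set)" unfolding AS_def by blast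
   then show "x \<in> {x \<in> UNIV \<times> D. f x = y}" using ed z by (simp add: f_def as_class_eq_iff)
  qed
  then show "card {x \<in> UNIV \<times> D. f x = y} = card W" by (simp add: card_image inj_on_def)
 qed (use assms in auto)
 then have "q * card D = card W * card Cls" by (simp add: card_cartesian_product card_k fX)
 then have "card W * (p * card D) = card W * card Cls" by (simp only: qW mult_ac)
 moreover have "card W > 0" using qW q_gt_1 by (intro Nat.gr0I) simp
 ultimately show "card Cls = p * card D" by (metis nat_mult_eq_cancel1)
qed

lemma card_stab_pos: "card (stab u) > 0" using finite_rat_auts rat_auts_id AS_0[OF prime_CHAR_ratfun]
 by (auto simp: card_gt_0_iff stab_def intro: finite_subset)

text \<open>The weight of an isomorphism class is the number of classes modulo \<open>AS\<close>
  contained in it, divided by \<open>p (q^3 - q)\<close>. Summing over all isomorphism classes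
  counts each of the \<open>p * card D\<close> classes modulo \<open>AS\<close> once, and p
  cancels.\<close>

theorem mass_formula:
 assumes D: "finite D" "D \<subseteq> CR - {\<lambda>_. 0}"
  and inv: "\<And>u v. equivalent u v \<Longrightarrow> canon v \<in> D \<Longrightarrow> canon u \<in> D"
 shows "weighted_count (AS_curve ` {u. canon u \<in> D}) = real (card D) / real (q ^ 3 - q)"
proof -
 define U where "U = {u. canon u \<in> D}"
 define A where "A = AS_curve ` U"
 have cur: "AS_curve u \<in> AS_curves" if "u \<in> U" for u using that D by (auto simp: U_def AS_curves_iff)
 have injC: "AS_curve u = AS_curve v \<longleftrightarrow> u = v" for u v :: "'k ratfun"
  using AS_field_inject[of u v] by (auto simp: AS_curve_def)
 define cl where "cl u = {v. equivalent u v}" for u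
 have clU: "cl u \<subseteq> U" if "u \<in> U" for u
 proof
  fix v assume "v \<in> cl u"
  then show "v \<in> U" using that inv[of v u] equivalent_sym[of u v] by (simp add: cl_def U_def)
 qed
 have cleq: "cl u = cl v" if "equivalent u v" for u v
  using that equivalent_trans equivalent_sym unfolding cl_def by blast
 have clself: "u \<in> cl u" for u by (simp add: cl_def equivalent_refl)
 have iso: "iso_classes A = (\<lambda>u. AS_curve ` cl u) ` U"
 proof -
  have "{(C, D). C \<in> AS_curves \<and> D \<in> AS_curves \<and> curve_aut_isomorphic constants C D} `` {AS_curve u}
    = AS_curve ` cl u" if "u \<in> U" for u
  proof (intro equalityI subsetI)
   fix C assume "C \<in> {(C, D). C \<in> AS_curves \<and> D \<in> AS_curves \<and> curve_aut_isomorphic constants C D} `` {AS_curve u}"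
   then have C: "C \<in> AS_curves" "curve_aut_isomorphic constants (AS_curve u) C" by auto
   then obtain v where "C = AS_curve v" by (auto simp: AS_curves_def)
   then show "C \<in> AS_curve ` cl u" using C by (auto simp: curve_aut_isomorphic_iff cl_def equivalent_def)
  next
   fix C assume "C \<in> AS_curve ` cl u"
   then obtain v where v: "v \<in> cl u" "C = AS_curve v" by auto
   then have "v \<in> U" using clU that by blast
   then show "C \<in> {(C, D). C \<in> AS_curves \<and> D \<in> AS_curves \<and> curve_aut_isomorphic constants C D} `` {AS_curve u}"
    using v that cur by (auto simp: curve_aut_isomorphic_iff cl_def equivalent_def)
  qed
  then show ?thesis unfolding iso_classes_def A_def quotient_def by auto
 qed
 define Cls where "Cls = as_class ` U"
 have Cls: "finite Cls" "card Cls = p * card D"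
  using card_classes_of_canon[OF D(1)] D(2) by (auto simp: Cls_def U_def)
 define orb where "orb c = as_class ` {u. AS_curve u \<in> c}" for c
 have OO: "orb (AS_curve ` cl u) = as_class ` cl u" for u
  unfolding orb_def using injC by (intro arg_cong[of _ _ "\<lambda>S. as_class ` S"]) auto
 have w: "weight (SOME C. C \<in> c) = real (card (orb c)) / (real p * real (q ^ 3 - q))"
  if c: "c \<in> iso_classes A" for c
 proof -
  obtain u where u: "u \<in> U" "c = AS_curve ` cl u" using c iso by auto
  have "\<exists>C. C \<in> c" using u clself by blast
  then have "(SOME C. C \<in> c) \<in> c" by (rule someI_ex)
  then obtain v where v: "v \<in> cl u" "(SOME C. C \<in> c) = AS_curve v" using u(2) by blast
  \<comment> \<open>The weight is evaluated at whichever representative \<open>v\<close> the choice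
    operator returns, so the orbit has to be rewritten as the orbit of \<open>v\<close>.\<close>
  have clv: "cl u = {w. equivalent w v}"
  proof (intro equalityI subsetI)
   fix w assume "w \<in> cl u"
   then show "w \<in> {w. equivalent w v}"
    using v(1) equivalent_sym[of u w] equivalent_trans[of w u v] by (simp add: cl_def)
  next
   fix w assume "w \<in> {w. equivalent w v}"
   then show "w \<in> cl u"
    using v(1) equivalent_sym[of w v] equivalent_trans[of u v w] by (simp add: cl_def)
  qed
  have prd: "card (orb c) * card (stab v) = q ^ 3 - q" unfolding u(2) OO by (simp only: clv card_orbit)
  have "q ^ 1 < q ^ 3" using q_gt_1 by (intro power_strict_increasing) auto
  then have orb_pos: "card (orb c) > 0" using prd by (intro Nat.gr0I) simp
  from prd have "real (q ^ 3 - q) = real (card (orb c)) * real (card (stab v))" by (metis of_nat_mult)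
  then show ?thesis using card_stab_pos[of v] orb_pos p_gt_1 unfolding v(2) weight_AS_curve
   by (auto simp: field_simps)
 qed
 have fin: "finite (iso_classes A)"
 proof -
  have "iso_classes A \<subseteq> (\<lambda>x. AS_curve ` cl (SOME u. u \<in> x)) ` Cls"
  proof
   fix c assume "c \<in> iso_classes A"
   then obtain u where u: "u \<in> U" "c = AS_curve ` cl u" using iso by auto
   have "u \<in> as_class u" using AS_0[OF prime_CHAR_ratfun] by (simp add: as_class_def)
   then have "(SOME v. v \<in> as_class u) \<in> as_class u" by (rule someI)
   then have "(SOME v. v \<in> as_class u) - u \<in> AS" by (simp add: as_class_def)
   then have "equivalent u (SOME v. v \<in> as_class u)" using rat_auts_id by (auto simp: equivalent_def)
   then have "c = AS_curve ` cl (SOME v. v \<in> as_class u)" using cleq u(2) by metis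
   then show "c \<in> (\<lambda>x. AS_curve ` cl (SOME u. u \<in> x)) ` Cls" using u(1) by (auto simp: Cls_def)
  qed
  then show ?thesis using Cls(1) finite_subset by blast
 qed
 have "card Cls = (\<Sum>c\<in>iso_classes A. card (orb c))"
 proof -
  have "Cls = (\<Union>c\<in>iso_classes A. orb c)"
   unfolding iso using clU clself by (auto simp: OO Cls_def)
  moreover have "orb c \<inter> orb c' = {}" if c: "c \<in> iso_classes A" "c' \<in> iso_classes A" "c \<noteq> c'" for c c'
  proof (rule ccontr)
   assume ne: "orb c \<inter> orb c' \<noteq> {}"
   obtain u u' where u: "c = AS_curve ` cl u" "c' = AS_curve ` cl u'" using c iso by auto
   obtain v v' where v: "v \<in> cl u" "v' \<in> cl u'" "as_class v = as_class v'" using ne unfolding u OO by blast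
   have "v' - v \<in> AS" using v(3) as_class_eq_iff by metis
   then have "equivalent v v'" using rat_auts_id by (auto simp: equivalent_def)
   then have "equivalent u u'" using v(1,2) equivalent_trans equivalent_sym unfolding cl_def by blast
   then show False using c(3) u cleq by metis
  qed
  moreover have "finite (orb c)" if c: "c \<in> iso_classes A" for c
  proof -
   obtain u where u: "u \<in> U" "c = AS_curve ` cl u" using c iso by auto
   have "orb c \<subseteq> Cls" unfolding u(2) OO Cls_def using clU[OF u(1)] by blast
   then show ?thesis using Cls(1) finite_subset by blast
  qed
  ultimately show ?thesis using fin by (simp add: card_UN_disjoint)
 qed
 then have "(\<Sum>c\<in>iso_classes A. weight (SOME C. C \<in> c)) = real (card Cls) / (real p * real (q ^ 3 - q))"
  using w by (simp add: sum_divide_distrib)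
 also have "\<dots> = real (card D) / real (q ^ 3 - q)" using Cls(2) p_gt_1 by simp
 finally show ?thesis by (simp add: weighted_count_def A_def U_def)
qed

end

section \<open>Automorphisms permute the points of the projective line\<close>

text \<open>Over an algebraically closed field every nonzero function is a constant times a quotient
  of products of linear factors, so a homomorphism that is trivial on constants is known from its
  values on linear factors.\<close>

lemma val_hom_eqI:
 fixes w :: "'a::alg_closed_field ratfun \<Rightarrow> int"
 assumes w: "\<And>f g. f \<noteq> 0 \<Longrightarrow> g \<noteq> 0 \<Longrightarrow> w (f * g) = w f + w g" "\<And>c. c \<noteq> 0 \<Longrightarrow> w (cst c) = 0"
  and lin: "\<And>a. w (ratX - cst a) = m * val Q (ratX - cst a)"
  and f: "f \<noteq> 0"
 shows "w f = m * val Q f"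
proof -
 have lin_prod: "(\<Prod>x\<in>#A. ratX - cst x) \<noteq> 0 \<and> w (\<Prod>x\<in>#A. ratX - cst x) = m * val Q (\<Prod>x\<in>#A. ratX - cst x)" for A
 proof (induction A)
  case empty
  then show ?case using w(2)[of 1] by simp
 next
  case (add x A)
  define G where "G = (\<Prod>x\<in>#A. ratX - cst x)"
  have nz: "ratX - cst x \<noteq> (0 :: 'a ratfun)" by (rule val_linear)
  have "w ((ratX - cst x) * G) = m * val Q ((ratX - cst x) * G)" "(ratX - cst x) * G \<noteq> 0"
   using add w(1)[OF nz, of G] val_mult[OF nz, of G Q] lin[of x] nz
   by (simp_all add: distrib_left flip: G_def)
  then show ?case unfolding G_def by (simp only: image_mset_add_mset prod_mset.add_mset) simp
 qed
 have fr: "to_fract (\<Prod>x\<in>#A. [:- x, 1:]) = (\<Prod>x\<in>#A. ratX - cst x)" for A :: "'a multiset"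
 proof (induction A)
  case (add x A)
  have "to_fract [:- x, 1:] = ratX - cst x" by (simp add: ratX_def cst_def flip: to_fract_diff)
  then show ?case using add by (simp only: to_fract_mult image_mset_add_mset prod_mset.add_mset)
 qed simp
 have P: "w (to_fract P) = m * val Q (to_fract P)" if nz: "P \<noteq> 0" for P :: "'a poly"
 proof -
  obtain A where A: "P = smult (lead_coeff P) (\<Prod>x\<in>#A. [:- x, 1:])"
   using alg_closed_imp_factorization[OF nz] by blast
  have "to_fract P = cst (lead_coeff P) * (\<Prod>x\<in>#A. ratX - cst x)"
   by (subst A) (simp only: to_fract_smult fr)
  then show ?thesis using lin_prod[of A] w nz by (simp add: val_mult)
 qed
 have nz: "to_fract (num f) \<noteq> 0" "to_fract (den f) \<noteq> 0" using f by simp_all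
 have "f * to_fract (den f) = to_fract (num f)" using ratfun_eq_div[of f] nz by (simp add: field_simps)
 then have s: "w f + w (to_fract (den f)) = w (to_fract (num f))"
  "val Q f + val Q (to_fract (den f)) = val Q (to_fract (num f))"
  using w(1)[OF f nz(2)] val_mult[OF f nz(2)] by simp_all
 have "m * val Q f + m * val Q (to_fract (den f)) = m * val Q (to_fract (num f))"
  using s(2) by (metis distrib_left)
 then show ?thesis using P[of "num f"] P[of "den f"] f s(1) by simp
qed

text \<open>Distinct \<open>x - a\<close> and \<open>x - b\<close> differ by a nonzero constant, so
  at most one of them has positive value. If \<open>x - a0\<close> does, all others have value 0 and
  \<open>w\<close> is a multiple of the valuation at \<open>a0\<close>; if none does, all have the
  same negative value and \<open>w\<close> is a multiple of the valuation at infinity. The element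
  \<open>f0\<close> of value 1 excludes the trivial case and makes the multiple 1.\<close>

lemma val_classification:
 fixes w :: "'a::alg_closed_field ratfun \<Rightarrow> int"
 assumes w: "\<And>f g. f \<noteq> 0 \<Longrightarrow> g \<noteq> 0 \<Longrightarrow> w (f * g) = w f + w g" "\<And>c. c \<noteq> 0 \<Longrightarrow> w (cst c) = 0"
  and ultra: "\<And>f g. f \<noteq> 0 \<Longrightarrow> g \<noteq> 0 \<Longrightarrow> f + g \<noteq> 0 \<Longrightarrow> w (f + g) \<ge> min (w f) (w g)"
  and unif: "f0 \<noteq> 0" "w f0 = 1"
 obtains Q where "\<And>f. f \<noteq> 0 \<Longrightarrow> w f = val Q f"
proof -
 have diff: "min (w (ratX - cst a)) (w (ratX - cst b)) \<le> 0" if "a \<noteq> b" for a b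
 proof -
  have "w (- g) = w g" if "g \<noteq> 0" for g using w(1)[of "cst (-1)" g] w(2)[of "-1"] that by simp
  moreover have "(ratX - cst a) + - (ratX - cst b) = cst (b - a)" by simp
  moreover have "w (cst (b - a)) = 0" using that by (intro w(2)) simp
  moreover have "ratX - cst a \<noteq> (0 :: 'a ratfun)" "ratX - cst b \<noteq> (0 :: 'a ratfun)" "cst (b - a) \<noteq> (0 :: 'a ratfun)"
   using that by (simp_all add: val_linear del: cst.h_diff)
  ultimately show ?thesis using ultra[of "ratX - cst a" "- (ratX - cst b)"] by (metis neg_equal_0_iff_equal)
 qed
 have mult: "w f = m * val Q f \<Longrightarrow> m \<ge> 0 \<Longrightarrow> w f = 1 \<Longrightarrow> m = 1" for m f Q
  using zmult_eq_1_iff[of m "val Q f"] by auto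
 consider a0 where "w (ratX - cst a0) > 0" | "\<And>a. w (ratX - cst a) \<le> 0" by (meson not_le)
 then show ?thesis
 proof cases
  case 1
  define m where "m = w (ratX - cst a0)"
  have other: "w (ratX - cst a) = 0" if "a \<noteq> a0" for a
  proof -
   have e: "ratX - cst a0 + cst (a0 - a) = ratX - cst a" by simp
   have "w (ratX - cst a) \<le> 0" using diff[OF that] 1 by (simp add: min_def split: if_splits)
   moreover have "min (w (ratX - cst a0)) (w (cst (a0 - a))) \<le> w (ratX - cst a0 + cst (a0 - a))"
    using that by (intro ultra) (simp_all only: e, simp_all add: val_linear del: cst.h_diff)
   moreover have "w (cst (a0 - a)) = 0" using that by (intro w(2)) simp
   ultimately show ?thesis using 1 unfolding e by simp
  qed
  have "w (ratX - cst a) = m * val (Some a0) (ratX - cst a)" for a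
   using other[of a] by (auto simp: val_linear m_def)
  then have e: "w f = m * val (Some a0) f" if "f \<noteq> 0" for f
   using val_hom_eqI[of w m "Some a0" f] w that by blast
  have m1: "m = 1" using e[OF unif(1)] unif(2) 1 by (intro mult[of f0 m "Some a0"]) (simp_all add: m_def)
  show ?thesis
  proof (rule that[of "Some a0"])
   fix f :: "'a ratfun" assume "f \<noteq> 0"
   from e[OF this] show "w f = val (Some a0) f" unfolding m1 by simp
  qed
 next
  case 2
  have "\<exists>a. w (ratX - cst a) \<noteq> 0"
  proof (rule ccontr)
   assume "\<nexists>a. w (ratX - cst a) \<noteq> 0"
   then have "w (ratX - cst a) = 0 * val None (ratX - cst a)" for a by simp
   then have "w f0 = 0 * val None f0" using val_hom_eqI[of w 0 None f0] w unif(1) by blast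
   then show False using unif by simp
  qed
  then obtain a1 where "w (ratX - cst a1) \<noteq> 0" by blast
  then have a1: "w (ratX - cst a1) < 0" using 2[of a1] by simp
  have "w (ratX - cst a) = w (ratX - cst a1)" for a
  proof (cases "a = a1")
   case False
   have *: "w (ratX - cst b) \<le> w (ratX - cst a)" if ab: "a \<noteq> b" for a b
   proof -
    have e: "ratX - cst b + cst (b - a) = ratX - cst a" by simp
    have "min (w (ratX - cst b)) (w (cst (b - a))) \<le> w (ratX - cst b + cst (b - a))"
     using ab by (intro ultra) (simp_all only: e, simp_all add: val_linear del: cst.h_diff)
    moreover have "w (cst (b - a)) = 0" using ab by (intro w(2)) simp
    ultimately show ?thesis using 2[of b] unfolding e by simp
   qed
   show ?thesis using *[OF False] *[OF False[symmetric]] by (rule antisym[rotated])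
  qed simp
  then have "w (ratX - cst a) = (- w (ratX - cst a1)) * val None (ratX - cst a)" for a
   by (simp add: val_linear)
  then have e: "w f = (- w (ratX - cst a1)) * val None f" if "f \<noteq> 0" for f
   using val_hom_eqI[of w "- w (ratX - cst a1)" None f] w that by blast
  have m1: "- w (ratX - cst a1) = 1"
   using e[OF unif(1)] unif(2) a1 by (intro mult[of f0 "- w (ratX - cst a1)" None]) linarith+
  show ?thesis
  proof (rule that[of None])
   fix f :: "'a ratfun" assume "f \<noteq> 0"
   from e[OF this] show "w f = val None f" unfolding m1 by simp
  qed
 qed
qed

lemma val_eq_imp:
 assumes "\<And>f. f \<noteq> 0 \<Longrightarrow> val Q f = val Q' f" shows "Q = Q'"
proof (rule ccontr)
 assume "Q \<noteq> Q'"
 then have "vge Q' 0 (local_gen Q)" by (intro vge_local_gen_other) blast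
 then have "0 \<le> val Q' (local_gen Q)" unfolding vge_def using local_gen_nonzero by blast
 moreover have "val Q (local_gen Q) = val Q' (local_gen Q)" using local_gen_nonzero by (rule assms)
 ultimately show False unfolding val_local_gen by simp
qed

text \<open>The valuation at \<open>Q\<close> composed with \<open>\<gamma>\<close> is again trivial
  on constants and takes the value 1, so it belongs to a point \<open>m Q\<close>. The inverse
  automorphism makes \<open>m\<close> bijective.\<close>

lemma rat_aut_permutes:
 fixes \<gamma> :: "'a::alg_closed_field ratfun \<Rightarrow> 'a ratfun"
 assumes g: "\<gamma> \<in> rat_auts"
 obtains m where "bij m" "\<And>Q f. f \<noteq> 0 \<Longrightarrow> val Q (\<gamma> f) = val (m Q) f"
proof -
 have ex: "\<exists>Q'. \<forall>f. f \<noteq> 0 \<longrightarrow> val Q (\<gamma> f) = val Q' f" if g: "\<gamma> \<in> rat_auts" for \<gamma> :: "'a ratfun \<Rightarrow> 'a ratfun" and Q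
 proof -
  interpret fhom \<gamma> using g by (simp add: rat_auts_def)
  have "surj \<gamma>" using g by (simp add: rat_auts_def)
  then obtain f0 where f0: "\<gamma> f0 = inverse (local_gen Q)" by (metis surjD)
  obtain Q' where "\<And>f. f \<noteq> 0 \<Longrightarrow> val Q (\<gamma> f) = val Q' f"
  proof (rule val_classification[of "\<lambda>f. val Q (\<gamma> f)" f0])
   show "val Q (\<gamma> (f * g)) = val Q (\<gamma> f) + val Q (\<gamma> g)" if "f \<noteq> 0" "g \<noteq> 0" for f g
    using that by (simp add: val_mult)
   show "val Q (\<gamma> (cst c)) = 0" if "c \<noteq> 0" for c using g that by (simp add: rat_auts_def)
   show "min (val Q (\<gamma> f)) (val Q (\<gamma> g)) \<le> val Q (\<gamma> (f + g))" if "f \<noteq> 0" "g \<noteq> 0" "f + g \<noteq> 0" for f g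
   proof -
    have "vge Q (min (val Q (\<gamma> f)) (val Q (\<gamma> g))) (\<gamma> f + \<gamma> g)"
     by (rule vge_add) (auto simp: vge_def)
    moreover have "\<gamma> f + \<gamma> g \<noteq> 0" using that(3) h_eq_0_iff[of "f + g"] by simp
    ultimately show ?thesis by (simp add: vge_def)
   qed
   show "f0 \<noteq> 0" using f0 by auto
   show "val Q (\<gamma> f0) = 1" by (simp add: f0 val_inverse val_local_gen)
  qed blast
  then show ?thesis by blast
 qed
 define m where "m Q = (SOME Q'. \<forall>f. f \<noteq> 0 \<longrightarrow> val Q (\<gamma> f) = val Q' f)" for Q
 have m: "f \<noteq> 0 \<Longrightarrow> val Q (\<gamma> f) = val (m Q) f" for Q f
  using someI_ex[OF ex[OF g, of Q]] by (simp add: m_def)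
 obtain \<delta> where d: "\<delta> \<in> rat_auts" "\<And>x. \<gamma> (\<delta> x) = x" "\<And>x. \<delta> (\<gamma> x) = x"
  using rat_auts_inv[OF g] by blast
 interpret d: fhom \<delta> using d by (simp add: rat_auts_def)
 interpret g: fhom \<gamma> using g by (simp add: rat_auts_def)
 have "inj m"
 proof (rule injI)
  fix Q1 Q2 assume e: "m Q1 = m Q2"
  show "Q1 = Q2"
  proof (rule val_eq_imp)
   fix f :: "'a ratfun" assume "f \<noteq> 0"
   then show "val Q1 f = val Q2 f" using m[of "\<delta> f" Q1] m[of "\<delta> f" Q2] e d by simp
  qed
 qed
 moreover have "surj m"
 proof -
  have "\<exists>Q. m Q = Q'" for Q'
  proof -
   obtain Q where Q: "\<And>f. f \<noteq> 0 \<Longrightarrow> val Q' (\<delta> f) = val Q f" using ex[OF d(1), of Q'] by blast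
   have "m Q = Q'"
   proof (rule val_eq_imp)
    fix f :: "'a ratfun" assume "f \<noteq> 0"
    then show "val (m Q) f = val Q' f" using m[of f Q] Q[of "\<gamma> f"] d by simp
   qed
   then show ?thesis by blast
  qed
  then show ?thesis by (metis surjI)
 qed
 ultimately have "bij m" by (rule bijI)
 then show ?thesis using that m by blast
qed

section \<open>Isomorphic curves have the same ramification data\<close>

context finite_base
begin

lemma rat_aut_base_change:
 assumes g: "\<gamma> \<in> rat_auts"
 obtains \<gamma>' where "\<gamma>' \<in> rat_auts" "\<And>f :: 'k ratfun. base_change (\<gamma> f) = \<gamma>' (base_change f)"
proof -
 define t where "t = base_change (\<gamma> ratX)"
 have t: "t \<in> moebius"
 proof -
  consider a b where "a \<noteq> 0" "\<gamma> ratX = cst a * ratX + cst b" | a b d where "b \<noteq> 0" "\<gamma> ratX = cst a + cst b / (ratX + cst d)"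
   using rat_aut_moebius[OF g] by (auto simp: moebius_def)
  then show ?thesis
  proof cases
   case 1
   then have "t = cst (to_ac a) * ratX + cst (to_ac b)" "to_ac a \<noteq> 0" by (simp_all add: t_def)
   then show ?thesis unfolding moebius_def by blast
  next
   case 2
   then have "t = cst (to_ac a) + cst (to_ac b) / (ratX + cst (to_ac d))" "to_ac b \<noteq> 0" by (simp_all add: t_def)
   then show ?thesis unfolding moebius_def by blast
  qed
 qed
 interpret t: ratfun_hom cst t by (rule moebius_hom[OF t])
 have gf: "fhom \<gamma>" using g by (simp add: rat_auts_def)
 have "base_change (\<gamma> f) = rmap cst t (base_change f)" for f
  by (rule ratfun_hom_unique[OF fhom_comp[OF bc.fhom_axioms gf] fhom_comp[OF t.rmap_fhom bc.fhom_axioms]])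
   (use g in \<open>simp_all add: rat_auts_def flip: t_def\<close>)
 then show ?thesis using that moebius_aut[OF t] by blast
qed

text \<open>After base change the automorphism permutes the points of the line, so it carries a
  representative with pole orders prime to p to another such one, with the same pole orders at the
  permuted points.\<close>

lemma ram_type_equivalent:
 assumes "equivalent u v"
 shows "ram_type (canon u) = ram_type (canon v)"
proof -
 obtain \<gamma> where g: "\<gamma> \<in> rat_auts" "\<gamma> v - u \<in> AS" using assms by (auto simp: equivalent_def)
 interpret fhom \<gamma> using g by (simp add: rat_auts_def)
 obtain \<gamma>' where g': "\<gamma>' \<in> rat_auts" "\<And>f :: 'k ratfun. base_change (\<gamma> f) = \<gamma>' (base_change f)"
  using rat_aut_base_change[OF g(1)] by blast
 interpret g': fhom \<gamma>' using g' by (simp add: rat_auts_def)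
 obtain m where m: "bij m" "\<And>Q f. f \<noteq> 0 \<Longrightarrow> val Q (\<gamma>' f) = val (m Q) f"
  using rat_aut_permutes[OF g'(1)] by blast
 have "has_ramification_data (AS_curve v) (ram_type (canon v))" by (simp add: has_ramification_data_iff)
 then obtain u0 v' where v': "AS_curve v = AS_curve u0" "v' - u0 \<in> AS"
  "\<forall>Q. pole_order Q (base_change v') > 0 \<longrightarrow> coprime (pole_order Q (base_change v')) CHAR('k)"
  "ram_type (canon v) = image_mset (\<lambda>Q. pole_order Q (base_change v') + 1) (mset_set {Q. pole_order Q (base_change v') > 0})"
  unfolding has_ramification_data_def by blast
 have "u0 = v" using v'(1) AS_field_inject[of v u0] by (simp add: AS_curve_def)
 have po: "pole_order Q (base_change (\<gamma> v')) = pole_order (m Q) (base_change v')" for Q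
  unfolding g'(2) using m(2)[of "base_change v'" Q] by (simp add: pole_order_eq)
 have "\<gamma> (v' - v) + (\<gamma> v - u) \<in> AS"
  using v'(2) \<open>u0 = v\<close> by (intro AS_add[OF prime_CHAR_ratfun rat_auts_AS[OF g(1)] g(2)]) simp
 then have "\<gamma> v' - u \<in> AS" by simp
 moreover have "image_mset (\<lambda>Q. pole_order Q (base_change (\<gamma> v')) + 1) (mset_set {Q. pole_order Q (base_change (\<gamma> v')) > 0})
   = ram_type (canon v)"
 proof -
  have "m ` {Q. pole_order (m Q) (base_change v') > 0} = {Q. pole_order Q (base_change v') > 0}"
  proof (intro equalityI subsetI)
   fix Q assume Q: "Q \<in> {Q. pole_order Q (base_change v') > 0}"
   obtain Q' where "Q = m Q'" using bij_is_surj[OF m(1)] by (metis surjD)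
   then show "Q \<in> m ` {Q. pole_order (m Q) (base_change v') > 0}" using Q by auto
  qed auto
  then have "mset_set {Q. pole_order Q (base_change v') > 0} = image_mset m (mset_set {Q. pole_order (m Q) (base_change v') > 0})"
   using image_mset_mset_set[of m "{Q. pole_order (m Q) (base_change v') > 0}"]
    inj_on_subset[OF bij_is_inj[OF m(1)]] by simp
  then show ?thesis unfolding v'(4) po by (simp add: multiset.map_comp comp_def)
 qed
 ultimately have "has_ramification_data (AS_curve u) (ram_type (canon v))"
  unfolding has_ramification_data_def using v'(3) unfolding po[symmetric]
  by (intro exI[of _ u] exI[of _ "\<gamma> v'"] conjI) (simp_all add: po)
 then show ?thesis by (simp add: has_ramification_data_iff)
qed

end

section \<open>Valuation rings\<close>

text \<open>Valuation rings of a subfield \<open>E\<close> of the ambient field, handled through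
  membership in \<open>V\<close> rather than through a value group. The case \<open>V = E\<close> is
  allowed here and excluded in \<open>place\<close>.\<close>

locale vring =
 fixes E V :: "'l::field set"
 assumes E_1 [simp]: "1 \<in> E"
  and E_diff [simp]: "\<And>x y. x \<in> E \<Longrightarrow> y \<in> E \<Longrightarrow> x - y \<in> E"
  and E_mult [simp]: "\<And>x y. x \<in> E \<Longrightarrow> y \<in> E \<Longrightarrow> x * y \<in> E"
  and E_inverse [simp]: "\<And>x. x \<in> E \<Longrightarrow> inverse x \<in> E"
  and V_sub: "V \<subseteq> E"
  and V_1 [simp]: "1 \<in> V"
  and V_diff [simp]: "\<And>x y. x \<in> V \<Longrightarrow> y \<in> V \<Longrightarrow> x - y \<in> V"
  and V_mult [simp]: "\<And>x y. x \<in> V \<Longrightarrow> y \<in> V \<Longrightarrow> x * y \<in> V"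
  and V_val: "\<And>x. x \<in> E \<Longrightarrow> x \<in> V \<or> inverse x \<in> V"
begin

lemma V_0 [simp]: "0 \<in> V" using V_diff[OF V_1 V_1] by simp
lemma E_0 [simp]: "0 \<in> E" using V_0 V_sub by blast
lemma V_uminus [simp]: "x \<in> V \<Longrightarrow> - x \<in> V" using V_diff[OF V_0] by simp
lemma V_add [simp]: "x \<in> V \<Longrightarrow> y \<in> V \<Longrightarrow> x + y \<in> V" using V_diff[of x "- y"] by simp
lemma E_uminus [simp]: "x \<in> E \<Longrightarrow> - x \<in> E" using E_diff[OF E_0] by simp
lemma E_add [simp]: "x \<in> E \<Longrightarrow> y \<in> E \<Longrightarrow> x + y \<in> E" using E_diff[of x "- y"] by simp
lemma V_E [simp]: "x \<in> V \<Longrightarrow> x \<in> E" using V_sub by blast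
lemma E_divide [simp]: "x \<in> E \<Longrightarrow> y \<in> E \<Longrightarrow> x / y \<in> E" by (simp add: divide_inverse)
lemma V_power [simp]: "x \<in> V \<Longrightarrow> x ^ n \<in> V" by (induction n) auto
lemma E_power [simp]: "x \<in> E \<Longrightarrow> x ^ n \<in> E" by (induction n) auto
lemma V_sum: "(\<And>i. i \<in> A \<Longrightarrow> f i \<in> V) \<Longrightarrow> sum f A \<in> V"
 by (induction A rule: infinite_finite_induct) auto
lemma E_sum: "(\<And>i. i \<in> A \<Longrightarrow> f i \<in> E) \<Longrightarrow> sum f A \<in> E"
 by (induction A rule: infinite_finite_induct) auto

definition mx :: "'l set" where "mx = {x \<in> V. x = 0 \<or> inverse x \<notin> V}"
definition unit :: "'l \<Rightarrow> bool" where "unit x \<longleftrightarrow> x \<noteq> 0 \<and> x \<in> V \<and> inverse x \<in> V"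

lemma mx_V: "x \<in> mx \<Longrightarrow> x \<in> V" by (simp add: mx_def)
lemma mx_0 [simp]: "0 \<in> mx" by (simp add: mx_def)
lemma V_cases: "x \<in> V \<Longrightarrow> unit x \<or> x \<in> mx" by (auto simp: mx_def unit_def)
lemma unit_not_mx: "unit x \<Longrightarrow> x \<notin> mx" by (auto simp: mx_def unit_def)
lemma unit_1 [simp]: "unit 1" by (simp add: unit_def)
lemma unit_V: "unit x \<Longrightarrow> x \<in> V" by (simp add: unit_def)
lemma unit_inverse: "unit x \<Longrightarrow> unit (inverse x)" by (simp add: unit_def)
lemma unit_mult: "unit x \<Longrightarrow> unit y \<Longrightarrow> unit (x * y)" by (simp add: unit_def)
lemma unit_power: "unit x \<Longrightarrow> unit (x ^ n)" by (induction n) (auto simp: unit_mult)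

lemma not_V_mx: "x \<in> E \<Longrightarrow> x \<notin> V \<Longrightarrow> inverse x \<in> mx"
 using V_val[of x] by (auto simp: mx_def)

lemma mx_inverse_not_V: "x \<in> mx \<Longrightarrow> x \<noteq> 0 \<Longrightarrow> inverse x \<notin> V" by (simp add: mx_def)

lemma mx_mult: assumes "x \<in> mx" "y \<in> V" shows "x * y \<in> mx"
proof -
 have "x = 0 \<or> y = 0 \<or> inverse (x * y) \<notin> V"
 proof (rule ccontr)
  assume *: "\<not> ?thesis"
  then have "y * inverse (x * y) \<in> V" using assms by simp
  moreover have "y * inverse (x * y) = inverse x" using * by (simp add: field_simps)
  ultimately show False using * mx_inverse_not_V[OF assms(1)] by metis
 qed
 then show ?thesis using assms by (auto simp: mx_def)
qed

lemma mx_add: assumes "x \<in> mx" "y \<in> mx" shows "x + y \<in> mx"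
proof -
 have *: "x + y \<in> mx" if "x \<in> mx" "y \<in> mx" "x / y \<in> V" "y \<noteq> 0" for x y
 proof -
  have "y * (1 + x / y) \<in> mx" using that by (intro mx_mult) auto
  then show ?thesis using that by (simp add: distrib_left add.commute)
 qed
 show ?thesis
 proof (cases "x = 0 \<or> y = 0")
  case False
  then have "x / y \<in> V \<or> y / x \<in> V" using V_val[of "x / y"] assms mx_V by simp
  then show ?thesis using *[of x y] *[of y x] False assms by (auto simp: add.commute)
 qed (use assms in auto)
qed

lemma mx_uminus: "x \<in> mx \<Longrightarrow> - x \<in> mx" using mx_mult[of x "- 1"] by simp

lemma mx_sum: "(\<And>i. i \<in> A \<Longrightarrow> f i \<in> mx) \<Longrightarrow> sum f A \<in> mx"
 by (induction A rule: infinite_finite_induct) (auto simp: mx_add)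

lemma unit_add_mx: assumes "unit u" "x \<in> mx" shows "unit (u + x)"
proof -
 have "u + x \<notin> mx"
 proof
  assume "u + x \<in> mx"
  then have "u + x + - x \<in> mx" by (rule mx_add[OF _ mx_uminus[OF assms(2)]])
  then show False using assms unit_not_mx by simp
 qed
 then show ?thesis using V_cases[of "u + x"] assms unit_V mx_V by auto
qed

lemma mx_prime: "x \<in> V \<Longrightarrow> y \<in> V \<Longrightarrow> x * y \<in> mx \<Longrightarrow> x \<in> mx \<or> y \<in> mx"
 using unit_mult unit_not_mx V_cases by blast

text \<open>If \<open>1/x\<close> lies in \<open>V\<close>, then so does
  \<open>x = x^n (1/x)^(n - 1)\<close>. This allows valuations to be compared after raising to a
  power.\<close>

lemma V_root: assumes "x \<in> E" "x ^ n \<in> V" "n > 0" shows "x \<in> V"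
proof (rule ccontr)
 assume "x \<notin> V"
 then have "inverse x \<in> V" "x \<noteq> 0" using V_val[OF assms(1)] by auto
 then have "x ^ n * inverse x ^ (n - 1) \<in> V" using assms by simp
 moreover have "x ^ n * inverse x ^ (n - 1) = x"
  using \<open>x \<noteq> 0\<close> assms(3) by (cases n) (simp_all add: power_inverse)
 ultimately show False using \<open>x \<notin> V\<close> by simp
qed

lemma mx_root: assumes "x \<in> E" "x ^ n \<in> mx" "n > 0" shows "x \<in> mx"
 using V_cases[OF V_root[OF assms(1) mx_V[OF assms(2)] assms(3)]] unit_power unit_not_mx assms(2) by blast

lemma unit_mult_V_iff: "unit u \<Longrightarrow> x \<in> E \<Longrightarrow> x * u \<in> V \<longleftrightarrow> x \<in> V"
 using V_mult[of "x * u" "inverse u"] by (auto simp: unit_def mult.assoc)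

lemma unit_mult_mx_iff: "unit u \<Longrightarrow> x * u \<in> mx \<longleftrightarrow> x \<in> mx"
 using mx_mult[of "x * u" "inverse u"] mx_mult[of x u] by (auto simp: unit_def mult.assoc)

text \<open>A term of least valuation, found by comparing quotients, as there is no value group in
  which to take a minimum.\<close>

lemma finite_dominant:
 assumes "finite A" "A \<noteq> {}" "\<And>i. i \<in> A \<Longrightarrow> f i \<in> E \<and> f i \<noteq> 0"
 shows "\<exists>i0\<in>A. \<forall>i\<in>A. f i / f i0 \<in> V" using assms
proof (induction A rule: finite_ne_induct)
 case (singleton x)
 then show ?case by simp
next
 case (insert x A)
 then obtain i0 where i0: "i0 \<in> A" "\<forall>i\<in>A. f i / f i0 \<in> V" by auto
 show ?case
 proof (cases "f x / f i0 \<in> V")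
  case True
  then show ?thesis using i0 by auto
 next
  case False
  have nz: "f x \<noteq> 0" "f i0 \<noteq> 0" "f x \<in> E" "f i0 \<in> E" using insert i0 by auto
  then have "inverse (f x / f i0) \<in> V" using V_val[of "f x / f i0"] False by auto
  then have 1: "f i0 / f x \<in> V" by (simp add: divide_inverse mult.commute)
  have "f i / f x \<in> V" if "i \<in> A" for i
  proof -
   have "f i / f i0 * (f i0 / f x) \<in> V" using i0 that 1 by (intro V_mult) auto
   then show ?thesis using nz by simp
  qed
  then show ?thesis using nz by (intro bexI[of _ x]) auto
 qed
qed

end

section \<open>The function field as a subfield of an algebraic closure\<close>

text \<open>The function field is realised as the subfield k(x)(y) of an algebraic closure, for the
  canonical equation \<open>y^p - y = v\<close>, so that ordinary field arithmetic applies to it.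
  Other equations of the same curve are reached later by translating \<open>y\<close>.\<close>

locale as_ext = finite_base k p n q for k :: "'k::{field,finite} itself" and p n q +
 fixes d :: "'k alg_closure option \<Rightarrow> 'k alg_closure poly" and e0 :: 'k and y :: "'k ratfun alg_closure"
 assumes d_CR: "d \<in> CR" and d_nz: "d \<noteq> (\<lambda>_. 0)" and root: "y ^ p - y = to_ac (cst e0 + rep d)"
begin

definition v :: "'k ratfun" where "v = cst e0 + rep d"

sublocale em: fhom "to_ac :: 'k ratfun \<Rightarrow> 'k ratfun alg_closure" by (rule fhom_to_ac)

abbreviation em :: "'k ratfun \<Rightarrow> 'k ratfun alg_closure" where "em \<equiv> to_ac"
abbreviation bc :: "'k ratfun \<Rightarrow> 'k alg_closure ratfun" where "bc \<equiv> base_change"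

lemma y_p: "y ^ p = y + em v" using root by (simp add: v_def algebra_simps)

lemma bc_v: "bc v = cst (to_ac e0) + pp_sum d"
 using base_change_rep[OF CR_D(2,3)[OF d_CR]] by (simp add: v_def CR_D d_CR)

lemma v_not_AS: "v \<notin> AS"
proof
 assume "v \<in> AS"
 then have "cst (to_ac e0) + pp_sum d \<in> AS" using base_change_AS bc_v by metis
 then show False using reduced_not_AS[of d "to_ac e0"] CR_D(1)[OF d_CR] d_nz by simp
qed

definition ev :: "'k ratfun poly \<Rightarrow> 'k ratfun alg_closure" where "ev F = poly (map_poly em F) y"

lemma ev_simps [simp]: "ev (F + G) = ev F + ev G" "ev (F - G) = ev F - ev G" "ev (F * G) = ev F * ev G"
 "ev [:c:] = em c" "ev [:0, 1:] = y" "ev 0 = 0" "ev 1 = 1" "ev (AS_poly v) = 0" "ev (- F) = - ev F"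
 "ev (pCons c F) = em c + y * ev F" "ev (monom c i) = em c * y ^ i"
 using y_p by (simp_all add: ev_def AS_poly_def poly_monom char_k)

lemma ev_sum: "ev (sum f A) = (\<Sum>i\<in>A. ev (f i))" by (simp add: ev_def em.map_sum poly_sum)

lemma irreducible_v: "irreducible (AS_poly v)"
 using irreducible_AS_poly_iff[OF prime_CHAR_ratfun] v_not_AS by simp

lemma ev_bezout:
 assumes "\<not> AS_poly v dvd F" obtains A where "ev A * ev F = 1"
proof -
 have nz: "AS_poly v \<noteq> 0" using irreducible_v by (simp add: Factorial_Ring.irreducible_def)
 obtain g a b s t where g: "F = g * a" "AS_poly v = g * b" "s * a + t * b = 1" "g \<noteq> 0"
  using poly_gcd_exists[OF nz] .
 have "is_unit g \<or> is_unit b" using Factorial_Ring.irreducibleD[OF irreducible_v g(2)] .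
 moreover have "\<not> is_unit b"
 proof
  assume "is_unit b"
  then obtain c where "b * c = 1" by (metis dvdE)
  then have "g = AS_poly v * c" using g(2) by (metis mult.assoc mult.right_neutral)
  then show False using g(1) assms by simp
 qed
 ultimately obtain c where c: "g * c = 1" by (metis dvdE)
 have "(c * s) * F + (c * t) * AS_poly v = (g * c) * (s * a + t * b)"
  using g(1,2) by (simp add: algebra_simps)
 also have "\<dots> = 1" using c g(3) by simp
 finally have "ev ((c * s) * F + (c * t) * AS_poly v) = 1" by simp
 then have "ev (c * s) * ev F = 1" by simp
 then show ?thesis by (rule that)
qed

lemma ev_eq_0_iff: "ev F = 0 \<longleftrightarrow> AS_poly v dvd F"
proof
 assume "ev F = 0"
 then show "AS_poly v dvd F" using ev_bezout[of F] by (metis mult_zero_right zero_neq_one)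
qed (auto elim!: dvdE)

lemma ev_mod: "ev (F mod AS_poly v) = ev F"
proof -
 have "ev F = ev (F div AS_poly v * AS_poly v + F mod AS_poly v)" by simp
 then show ?thesis by (simp only: ev_simps) simp
qed

definition E :: "'k ratfun alg_closure set" where "E = range ev"

text \<open>Coordinates with respect to \<open>1, y, ..., y^(p - 1)\<close>; values of
  \<open>a\<close> from \<open>p\<close> on are ignored.\<close>

definition el :: "(nat \<Rightarrow> 'k ratfun) \<Rightarrow> 'k ratfun alg_closure" where "el a = (\<Sum>i<p. em (a i) * y ^ i)"

lemma el_eq_ev: "el a = ev (\<Sum>i<p. monom (a i) i)" by (simp add: el_def ev_sum)

lemma el_coeff: "degree F < p \<Longrightarrow> el (coeff F) = ev F"
proof -
 assume F: "degree F < p"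
 have "(\<Sum>i<p. monom (coeff F i) i) = (\<Sum>i\<le>degree F. monom (coeff F i) i)"
  using F by (intro sum.mono_neutral_right) (auto simp: coeff_eq_0)
 then show ?thesis by (simp add: el_eq_ev poly_as_sum_of_monoms)
qed

lemma E_cases: assumes "z \<in> E" obtains a where "z = el a"
proof -
 obtain F where "z = ev F" using assms by (auto simp: E_def)
 then have "z = ev (F mod AS_poly v)" by (simp add: ev_mod)
 then have "z = el (coeff (F mod AS_poly v))"
  using el_coeff[of "F mod AS_poly v"] degree_mod_AS[of F v] by (simp add: char_k)
 then show ?thesis by (rule that)
qed

lemma el_E [simp]: "el a \<in> E" by (simp add: el_eq_ev E_def)

lemma el_simps: "el (\<lambda>i. a i + b i) = el a + el b" "el (\<lambda>i. a i - b i) = el a - el b"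
 by (simp_all add: el_def algebra_simps sum.distrib sum_subtractf)

lemma E_field: "1 \<in> E" "x \<in> E \<Longrightarrow> z \<in> E \<Longrightarrow> x - z \<in> E" "x \<in> E \<Longrightarrow> z \<in> E \<Longrightarrow> x * z \<in> E"
 "x \<in> E \<Longrightarrow> inverse x \<in> E"
proof -
 show "1 \<in> E" unfolding E_def by (rule range_eqI[of _ _ 1]) simp
 show "x - z \<in> E" if xz: "x \<in> E" "z \<in> E"
 proof -
  obtain F G where "x = ev F" "z = ev G" using xz by (auto simp: E_def)
  then have "x - z = ev (F - G)" by simp
  then show ?thesis unfolding E_def by blast
 qed
 show "x * z \<in> E" if xz: "x \<in> E" "z \<in> E"
 proof -
  obtain F G where "x = ev F" "z = ev G" using xz by (auto simp: E_def)
  then have "x * z = ev (F * G)" by simp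
  then show ?thesis unfolding E_def by blast
 qed
 show "inverse x \<in> E" if x: "x \<in> E"
 proof -
  obtain F where F: "x = ev F" using x by (auto simp: E_def)
  show ?thesis
  proof (cases "x = 0")
   case True
   then have "inverse x = ev 0" by simp
   then show ?thesis unfolding E_def by blast
  next
   case False
   then obtain A where "ev A * ev F = 1" using ev_bezout[of F] F ev_eq_0_iff by metis
   then have "inverse x = ev A" using F by (metis inverse_unique mult.commute)
   then show ?thesis unfolding E_def by blast
  qed
 qed
qed

lemma em_E [simp]: "em f \<in> E"
proof -
 have "em f = ev [:f:]" by simp
 then show ?thesis unfolding E_def by blast
qed

lemma y_E [simp]: "y \<in> E"
proof -
 have "y = ev [:0, 1:]" by simp
 then show ?thesis unfolding E_def by blast
qed

definition place :: "'k ratfun alg_closure set \<Rightarrow> bool" where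
 "place V \<longleftrightarrow> vring E V \<and> (\<forall>c. em (cst c) \<in> V) \<and> V \<noteq> E"

text \<open>The trace of \<open>V\<close> on k(x) is the local ring at \<open>Q\<close>. The points
  \<open>Q\<close> are geometric, so a place above \<open>Q\<close> is also above all Frobenius
  conjugates of \<open>Q\<close>.\<close>

definition above :: "'k alg_closure option \<Rightarrow> 'k ratfun alg_closure set \<Rightarrow> bool" where
 "above Q V \<longleftrightarrow> place V \<and> (\<forall>f. em f \<in> V \<longleftrightarrow> vge Q 0 (bc f))"

lemma place_vring: "place V \<Longrightarrow> vring E V" by (simp add: place_def)

text \<open>Otherwise \<open>w = 1/y\<close> lies in \<open>V\<close>, and dividing the equation by
  \<open>y^(p - 1)\<close> gives \<open>y = w^(p - 2) + v w^(p - 1)\<close>, which is in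
  \<open>V\<close> after all.\<close>

lemma y_in_place: assumes "vring E V" "em v \<in> V" shows "y \<in> V"
proof (rule ccontr)
 interpret vring E V by fact
 assume y: "y \<notin> V"
 define w where "w = inverse y"
 have w: "w \<in> V" "y \<noteq> 0" using V_val[of y] y by (auto simp: w_def)
 have p2: "p = Suc (p - 1)" "p - 1 = Suc (p - 2)" using p_gt_1 by simp_all
 have "y = y ^ p * w ^ (p - 1)"
 proof -
  have "y ^ p = y * y ^ (p - 1)" using p2(1) by (metis power_Suc)
  then show ?thesis using w(2) by (simp add: w_def power_inverse)
 qed
 also have "\<dots> = (y * w) * w ^ (p - 2) + em v * w ^ (p - 1)"
 proof -
  have "w ^ (p - 1) = w * w ^ (p - 2)" using p2(2) by (metis power_Suc)
  then show ?thesis unfolding y_p distrib_right by (simp only: mult.assoc)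
 qed
 also have "y * w = 1" using w(2) by (simp add: w_def)
 finally have "y \<in> V" using w(1) assms(2) by simp
 then show False using y by simp
qed

lemma place_not_all:
 assumes "place V" obtains f where "em f \<notin> V"
proof -
 interpret vring E V using assms by (rule place_vring)
 have False if "\<forall>f. em f \<in> V"
 proof -
  have "y \<in> V" using y_in_place[OF vring_axioms] that by blast
  then have "el a \<in> V" for a unfolding el_def using that by (intro V_sum V_mult V_power) auto
  then have "E \<subseteq> V" by (auto elim!: E_cases)
  then show False using assms V_sub by (auto simp: place_def)
 qed
 then show ?thesis using that by blast
qed

lemma bc_fract: "f \<noteq> 0 \<Longrightarrow> val Q (bc f) =
  (case Q of Some z \<Rightarrow> int (order z (map_poly to_ac (num f))) - int (order z (map_poly to_ac (den f)))
   | None \<Rightarrow> int (degree (den f)) - int (degree (num f)))"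
proof -
 assume f: "f \<noteq> 0"
 have "bc f = to_fract (map_poly to_ac (num f)) / to_fract (map_poly to_ac (den f))"
  using ratfun_eq_div[of f] by (metis bc.h_divide base_change_to_fract)
 then show ?thesis using f val_frac[of "map_poly to_ac (num f)" "map_poly to_ac (den f)"]
  by (auto split: option.splits)
qed

text \<open>The polynomials over k lying in the maximal ideal are the multiples of one of least
  degree, \<open>a\<close>. There is a nonzero one, as otherwise all of k(x) would lie in
  \<open>V\<close>; and since the ideal is prime, a polynomial over k vanishes at a root
  \<open>z\<close> of \<open>a\<close> iff \<open>a\<close> divides it.\<close>

lemma restrict_finite:
 assumes pl: "place V" and x: "em ratX \<in> V"
 obtains z where "above (Some z) V"
proof -
 interpret vring E V using pl by (rule place_vring)
 have cst: "em (cst c) \<in> V" for c using pl by (simp add: place_def)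
 have poly: "em (to_fract P) \<in> V" for P
 proof -
  have "em (poly (map_poly cst P) ratX) \<in> V" by (induction P) (auto simp: cst x)
  then show ?thesis by simp
 qed
 define I where "I = {P. P \<noteq> 0 \<and> em (to_fract P) \<in> mx}"
 have "I \<noteq> {}"
 proof
  assume I: "I = {}"
  have "em f \<in> V" for f
  proof -
   have "em (to_fract (den f)) \<notin> mx" using I den_nonzero[of f] unfolding I_def by blast
   then have "unit (em (to_fract (den f)))" using V_cases[OF poly] by blast
   then have "em (to_fract (num f)) * inverse (em (to_fract (den f))) \<in> V" using poly by (simp add: unit_def)
   then have "em (to_fract (num f) / to_fract (den f)) \<in> V" by (simp add: divide_inverse)
   then show ?thesis by (simp only: ratfun_eq_div)
  qed
  then show False using place_not_all[OF pl] by blast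
 qed
 then obtain a where a: "a \<in> I" "\<And>b. b \<in> I \<Longrightarrow> degree a \<le> degree b"
  using ex_has_least_nat[of "\<lambda>P. P \<in> I" _ degree] by (metis all_not_in_conv)
 have a0: "a \<noteq> 0" "em (to_fract a) \<in> mx" using a by (auto simp: I_def)
 have mdvd: "em (to_fract b) \<in> mx \<longleftrightarrow> a dvd b" for b
 proof
  assume b: "em (to_fract b) \<in> mx"
  have "to_fract (b mod a) = to_fract b + - (to_fract (b div a) * to_fract a)"
   by (metis add_uminus_conv_diff minus_div_mult_eq_mod to_fract_diff to_fract_mult)
  then have "em (to_fract (b mod a)) = em (to_fract b) + - (em (to_fract a) * em (to_fract (b div a)))"
   by (simp add: mult.commute)
  also have "\<dots> \<in> mx" using b a0 poly by (intro mx_add mx_uminus mx_mult)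
  finally have "b mod a = 0 \<or> b mod a \<in> I" by (auto simp: I_def)
  then show "a dvd b" using a(2)[of "b mod a"] degree_mod_less[OF a0(1), of b] by (auto simp: mod_eq_0_iff_dvd)
 next
  assume "a dvd b"
  then obtain c where "b = a * c" by (elim dvdE)
  then show "em (to_fract b) \<in> mx" using mx_mult[OF a0(2) poly[of c]] by simp
 qed
 have "degree a > 0"
 proof (rule ccontr)
  assume "\<not> degree a > 0"
  then have "is_unit a" using a0(1) by (simp add: is_unit_iff_degree)
  then have "em (to_fract 1) \<in> mx" unfolding mdvd .
  then show False using unit_not_mx[OF unit_1] by simp
 qed
 then obtain z where z: "poly (map_poly to_ac a) z = 0"
  using alg_closed_imp_poly_has_root[of "map_poly to_ac a"] by auto
 have rt: "poly (map_poly to_ac b) z = 0 \<longleftrightarrow> a dvd b" for b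
 proof
  assume "a dvd b"
  then show "poly (map_poly to_ac b) z = 0" using z by (auto elim!: dvdE)
 next
  assume b: "poly (map_poly to_ac b) z = 0"
  obtain g b' a' s t where g: "b = g * b'" "a = g * a'" "s * b' + t * a' = 1" "g \<noteq> 0"
   using poly_gcd_exists[OF a0(1)] .
  have "s * b + t * a = g * (s * b' + t * a')" unfolding g(1,2) by (simp add: algebra_simps)
  then have "g = s * b + t * a" using g(3) by simp
  then have gz: "poly (map_poly to_ac g) z = 0" using z b by simp
  have "em (to_fract g) * em (to_fract a') \<in> mx" using a0(2) g(2) by simp
  then have "a dvd g \<or> a dvd a'" using mx_prime[OF poly poly] mdvd by metis
  moreover have "\<not> a dvd a'"
  proof
   assume "a dvd a'"
   then have "degree a \<le> degree a'" using a0(1) g(2) by (intro dvd_imp_degree_le) auto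
   then have "degree g = 0" using a0(1) g(2) by (auto simp: degree_mult_eq)
   then obtain c where "g = [:c:]" by (elim degree_eq_zeroE)
   then show False using gz g(4) by simp
  qed
  ultimately show "a dvd b" using g(1) by auto
 qed
 have "em f \<in> V \<longleftrightarrow> vge (Some z) 0 (bc f)" for f
 proof (cases "f = 0")
  case False
  define N D where "N = num f" and "D = den f"
  have nz: "N \<noteq> 0" "D \<noteq> 0" using False by (simp_all add: N_def D_def)
  have ef: "em f = em (to_fract N) * inverse (em (to_fract D))"
   using ratfun_eq_div[of f] unfolding N_def D_def by (metis em.h_divide divide_inverse)
  have vb: "val (Some z) (bc f) = int (order z (map_poly to_ac N)) - int (order z (map_poly to_ac D))"
   using bc_fract[OF False, of "Some z"] by (simp add: N_def D_def)
  show ?thesis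
  proof (cases "poly (map_poly to_ac D) z = 0")
   case True
   obtain s t where "s * N + t * D = 1" using poly_bezout[OF coprime_num_den] unfolding N_def D_def .
   then have "poly (map_poly to_ac (s * N + t * D)) z = 1" by simp
   then have Nz: "poly (map_poly to_ac N) z \<noteq> 0" using True by auto
   then have "order z (map_poly to_ac N) = 0" by (rule order_0I)
   moreover have "order z (map_poly to_ac D) > 0" using True nz by (simp add: order_gt_0_iff)
   ultimately have "\<not> vge (Some z) 0 (bc f)" using False vb by (simp add: vge_def)
   moreover have "em f \<notin> V"
   proof
    assume "em f \<in> V"
    then have "em (to_fract D) * em f \<in> mx" using True rt mdvd by (intro mx_mult) auto
    moreover have "em (to_fract D) * em f = em (to_fract N)" using nz by (simp add: ef)
    ultimately show False using Nz rt mdvd by simp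
   qed
   ultimately show ?thesis by simp
  next
   case D: False
   then have "em (to_fract D) \<notin> mx" using rt mdvd by simp
   then have "unit (em (to_fract D))" using V_cases[OF poly] by blast
   then have "em f \<in> V" unfolding ef using poly by (simp add: unit_def)
   moreover have "vge (Some z) 0 (bc f)" using D vb by (simp add: vge_def order_0I)
   ultimately show ?thesis by simp
  qed
 qed simp
 then show ?thesis using that[of z] pl by (simp add: above_def)
qed

text \<open>With \<open>w = 1/x\<close> in the maximal ideal, \<open>P w^(deg P)\<close> is the
  leading coefficient plus an element of the maximal ideal, hence a unit. Membership in
  \<open>V\<close> therefore depends on degrees only.\<close>

lemma restrict_infinite:
 assumes pl: "place V" and x: "em ratX \<notin> V"
 shows "above None V"
proof -
 interpret vring E V using pl by (rule place_vring)
 have cst: "em (cst c) \<in> V" for c using pl by (simp add: place_def)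
 have cu: "unit (em (cst c))" if "c \<noteq> 0" for c
  using that cst[of c] cst[of "inverse c"] by (simp add: unit_def)
 define w where "w = inverse (em ratX)"
 have w: "w \<in> mx" unfolding w_def using x by (intro not_V_mx) auto
 have w0: "w \<noteq> 0" by (simp add: w_def val_linear)
 have ew: "em ratX * w = 1" by (simp add: w_def val_linear)
 have un: "unit (em (to_fract P) * w ^ degree P)" if "P \<noteq> 0" for P using that
 proof (induction P)
  case (pCons a P)
  have tp: "em (to_fract (pCons a P)) = em (cst a) + em ratX * em (to_fract P)"
  proof -
   have "to_fract (pCons a P) = cst a + ratX * to_fract P"
    unfolding poly_map_cst[symmetric] cst.map_pCons poly_pCons ..
   then show ?thesis by simp
  qed
  show ?case
  proof (cases "P = 0")
   case True
   then show ?thesis using pCons cu[of a] tp by simp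
  next
   case False
   then have "em (to_fract (pCons a P)) * w ^ degree (pCons a P)
    = em (to_fract P) * w ^ degree P * (em ratX * w) + w * (em (cst a) * w ^ degree P)"
    unfolding tp by (simp add: algebra_simps)
   also have "unit \<dots>"
    unfolding ew using pCons False w cst by (intro unit_add_mx mx_mult) (auto simp: mx_V)
   finally show ?thesis .
  qed
 qed simp
 have "em f \<in> V \<longleftrightarrow> vge None 0 (bc f)" for f
 proof (cases "f = 0")
  case False
  define N D where "N = num f" and "D = den f"
  have nz: "N \<noteq> 0" "D \<noteq> 0" using False by (simp_all add: N_def D_def)
  define uN uD where "uN = em (to_fract N) * w ^ degree N" and "uD = em (to_fract D) * w ^ degree D"
  have u: "unit uN" "unit uD" using un nz by (auto simp: uN_def uD_def)
  have ef: "em f = em (to_fract N) / em (to_fract D)"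
   using ratfun_eq_div[of f] unfolding N_def D_def by (metis em.h_divide)
  have "em f * w ^ degree N = w ^ degree D * (uN * inverse uD)"
   unfolding ef uN_def uD_def using nz w0 by (simp add: field_simps)
  moreover have uu: "unit (uN * inverse uD)" using u by (intro unit_mult unit_inverse)
  ultimately have main: "em f * w ^ degree N = w ^ degree D * (uN * inverse uD)" by simp
  show ?thesis
  proof (cases "degree N \<le> degree D")
   case True
   have "em f * w ^ degree N = w ^ (degree D - degree N) * (uN * inverse uD) * w ^ degree N"
   proof -
    have "w ^ degree D = w ^ (degree D - degree N) * w ^ degree N" using True by (simp flip: power_add)
    then show ?thesis unfolding main by (simp only: mult_ac)
   qed
   moreover have "w ^ degree N \<noteq> 0" using w0 by simp
   ultimately have "em f = w ^ (degree D - degree N) * (uN * inverse uD)" using mult_right_cancel by blast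
   then have "em f \<in> V" using uu w by (simp add: unit_def mx_V)
   moreover have "vge None 0 (bc f)" using bc_fract[OF False, of None] True by (simp add: vge_def N_def D_def)
   ultimately show ?thesis by simp
  next
   case F: False
   have "em f * w ^ (degree N - degree D) * w ^ degree D = (uN * inverse uD) * w ^ degree D"
   proof -
    have "w ^ degree N = w ^ (degree N - degree D) * w ^ degree D" using F by (simp flip: power_add)
    then show ?thesis using main by (simp only: mult_ac)
   qed
   moreover have "w ^ degree D \<noteq> 0" using w0 by simp
   ultimately have "em f * w ^ (degree N - degree D) = uN * inverse uD" using mult_right_cancel by blast
   then have e: "w ^ (degree N - degree D) * em f = uN * inverse uD" by (simp only: mult.commute)
   have "em f \<notin> V"
   proof
    assume "em f \<in> V"
    moreover have "w ^ (degree N - degree D) \<in> mx"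
    proof -
     have "w * w ^ (degree N - degree D - 1) \<in> mx" using mx_V[OF w] by (intro mx_mult[OF w]) simp
     moreover have "degree N - degree D = Suc (degree N - degree D - 1)" using F by simp
     ultimately show ?thesis by (metis power_Suc)
    qed
    ultimately have "uN * inverse uD \<in> mx" using e mx_mult by metis
    then show False using unit_not_mx[OF uu] by simp
   qed
   moreover have "\<not> vge None 0 (bc f)" using bc_fract[OF False, of None] F False by (simp add: vge_def N_def D_def)
   ultimately show ?thesis by simp
  qed
 qed simp
 then show ?thesis using pl by (simp add: above_def)
qed

lemma above_exists: assumes "place V" obtains Q where "above Q V"
 using restrict_finite[OF assms] restrict_infinite[OF assms] by metis

lemma above_None_iff: "above Q V \<Longrightarrow> em ratX \<in> V \<longleftrightarrow> Q \<noteq> None"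
proof -
 assume "above Q V"
 then have "em ratX \<in> V \<longleftrightarrow> vge Q 0 (ratX :: 'k alg_closure ratfun)"
  unfolding above_def by (metis base_change_X)
 then show ?thesis by (cases Q) (simp_all add: val_linear(6), simp add: vge_def val_linear)
qed

end

section \<open>Places above a point of the line\<close>

context finite_base
begin

lemma order_map_frob: "P \<noteq> 0 \<Longrightarrow> order (frob z) (map_poly frob P) = order z P"
proof -
 assume P: "P \<noteq> 0"
 obtain R where R: "P = [:- z, 1:] ^ order z P * R" "\<not> [:- z, 1:] dvd R"
  using order_decomp[OF P, of z] by blast
 have "poly R z \<noteq> 0" using R(2) by (simp add: poly_eq_0_iff_dvd)
 then have "poly (map_poly frob R) (frob z) \<noteq> 0" by (simp flip: frob.h_poly)
 then have o: "order (frob z) (map_poly frob R) = 0" by (rule order_0I)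
 have nz: "R \<noteq> 0" using R P by auto
 define m where "m = order z P"
 have "map_poly frob P = [:- frob z, 1:] ^ m * map_poly frob R" by (subst R(1)) (simp add: m_def)
 moreover have "[:- frob z, 1:] ^ m * map_poly frob R \<noteq> 0" using nz by simp
 ultimately show ?thesis using o by (simp add: order_mult order_power_n_n m_def del: mult_eq_0_iff)
qed

lemma val_base_change_frob: "f \<noteq> 0 \<Longrightarrow> val (frobQ Q) (base_change f) = val Q (base_change (f :: 'k ratfun))"
proof (cases "Q = None")
 case False
 assume "f \<noteq> 0"
 with False obtain z where z: "Q = Some z" "f \<noteq> 0" by auto
 define N D where "N = map_poly to_ac (num f)" and "D = map_poly to_ac (den f)"
 have nz: "N \<noteq> 0" "D \<noteq> 0" using z by (simp_all add: N_def D_def)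
 have f: "frob (to_ac c) = to_ac c" for c :: 'k by (simp add: frob_fixed_iff)
 have fx: "map_poly frob N = N" "map_poly frob D = D" by (simp_all add: N_def D_def poly_eq_iff f)
 have "base_change f = to_fract N / to_fract D"
  using ratfun_eq_div[of f] unfolding N_def D_def by (metis bc.h_divide base_change_to_fract)
 then show ?thesis
  using val_frac(1)[OF nz, of z] val_frac(1)[OF nz, of "frob z"] order_map_frob[OF nz(1), of z]
   order_map_frob[OF nz(2), of z] fx z(1) by simp
qed simp

text \<open>A product of linear factors with Frobenius-invariant multiplicities is itself fixed by
  Frobenius. So an effective divisor on the affine line that is stable under Frobenius has an
  equation over k.\<close>

lemma descend_prod:
 assumes fin: "finite {z. m z \<noteq> (0::nat)}" and inv: "\<And>z. m (frob z) = m z"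
 obtains H :: "'k poly" where "H \<noteq> 0" "\<forall>z. order z (map_poly to_ac H) = m z"
  "degree H = (\<Sum>z | m z \<noteq> 0. m z)"
proof -
 define S where "S = {z. m z \<noteq> 0}"
 define G where "G = (\<Prod>z\<in>S. [:- z, 1:] ^ m z)"
 have S: "finite S" using fin by (simp add: S_def)
 have fS: "frob ` S = S"
 proof (intro equalityI subsetI)
  fix z assume z: "z \<in> S"
  obtain w where "z = frob w" using bij_is_surj[OF bij_frob] by (metis surjD)
  then show "z \<in> frob ` S" using z inv by (auto simp: S_def)
 qed (auto simp: S_def inv)
 have "map_poly frob G = (\<Prod>z\<in>S. [:- frob z, 1:] ^ m (frob z))"
  by (simp add: G_def frob.map_prod inv)
 also have "\<dots> = (\<Prod>z\<in>frob ` S. [:- z, 1:] ^ m z)"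
  by (rule prod.reindex[symmetric, unfolded comp_def]) (rule inj_on_subset[OF bij_is_inj[OF bij_frob] subset_UNIV])
 finally have "map_poly frob G = G" by (simp add: fS G_def)
 then obtain H where H: "G = map_poly to_ac H" by (rule descend_poly)
 have "G \<noteq> 0" using S by (simp add: G_def)
 have "order z G = m z" for z
 proof -
  have "order z (\<Prod>z\<in>T. [:- z, 1:] ^ m z) = (if z \<in> T then m z else 0)" if "finite T" for T
   using that
  proof (induction T rule: finite_induct)
   case (insert w T)
   have nz: "[:- w, 1:] ^ m w * (\<Prod>z\<in>T. [:- z, 1:] ^ m z) \<noteq> 0" using insert by simp
   have "order z ([:- w, 1:] ^ m w) = (if z = w then m w else 0)"
    by (auto simp: order_power_n_n intro!: order_0I)
   then show ?case using insert nz by (auto simp: order_mult simp del: mult_eq_0_iff)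
  qed simp
  from this[OF S] show ?thesis by (auto simp: G_def S_def)
 qed
 moreover have "degree G = (\<Sum>z\<in>S. m z)"
  unfolding G_def by (subst degree_prod_eq_sum_degree) (simp_all add: degree_power_eq)
 ultimately show ?thesis using that[of H] H \<open>G \<noteq> 0\<close> by (simp add: S_def)
qed

definition orbit :: "'k alg_closure \<Rightarrow> 'k alg_closure set" where
 "orbit z = range (\<lambda>i. (frob ^^ i) z)"

lemma orbit_self: "z \<in> orbit z" unfolding orbit_def by (rule range_eqI[of _ _ 0]) simp

lemma frob_roots:
 assumes "poly (map_poly to_ac (P :: 'k poly)) z = 0"
 shows "poly (map_poly to_ac P) (frob z) = 0"
proof -
 have f: "frob (to_ac c) = to_ac c" for c :: 'k by (simp add: frob_fixed_iff)
 have "map_poly frob (map_poly to_ac P) = map_poly to_ac P" by (simp add: poly_eq_iff f)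
 then show ?thesis using frob.h_poly[of "map_poly to_ac P" z] assms by simp
qed

lemma finite_orbit: "finite (orbit z)"
proof -
 obtain P :: "'k poly" where P: "P \<noteq> 0" "poly (map_poly to_ac P) z = 0"
  by (rule alg_closure_algebraic)
 have "poly (map_poly to_ac P) ((frob ^^ i) z) = 0" for i
  using P(2) by (induction i) (simp_all add: frob_roots)
 then have "orbit z \<subseteq> {w. poly (map_poly to_ac P) w = 0}" by (auto simp: orbit_def)
 moreover have "finite {w. poly (map_poly to_ac P) w = 0}" using P(1) by (intro poly_roots_finite) simp
 ultimately show ?thesis by (rule finite_subset)
qed

lemma frob_orbit: "frob w \<in> orbit z \<longleftrightarrow> w \<in> orbit z"
proof -
 have "frob ` orbit z \<subseteq> orbit z" by (auto simp: orbit_def intro: range_eqI[of _ _ "Suc _"])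
 then have "frob ` orbit z = orbit z"
  using finite_orbit endo_inj_surj[of "orbit z" frob] inj_on_subset[OF bij_is_inj[OF bij_frob]] by blast
 then show ?thesis using bij_is_inj[OF bij_frob] by (metis image_iff injD)
qed

text \<open>A polynomial over k vanishes at all conjugates of \<open>z\<close> together; the
  equation of the whole orbit does so with simple zeros.\<close>

lemma uniformizer_exists:
 fixes z :: "'k alg_closure"
 obtains P :: "'k poly" where "P \<noteq> 0" "\<forall>w. order w (map_poly to_ac P) = (if w \<in> orbit z then 1 else 0)"
proof -
 obtain H :: "'k poly" where "H \<noteq> 0" "\<forall>w. order w (map_poly to_ac H) = (if w \<in> orbit z then 1 else 0)"
  by (rule descend_prod[of "\<lambda>w. if w \<in> orbit z then 1 else 0"]) (auto simp: finite_orbit frob_orbit)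
 then show ?thesis by (rule that)
qed

lemma uniformizer:
 obtains \<pi> :: "'k ratfun" where "\<pi> \<noteq> 0" "val Q (base_change \<pi>) = 1"
proof (cases Q)
 case None
 have "inverse ratX \<noteq> (0 :: 'k ratfun)" "val Q (base_change (inverse (ratX :: 'k ratfun))) = 1"
  using None by (simp_all add: val_inverse val_linear)
 then show ?thesis by (rule that)
next
 case (Some z)
 obtain P :: "'k poly" where P: "P \<noteq> 0" "\<forall>w. order w (map_poly to_ac P) = (if w \<in> orbit z then 1 else 0)"
  by (rule uniformizer_exists[of z])
 have "val Q (base_change (to_fract P)) = 1" using P orbit_self by (simp add: Some val_to_fract)
 then show ?thesis using P(1) that[of "to_fract P"] by simp
qed

end

context as_ext
begin

definition local_ring :: "'k alg_closure option \<Rightarrow> 'k ratfun alg_closure set" where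
 "local_ring Q = {em f | f. vge Q 0 (bc f)}"

lemma local_ring_iff: "em f \<in> local_ring Q \<longleftrightarrow> vge Q 0 (bc f)"
 by (auto simp: local_ring_def)

text \<open>A subring of \<open>E\<close> containing the local ring and maximal among those omitting \<open>1 / \<pi>\<close> is a
 valuation ring.\<close>

lemma place_exists: obtains V where "above Q V"
proof -
 obtain \<pi> :: "'k ratfun" where pi: "\<pi> \<noteq> 0" "val Q (bc \<pi>) = 1" by (rule uniformizer)
 define \<rho> where "\<rho> = em \<pi>"
 have w0: "\<rho> \<noteq> 0" using pi by (simp add: \<rho>_def)
 define rng where "rng = {A. local_ring Q \<subseteq> A \<and> A \<subseteq> E \<and> (\<forall>x\<in>A. \<forall>z\<in>A. x - z \<in> A \<and> x * z \<in> A) \<and> inverse \<rho> \<notin> A}"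
 have "local_ring Q \<in> rng"
 proof -
  have "inverse \<rho> \<notin> local_ring Q"
   using local_ring_iff[of "inverse \<pi>" Q] pi by (simp add: \<rho>_def vge_def val_inverse)
  moreover have "x - z \<in> local_ring Q \<and> x * z \<in> local_ring Q" if xz: "x \<in> local_ring Q" "z \<in> local_ring Q" for x z
  proof -
   obtain f g where fg: "x = em f" "z = em g" "vge Q 0 (bc f)" "vge Q 0 (bc g)"
    using xz by (auto simp: local_ring_def)
   then have "em (f - g) \<in> local_ring Q" "em (f * g) \<in> local_ring Q"
    unfolding local_ring_iff using vge_mult[of Q 0 "bc f" 0 "bc g"] by (auto intro: vge_diff)
   then show ?thesis using fg by simp
  qed
  ultimately show ?thesis by (auto simp: rng_def local_ring_def)
 qed
 moreover have "\<Union>\<C> \<in> rng" if ne: "\<C> \<noteq> {}" and ch: "subset.chain rng \<C>" for \<C>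
 proof -
  have sub: "A \<in> \<C> \<Longrightarrow> A \<in> rng" for A using ch by (auto simp: subset.chain_def)
  have "x - z \<in> \<Union>\<C> \<and> x * z \<in> \<Union>\<C>" if xz: "x \<in> \<Union>\<C>" "z \<in> \<Union>\<C>" for x z
  proof -
   obtain A B where AB: "A \<in> \<C>" "B \<in> \<C>" "x \<in> A" "z \<in> B" using xz by auto
   then have "A \<subseteq> B \<or> B \<subseteq> A" using ch by (auto simp: subset.chain_def)
   then obtain C where "C \<in> \<C>" "x \<in> C" "z \<in> C" using AB by auto
   moreover from this(1) have "C \<in> rng" by (rule sub)
   ultimately have "x - z \<in> C \<and> x * z \<in> C" unfolding rng_def by blast
   then show ?thesis using \<open>C \<in> \<C>\<close> by blast
  qed
  moreover obtain A where "A \<in> \<C>" using ne by auto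
  ultimately show ?thesis using sub unfolding rng_def by blast
 qed
 ultimately have "\<exists>M\<in>rng. \<forall>A\<in>rng. M \<subseteq> A \<longrightarrow> A = M"
  by (intro subset_Zorn_nonempty) auto
 then obtain M where M: "M \<in> rng" "\<And>A. A \<in> rng \<Longrightarrow> M \<subseteq> A \<Longrightarrow> A = M" by blast
 have OM: "local_ring Q \<subseteq> M" and ME: "M \<subseteq> E" and wM: "inverse \<rho> \<notin> M"
  and Md: "x \<in> M \<Longrightarrow> z \<in> M \<Longrightarrow> x - z \<in> M" and Mm: "x \<in> M \<Longrightarrow> z \<in> M \<Longrightarrow> x * z \<in> M" for x z
  using M(1) by (auto simp: rng_def)
 have loc: "em f \<in> M" if "vge Q 0 (bc f)" for f using OM local_ring_iff[of f Q] that by blast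
 have M0: "0 \<in> M" "1 \<in> M" using loc[of 0] loc[of 1] by (simp_all add: vge_def)
 have Ma: "x + z \<in> M" if xz: "x \<in> M" "z \<in> M" for x z
  using Md[OF xz(1) Md[OF M0(1) xz(2)]] by simp
 have Ms: "sum f A \<in> M" if "\<And>i. i \<in> A \<Longrightarrow> f i \<in> M" for f and A :: "nat set"
  using that by (induction A rule: infinite_finite_induct) (auto simp: M0 Ma)
 have Mp: "x ^ i \<in> M" if "x \<in> M" for x i using that by (induction i) (auto simp: M0 Mm)
 have wM': "\<rho> \<in> M" unfolding \<rho>_def using pi by (intro loc) (simp add: vge_def)
 \<comment> \<open>By maximality of \<open>M\<close>, the ring obtained by adjoining an outside
   element \<open>z\<close> must contain the forbidden \<open>1/\<rho>\<close>.\<close>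
 have adj: "\<exists>P. (\<forall>i. coeff P i \<in> M) \<and> poly P z = inverse \<rho>" if zE: "z \<in> E" and zM: "z \<notin> M" for z
 proof (rule ccontr)
  assume no: "\<not> ?thesis"
  define A where "A = {poly P z | P. \<forall>i. coeff P i \<in> M}"
  have "A \<in> rng"
  proof -
   have "M \<subseteq> A"
   proof
    fix x assume "x \<in> M"
    then have "x = poly [:x:] z" "\<forall>i. coeff [:x:] i \<in> M"
     using M0 by (auto simp: coeff_pCons split: nat.splits)
    then show "x \<in> A" unfolding A_def by blast
   qed
   then have "local_ring Q \<subseteq> A" using OM by blast
   moreover have "A \<subseteq> E"
   proof
    fix x assume "x \<in> A"
    then obtain P where P: "x = poly P z" "\<forall>i. coeff P i \<in> M" by (auto simp: A_def)
    have E0: "0 \<in> E" using E_field(2)[OF E_field(1) E_field(1)] by simp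
    have Es: "a + b \<in> E" if "a \<in> E" "b \<in> E" for a b
     using E_field(2)[OF that(1) E_field(2)[OF E0 that(2)]] by simp
    have "poly P z \<in> E" using P(2)
    proof (induction P)
     case (pCons a P)
     have "a \<in> E" using pCons(3) ME by (metis coeff_pCons_0 subsetD)
     moreover have "\<forall>i. coeff P i \<in> M" using pCons(3) by (metis coeff_pCons_Suc)
     ultimately show ?case using pCons(2) zE by (simp add: Es E_field)
    qed (simp add: E0)
    then show "x \<in> E" using P by simp
   qed
   moreover have "x - w \<in> A \<and> x * w \<in> A" if xw: "x \<in> A" "w \<in> A" for x w
   proof -
    obtain P R where PR: "x = poly P z" "w = poly R z" "\<forall>i. coeff P i \<in> M" "\<forall>i. coeff R i \<in> M"
     using xw by (auto simp: A_def)
    have "x - w = poly (P - R) z" "\<forall>i. coeff (P - R) i \<in> M"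
     "x * w = poly (P * R) z" "\<forall>i. coeff (P * R) i \<in> M"
     using PR Md Mm by (auto simp: coeff_mult intro!: Ms)
    then show ?thesis unfolding A_def by blast
   qed
   moreover have "inverse \<rho> \<notin> A" using no by (auto simp: A_def)
   ultimately show ?thesis by (simp add: rng_def)
  qed
  moreover have "M \<subseteq> A"
  proof
   fix x assume "x \<in> M"
   then have "x = poly [:x:] z" "\<forall>i. coeff [:x:] i \<in> M"
    using M0 by (auto simp: coeff_pCons split: nat.splits)
   then show "x \<in> A" unfolding A_def by blast
  qed
  moreover have "z \<in> A"
  proof -
   have "z = poly [:0, 1:] z" "\<forall>i. coeff [:0, 1 :: 'k ratfun alg_closure:] i \<in> M"
    using M0 by (auto simp: coeff_pCons split: nat.splits)
   then show ?thesis unfolding A_def by blast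
  qed
  ultimately show False using M(2)[of A] zM by blast
 qed
 \<comment> \<open>If \<open>1/s\<close> were outside \<open>M\<close>, some polynomial in it would
   equal \<open>1/\<rho>\<close>; multiplying by \<open>s^r\<close> puts \<open>s^r / \<rho>\<close>
   into \<open>M\<close>. As \<open>s^r\<close> is 1 minus a multiple of \<open>\<rho>\<close>, the
   element \<open>1/\<rho>\<close> itself would be in \<open>M\<close>.\<close>
 have unit: "1 - \<rho> * a \<noteq> 0 \<and> inverse (1 - \<rho> * a) \<in> M" if a: "a \<in> M" for a
 proof -
  define s where "s = 1 - \<rho> * a"
  have sM: "s \<in> M" unfolding s_def using a wM' M0 Md Mm by blast
  have s0: "s \<noteq> 0"
  proof
   assume "s = 0"
   then have "\<rho> * a = 1" by (simp add: s_def)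
   then have "inverse \<rho> = a" by (rule inverse_unique)
   then show False using a wM by simp
  qed
  have "inverse s \<in> M"
  proof (rule ccontr)
   assume "inverse s \<notin> M"
   moreover have "inverse s \<in> E" using sM ME E_field(4) by blast
   ultimately obtain P where P: "\<forall>i. coeff P i \<in> M" "poly P (inverse s) = inverse \<rho>"
    using adj by blast
   define r where "r = degree P"
   have "s ^ r * poly P (inverse s) = (\<Sum>i\<le>r. coeff P i * s ^ (r - i))"
    unfolding poly_altdef sum_distrib_left r_def[symmetric]
   proof (rule sum.cong[OF refl])
    fix i assume "i \<in> {..r}"
    then have "s ^ r = s ^ (r - i) * s ^ i" by (simp flip: power_add)
    then show "s ^ r * (coeff P i * inverse s ^ i) = coeff P i * s ^ (r - i)"
     using s0 by (simp add: power_inverse)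
   qed
   also have "\<dots> \<in> M" using P sM by (intro Ms Mm Mp) auto
   finally have c: "s ^ r * inverse \<rho> \<in> M" using P by simp
   have "\<exists>b\<in>M. s ^ i = 1 - \<rho> * b" for i
   proof (induction i)
    case 0
    then show ?case using M0 by (intro bexI[of _ 0]) auto
   next
    case (Suc i)
    then obtain b where b: "b \<in> M" "s ^ i = 1 - \<rho> * b" by blast
    have "s ^ Suc i = 1 - \<rho> * (b + a - \<rho> * a * b)"
     unfolding power_Suc b(2) by (simp add: s_def algebra_simps)
    moreover have "b + a - \<rho> * a * b \<in> M" using a b wM' by (intro Md Ma Mm) auto
    ultimately show ?case by blast
   qed
   then obtain b where b: "b \<in> M" "s ^ r = 1 - \<rho> * b" by blast
   have "inverse \<rho> = s ^ r * inverse \<rho> + b" using w0 by (simp add: b(2) algebra_simps)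
   then show False using Ma[OF c b(1)] wM by simp
  qed
  then show ?thesis using s0 by (simp add: s_def)
 qed
 \<comment> \<open>Descent on the degree. In the relation for \<open>1/z\<close> the constant term
   is moved to the other side, where it leaves the unit \<open>s\<close>; this expresses
   \<open>z^n\<close> through lower powers of \<open>z\<close>, and inserting it into the minimal
   relation for \<open>z\<close> lowers the degree.\<close>
 have core: False
  if z0: "z \<noteq> 0" and P: "\<forall>i. coeff P i \<in> M" "poly P z = inverse \<rho>"
   and min: "\<And>R. \<forall>i. coeff R i \<in> M \<Longrightarrow> poly R z = inverse \<rho> \<Longrightarrow> degree P \<le> degree R"
   and R: "\<forall>i. coeff R i \<in> M" "poly R (inverse z) = inverse \<rho>" "degree R \<le> degree P"
  for z P R
 proof -
  define n m where "n = degree P" and "m = degree R"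
  define s where "s = 1 - \<rho> * coeff R 0"
  define t where "t = inverse s"
  have st: "s \<noteq> 0" "t \<in> M" using unit[of "coeff R 0"] R by (auto simp: s_def t_def)
  have n: "n > 0"
  proof (rule ccontr)
   assume "\<not> n > 0"
   then obtain c where "P = [:c:]" by (auto simp: n_def elim: degree_eq_zeroE)
   then have "inverse \<rho> = coeff P 0" using P(2) by simp
   then show False using P(1) wM by metis
  qed
  have "inverse \<rho> = (\<Sum>j\<le>m. coeff R j * inverse z ^ j)"
   using R(2) by (simp add: poly_altdef m_def)
  also have "\<dots> = coeff R 0 + (\<Sum>j\<in>{1..m}. coeff R j * inverse z ^ j)"
   by (simp add: atMost_atLeast0 sum.atLeast_Suc_atMost)
  finally have "\<rho> * inverse \<rho> = \<rho> * (coeff R 0 + (\<Sum>j\<in>{1..m}. coeff R j * inverse z ^ j))"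
   by simp
  then have s: "s = \<rho> * (\<Sum>j\<in>{1..m}. coeff R j * inverse z ^ j)"
   using w0 by (simp add: s_def algebra_simps)
  have zn: "z ^ n = (\<Sum>j\<in>{1..m}. \<rho> * t * coeff R j * z ^ (n - j))"
  proof -
   have "z ^ n = z ^ n * (t * s)" using st by (simp add: t_def)
   also have "\<dots> = (\<Sum>j\<in>{1..m}. z ^ n * (t * (\<rho> * (coeff R j * inverse z ^ j))))"
    by (subst s) (simp only: sum_distrib_left)
   also have "\<dots> = (\<Sum>j\<in>{1..m}. \<rho> * t * coeff R j * z ^ (n - j))"
   proof (rule sum.cong[OF refl])
    fix j assume "j \<in> {1..m}"
    then have "z ^ n = z ^ (n - j) * z ^ j" using R(3) by (simp add: n_def m_def flip: power_add)
    then show "z ^ n * (t * (\<rho> * (coeff R j * inverse z ^ j))) = \<rho> * t * coeff R j * z ^ (n - j)"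
     using z0 by (simp add: power_inverse)
   qed
   finally show ?thesis .
  qed
  define a where "a = coeff P n"
  define P' where "P' = P - monom a n + (\<Sum>j\<in>{1..m}. monom (a * (\<rho> * t * coeff R j)) (n - j))"
  have cP: "coeff P' i = coeff P i - (if n = i then a else 0)
    + (\<Sum>j\<in>{1..m}. if n - j = i then a * (\<rho> * t * coeff R j) else 0)" for i
   by (simp add: P'_def coeff_sum)
  have "\<forall>i. coeff P' i \<in> M"
   unfolding cP using P R st wM' M0 by (auto intro!: Ma Md Ms Mm simp: a_def)
  moreover have "poly P' z = inverse \<rho>"
  proof -
   have "poly P' z = inverse \<rho> - a * z ^ n + a * (\<Sum>j\<in>{1..m}. \<rho> * t * coeff R j * z ^ (n - j))"
    by (simp add: P'_def poly_sum poly_monom P sum_distrib_left mult.assoc)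
   then show ?thesis unfolding zn[symmetric] by simp
  qed
  moreover have "degree P' < n"
  proof (rule degree_lessI)
   show "P' \<noteq> 0 \<or> n > 0" using n by simp
   show "\<forall>i\<ge>n. coeff P' i = 0"
   proof (intro allI impI)
    fix i assume i: "n \<le> i"
    have "(\<Sum>j\<in>{1..m}. if n - j = i then a * (\<rho> * t * coeff R j) else 0) = 0"
     using i n by (intro sum.neutral) auto
    then show "coeff P' i = 0" unfolding cP using i by (cases "n = i") (auto simp: a_def n_def coeff_eq_0)
   qed
  qed
  ultimately show False using min[of P'] by (simp add: n_def)
 qed
 have val: "z \<in> M \<or> inverse z \<in> M" if zE: "z \<in> E" for z
 proof (rule ccontr)
  assume no: "\<not> ?thesis"
  then have z0: "z \<noteq> 0" using M0 by auto
  have izE: "inverse z \<in> E" using zE by (rule E_field)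
  have mins: "\<exists>P. (\<forall>i. coeff P i \<in> M) \<and> poly P x = inverse \<rho> \<and>
    (\<forall>R. (\<forall>i. coeff R i \<in> M) \<and> poly R x = inverse \<rho> \<longrightarrow> degree P \<le> degree R)"
   if x: "x \<in> E" "x \<notin> M" for x
  proof -
   obtain P0 where "(\<forall>i. coeff P0 i \<in> M) \<and> poly P0 x = inverse \<rho>" using adj[OF x] by blast
   from ex_has_least_nat[of "\<lambda>P. (\<forall>i. coeff P i \<in> M) \<and> poly P x = inverse \<rho>", OF this]
   show ?thesis by blast
  qed
  obtain P where P: "\<forall>i. coeff P i \<in> M" "poly P z = inverse \<rho>"
   "\<And>R. \<forall>i. coeff R i \<in> M \<Longrightarrow> poly R z = inverse \<rho> \<Longrightarrow> degree P \<le> degree R"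
   using mins[OF zE] no by blast
  obtain R where R: "\<forall>i. coeff R i \<in> M" "poly R (inverse z) = inverse \<rho>"
   "\<And>P. \<forall>i. coeff P i \<in> M \<Longrightarrow> poly P (inverse z) = inverse \<rho> \<Longrightarrow> degree R \<le> degree P"
   using mins[OF izE] no by blast
  show False
  proof (cases "degree R \<le> degree P")
   case True
   show False by (rule core[OF z0 P R(1,2) True])
  next
   case False
   then have "degree P \<le> degree R" by simp
   moreover have "poly P (inverse (inverse z)) = inverse \<rho>" using P by simp
   ultimately show False using core[of "inverse z" R P] R P z0 by simp
  qed
 qed
 have vr: "vring E M" by unfold_locales (use ME M0 Md Mm val E_field in auto)
 have "M \<noteq> E" using wM E_field(4)[of \<rho>] by (auto simp: \<rho>_def)
 then have pl: "place M" using vr loc by (simp add: place_def vge_cst)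
 \<comment> \<open>A function in \<open>M\<close> with a pole at \<open>Q\<close> would, multiplied
   by a suitable function regular at \<open>Q\<close>, give \<open>1/\<rho>\<close>.\<close>
 have "em f \<in> M \<longleftrightarrow> vge Q 0 (bc f)" for f
 proof
  assume f: "em f \<in> M"
  show "vge Q 0 (bc f)"
  proof (rule ccontr)
   assume nv: "\<not> vge Q 0 (bc f)"
   then have f0: "f \<noteq> 0" "val Q (bc f) < 0" by (auto simp: vge_def)
   define g where "g = inverse (f * \<pi>)"
   have "vge Q 0 (bc g)" using f0 pi by (simp add: g_def vge_def val_inverse val_mult)
   then have "em f * em g \<in> M" using f loc Mm by blast
   moreover have "em f * em g = inverse \<rho>" using f0 by (simp add: g_def \<rho>_def)
   ultimately show False using wM by simp
  qed
 qed (rule loc)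
 then show ?thesis using pl that[of M] by (simp add: above_def)
qed

end

section \<open>Weak approximation\<close>

abbreviation Mx :: "'l::field set \<Rightarrow> 'l set" where "Mx \<equiv> vring.mx"
abbreviation Unit :: "'l::field set \<Rightarrow> 'l \<Rightarrow> bool" where "Unit \<equiv> vring.unit"

context as_ext
begin

lemma above_vring: "above Q V \<Longrightarrow> vring E V" by (simp add: above_def place_def)

lemma above_iff: "above Q V \<Longrightarrow> em f \<in> V \<longleftrightarrow> vge Q 0 (bc f)" by (simp add: above_def)

lemma above_mx_iff: assumes "above Q V" shows "em f \<in> Mx V \<longleftrightarrow> vge Q 1 (bc f)"
proof -
 interpret vring E V using assms by (rule above_vring)
 show ?thesis using above_iff[OF assms, of f] above_iff[OF assms, of "inverse f"]
  by (auto simp: mx_def vge_def val_inverse)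
qed

text \<open>In an algebraic equation for \<open>z\<close> over k(x) the terms add up to zero, so no
  single one can dominate strictly: two terms agree up to a unit. Their quotient shows that a power
  of \<open>z\<close> is a function from k(x) times a unit, which stands in for a finite
  ramification index.\<close>

lemma power_eq_base:
 assumes V: "above Q V" and z: "z \<in> E" "z \<noteq> 0"
 obtains m f u where "m > 0" "f \<noteq> 0" "Unit V u" "z ^ m = em f * u"
proof -
 interpret vring E V using V by (rule above_vring)
 obtain P :: "'k ratfun poly" where P: "P \<noteq> 0" "poly (map_poly em P) z = 0"
  by (rule alg_closure_algebraic)
 define A where "A = {i. i \<le> degree P \<and> coeff P i \<noteq> 0}"
 define t where "t i = em (coeff P i) * z ^ i" for i
 have "degree P \<in> A" using P(1) by (simp add: A_def)
 then have A: "finite A" "A \<noteq> {}" by (auto simp: A_def)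
 have tA: "t i \<in> E \<and> t i \<noteq> 0" if "i \<in> A" for i using that z by (simp add: t_def A_def)
 have "\<exists>i0\<in>A. \<forall>i\<in>A. t i / t i0 \<in> V" by (rule finite_dominant[OF A]) (rule tA)
 then obtain i0 where i0: "i0 \<in> A" "\<forall>i\<in>A. t i / t i0 \<in> V" by blast
 have sum0: "(\<Sum>i\<in>A. t i) = 0"
 proof -
  have "(\<Sum>i\<in>A. t i) = (\<Sum>i\<le>degree P. t i)"
   by (rule sum.mono_neutral_left) (auto simp: A_def t_def)
  also have "\<dots> = poly (map_poly em P) z" by (simp add: poly_altdef t_def)
  finally show ?thesis using P by simp
 qed
 have "\<exists>i1\<in>A - {i0}. t i1 / t i0 \<notin> mx"
 proof (rule ccontr)
  assume no: "\<not> ?thesis"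
  have "unit (1 + (\<Sum>i\<in>A - {i0}. t i / t i0))" using no by (intro unit_add_mx mx_sum) auto
  moreover have "1 + (\<Sum>i\<in>A - {i0}. t i / t i0) = (\<Sum>i\<in>A. t i) / t i0"
   using A(1) i0(1) tA[OF i0(1)] by (subst sum.remove[of _ i0]) (auto simp: add_divide_distrib sum_divide_distrib)
  ultimately show False using sum0 by (simp add: unit_def)
 qed
 then obtain i1 where i1: "i1 \<in> A" "i1 \<noteq> i0" "t i1 / t i0 \<notin> mx" by blast
 define u where "u = t i1 / t i0"
 have u: "unit u" using i0(2) i1 V_cases by (auto simp: u_def)
 define c0 c1 where "c0 = coeff P i0" and "c1 = coeff P i1"
 have c: "c0 \<noteq> 0" "c1 \<noteq> 0" using i0(1) i1(1) by (auto simp: A_def c0_def c1_def)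
 have eq: "em c1 * z ^ i1 = em c0 * z ^ i0 * u" using tA[OF i0(1)] by (simp add: u_def t_def c0_def c1_def)
 show ?thesis
 proof (cases "i1 > i0")
  case True
  then have "z ^ i1 = z ^ (i1 - i0) * z ^ i0" by (simp flip: power_add)
  then have "z ^ (i1 - i0) = em (c0 / c1) * u" using eq z c by (simp add: field_simps)
  then show ?thesis using that[of "i1 - i0" "c0 / c1" u] True c u by simp
 next
  case False
  then have "z ^ i0 = z ^ (i0 - i1) * z ^ i1" by (simp flip: power_add)
  then have "z ^ (i0 - i1) = em (c1 / c0) * inverse u" using eq z c u by (simp add: field_simps unit_def)
  then show ?thesis using that[of "i0 - i1" "c1 / c0" "inverse u"] False i1(2) c u unit_inverse by simp
 qed
qed

text \<open>One uniformizer of the line at \<open>Q\<close>, used for all places above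
  \<open>Q\<close>.\<close>

definition upi :: "'k alg_closure option \<Rightarrow> 'k ratfun alg_closure" where
 "upi Q = em (SOME \<pi>. \<pi> \<noteq> 0 \<and> val Q (bc \<pi>) = 1)"

lemma upi: obtains \<pi> where "upi Q = em \<pi>" "\<pi> \<noteq> 0" "val Q (bc \<pi>) = 1"
proof -
 have "\<exists>\<pi>. \<pi> \<noteq> 0 \<and> val Q (bc \<pi>) = 1" using uniformizer by metis
 from someI_ex[OF this] show ?thesis using that unfolding upi_def by blast
qed

lemma upi_E [simp]: "upi Q \<in> E" "upi Q \<noteq> 0"
proof -
 obtain \<pi> where pi: "upi Q = em \<pi>" "\<pi> \<noteq> 0" "val Q (bc \<pi>) = 1" by (rule upi)
 show "upi Q \<in> E" "upi Q \<noteq> 0" unfolding pi(1) using pi(2) by simp_all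
qed

lemma upi_cancel: "(x * inverse (upi Q) ^ N) * (upi Q ^ N * z) = x * z"
proof -
 have "inverse (upi Q) ^ N * upi Q ^ N = 1" by (simp flip: power_mult_distrib)
 moreover have "(x * inverse (upi Q) ^ N) * (upi Q ^ N * z) = x * (inverse (upi Q) ^ N * upi Q ^ N) * z"
  by (simp only: mult.assoc)
 ultimately show ?thesis by simp
qed

lemma upi_mx: "above Q V \<Longrightarrow> upi Q \<in> Mx V"
proof -
 assume V: "above Q V"
 obtain \<pi> where pi: "upi Q = em \<pi>" "\<pi> \<noteq> 0" "val Q (bc \<pi>) = 1" by (rule upi)
 then show "upi Q \<in> Mx V" using above_mx_iff[OF V, of \<pi>] by (simp add: vge_def)
qed

lemma bounded_pole:
 assumes V: "above Q V" and z: "z \<in> E"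
 shows "\<exists>N. \<forall>n\<ge>N. upi Q ^ n * z \<in> V"
proof (cases "z = 0")
 case False
 interpret vring E V using V by (rule above_vring)
 obtain m f u where mfu: "m > 0" "f \<noteq> 0" "unit u" "z ^ m = em f * u" using power_eq_base[OF V z False] .
 obtain \<pi> where pi: "upi Q = em \<pi>" "\<pi> \<noteq> 0" "val Q (bc \<pi>) = 1" by (rule upi)
 have "upi Q ^ n * z \<in> V" if n: "n \<ge> nat \<bar>val Q (bc f)\<bar>" for n
 proof (rule V_root[of _ m])
  have "(upi Q ^ n * z) ^ m = em (\<pi> ^ (n * m) * f) * u"
   using mfu pi by (simp add: power_mult_distrib power_mult)
  moreover have "vge Q 0 (bc (\<pi> ^ (n * m) * f))"
  proof -
   have "int n * 1 \<le> int n * int m" using mfu(1) by (intro mult_left_mono) auto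
   then show ?thesis using pi mfu(2) n by (simp add: vge_def val_mult val_power)
  qed
  then have "em (\<pi> ^ (n * m) * f) \<in> V" using above_iff[OF V] by blast
  then have "em (\<pi> ^ (n * m) * f) * u \<in> V" using unit_V[OF mfu(3)] by (rule V_mult)
  ultimately show "(upi Q ^ n * z) ^ m \<in> V" by simp
 qed (use z mfu in auto)
 then show ?thesis by blast
qed (use above_vring[OF V] vring.V_0 in auto)

text \<open>A power of \<open>z\<close> is a unit times a function vanishing at \<open>Q\<close>, so
  high powers of \<open>z\<close> are divisible by any given power of \<open>upi Q\<close>. Together
  with \<open>bounded_pole\<close> this says that the places have rank one.\<close>

lemma bounded_zero:
 assumes V: "above Q V" and z: "z \<in> Mx V"
 shows "\<exists>n0. \<forall>n\<ge>n0. z ^ n * inverse (upi Q) ^ N \<in> V"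
proof (cases "z = 0")
 case True
 interpret vring E V using V by (rule above_vring)
 show ?thesis using True by (intro exI[of _ 1]) (auto simp: power_0_left)
next
 case False
 interpret vring E V using V by (rule above_vring)
 have zE: "z \<in> E" using z mx_V by simp
 obtain m f u where mfu: "m > 0" "f \<noteq> 0" "unit u" "z ^ m = em f * u" using power_eq_base[OF V zE False] .
 obtain \<pi> where pi: "upi Q = em \<pi>" "\<pi> \<noteq> 0" "val Q (bc \<pi>) = 1" by (rule upi)
 have "z ^ m \<in> mx"
 proof -
  have "z * z ^ (m - 1) \<in> mx" using z mx_V by (intro mx_mult) auto
  then show ?thesis using mfu(1) by (simp flip: power_Suc)
 qed
 then have "em f \<in> mx" using mfu unit_mult_mx_iff by simp
 then have "vge Q 1 (bc f)" using above_mx_iff[OF V] by simp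
 then have "vge Q 0 (bc (f * inverse \<pi>))" using mfu(2) pi by (simp add: vge_def val_mult val_inverse)
 then have "em (f * inverse \<pi>) \<in> V" using above_iff[OF V] by blast
 then have "em (f * inverse \<pi>) * u \<in> V" using unit_V[OF mfu(3)] by (rule V_mult)
 then have 1: "z ^ m * inverse (upi Q) \<in> V" using mfu pi by (simp add: mult_ac)
 have "z ^ n * inverse (upi Q) ^ N \<in> V" if n: "n \<ge> m * N" for n
 proof -
  have "(z ^ m * inverse (upi Q)) ^ N * z ^ (n - m * N) \<in> V" using 1 z mx_V by simp
  moreover have "z ^ n = z ^ (m * N) * z ^ (n - m * N)" using n by (simp flip: power_add)
  moreover have "(z ^ m) ^ N = z ^ (m * N)" by (simp add: power_mult)
  ultimately show ?thesis by (simp only: power_mult_distrib mult_ac)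
 qed
 then show ?thesis by blast
qed

text \<open>Each element of \<open>W\<close> has a power that is, up to a unit of \<open>V\<close>,
  a function on the line, and on such functions the two rings agree.\<close>

lemma above_incomparable:
 assumes V: "above Q V" and W: "above Q W" and sub: "V \<subseteq> W" shows "V = W"
proof
 interpret V: vring E V using V by (rule above_vring)
 interpret W: vring E W using W by (rule above_vring)
 show "W \<subseteq> V"
 proof
  fix z assume z: "z \<in> W"
  show "z \<in> V"
  proof (cases "z = 0")
   case False
   have zE: "z \<in> E" using z by simp
   obtain m f u where mfu: "m > 0" "f \<noteq> 0" "Unit V u" "z ^ m = em f * u" using power_eq_base[OF V zE False] .
   have "u \<noteq> 0" "inverse u \<in> W" using mfu(3) sub by (auto simp: V.unit_def)
   then have "z ^ m * inverse u \<in> W" using z by simp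
   then have "em f \<in> W" using mfu(4) \<open>u \<noteq> 0\<close> by (simp add: mult.assoc)
   then have "em f \<in> V" using above_iff[OF V] above_iff[OF W] by simp
   then have "z ^ m \<in> V" using mfu by (simp add: V.unit_def)
   then show ?thesis using V.V_root[OF zE] mfu(1) by blast
  qed simp
 qed
qed (rule sub)

lemma uniform_bound:
 assumes "finite T" "\<And>U. U \<in> T \<Longrightarrow> \<exists>m0. \<forall>m\<ge>m0. R U (m::nat)"
 obtains m0 where "\<And>U m. U \<in> T \<Longrightarrow> m \<ge> m0 \<Longrightarrow> R U m"
proof -
 have "\<exists>m0. \<forall>U\<in>T. \<forall>m\<ge>m0. R U m" using assms
 proof (induction T rule: finite_induct)
  case (insert U T)
  then obtain m0 m1 where "\<forall>U\<in>T. \<forall>m\<ge>m0. R U m" "\<forall>m\<ge>m1. R U m" by (metis insertCI)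
  then show ?case by (intro exI[of _ "max m0 m1"]) auto
 qed simp
 then show ?thesis using that by blast
qed

text \<open>Neither ring contains the other. With \<open>a\<close> in \<open>V\<close> but not in
  \<open>W\<close>, and \<open>b\<close> in \<open>W\<close> but not in \<open>V\<close>, the
  quotient \<open>b / a\<close> has the required property.\<close>

lemma separate_pair:
 assumes V: "above Q V" and W: "above Q W" and ne: "V \<noteq> W"
 obtains z where "z \<in> E" "z \<notin> V" "z \<in> Mx W"
proof -
 interpret V: vring E V using V by (rule above_vring)
 interpret W: vring E W using W by (rule above_vring)
 obtain a where a: "a \<in> V" "a \<notin> W" using above_incomparable[OF V W] ne by blast
 obtain b where b: "b \<in> W" "b \<notin> V" using above_incomparable[OF W V] ne by blast
 have a0: "a \<noteq> 0" using a by auto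
 have "inverse a \<in> Mx W" using a by (intro W.not_V_mx) auto
 then have "inverse a * b \<in> Mx W" using b by (intro W.mx_mult)
 moreover have "inverse a * b \<notin> V"
 proof
  assume "inverse a * b \<in> V"
  then have "a * (inverse a * b) \<in> V" by (rule V.V_mult[OF a(1)])
  then have "b \<in> V" using a0 by (simp flip: mult.assoc)
  then show False using b by simp
 qed
 ultimately show ?thesis using that W.mx_V W.V_E by blast
qed

text \<open>Induction on \<open>T\<close> with two cases for the new place \<open>W\<close>. If
  \<open>w\<close> is integral at \<open>W\<close>, then \<open>z w^m\<close> works for large
  \<open>m\<close>. Otherwise the factor \<open>w^m / (1 + w^m)\<close> is used instead: a unit at
  \<open>V\<close> and \<open>W\<close>, where \<open>w\<close> has poles, and close to zero on
  \<open>T\<close>.\<close>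

lemma separate:
 assumes "finite T" and V: "above Q V" and T: "\<And>W. W \<in> T \<Longrightarrow> above Q W \<and> W \<noteq> V"
 shows "\<exists>w\<in>E. w \<notin> V \<and> (\<forall>W\<in>T. w \<in> Mx W)" using assms(1) T
proof (induction T rule: finite_induct)
 case empty
 interpret vring E V using V by (rule above_vring)
 show ?case using mx_inverse_not_V[OF upi_mx[OF V]] by (intro bexI[of _ "inverse (upi Q)"]) auto
next
 case (insert W T)
 interpret V: vring E V using V by (rule above_vring)
 have aW: "above Q W" "V \<noteq> W" using insert by auto
 interpret W: vring E W using aW(1) by (rule above_vring)
 obtain w where w: "w \<in> E" "w \<notin> V" "\<forall>U\<in>T. w \<in> Mx U" using insert by blast
 obtain z where z: "z \<in> E" "z \<notin> V" "z \<in> Mx W" using separate_pair[OF V aW] .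
 have vr: "vring E U" "above Q U" if "U \<in> T" for U using insert.prems[of U] that above_vring by auto
 have "\<exists>m0. \<forall>m\<ge>m0. z * w ^ m \<in> Mx U" if U: "U \<in> T" for U
 proof -
  interpret U: vring E U using vr U by blast
  obtain N where N: "upi Q ^ N * z \<in> U" using bounded_pole[OF vr(2)[OF U] z(1)] by blast
  obtain n0 where n0: "\<forall>n\<ge>n0. w ^ n * inverse (upi Q) ^ N \<in> U"
   using bounded_zero[OF vr(2)[OF U], of w N] w(3) U by blast
  have "z * w ^ m \<in> Mx U" if m: "m \<ge> Suc n0" for m
  proof -
   have "w * ((w ^ (m - 1) * inverse (upi Q) ^ N) * (upi Q ^ N * z)) \<in> Mx U"
   proof -
    have "w ^ (m - 1) * inverse (upi Q) ^ N \<in> U" using n0 m by auto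
    then have "(w ^ (m - 1) * inverse (upi Q) ^ N) * (upi Q ^ N * z) \<in> U" using N by (rule U.V_mult)
    then show ?thesis using w(3) U by (intro U.mx_mult) blast+
   qed
   moreover have "w * ((w ^ (m - 1) * inverse (upi Q) ^ N) * (upi Q ^ N * z)) = z * (w * w ^ (m - 1))"
    unfolding upi_cancel by (simp only: mult_ac)
   moreover have "w * w ^ (m - 1) = w ^ m" using m by (cases m) auto
   ultimately show ?thesis by (simp only:)
  qed
  then show ?thesis by blast
 qed
 then obtain m0 where m0: "\<And>U m. U \<in> T \<Longrightarrow> m \<ge> m0 \<Longrightarrow> z * w ^ m \<in> Mx U"
  using uniform_bound[OF insert.hyps(1), of "\<lambda>U m. z * w ^ m \<in> Mx U"] by blast
 define m where "m = Suc m0"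
 have w0: "w \<noteq> 0" using w(2) by auto
 have wm: "w ^ m \<notin> V" using V.V_root[OF w(1), of m] w(2) by (auto simp: m_def)
 have unit1: "Unit U (inverse (1 + w ^ m))" if U: "U \<in> T" for U
 proof -
  interpret U: vring E U using vr U by blast
  have "w * w ^ m0 \<in> Mx U" using w(3) U U.mx_V by (intro U.mx_mult) auto
  then have "Unit U (1 + w ^ m)" by (intro U.unit_add_mx) (simp_all add: m_def)
  then show ?thesis by (rule U.unit_inverse)
 qed
 have unit2: "Unit U (w ^ m * inverse (1 + w ^ m))" if U: "vring E U" "w ^ m \<notin> U" for U
 proof -
  interpret U: vring E U by fact
  have "inverse (w ^ m) \<in> Mx U" using w U by (intro U.not_V_mx) auto
  then have "Unit U (1 + inverse (w ^ m))" by (intro U.unit_add_mx) simp_all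
  then have "Unit U (inverse (1 + inverse (w ^ m)))" by (rule U.unit_inverse)
  moreover have "w ^ m * inverse (1 + w ^ m) = inverse (1 + inverse (w ^ m))"
  proof -
   have "1 + inverse (w ^ m) = (1 + w ^ m) * inverse (w ^ m)" using w0 by (simp add: field_simps)
   then show ?thesis using w0 by (simp add: field_simps)
  qed
  ultimately show ?thesis by simp
 qed
 show ?case
 proof (cases "w \<in> W")
  case True
  have "z * w ^ m \<notin> V"
  proof
   assume "z * w ^ m \<in> V"
   moreover have "inverse z \<in> V" using V.not_V_mx[OF z(1,2)] V.mx_V by blast
   ultimately have "inverse z * (z * w ^ m) \<in> V" by simp
   moreover have "z \<noteq> 0" using z(2) by auto
   ultimately have "w ^ m \<in> V" by (simp flip: mult.assoc)
   then show False using wm by simp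
  qed
  moreover have "z * w ^ m \<in> Mx W" using z(3) True by (intro W.mx_mult) auto
  moreover have "z * w ^ m \<in> Mx U" if "U \<in> T" for U by (rule m0[OF that]) (simp add: m_def)
  ultimately show ?thesis using z(1) w(1) by (intro bexI[of _ "z * w ^ m"]) auto
 next
  case False
  define x where "x = w ^ m * inverse (1 + w ^ m)"
  have wmW: "w ^ m \<notin> W" using W.V_root[OF w(1), of m] False by (auto simp: m_def)
  have "z * x \<notin> V" using unit2[OF V.vring_axioms wm] V.unit_mult_V_iff z by (simp add: x_def)
  moreover have "z * x \<in> Mx W"
   using unit2[OF W.vring_axioms wmW] W.unit_mult_mx_iff z by (simp add: x_def)
  moreover have "z * x \<in> Mx U" if U: "U \<in> T" for U
  proof -
   interpret U: vring E U using vr U by blast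
   have "(z * w ^ m) * inverse (1 + w ^ m) \<in> Mx U"
   proof (rule U.mx_mult)
    show "z * w ^ m \<in> Mx U" by (rule m0[OF U]) (simp add: m_def)
    show "inverse (1 + w ^ m) \<in> U" using unit1[OF U] by (rule U.unit_V)
   qed
   then show ?thesis by (simp add: x_def mult.assoc)
  qed
  moreover have "z * x \<in> E" using z(1) w(1) by (simp add: x_def)
  ultimately show ?thesis by blast
 qed
qed

text \<open>With \<open>w\<close> having a pole at \<open>V\<close> and zeros on \<open>T\<close>,
  the fraction \<open>w^n / (1 + w^n)\<close> is close to 1 at \<open>V\<close> and close to 0 on
  \<open>T\<close>, closeness being measured by powers of \<open>upi Q\<close>.\<close>

lemma approx_idempotent:
 assumes "finite T" and V: "above Q V" and T: "\<And>W. W \<in> T \<Longrightarrow> above Q W \<and> W \<noteq> V"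
 shows "\<exists>e\<in>E. (e - 1) * inverse (upi Q) ^ N \<in> V \<and> (\<forall>W\<in>T. e * inverse (upi Q) ^ N \<in> W)"
proof -
 interpret V: vring E V using V by (rule above_vring)
 obtain w where w: "w \<in> E" "w \<notin> V" "\<forall>W\<in>T. w \<in> Mx W" using separate[OF assms] by blast
 define x where "x = inverse w"
 have x: "x \<in> Mx V" "w \<noteq> 0" using V.not_V_mx[OF w(1,2)] w(2) by (auto simp: x_def)
 obtain n1 where n1: "\<forall>n\<ge>n1. x ^ n * inverse (upi Q) ^ N \<in> V" using bounded_zero[OF V x(1)] by blast
 have "\<exists>m0. \<forall>m\<ge>m0. w ^ m * inverse (upi Q) ^ N \<in> U" if "U \<in> T" for U
  using bounded_zero[of Q U w N] T[OF that] w(3) that by blast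
 then obtain n2 where n2: "\<And>U m. U \<in> T \<Longrightarrow> m \<ge> n2 \<Longrightarrow> w ^ m * inverse (upi Q) ^ N \<in> U"
  using uniform_bound[OF assms(1), of "\<lambda>U m. w ^ m * inverse (upi Q) ^ N \<in> U"] by blast
 define n where "n = Suc (max n1 n2)"
 have Vx: "Unit V (1 + x ^ n)"
 proof -
  have "x * x ^ max n1 n2 \<in> Mx V" using x V.mx_V by (intro V.mx_mult) auto
  then show ?thesis by (intro V.unit_add_mx) (simp_all add: n_def)
 qed
 have xn: "x ^ n * w ^ n = 1" using x(2) by (simp add: x_def flip: power_mult_distrib)
 have nz: "1 + w ^ n \<noteq> 0"
 proof
  assume "1 + w ^ n = 0"
  then have "w ^ n = - 1" by (simp add: eq_neg_iff_add_eq_0 add.commute)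
  then have "w ^ n \<in> V" by simp
  then show False using V.V_root[OF w(1), of n] w(2) by (simp add: n_def)
 qed
 define e where "e = w ^ n * inverse (1 + w ^ n)"
 have "(e - 1) * inverse (upi Q) ^ N \<in> V"
 proof -
  have "e - 1 = - inverse (1 + w ^ n)" using nz by (simp add: e_def field_simps)
  also have "inverse (1 + w ^ n) = x ^ n * inverse (1 + x ^ n)"
  proof -
   have "1 + x ^ n = x ^ n * (1 + w ^ n)" using xn by (simp add: distrib_left add.commute)
   moreover have "x ^ n \<noteq> 0" using x(2) by (simp add: x_def)
   ultimately show ?thesis by simp
  qed
  finally have "(e - 1) * inverse (upi Q) ^ N = - (inverse (1 + x ^ n) * (x ^ n * inverse (upi Q) ^ N))" by simp
  moreover have "x ^ n * inverse (upi Q) ^ N \<in> V" using n1 unfolding n_def by (meson le_Suc_eq max.cobounded1 le_SucI)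
  moreover have "inverse (1 + x ^ n) \<in> V" using Vx by (simp add: V.unit_def)
  ultimately show ?thesis using V.V_uminus[OF V.V_mult] by metis
 qed
 moreover have "e * inverse (upi Q) ^ N \<in> W" if W: "W \<in> T" for W
 proof -
  interpret W: vring E W using T[OF W] above_vring by blast
  have "w * w ^ max n1 n2 \<in> Mx W" using w(3) W W.mx_V by (intro W.mx_mult) auto
  then have "Unit W (1 + w ^ n)" by (intro W.unit_add_mx) (simp_all add: n_def)
  then have "inverse (1 + w ^ n) * (w ^ n * inverse (upi Q) ^ N) \<in> W"
  proof (intro W.V_mult[of "inverse (1 + w ^ n)" "w ^ n * inverse (upi Q) ^ N"])
   show "inverse (1 + w ^ n) \<in> W" using \<open>Unit W (1 + w ^ n)\<close> by (simp add: W.unit_def)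
   show "w ^ n * inverse (upi Q) ^ N \<in> W" by (rule n2[OF W]) (simp add: n_def)
  qed
  then show ?thesis by (simp add: e_def mult_ac)
 qed
 moreover have "e \<in> E" using w(1) by (simp add: e_def)
 ultimately show ?thesis by blast
qed

text \<open>Approximate idempotents belonging to distinct places are linearly independent over k(x),
  while \<open>E\<close> is spanned by p powers of \<open>y\<close>.\<close>

lemma finite_above: "finite {V. above Q V}"
proof -
 have bound: "card T \<le> p" if fin: "finite T" and T: "\<And>V. V \<in> T \<Longrightarrow> above Q V" for T
 proof -
  interpret vs: vector_space "\<lambda>c z. em c * z" by unfold_locales (simp_all add: algebra_simps)
  have "\<exists>e\<in>E. (e - 1) * inverse (upi Q) ^ 1 \<in> V \<and> (\<forall>W\<in>T - {V}. e * inverse (upi Q) ^ 1 \<in> W)" if V: "V \<in> T" for V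
   using fin T V by (intro approx_idempotent) auto
  then obtain e where e: "\<And>V. V \<in> T \<Longrightarrow> e V \<in> E" "\<And>V. V \<in> T \<Longrightarrow> (e V - 1) * inverse (upi Q) ^ 1 \<in> V"
   "\<And>V W. V \<in> T \<Longrightarrow> W \<in> T - {V} \<Longrightarrow> e V * inverse (upi Q) ^ 1 \<in> W" by metis
  have mxI: "z \<in> Mx V" if "V \<in> T" "z * inverse (upi Q) ^ 1 \<in> V" for z V
  proof -
   interpret vring E V using T[OF that(1)] above_vring by blast
   have "upi Q * (z * inverse (upi Q) ^ 1) \<in> Mx V" using that by (intro mx_mult upi_mx T)
   then show ?thesis by (simp add: field_simps)
  qed
  have e1: "Unit V (e V)" if V: "V \<in> T" for V
  proof -
   interpret vring E V using T[OF V] above_vring by blast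
   have "unit (1 + (e V - 1))" using mxI[OF V e(2)[OF V]] by (intro unit_add_mx) auto
   then show ?thesis by simp
  qed
  have e0: "e V \<in> Mx W" if "V \<in> T" "W \<in> T" "V \<noteq> W" for V W
   using that by (intro mxI e(3)) auto
  have inj: "inj_on e T"
  proof (rule inj_onI)
   fix V W assume VW: "V \<in> T" "W \<in> T" "e V = e W"
   show "V = W"
   proof (rule ccontr)
    assume "V \<noteq> W"
    then have "e V \<in> Mx W" using e0 VW by blast
    moreover have "vring E W" using T[OF VW(2)] above_vring by blast
    ultimately show False using vring.unit_not_mx[of E W "e W"] e1[OF VW(2)] VW(3) by metis
   qed
  qed
  have "vs.independent (e ` T)"
  proof (rule vs.independent_if_scalars_zero)
   show "finite (e ` T)" using fin by simp
   fix c x assume sum: "(\<Sum>x\<in>e ` T. em (c x) * x) = 0" and x: "x \<in> e ` T"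
   have s: "(\<Sum>V\<in>T. em (c (e V)) * e V) = 0" using sum by (simp add: sum.reindex[OF inj] comp_def)
   show "c x = 0"
   proof (rule ccontr)
    assume cx: "c x \<noteq> 0"
    define A where "A = {V \<in> T. c (e V) \<noteq> 0}"
    have A: "finite A" "A \<noteq> {}" using fin x cx by (auto simp: A_def)
    \<comment> \<open>After division by the coefficient of least valuation at \<open>Q\<close> all
      coefficients are integral. At the corresponding place one term is then a unit and the others
      lie in the maximal ideal, so the sum cannot be zero.\<close>
    define V0 where "V0 = arg_min_on (\<lambda>V. val Q (bc (c (e V)))) A"
    have V0: "V0 \<in> A" "\<And>V. V \<in> A \<Longrightarrow> val Q (bc (c (e V0))) \<le> val Q (bc (c (e V)))"
     unfolding V0_def using arg_min_if_finite(1)[OF A] arg_min_least[OF A] by auto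
    have V0T: "V0 \<in> T" "c (e V0) \<noteq> 0" using V0 by (auto simp: A_def)
    interpret V0: vring E V0 using T[OF V0T(1)] above_vring by blast
    have "(\<Sum>V\<in>T. em (c (e V) / c (e V0)) * e V) = (\<Sum>V\<in>T. em (c (e V)) * e V) / em (c (e V0))"
     by (simp add: sum_divide_distrib)
    then have "(\<Sum>V\<in>T. em (c (e V) / c (e V0)) * e V) = 0" using s by simp
    then have "e V0 + (\<Sum>V\<in>T - {V0}. em (c (e V) / c (e V0)) * e V) = 0"
     using V0T fin by (subst (asm) sum.remove[of _ V0]) auto
    moreover have "(\<Sum>V\<in>T - {V0}. em (c (e V) / c (e V0)) * e V) \<in> Mx V0"
    proof (rule V0.mx_sum)
     fix V assume V: "V \<in> T - {V0}"
     have "vge Q 0 (bc (c (e V) / c (e V0)))"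
      using V0(2)[of V] V V0T by (cases "c (e V) = 0") (auto simp: vge_def val_divide A_def)
     then have "em (c (e V) / c (e V0)) \<in> V0" using above_iff[OF T[OF V0T(1)]] by blast
     then have "e V * em (c (e V) / c (e V0)) \<in> Mx V0" using e0[of V V0] V V0T by (intro V0.mx_mult) auto
     then show "em (c (e V) / c (e V0)) * e V \<in> Mx V0" by (simp only: mult.commute)
    qed
    then have "Unit V0 (e V0 + (\<Sum>V\<in>T - {V0}. em (c (e V) / c (e V0)) * e V))"
     by (rule V0.unit_add_mx[OF e1[OF V0T(1)]])
    ultimately show False by (simp add: V0.unit_def)
   qed
  qed
  moreover have "e ` T \<subseteq> vs.span ((\<lambda>i. y ^ i) ` {..<p})"
  proof
   fix x assume "x \<in> e ` T"
   then have "x \<in> E" using e by auto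
   then obtain a where "x = el a" by (rule E_cases)
   then show "x \<in> vs.span ((\<lambda>i. y ^ i) ` {..<p})"
    unfolding el_def by (auto intro!: vs.span_sum vs.span_scale[OF vs.span_base])
  qed
  ultimately have "card (e ` T) \<le> card ((\<lambda>i. y ^ i) ` {..<p})"
   using vs.independent_span_bound[of "(\<lambda>i. y ^ i) ` {..<p}" "e ` T"] by blast
  also have "\<dots> \<le> p" using card_image_le[of "{..<p}" "\<lambda>i. y ^ i"] by simp
  finally show ?thesis using inj by (simp add: card_image)
 qed
 show ?thesis
 proof (rule ccontr)
  assume "infinite {V. above Q V}"
  then obtain T where "T \<subseteq> {V. above Q V}" "finite T" "card T = Suc p"
   using infinite_arbitrarily_large by blast
  then show False using bound[of T] by auto
 qed
qed

text \<open>\<open>N\<close> is taken so large that \<open>upi Q ^ N * r V\<close> is integral at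
  every place above \<open>Q\<close>. The errors of the approximate idempotents, divisible by
  \<open>upi Q ^ N\<close>, then absorb all poles in the sum of the
  \<open>e V * r V\<close>.\<close>

theorem local_approximation:
 assumes r: "\<And>V. above Q V \<Longrightarrow> r V \<in> E"
 obtains f where "f \<in> E" "\<And>V. above Q V \<Longrightarrow> f - r V \<in> V"
proof -
 define T where "T = {V. above Q V}"
 have T: "finite T" using finite_above by (simp add: T_def)
 have N0: "\<exists>N. \<forall>n\<ge>N. \<forall>U\<in>T. upi Q ^ n * r V \<in> U" if V: "V \<in> T" for V
 proof -
  have "\<exists>N. \<forall>n\<ge>N. upi Q ^ n * r V \<in> U" if "U \<in> T" for U
   using bounded_pole[of Q U "r V"] that r V by (simp add: T_def)
  then obtain m0 where "\<And>U m. U \<in> T \<Longrightarrow> m \<ge> m0 \<Longrightarrow> upi Q ^ m * r V \<in> U"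
   using uniform_bound[OF T, of "\<lambda>U n. upi Q ^ n * r V \<in> U"] by blast
  then show ?thesis by blast
 qed
 obtain N where N: "\<And>V U. V \<in> T \<Longrightarrow> U \<in> T \<Longrightarrow> upi Q ^ N * r V \<in> U"
 proof -
  obtain m0 where "\<And>V m. V \<in> T \<Longrightarrow> m \<ge> m0 \<Longrightarrow> \<forall>U\<in>T. upi Q ^ m * r V \<in> U"
   using uniform_bound[OF T, of "\<lambda>V n. \<forall>U\<in>T. upi Q ^ n * r V \<in> U"] N0 by blast
  then show ?thesis using that[of m0] by blast
 qed
 have "\<exists>e\<in>E. (e - 1) * inverse (upi Q) ^ N \<in> V \<and> (\<forall>W\<in>T - {V}. e * inverse (upi Q) ^ N \<in> W)" if V: "V \<in> T" for V
  using T V by (intro approx_idempotent) (auto simp: T_def)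
 then obtain e where e: "\<And>V. V \<in> T \<Longrightarrow> e V \<in> E" "\<And>V. V \<in> T \<Longrightarrow> (e V - 1) * inverse (upi Q) ^ N \<in> V"
  "\<And>V W. V \<in> T \<Longrightarrow> W \<in> T - {V} \<Longrightarrow> e V * inverse (upi Q) ^ N \<in> W" by metis
 define f where "f = (\<Sum>V\<in>T. e V * r V)"
 show ?thesis
 proof (rule that)
  obtain V0 where V0: "above Q V0" by (rule place_exists)
  interpret V0: vring E V0 using V0 by (rule above_vring)
  show "f \<in> E" unfolding f_def using e r by (intro V0.E_sum V0.E_mult) (auto simp: T_def)
  fix V assume "above Q V"
  then have V: "V \<in> T" "vring E V" using above_vring by (auto simp: T_def)
  interpret vring E V by fact
  have eq: "f - r V = (e V - 1) * r V + (\<Sum>W\<in>T - {V}. e W * r W)"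
   using T V by (simp add: f_def sum.remove[of _ V] algebra_simps)
  have s1: "(e V - 1) * r V \<in> V"
   using V_mult[OF e(2)[OF V(1)] N[OF V(1) V(1)]] by (simp only: upi_cancel)
  have s2: "(\<Sum>W\<in>T - {V}. e W * r W) \<in> V"
  proof (rule V_sum)
   fix W assume "W \<in> T - {V}"
   then have "e W * inverse (upi Q) ^ N \<in> V" "upi Q ^ N * r W \<in> V" using e(3)[of W V] N[of W V] V by auto
   then have "(e W * inverse (upi Q) ^ N) * (upi Q ^ N * r W) \<in> V" by (rule V_mult)
   then show "e W * r W \<in> V" by (simp only: upi_cancel)
  qed
  show "f - r V \<in> V" unfolding eq by (rule V_add[OF s1 s2])
 qed
qed

end

section \<open>Integrality in coordinates\<close>

lemma ceiling_div_le_iff: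
 assumes "p > (0::nat)"
 shows "int ((m + p - 1) div p) \<le> x \<longleftrightarrow> int m \<le> int p * x"
proof (cases "x < 0")
 case True
 then have "int p * x < 0" using assms by (simp add: mult_pos_neg)
 then show ?thesis using True by linarith
next
 case False
 then obtain t where t: "x = int t" by (metis nonneg_int_cases not_less)
 have "(m + p - 1) div p \<le> t \<longleftrightarrow> (m + p - 1) div p < Suc t" by auto
 also have "\<dots> \<longleftrightarrow> m + p - 1 < Suc t * p" using assms by (rule div_less_iff_less_mult)
 also have "\<dots> \<longleftrightarrow> m \<le> p * t" using assms by (auto simp: mult.commute)
 finally show ?thesis unfolding t by (metis of_nat_le_iff of_nat_mult)
qed

context as_ext
begin

definition ram :: "'k alg_closure option \<Rightarrow> nat" where "ram Q = degree (d Q)"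

text \<open>The ceiling of \<open>i * ram Q / p\<close>, which is the multiplicity of the divisor
  D_i at \<open>Q\<close>.\<close>

definition ni :: "nat \<Rightarrow> 'k alg_closure option \<Rightarrow> nat" where "ni i Q = (i * ram Q + p - 1) div p"

lemma ni_unram: "ram Q = 0 \<Longrightarrow> ni i Q = 0" using p_gt_1 by (simp add: ni_def)

lemma pole_order_v: "pole_order Q (bc v) = ram Q"
 unfolding bc_v ram_def by (rule pole_order_pp[OF CR_D(2)[OF d_CR]])

lemma val_v: "ram Q > 0 \<Longrightarrow> v \<noteq> 0 \<and> val Q (bc v) = - int (ram Q)"
 using pole_order_v[of Q] by (auto simp: pole_order_eq split: if_splits)

lemma vge_v: "ram Q = 0 \<Longrightarrow> vge Q 0 (bc v)" using pole_order_v[of Q] pole_order_0_iff by metis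

lemma ram_not_dvd: "ram Q > 0 \<Longrightarrow> \<not> p dvd ram Q"
proof -
 assume "ram Q > 0"
 then have "d Q \<noteq> 0" by (auto simp: ram_def)
 moreover have "d Q \<in> no_p_terms" using CR_D(1)[OF d_CR] by (simp add: reduced_parts_def)
 ultimately show ?thesis using no_p_terms_degree[of "d Q"] by (simp add: ram_def char_k)
qed

text \<open>Here \<open>y\<close> has a pole, so \<open>y^p - y\<close> is \<open>y^p\<close> times
  the unit \<open>1 - y^(1 - p)\<close>. Up to a unit, \<open>y\<close> is thus a p-th root of
  \<open>v\<close>.\<close>

lemma y_power_ramified:
 assumes V: "above Q V" and e: "ram Q > 0"
 obtains u where "Unit V u" "y ^ p = em v * u" "y \<noteq> 0"
proof -
 interpret vring E V using V by (rule above_vring)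
 have nv: "em v \<notin> V" using above_iff[OF V, of v] val_v[OF e] e by (auto simp: vge_def)
 have "em v = y ^ p - y" using y_p by simp
 then have "y \<notin> V" using nv by auto
 then have x: "inverse y \<in> mx" "y \<noteq> 0" by (auto intro: not_V_mx)
 have p2: "p = Suc (p - 1)" "p - 1 = Suc (p - 2)" using p_gt_1 by simp_all
 define s where "s = 1 + - (inverse y * inverse y ^ (p - 2))"
 have s: "unit s" unfolding s_def using x mx_V by (intro unit_add_mx mx_uminus mx_mult) auto
 have "inverse y * inverse y ^ (p - 2) = inverse (y ^ (p - 1))"
  using p2(2) by (metis power_Suc power_inverse)
 moreover have "y ^ p = y * y ^ (p - 1)" using p2(1) by (metis power_Suc)
 ultimately have "y ^ p * s = y ^ p - y" using x(2) by (simp add: s_def algebra_simps)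
 then have "y ^ p = em v * inverse s" using y_p s by (simp add: unit_def field_simps)
 then show ?thesis using that[of "inverse s"] unit_inverse[OF s] x(2) by blast
qed

lemma vge_ni_iff: "a \<noteq> 0 \<Longrightarrow> vge Q (int (ni i Q)) (bc a) \<longleftrightarrow> 0 \<le> int p * val Q (bc a) - int (i * ram Q)"
 unfolding ni_def using ceiling_div_le_iff[of p "i * ram Q" "val Q (bc a)"] p_gt_1 by (simp add: vge_def)

text \<open>The terms \<open>a_i y^i\<close> have pairwise different valuations: multiplied by p
  these are the integers \<open>t i\<close>, which are distinct modulo p because p does not divide
  \<open>ram Q\<close>. So the least one decides. Comparisons are made on p-th powers, which are
  functions on the line up to units.\<close>

lemma el_ramified:
 assumes V: "above Q V" and e: "ram Q > 0"
 shows "el a \<in> V \<longleftrightarrow> (\<forall>i<p. vge Q (int (ni i Q)) (bc (a i)))"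
proof -
 interpret vring E V using V by (rule above_vring)
 obtain u where u: "unit u" "y ^ p = em v * u" "y \<noteq> 0" using y_power_ramified[OF V e] .
 define t where "t i = int p * val Q (bc (a i)) - int (i * ram Q)" for i
 define z where "z i = em (a i) * y ^ i" for i
 define w where "w i = a i ^ p * v ^ i" for i
 define A where "A = {i. i < p \<and> a i \<noteq> 0}"
 have v0: "v \<noteq> 0" using val_v[OF e] by simp
 have zp: "z i ^ p = em (w i) * u ^ i" for i
 proof -
  have "(y ^ i) ^ p = (y ^ p) ^ i" by (simp add: mult.commute flip: power_mult)
  then show ?thesis by (simp add: z_def w_def power_mult_distrib u(2))
 qed
 have vw: "w i \<noteq> 0 \<and> val Q (bc (w i)) = t i" if "i \<in> A" for i
  using that v0 val_v[OF e] by (simp add: w_def A_def t_def val_mult val_power)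
 have z0: "z i \<noteq> 0" if "i \<in> A" for i using that u(3) by (simp add: z_def A_def)
 have zE: "z i \<in> E" for i by (simp add: z_def)
 have rhs: "(\<forall>i<p. vge Q (int (ni i Q)) (bc (a i))) \<longleftrightarrow> (\<forall>i\<in>A. 0 \<le> t i)"
  using vge_ni_iff by (auto simp: A_def t_def vge_def)
 have elA: "el a = (\<Sum>i\<in>A. z i)" unfolding el_def z_def A_def by (rule sum.mono_neutral_right) auto
 show ?thesis
 proof (cases "A = {}")
  case True
  then show ?thesis unfolding rhs elA by simp
 next
  case False
  have fin: "finite A" by (simp add: A_def)
  define i0 where "i0 = arg_min_on t A"
  have i0: "i0 \<in> A" "\<And>i. i \<in> A \<Longrightarrow> t i0 \<le> t i"
   unfolding i0_def using arg_min_if_finite(1)[OF fin False] arg_min_least[OF fin False] by auto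
  have tne: "t i0 < t i" if i: "i \<in> A" "i \<noteq> i0" for i
  proof (rule ccontr)
   assume "\<not> t i0 < t i"
   then have "t i = t i0" using i0(2)[OF i(1)] by simp
   then have "int p * (val Q (bc (a i)) - val Q (bc (a i0))) = (int i - int i0) * int (ram Q)"
    by (simp add: t_def algebra_simps)
   then have "int p dvd (int i - int i0) * int (ram Q)" by (metis dvd_triv_left)
   moreover have "\<not> int p dvd int (ram Q)" using ram_not_dvd[OF e] by (simp add: int_dvd_int_iff)
   ultimately have "int p dvd int i - int i0"
    using prime_p by (metis prime_dvd_mult_iff prime_nat_int_transfer)
   moreover have "\<bar>int i - int i0\<bar> < int p" using i i0(1) by (auto simp: A_def)
   ultimately have "int i - int i0 = 0" using zdvd_not_zless by (metis abs_of_nonneg abs_ge_zero dvd_abs_iff zero_less_abs_iff)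
   then show False using i by simp
  qed
  have "z i / z i0 \<in> mx" if i: "i \<in> A - {i0}" for i
  proof (rule mx_root[of _ p])
   have A': "i \<in> A" "i \<noteq> i0" using i by auto
   have "vge Q 1 (bc (w i / w i0))" using vw[OF A'(1)] vw[OF i0(1)] tne[OF A'] by (simp add: vge_def val_divide)
   then have "em (w i / w i0) \<in> mx" using above_mx_iff[OF V] by blast
   then have "em (w i / w i0) * (u ^ i * inverse (u ^ i0)) \<in> mx"
    using u(1) unit_mult unit_power unit_inverse unit_mult_mx_iff by blast
   moreover have "(z i / z i0) ^ p = em (w i / w i0) * (u ^ i * inverse (u ^ i0))"
    unfolding power_divide zp em.h_divide by (simp only: divide_inverse inverse_mult_distrib mult_ac)
   ultimately show "(z i / z i0) ^ p \<in> mx" by simp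
  qed (use zE prime_gt_0_nat[OF prime_p] in auto)
  then have un: "unit (1 + (\<Sum>i\<in>A - {i0}. z i / z i0))" by (intro unit_add_mx mx_sum) auto
  have "el a = z i0 * (1 + (\<Sum>i\<in>A - {i0}. z i / z i0))"
   unfolding elA using fin i0(1) z0[OF i0(1)] by (simp add: sum.remove[of A i0] distrib_left sum_distrib_left)
  then have "el a \<in> V \<longleftrightarrow> z i0 \<in> V" using unit_mult_V_iff[OF un zE] by simp
  also have "\<dots> \<longleftrightarrow> z i0 ^ p \<in> V" using V_root[OF zE, of i0 p] prime_gt_0_nat[OF prime_p] by auto
  also have "\<dots> \<longleftrightarrow> em (w i0) \<in> V" unfolding zp using u(1) by (intro unit_mult_V_iff unit_power) auto
  also have "\<dots> \<longleftrightarrow> 0 \<le> t i0" using above_iff[OF V] vw[OF i0(1)] by (simp add: vge_def)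
  also have "\<dots> \<longleftrightarrow> (\<forall>i\<in>A. 0 \<le> t i)" using i0 by force
  finally show ?thesis unfolding rhs .
 qed
qed

text \<open>The difference operator lowers the degree, and on the top coefficient it acts like
  differentiation.\<close>

lemma shift_diff_degree:
 assumes "degree (f :: 'k ratfun poly) \<le> Suc m"
 shows "degree (shift f - f) \<le> m"
  "coeff (shift f - f) m = of_nat (Suc m) * coeff f (Suc m)"
proof -
 have "degree (shift f - f) \<le> m \<and> coeff (shift f - f) m = of_nat (Suc m) * coeff f (Suc m)"
  using assms
 proof (induction m arbitrary: f)
  case 0
  obtain a g where f: "f = pCons a g" by (cases f)
  then have "degree g = 0" using 0 by (auto split: if_splits)
  then obtain b where "g = [:b:]" by (rule degree_eq_zeroE)
  then have "f = [:a, b:]" using f by simp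
  then show ?case by (simp add: shift_def pcompose_pCons)
 next
  case (Suc m)
  obtain a g where f: "f = pCons a g" by (cases f)
  have dg: "degree g \<le> Suc m" using Suc.prems f by (auto split: if_splits)
  have e: "shift f - f = pCons 0 (shift g - g) + shift g"
   unfolding f shift_def by (simp add: pcompose_pCons algebra_simps)
  have IH: "degree (shift g - g) \<le> m" "coeff (shift g - g) m = of_nat (Suc m) * coeff g (Suc m)"
   using Suc.IH[OF dg] by auto
  have c: "coeff (shift g) (Suc m) = coeff g (Suc m)"
   using IH(1) coeff_eq_0[of "shift g - g" "Suc m"] by simp
  have "degree (pCons 0 (shift g - g)) \<le> Suc m" using IH(1) degree_pCons_le[of 0 "shift g - g"] by linarith
  then have "degree (shift f - f) \<le> Suc m" unfolding e using dg by (intro degree_add_le) auto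
  moreover have "coeff (shift f - f) (Suc m) = of_nat (Suc (Suc m)) * coeff f (Suc (Suc m))"
   unfolding e using IH(2) c by (simp add: f algebra_simps)
  ultimately show ?case by blast
 qed
 then show "degree (shift f - f) \<le> m"
  "coeff (shift f - f) m = of_nat (Suc m) * coeff f (Suc m)" by auto
qed

text \<open>Conjugation by \<open>y \<mapsto> y + 1\<close> does not change the trace on k(x), so
  the automorphism permutes the places above \<open>Q\<close>. Elements are described by polynomials
  \<open>F\<close>, hence the check that the shift respects equality under
  \<open>ev\<close>.\<close>

lemma shift_place:
 assumes V: "above Q V"
 shows "above Q {ev F | F. ev (shift F) \<in> V}" (is "above Q ?W")
  and "ev F \<in> {ev F | F. ev (shift F) \<in> V} \<longleftrightarrow> ev (shift F) \<in> V"
proof -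
 interpret vring E V using V by (rule above_vring)
 have wd: "ev (shift F) = ev (shift G)" if "ev F = ev G" for F G
 proof -
  have "ev (F - G) = 0" using that by simp
  then have "AS_poly v dvd F - G" using ev_eq_0_iff by blast
  then obtain H where "F - G = AS_poly v * H" by (elim dvdE)
  then have "shift F - shift G = AS_poly v * shift H" by (metis shift_AS_poly shift_simps(2,3))
  then have "ev (shift F - shift G) = 0" by simp
  then show ?thesis by simp
 qed
 have mem: "ev F \<in> ?W \<longleftrightarrow> ev (shift F) \<in> V" for F
 proof
  assume "ev F \<in> ?W"
  then obtain G where "ev F = ev G" "ev (shift G) \<in> V" by blast
  then show "ev (shift F) \<in> V" using wd[of F G] by simp
 qed blast
 then show "ev F \<in> {ev F | F. ev (shift F) \<in> V} \<longleftrightarrow> ev (shift F) \<in> V" .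
 have em_mem: "em f \<in> ?W \<longleftrightarrow> em f \<in> V" for f using mem[of "[:f:]"] by simp
 have "vring E ?W"
 proof unfold_locales
  show "?W \<subseteq> E" by (auto simp: E_def)
  show "1 \<in> ?W" using mem[of 1] by simp
  show "x - w \<in> ?W" "x * w \<in> ?W" if xw: "x \<in> ?W" "w \<in> ?W" for x w
  proof -
   obtain F where F: "x = ev F" "ev (shift F) \<in> V" using xw(1) by blast
   obtain G where G: "w = ev G" "ev (shift G) \<in> V" using xw(2) by blast
   have "ev (shift (F - G)) \<in> V" using V_diff[OF F(2) G(2)] by (simp only: shift_simps ev_simps)
   then have "ev (F - G) \<in> ?W" by (subst mem)
   then show "x - w \<in> ?W" using F G by (simp only: ev_simps)
   have "ev (shift (F * G)) \<in> V" using V_mult[OF F(2) G(2)] by (simp only: shift_simps ev_simps)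
   then have "ev (F * G) \<in> ?W" by (subst mem)
   then show "x * w \<in> ?W" using F G by (simp only: ev_simps)
  qed
  fix x assume "x \<in> E"
  then obtain F where F: "x = ev F" by (auto simp: E_def)
  show "x \<in> ?W \<or> inverse x \<in> ?W"
  proof (cases "x = 0")
   case True
   then show ?thesis using mem[of 0] by simp
  next
   case False
   then obtain A where A: "ev A * ev F = 1" using ev_bezout[of F] ev_eq_0_iff F by metis
   have "ev (A * F) = ev 1" using A by simp
   then have "ev (shift A) * ev (shift F) = 1" using wd[of "A * F" 1] by simp
   then have "inverse (ev (shift F)) = ev (shift A)" by (metis inverse_unique mult.commute)
   moreover have "inverse x = ev A" using A F by (metis inverse_unique mult.commute)
   moreover have "ev (shift F) \<in> V \<or> inverse (ev (shift F)) \<in> V" by (rule V_val) (simp add: E_def)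
   ultimately show ?thesis using mem[of F] mem[of A] F by simp
  qed
 qed simp_all
 moreover have "?W \<noteq> E"
 proof -
  have "place V" using V by (simp add: above_def)
  then obtain f where "em f \<notin> V" by (rule place_not_all)
  then show ?thesis using em_mem[of f] em_E[of f] by blast
 qed
 moreover have "\<forall>c. em (cst c) \<in> ?W" "\<forall>f. em f \<in> ?W \<longleftrightarrow> vge Q 0 (bc f)"
  using V unfolding em_mem above_def place_def by blast+
 ultimately show "above Q ?W" unfolding above_def place_def by (intro conjI)
qed

text \<open>Integrality at all places above \<open>Q\<close> is preserved by the automorphism and
  hence by the difference operator. The latter lowers the degree while multiplying the top
  coefficient by an integer prime to p, so induction reaches a constant.\<close>

lemma unramified_coeff_top:
 assumes e: "ram Q = 0" and "\<And>V. above Q V \<Longrightarrow> ev F \<in> V" "degree F \<le> m" "m < p"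
 shows "vge Q 0 (bc (coeff F m))" using assms(2-4)
proof (induction m arbitrary: F)
 case 0
 then obtain c where c: "F = [:c:]" by (auto elim: degree_eq_zeroE)
 obtain V where V: "above Q V" by (rule place_exists)
 then show ?case using 0(1)[OF V] above_iff[OF V] c by simp
next
 case (Suc m)
 define G where "G = shift F - F"
 have "ev G \<in> V" if V: "above Q V" for V
 proof -
  interpret vring E V using V by (rule above_vring)
  have "ev (shift F) \<in> V" using Suc.prems(1)[OF shift_place(1)[OF V]] shift_place(2)[OF V] by blast
  then show ?thesis using Suc.prems(1)[OF V] by (simp add: G_def)
 qed
 then have g: "vge Q 0 (bc (coeff G m))"
  using Suc.prems(3) shift_diff_degree(1)[OF Suc.prems(2)] by (intro Suc.IH) (auto simp: G_def)
 have cG: "coeff G m = of_nat (Suc m) * coeff F (Suc m)"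
  unfolding G_def by (rule shift_diff_degree(2)[OF Suc.prems(2)])
 define c where "c = (of_nat (Suc m) :: 'k)"
 have c: "c \<noteq> 0" unfolding c_def of_nat_eq_0_iff_char_dvd char_k using Suc.prems(3) by (auto dest: dvd_imp_le)
 have "(of_nat (Suc m) :: 'k ratfun) = cst c" unfolding c_def by (simp only: cst.h_of_nat)
 then have "coeff F (Suc m) = cst (inverse c) * coeff G m" using cG c by simp
 then show ?case using vge_mult[of Q 0 "bc (cst (inverse c))" 0 "bc (coeff G m)"] g vge_cst[of 0 Q "to_ac (inverse c)"]
  by (simp del: to_ac_inverse)
qed

text \<open>Since \<open>y\<close> is integral above an unramified point, the top term can be
  subtracted and the argument repeated.\<close>

lemma el_unramified:
 assumes e: "ram Q = 0" and el: "\<And>V. above Q V \<Longrightarrow> ev F \<in> V" "degree F \<le> m" "m < p"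
 shows "vge Q 0 (bc (coeff F i))" using el
proof (induction m arbitrary: F)
 case 0
 then have "vge Q 0 (bc (coeff F 0))" by (intro unramified_coeff_top[OF e]) auto
 then show ?case using 0(2) by (cases i) (auto simp: coeff_eq_0)
next
 case (Suc m)
 define c where "c = coeff F (Suc m)"
 have c: "vge Q 0 (bc c)" unfolding c_def by (rule unramified_coeff_top[OF e Suc.prems])
 define F' where "F' = F - monom c (Suc m)"
 have "ev F' \<in> V" if V: "above Q V" for V
 proof -
  interpret vring E V using V by (rule above_vring)
  have "em v \<in> V" "em c \<in> V" using above_iff[OF V] vge_v[OF e] c by auto
  then have "em c * y ^ Suc m \<in> V" using y_in_place[OF vring_axioms] by (intro V_mult V_power)
  then have "ev F - em c * y ^ Suc m \<in> V" using Suc.prems(1)[OF V] by (rule V_diff[rotated])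
  then show ?thesis unfolding F'_def by (simp only: ev_simps)
 qed
 moreover have "degree F' \<le> m"
 proof (rule degree_le, intro allI impI)
  fix j assume "m < j"
  then show "coeff F' j = 0" using Suc.prems(2) by (cases "j = Suc m") (auto simp: F'_def c_def coeff_eq_0)
 qed
 ultimately have "vge Q 0 (bc (coeff F' i))" using Suc.prems(3) by (intro Suc.IH) auto
 then show ?case using c by (cases "i = Suc m") (auto simp: F'_def c_def)
qed

text \<open>At a ramified point a single place decides. At an unramified one the argument applies
  the automorphism, which may move the place, and this is why all places above \<open>Q\<close> are
  quantified over.\<close>

theorem integral_iff:
 "(\<forall>V. above Q V \<longrightarrow> el a \<in> V) \<longleftrightarrow> (\<forall>i<p. vge Q (int (ni i Q)) (bc (a i)))"
proof (cases "ram Q > 0")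
 case True
 obtain V where "above Q V" by (rule place_exists)
 then show ?thesis using el_ramified[OF _ True] by blast
next
 case False
 then have e: "ram Q = 0" by simp
 define F where "F = (\<Sum>i<p. monom (a i) i)"
 have cF: "coeff F i = (if i < p then a i else 0)" for i
  by (simp add: F_def coeff_sum if_distrib cong: if_cong)
 have dF: "degree F \<le> p - 1" by (rule degree_le) (auto simp: cF)
 have elF: "el a = ev F" by (simp add: el_eq_ev F_def)
 show ?thesis
 proof
  assume *: "\<forall>V. above Q V \<longrightarrow> el a \<in> V"
  show "\<forall>i<p. vge Q (int (ni i Q)) (bc (a i))"
  proof (intro allI impI)
   fix i assume "i < p"
   have "vge Q 0 (bc (coeff F i))" by (rule el_unramified[OF e _ dF]) (use * elF p_gt_1 in auto)
   then show "vge Q (int (ni i Q)) (bc (a i))" using cF[of i] \<open>i < p\<close> ni_unram[OF e] by simp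
  qed
 next
  assume *: "\<forall>i<p. vge Q (int (ni i Q)) (bc (a i))"
  show "\<forall>V. above Q V \<longrightarrow> el a \<in> V"
  proof (intro allI impI)
   fix V assume V: "above Q V"
   interpret vring E V using V by (rule above_vring)
   have "y \<in> V" using y_in_place[OF vring_axioms] above_iff[OF V] vge_v[OF e] by blast
   moreover have "em (a i) \<in> V" if "i < p" for i using * that ni_unram[OF e] above_iff[OF V] by simp
   ultimately show "el a \<in> V" unfolding el_def by (intro V_sum V_mult V_power) auto
  qed
 qed
qed

end

section \<open>The adelic quotient of the function field\<close>

lemma to_fract_monom: "to_fract (monom a n) = cst a * ratX ^ n" using local_term_None[of "monom a n"] by simp

lemma to_fract_low: "to_fract (\<Sum>j<m. monom (c j) j) = (\<Sum>j<m. cst (c j) * ratX ^ j)"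
 by (induction m) (simp_all add: to_fract_monom)

lemma coeff_low: "coeff (\<Sum>j<m. monom (c j) j) i = (if i < m then c i else 0)"
 by (simp add: coeff_sum if_distrib cong: if_cong)

lemma scale_split:
 assumes "t = Y * s + S" "Y * Z = (1 :: 'a::field)"
 shows "(b * Y - t) * Z = b - (s + S * Z)"
proof -
 have "(b * Y - t) * Z = (Y * Z) * b - (Y * Z) * s - S * Z" unfolding assms(1) by (simp add: algebra_simps)
 then show ?thesis unfolding assms(2) by simp
qed

context finite_base
begin

lemma poly_of_regular:
 assumes "\<And>z. vge (Some z) 0 (base_change (f :: 'k ratfun))"
 obtains P where "f = to_fract P"
proof -
 obtain P where P: "base_change f = to_fract P" using const_if_no_poles[of "base_change f"] assms by blast
 have "to_fract (map_poly frob P) = to_fract P" using frobX_base_change[of f] unfolding P by (simp only: frobX_to_fract)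
 then have "map_poly frob P = P" by simp
 then obtain P' where "P = map_poly to_ac P'" by (rule descend_poly)
 then have "base_change f = base_change (to_fract P')" using P by simp
 then have "f = to_fract P'" by (simp only: bc.h_eq_iff)
 then show ?thesis by (rule that)
qed

text \<open>The prescribed principal parts at finite points are collected into one family with
  nothing at infinity. It is equivariant because the prescription is invariant, so its sum is a
  function over k.\<close>

lemma strong_approximation:
 fixes a :: "'k alg_closure \<Rightarrow> 'k ratfun"
 assumes inv: "\<And>z. a (frob z) = a z" and fin: "finite {z. \<not> vge (Some z) 0 (base_change (a z))}"
 shows "\<exists>h. \<forall>z. vge (Some z) 0 (base_change (h - a z))"
proof -
 have "\<exists>c e. c \<in> principal_parts \<and> equivariant c \<and> base_change u = cst (to_ac e) + pp_sum c" for u :: "'k ratfun"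
  using pp_of_ratfun[of u] by metis
 then obtain C e where C: "\<And>u. C u \<in> principal_parts" "\<And>u. equivariant (C u)"
  "\<And>u :: 'k ratfun. base_change u = cst (to_ac (e u)) + pp_sum (C u)" by metis
 define c where "c Q = (case Q of None \<Rightarrow> 0 | Some z \<Rightarrow> C (a z) (Some z))" for Q
 have c: "c \<in> principal_parts"
 proof -
  have "{Q. c Q \<noteq> 0} \<subseteq> Some ` {z. \<not> vge (Some z) 0 (base_change (a z))}"
  proof
   fix Q assume "Q \<in> {Q. c Q \<noteq> 0}"
   then obtain z where z: "Q = Some z" "C (a z) (Some z) \<noteq> 0" by (auto simp: c_def split: option.splits)
   then have "pole_order (Some z) (base_change (a z)) > 0"
    using pole_order_pp[OF C(1)[of "a z"]] C(3)[of "a z"] degree_pos_pp[OF C(1)] by metis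
   then show "Q \<in> Some ` {z. \<not> vge (Some z) 0 (base_change (a z))}"
    using z(1) pole_order_0_iff by (metis (mono_tags) imageI mem_Collect_eq less_numeral_extra(3))
  qed
  then have "finite {Q. c Q \<noteq> 0}" using fin finite_surj by blast
  moreover have "coeff (c Q) 0 = 0" for Q using C(1) by (cases Q) (auto simp: c_def principal_parts_def)
  ultimately show ?thesis by (simp add: principal_parts_def)
 qed
 have eq: "equivariant c" unfolding equivariant_def
 proof
  fix Q show "c (frobQ Q) = map_poly frob (c Q)"
  proof (cases Q)
   case (Some z)
   have "C (a z) (frobQ (Some z)) = map_poly frob (C (a z) (Some z))"
    using C(2)[of "a z"] unfolding equivariant_def by blast
   then show ?thesis using Some by (simp add: c_def inv)
  qed (simp add: c_def)
 qed
 have "vge (Some z) 0 (base_change (rep c - a z))" for z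
 proof -
  have "base_change (rep c - a z) = cst (- to_ac (e (a z))) + pp_sum (\<lambda>Q. c Q - C (a z) Q)"
   using base_change_rep[OF c eq] C(3)[of "a z"] pp_sum_combine(4)[OF c C(1)] by simp
  then have "pole_order (Some z) (base_change (rep c - a z)) = degree (c (Some z) - C (a z) (Some z))"
   using pole_order_pp[OF pp_sum_combine(3)[OF c C(1)]] by metis
  then have "pole_order (Some z) (base_change (rep c - a z)) = 0" by (simp add: c_def)
  then show ?thesis using pole_order_0_iff by blast
 qed
 then show ?thesis by blast
qed

text \<open>The computation of \<open>H^1\<close> of the line for the sheaf of functions vanishing
  to order \<open>m + 1\<close> at infinity: a function is a polynomial, plus a combination of
  \<open>x^(-1), ..., x^(-m)\<close>, plus a remainder vanishing to order \<open>m + 1\<close>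
  there. The middle part accounts for dimension \<open>m\<close>.\<close>

lemma infinity_split:
 "\<exists>s c. vge None (int m + 1) (base_change (b - (to_fract s + (\<Sum>j<m. cst (c j :: 'k) * ratX ^ j) * inverse ratX ^ m)))"
proof -
 obtain A D where AD: "D \<noteq> 0" "b * ratX ^ m = to_fract A / to_fract D" by (rule ratfun_cases)
 define t where "t = A div D"
 \<comment> \<open>Division by \<open>x^m\<close>: the quotient becomes the polynomial
   \<open>s\<close>, the remainder gives the negative powers.\<close>
 have t: "t = monom 1 m * poly_shift m t + (\<Sum>j<m. monom (coeff t j) j)"
  by (rule poly_eqI) (auto simp: coeff_low coeff_monom_mult coeff_poly_shift)
 have X: "ratX ^ m \<noteq> (0 :: 'k ratfun)" by (simp add: val_linear)
 define w where "w = b * ratX ^ m - to_fract t"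
 have "A = t * D + A mod D" by (simp add: t_def)
 then have "to_fract A = to_fract t * to_fract D + to_fract (A mod D)" by (metis to_fract_add to_fract_mult)
 then have w: "w = to_fract (A mod D) / to_fract D" using AD by (simp add: w_def field_simps)
 have "vge None 1 (base_change w)"
 proof (cases "A mod D = 0")
  case False
  then have "degree (A mod D) < degree D" using AD(1) degree_mod_less' by blast
  then show ?thesis unfolding w using False AD(1) by (simp add: vge_def val_frac)
 qed (simp add: w)
 moreover have "vge None (int m) (inverse ratX ^ m :: 'k alg_closure ratfun)"
  by (simp add: vge_def val_power val_inverse val_linear)
 ultimately have 1: "vge None (int m + 1) (inverse ratX ^ m * base_change w)" by (intro vge_mult)
 have 2: "w * inverse ratX ^ m = b - (to_fract (poly_shift m t) + (\<Sum>j<m. cst (coeff t j) * ratX ^ j) * inverse ratX ^ m)"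
 proof -
  have "to_fract t = ratX ^ m * to_fract (poly_shift m t) + (\<Sum>j<m. cst (coeff t j) * ratX ^ j)"
   by (subst t) (simp add: to_fract_monom to_fract_low)
  moreover have "ratX ^ m * inverse ratX ^ m = (1 :: 'k ratfun)" using X by (simp add: power_inverse)
  ultimately show ?thesis unfolding w_def by (intro scale_split)
 qed
 have "base_change (w * inverse ratX ^ m) = inverse ratX ^ m * base_change w" by (simp add: mult.commute)
 then have "vge None (int m + 1) (base_change (w * inverse ratX ^ m))" using 1 by (simp only:)
 then show ?thesis unfolding 2 by (intro exI)
qed

text \<open>Multiplied by \<open>x^m\<close> the function becomes a polynomial that vanishes at
  infinity, hence zero; its coefficients below \<open>m\<close> are the \<open>c j\<close>.\<close>

lemma infinity_unique:
 assumes "vge None (int m + 1) (base_change (to_fract s + (\<Sum>j<m. cst (c j :: 'k) * ratX ^ j) * inverse ratX ^ m))" "j < m"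
 shows "c j = 0"
proof -
 define t where "t = monom 1 m * s + (\<Sum>j<m. monom (c j) j)"
 have X: "ratX ^ m \<noteq> (0 :: 'k ratfun)" by (simp add: val_linear)
 have "vge None (- int m) (ratX ^ m :: 'k alg_closure ratfun)" by (simp add: vge_def val_power val_linear)
 then have "vge None (int m + 1 + - int m)
  (base_change (to_fract s + (\<Sum>j<m. cst (c j) * ratX ^ j) * inverse ratX ^ m) * ratX ^ m)"
  by (rule vge_mult[OF assms(1)])
 moreover have "(to_fract s + (\<Sum>j<m. cst (c j) * ratX ^ j) * inverse ratX ^ m) * ratX ^ m = to_fract t"
 proof -
  have X1: "inverse ratX ^ m * ratX ^ m = (1 :: 'k ratfun)" using X by (simp add: power_inverse)
  have "to_fract t = ratX ^ m * to_fract s + (\<Sum>j<m. cst (c j) * ratX ^ j)"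
   unfolding t_def by (simp add: to_fract_monom to_fract_low)
  then show ?thesis by (simp only: distrib_right mult.assoc X1 mult_1_right mult.commute[of "to_fract s"])
 qed
 then have "base_change ((to_fract s + (\<Sum>j<m. cst (c j) * ratX ^ j) * inverse ratX ^ m) * ratX ^ m) = base_change (to_fract t)"
  by (simp only:)
 then have "base_change (to_fract s + (\<Sum>j<m. cst (c j) * ratX ^ j) * inverse ratX ^ m) * ratX ^ m = to_fract (map_poly to_ac t)"
  unfolding bc.h_mult[of "_ + _"] bc.h_power base_change_X base_change_to_fract .
 ultimately have v: "vge None (int m + 1 + - int m) (to_fract (map_poly to_ac t))" by (simp only:)
 have "t = 0"
 proof (rule ccontr)
  assume "t \<noteq> 0"
  then have "val None (to_fract (map_poly to_ac t)) = - int (degree t)" using val_to_fract(2)[of "map_poly to_ac t"] by simp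
  then show False using v \<open>t \<noteq> 0\<close> by (simp add: vge_def)
 qed
 then have "coeff t j = 0" by simp
 then show ?thesis using assms(2) by (simp add: t_def coeff_low coeff_monom_mult)
qed

end

section \<open>Twisting each coordinate: the adelic quotient as a sum over the line\<close>

context as_ext
begin

lemma above_frobQ: "above (frobQ Q) V \<longleftrightarrow> above Q V"
proof -
 have "vge (frobQ Q) 0 (bc f) \<longleftrightarrow> vge Q 0 (bc f)" for f
  by (cases "f = 0") (simp_all add: vge_def val_base_change_frob)
 then show ?thesis by (simp add: above_def)
qed

text \<open>The polynomial over k that cuts out the orbit of one such point lies in the maximal
  ideal of \<open>V\<close>, so it vanishes at every other such point: they form part of a single
  Frobenius orbit.\<close>

lemma finite_below: "finite {z. above (Some z) V}"
proof (cases "\<exists>w. above (Some w) V")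
 case True
 then obtain w where w: "above (Some w) V" by blast
 obtain P :: "'k poly" where P: "P \<noteq> 0" "\<forall>z. order z (map_poly to_ac P) = (if z \<in> orbit w then 1 else 0)"
  by (rule uniformizer_exists)
 have v: "vge (Some z) 1 (bc (to_fract P)) \<longleftrightarrow> z \<in> orbit w" for z
  using P by (simp add: vge_def val_to_fract)
 have "{z. above (Some z) V} \<subseteq> orbit w"
 proof
  fix z assume "z \<in> {z. above (Some z) V}"
  then have "em (to_fract P) \<in> Mx V \<longleftrightarrow> z \<in> orbit w" using above_mx_iff v by blast
  moreover have "em (to_fract P) \<in> Mx V \<longleftrightarrow> w \<in> orbit w" using above_mx_iff[OF w] v by blast
  ultimately show "z \<in> orbit w" using orbit_self by blast
 qed
 then show ?thesis using finite_orbit finite_subset by blast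
qed simp

lemma finite_ram: "finite {Q. ram Q \<noteq> 0}"
proof (rule finite_subset)
 show "{Q. ram Q \<noteq> 0} \<subseteq> {Q. d Q \<noteq> 0}" by (auto simp: ram_def)
 show "finite {Q. d Q \<noteq> 0}" using CR_D(2)[OF d_CR] by (simp add: principal_parts_def)
qed

text \<open>The degree of the divisor D_i, summed over geometric points.\<close>

definition M :: "nat \<Rightarrow> nat" where "M i = (\<Sum>Q | ram Q \<noteq> 0. ni i Q)"

text \<open>An equation over k for the part of D_i in the affine line. Dividing a coordinate by it
  moves the whole divisor to infinity.\<close>

definition Hp :: "nat \<Rightarrow> 'k poly" where
 "Hp i = (SOME H. H \<noteq> 0 \<and> (\<forall>z. order z (map_poly to_ac H) = ni i (Some z)) \<and>
   degree H = (\<Sum>z | ni i (Some z) \<noteq> 0. ni i (Some z)))"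

lemma ni_ram: "ni i Q \<noteq> 0 \<Longrightarrow> ram Q \<noteq> 0" by (erule contrapos_nn) (rule ni_unram)

lemma finite_ni: "finite {Q. ni i Q \<noteq> 0}"
 by (rule finite_subset[OF _ finite_ram]) (use ni_ram in blast)

lemma Hp: "Hp i \<noteq> 0" "order z (map_poly to_ac (Hp i)) = ni i (Some z)"
 "degree (Hp i) + ni i None = M i"
proof -
 have fin: "finite {z. ni i (Some z) \<noteq> 0}"
  using finite_vimageI[OF finite_ni, of Some i] by (simp add: vimage_def)
 have "ram (Some (frob z)) = ram (Some z)" for z
 proof -
  have "d (frobQ (Some z)) = map_poly frob (d (Some z))" using CR_D(3)[OF d_CR] unfolding equivariant_def by blast
  then show ?thesis by (simp add: ram_def)
 qed
 then have "ni i (Some (frob z)) = ni i (Some z)" for z by (simp add: ni_def)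
 then obtain H :: "'k poly" where "H \<noteq> 0" "\<forall>z. order z (map_poly to_ac H) = ni i (Some z)"
  "degree H = (\<Sum>z | ni i (Some z) \<noteq> 0. ni i (Some z))"
  using descend_prod[of "\<lambda>z. ni i (Some z)"] fin by metis
 then have H: "Hp i \<noteq> 0 \<and> (\<forall>z. order z (map_poly to_ac (Hp i)) = ni i (Some z)) \<and>
   degree (Hp i) = (\<Sum>z | ni i (Some z) \<noteq> 0. ni i (Some z))"
  unfolding Hp_def by (intro someI[of "\<lambda>H. H \<noteq> 0 \<and> _ H \<and> _ H"]) blast
 then show "Hp i \<noteq> 0" "order z (map_poly to_ac (Hp i)) = ni i (Some z)" by auto
 have "M i = (\<Sum>Q | ni i Q \<noteq> 0. ni i Q)"
  unfolding M_def by (rule sum.mono_neutral_right[OF finite_ram]) (use ni_ram in blast)+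
 also have "\<dots> = (\<Sum>Q\<in>insert None (Some ` {z. ni i (Some z) \<noteq> 0}). ni i Q)"
 proof (rule sum.mono_neutral_left)
  show "{Q. ni i Q \<noteq> 0} \<subseteq> insert None (Some ` {z. ni i (Some z) \<noteq> 0})"
  proof
   fix Q assume "Q \<in> {Q. ni i Q \<noteq> 0}"
   then show "Q \<in> insert None (Some ` {z. ni i (Some z) \<noteq> 0})" by (cases Q) auto
  qed
 qed (use fin in auto)
 also have "\<dots> = ni i None + (\<Sum>z | ni i (Some z) \<noteq> 0. ni i (Some z))"
  using fin by (subst sum.insert) (auto simp: sum.reindex)
 finally show "degree (Hp i) + ni i None = M i" using H by simp
qed

abbreviation Hf :: "nat \<Rightarrow> 'k ratfun" where "Hf i \<equiv> to_fract (Hp i)"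

lemma Hf_nonzero: "Hf i \<noteq> 0" using Hp(1) by simp

text \<open>Division by \<open>Hf i\<close> turns vanishing along D_i into regularity at finite
  points and vanishing to order \<open>M i\<close> at infinity, so only one point remains to be
  examined.\<close>

lemma vge_Hf:
 "vge (Some z) (int (ni i (Some z))) (bc f) \<longleftrightarrow> vge (Some z) 0 (bc (f / Hf i))"
 "vge None (int (ni i None)) (bc f) \<longleftrightarrow> vge None (int (M i)) (bc (f / Hf i))"
proof -
 have nz: "bc (Hf i) \<noteq> 0" using Hp(1)[of i] by (simp del: base_change_to_fract)
 have v: "val (Some z) (bc (Hf i)) = int (ni i (Some z))" "val None (bc (Hf i)) = int (ni i None) - int (M i)"
  using Hp(1)[of i] Hp(2)[of z i] Hp(3)[of i] by (simp_all add: val_to_fract)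
 show "vge (Some z) (int (ni i (Some z))) (bc f) \<longleftrightarrow> vge (Some z) 0 (bc (f / Hf i))"
  "vge None (int (ni i None)) (bc f) \<longleftrightarrow> vge None (int (M i)) (bc (f / Hf i))"
  unfolding bc.h_divide by (cases "f = 0"; use nz v in \<open>auto simp: vge_def val_divide simp del: base_change_to_fract\<close>)+
qed

definition cmb :: "(nat \<times> nat \<Rightarrow> 'k) \<Rightarrow> nat \<Rightarrow> 'k ratfun" where
 "cmb c i = (\<Sum>j<M i - 1. cst (c (i, j)) * ratX ^ j) * inverse ratX ^ (M i - 1)"

text \<open>In the coordinate \<open>i\<close> the basis uses
  \<open>x^(-1), ..., x^(1 - M i)\<close>. For \<open>i = 0\<close> truncated subtraction gives
  none, as \<open>M 0 = 0\<close>; this agrees with \<open>H^1\<close> of the structure sheaf of the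
  line being zero.\<close>

definition JJ :: "(nat \<times> nat) set" where "JJ = (SIGMA i:{..<p}. {..<M i - 1})"

text \<open>Representatives supported at the places above infinity, which are those where
  \<open>x\<close> is not integral. The factor \<open>Hf\<close> undoes the division by the equation
  of D_i.\<close>

definition bas :: "'k ratfun alg_closure set \<Rightarrow> nat \<times> nat \<Rightarrow> 'k ratfun alg_closure" where
 "bas V x = (if em ratX \<in> V then 0
   else em (Hf (fst x) * (ratX ^ snd x * inverse ratX ^ (M (fst x) - 1))) * y ^ fst x)"

lemma bas_E: "bas V x \<in> E"
proof -
 have "em f * y ^ i \<in> E" for f i
 proof -
  have "em f * y ^ i = ev (monom f i)" by simp
  then show ?thesis unfolding E_def by blast
 qed
 moreover have "0 \<in> E" using em_E[of 0] by simp
 ultimately show ?thesis by (simp only: bas_def split: if_split) blast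
qed

lemma bas_sum:
 "(\<Sum>x\<in>JJ. em (cst (c x)) * bas V x) = (if em ratX \<in> V then 0 else el (\<lambda>i. Hf i * cmb c i))"
proof (cases "em ratX \<in> V")
 case False
 have "(\<Sum>x\<in>JJ. em (cst (c x)) * bas V x) =
   (\<Sum>i<p. \<Sum>j<M i - 1. em (cst (c (i, j))) * (em (Hf i * (ratX ^ j * inverse ratX ^ (M i - 1))) * y ^ i))"
  unfolding JJ_def using False by (subst sum.Sigma) (auto simp: bas_def split: prod.splits intro!: sum.cong)
 also have "\<dots> = el (\<lambda>i. Hf i * cmb c i)" unfolding el_def cmb_def
  by (intro sum.cong refl) (simp add: em.h_sum sum_distrib_left sum_distrib_right mult_ac)
 finally show ?thesis using False by simp
qed (simp add: bas_def)

text \<open>Integrality at the finite places makes the twisted coordinates of \<open>f\<close>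
  polynomials. At infinity, such a polynomial plus \<open>cmb c i\<close> vanishes to order
  \<open>M i\<close>, and uniqueness there kills the coefficients.\<close>

lemma JJ_kernel:
 assumes c: "\<And>V. place V \<Longrightarrow> (\<Sum>x\<in>JJ. em (cst (c x)) * bas V x) + f \<in> V" and f: "f \<in> E" and x: "x \<in> JJ"
 shows "c x = 0"
proof -
 obtain a where a: "f = el a" using f by (rule E_cases)
 obtain i j where ij: "x = (i, j)" "i < p" "j < M i - 1" using x by (auto simp: JJ_def)
 have pl: "above Q V \<Longrightarrow> place V" for Q V by (simp add: above_def)
 have "vge (Some z) 0 (bc (a i / Hf i))" for z
 proof -
  have "\<forall>V. above (Some z) V \<longrightarrow> el a \<in> V"
  proof (intro allI impI)
   fix V assume V: "above (Some z) V"
   then have "em ratX \<in> V" using above_None_iff by blast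
   then show "el a \<in> V" using c[OF pl[OF V]] unfolding bas_sum a by simp
  qed
  then show ?thesis using integral_iff[of "Some z" a] ij(2) vge_Hf(1) by blast
 qed
 then obtain s where s: "a i / Hf i = to_fract s" by (rule poly_of_regular)
 have "\<forall>V. above None V \<longrightarrow> el (\<lambda>i. Hf i * cmb c i + a i) \<in> V"
 proof (intro allI impI)
  fix V assume V: "above None V"
  then have "em ratX \<notin> V" using above_None_iff by blast
  then show "el (\<lambda>i. Hf i * cmb c i + a i) \<in> V" using c[OF pl[OF V]] unfolding bas_sum a el_simps by simp
 qed
 then have 1: "vge None (int (M i)) (bc ((Hf i * cmb c i + a i) / Hf i))"
  using integral_iff[of None "\<lambda>i. Hf i * cmb c i + a i"] ij(2) vge_Hf(2) by blast
 have 2: "(Hf i * cmb c i + a i) / Hf i = to_fract s + cmb c i"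
  using Hf_nonzero[of i] s by (simp add: add_divide_distrib)
 have "vge None (int (M i - 1) + 1) (bc (to_fract s + cmb c i))"
  by (rule vge_mono[OF 1[unfolded 2]]) (use ij(3) in simp)
 then show ?thesis unfolding cmb_def ij(1) using ij(3) by (rule infinity_unique)
qed

text \<open>Weak approximation replaces the repartition above each point \<open>Q\<close> by a
  single element of \<open>E\<close>, whose coordinates are repartitions on the line. There strong
  approximation settles all finite points at once, and what remains at infinity is split.\<close>

lemma adelic_surjective:
 assumes rE: "\<And>V. place V \<Longrightarrow> r V \<in> E" and fin: "finite {V. place V \<and> r V \<notin> V}"
 shows "\<exists>c. \<exists>f\<in>E. \<forall>V. place V \<longrightarrow> r V - (\<Sum>x\<in>JJ. em (cst (c x)) * bas V x) - f \<in> V"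
proof -
 have pl: "above Q V \<Longrightarrow> place V" for Q V by (simp add: above_def)
 define good where "good Q f \<longleftrightarrow> f \<in> E \<and> (\<forall>V. above Q V \<longrightarrow> f - r V \<in> V)" for Q f
 \<comment> \<open>Two features of this choice matter: it is zero wherever \<open>r\<close> is
   already integral, so only finitely many finite points are involved; and it depends on
   \<open>Q\<close> only through the places above it, so it takes the same value at Frobenius
   conjugates.\<close>
 define F where "F Q = (if \<forall>V. above Q V \<longrightarrow> r V \<in> V then 0 else SOME f. good Q f)" for Q
 define A where "A Q = (if F Q = 0 then (\<lambda>_. 0) else SOME a. F Q = el a)" for Q
 have F: "good Q (F Q)" for Q
 proof (cases "\<forall>V. above Q V \<longrightarrow> r V \<in> V")
  case True
  have "0 \<in> E" using em_E[of 0] by simp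
  moreover have "0 - r V \<in> V" if V: "above Q V" for V
  proof -
   interpret vring E V using V by (rule above_vring)
   show ?thesis using True V by simp
  qed
  ultimately show ?thesis using True by (simp add: F_def good_def)
 next
  case False
  obtain f where "f \<in> E" "\<And>V. above Q V \<Longrightarrow> f - r V \<in> V"
   using local_approximation[of Q r] rE pl by blast
  then have "good Q f" by (simp add: good_def)
  then have "good Q (SOME f. good Q f)" by (rule someI)
  moreover have "F Q = (SOME f. good Q f)" unfolding F_def by (rule if_not_P[OF False])
  ultimately show ?thesis by (simp only:)
 qed
 have elA: "el (A Q) = F Q" for Q
 proof (cases "F Q = 0")
  case False
  have "\<exists>a. F Q = el a" using F[of Q] E_cases unfolding good_def by metis
  then have "F Q = el (SOME a. F Q = el a)" by (rule someI_ex)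
  then show ?thesis unfolding A_def using False by simp
 qed (simp add: A_def el_def)
 have gd: "good (frobQ Q) = good Q" for Q by (intro ext) (simp add: good_def above_frobQ)
 have "F (frobQ Q) = F Q" for Q by (simp only: F_def above_frobQ gd)
 then have Ainv: "A (frobQ Q) = A Q" for Q unfolding A_def by simp
 have finA: "finite {z. F (Some z) \<noteq> 0}"
 proof (rule finite_subset)
  show "{z. F (Some z) \<noteq> 0} \<subseteq> (\<Union>V\<in>{V. place V \<and> r V \<notin> V}. {z. above (Some z) V})"
   using pl by (auto simp: F_def split: if_splits)
  show "finite (\<Union>V\<in>{V. place V \<and> r V \<notin> V}. {z. above (Some z) V})"
   using fin finite_below by blast
 qed
 have "\<exists>h. \<forall>z. vge (Some z) 0 (bc (h - A (Some z) i / Hf i))" for i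
 proof (rule strong_approximation)
  show "A (Some (frob z)) i / Hf i = A (Some z) i / Hf i" for z using Ainv[of "Some z"] by simp
  show "finite {z. \<not> vge (Some z) 0 (bc (A (Some z) i / Hf i))}"
   by (rule finite_subset[OF _ finA]) (auto simp: A_def)
 qed
 then obtain h where h: "\<And>i z. vge (Some z) 0 (bc (h i - A (Some z) i / Hf i))" by metis
 define T where "T i s c \<longleftrightarrow> vge None (int (M i - 1) + 1) (bc ((A None i / Hf i - h i) -
   (to_fract s + (\<Sum>j<M i - 1. cst (c j) * ratX ^ j) * inverse ratX ^ (M i - 1))))" for i s c
 have "\<exists>s c. T i s c" for i unfolding T_def by (rule infinity_split)
 then obtain s c' where "\<And>i. T i (s i) (c' i)" by metis
 then have sc: "vge None (int (M i - 1) + 1) (bc ((A None i / Hf i - h i) -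
   (to_fract (s i) + (\<Sum>j<M i - 1. cst (c' i j) * ratX ^ j) * inverse ratX ^ (M i - 1))))" for i
  unfolding T_def by blast
 define c where "c x = c' (fst x) (snd x)" for x
 have sc': "vge None (int (M i)) (bc ((A None i / Hf i - h i) - (to_fract (s i) + cmb c i)))" for i
  using vge_mono[OF sc, of "int (M i)"] by (simp add: cmb_def c_def)
 define f where "f = el (\<lambda>i. Hf i * (h i + to_fract (s i)))"
 have "r V - (\<Sum>x\<in>JJ. em (cst (c x)) * bas V x) - f \<in> V" if V: "place V" for V
 proof -
  obtain Q where Q: "above Q V" using above_exists[OF V] by blast
  interpret vring E V using Q by (rule above_vring)
  have rF: "F Q - r V \<in> V" using F[of Q] Q by (simp add: good_def)
  show ?thesis
  proof (cases Q)
   case (Some z)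
   have "vge (Some z) (int (ni i (Some z))) (bc (A Q i - Hf i * (h i + to_fract (s i))))" for i
   proof -
    have e: "(A Q i - Hf i * (h i + to_fract (s i))) / Hf i = - (h i - A (Some z) i / Hf i) - to_fract (s i)"
     using Hf_nonzero[of i] Some by (simp add: field_simps)
    have "vge (Some z) 0 (bc (to_fract (s i)))" by (cases "s i = 0") (simp_all add: vge_def val_to_fract)
    then have "vge (Some z) 0 (bc (- (h i - A (Some z) i / Hf i) - to_fract (s i)))"
     unfolding bc.h_diff[of "- _"] bc.h_uminus by (intro vge_diff) (simp_all only: vge_uminus h)
    then show ?thesis unfolding vge_Hf(1) e .
   qed
   then have "el (\<lambda>i. A Q i - Hf i * (h i + to_fract (s i))) \<in> V"
    using integral_iff[of "Some z" "\<lambda>i. A Q i - Hf i * (h i + to_fract (s i))"] Q Some by blast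
   then have "F Q - f - (F Q - r V) \<in> V" unfolding el_simps elA f_def using rF by (rule V_diff)
   moreover have "em ratX \<in> V" using above_None_iff[OF Q] Some by blast
   ultimately show ?thesis unfolding bas_sum by (simp add: algebra_simps)
  next
   case None
   have "vge None (int (ni i None)) (bc (A Q i - Hf i * cmb c i - Hf i * (h i + to_fract (s i))))" for i
   proof -
    have e: "(A Q i - Hf i * cmb c i - Hf i * (h i + to_fract (s i))) / Hf i =
      (A None i / Hf i - h i) - (to_fract (s i) + cmb c i)"
     using Hf_nonzero[of i] None by (simp add: field_simps)
    show ?thesis unfolding vge_Hf(2) e by (rule sc')
   qed
   then have "el (\<lambda>i. A Q i - Hf i * cmb c i - Hf i * (h i + to_fract (s i))) \<in> V"
    using integral_iff[of None "\<lambda>i. A Q i - Hf i * cmb c i - Hf i * (h i + to_fract (s i))"] Q None by blast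
   then have "F Q - el (\<lambda>i. Hf i * cmb c i) - f - (F Q - r V) \<in> V"
    unfolding el_simps elA f_def using rF by (rule V_diff)
   moreover have "em ratX \<notin> V" using above_None_iff[OF Q] None by blast
   ultimately show ?thesis unfolding bas_sum by (simp add: algebra_simps)
  qed
 qed
 moreover have "f \<in> E" by (simp add: f_def)
 ultimately show ?thesis by blast
qed

theorem adelic_basis:
 assumes rE: "\<And>V. place V \<Longrightarrow> r V \<in> E" and fin: "finite {V. place V \<and> r V \<notin> V}"
 shows "\<exists>!c. c \<in> JJ \<rightarrow>\<^sub>E UNIV \<and> (\<exists>f\<in>E. \<forall>V. place V \<longrightarrow> r V - (\<Sum>x\<in>JJ. em (cst (c x)) * bas V x) - f \<in> V)"
proof (rule ex_ex1I)
 obtain c f where cf: "f \<in> E" "\<forall>V. place V \<longrightarrow> r V - (\<Sum>x\<in>JJ. em (cst (c x)) * bas V x) - f \<in> V"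
  using adelic_surjective[OF assms] by blast
 have "(\<Sum>x\<in>JJ. em (cst (restrict c JJ x)) * bas V x) = (\<Sum>x\<in>JJ. em (cst (c x)) * bas V x)" for V
  by (rule sum.cong) auto
 then show "\<exists>c. c \<in> JJ \<rightarrow>\<^sub>E UNIV \<and> (\<exists>f\<in>E. \<forall>V. place V \<longrightarrow> r V - (\<Sum>x\<in>JJ. em (cst (c x)) * bas V x) - f \<in> V)"
  using cf by (intro exI[of _ "restrict c JJ"] conjI bexI[of _ f]) auto
next
 fix c c' assume
  1: "c \<in> JJ \<rightarrow>\<^sub>E UNIV \<and> (\<exists>f\<in>E. \<forall>V. place V \<longrightarrow> r V - (\<Sum>x\<in>JJ. em (cst (c x)) * bas V x) - f \<in> V)"
  and 2: "c' \<in> JJ \<rightarrow>\<^sub>E UNIV \<and> (\<exists>f\<in>E. \<forall>V. place V \<longrightarrow> r V - (\<Sum>x\<in>JJ. em (cst (c' x)) * bas V x) - f \<in> V)"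
 obtain f where f: "f \<in> E" "\<forall>V. place V \<longrightarrow> r V - (\<Sum>x\<in>JJ. em (cst (c x)) * bas V x) - f \<in> V" using 1 by blast
 obtain f' where f': "f' \<in> E" "\<forall>V. place V \<longrightarrow> r V - (\<Sum>x\<in>JJ. em (cst (c' x)) * bas V x) - f' \<in> V" using 2 by blast
 have *: "(\<Sum>x\<in>JJ. em (cst (c x - c' x)) * bas V x) + (f - f') \<in> V" if V: "place V" for V
 proof -
  interpret vring E V using V by (rule place_vring)
  have m: "(r V - (\<Sum>x\<in>JJ. em (cst (c' x)) * bas V x) - f') - (r V - (\<Sum>x\<in>JJ. em (cst (c x)) * bas V x) - f) \<in> V"
   by (rule V_diff[OF f'(2)[rule_format, OF V] f(2)[rule_format, OF V]])
  have eq: "(\<Sum>x\<in>JJ. em (cst (c x - c' x)) * bas V x) =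
    (\<Sum>x\<in>JJ. em (cst (c x)) * bas V x) - (\<Sum>x\<in>JJ. em (cst (c' x)) * bas V x)"
   by (simp add: left_diff_distrib sum_subtractf)
  show ?thesis unfolding eq using m by (simp add: algebra_simps)
 qed
 have "f - f' \<in> E" using f(1) f'(1) by (rule E_field)
 then have "c x - c' x = 0" if "x \<in> JJ" for x
  using JJ_kernel[of "\<lambda>x. c x - c' x" "f - f'" x] * that by blast
 then show "c = c'" using 1 2 by (intro PiE_ext[of c JJ "\<lambda>_. UNIV" c']) auto
qed

text \<open>With \<open>e = ram Q\<close>, the numbers \<open>i e / p\<close> and
  \<open>(p - i) e / p\<close> add up to \<open>e\<close> and neither is an integer, so rounding
  both up adds exactly 1.\<close>

lemma ni_pair:
 assumes e: "ram Q \<noteq> 0" and i: "i \<in> {1..<p}"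
 shows "ni i Q + ni (p - i) Q = ram Q + 1"
proof -
 define a b where "a = i * ram Q div p" and "b = i * ram Q mod p"
 have ie: "i * ram Q = a * p + b" "b < p" using p_gt_1 by (simp_all add: a_def b_def)
 have "\<not> p dvd i * ram Q"
  using prime_p ram_not_dvd e i by (auto simp: prime_dvd_mult_iff dest: dvd_imp_le)
 then have b: "b > 0" unfolding b_def by (metis mod_greater_zero_iff_not_dvd)
 have "i * ram Q < p * ram Q" using e i by simp
 then have "p * a < p * ram Q" using ie(1) mult.commute[of a p] by linarith
 then have ae: "a < ram Q" using p_gt_1 by simp
 then obtain t where t: "ram Q = a + Suc t" using less_imp_Suc_add by (metis add_Suc_right)
 have "ni i Q = a + 1"
  unfolding ni_def ie(1) using ie(2) b p_gt_1 by (intro div_nat_eqI) (auto simp: algebra_simps)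
 moreover have "(p - i) * ram Q = t * p + (p - b)"
 proof -
  have "(p - i) * ram Q = p * ram Q - i * ram Q" by (simp add: diff_mult_distrib)
  also have "\<dots> = p * (a + Suc t) - (a * p + b)" by (simp only: ie(1)[symmetric] t[symmetric])
  also have "\<dots> = t * p + (p - b)" using ie(2) by (simp add: algebra_simps)
  finally show ?thesis .
 qed
 then have "ni (p - i) Q = t + 1"
  unfolding ni_def using ie(2) b p_gt_1 by (intro div_nat_eqI) (auto simp: algebra_simps)
 ultimately show ?thesis using t by simp
qed

text \<open>Pairing \<open>i\<close> with \<open>p - i\<close> evaluates the sum of the
  \<open>M i\<close>. Each of the p - 1 indices \<open>i > 0\<close> loses 1, and without
  truncation, since \<open>M i \<ge> 1\<close> because there is at least one pole. Doubling and
  moving terms across keeps the formula within the natural numbers.\<close>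

theorem card_JJ: "2 * card JJ + 2 * (p - 1) = (p - 1) * sum_mset (ram_type d)"
proof -
 let ?S = "{Q. ram Q \<noteq> 0}"
 have S: "?S = {Q. d Q \<noteq> 0}" using degree_pos_pp[OF CR_D(2)[OF d_CR]] by (auto simp: ram_def)
 obtain Q0 where "d Q0 \<noteq> 0" using d_nz by (auto simp: fun_eq_iff)
 then have Q0: "Q0 \<in> ?S" unfolding S by simp
 have M1: "M i \<ge> 1" if i: "i \<in> {1..<p}" for i
 proof -
  have "i * ram Q0 \<ge> 1" using Q0 i by (simp add: Suc_le_eq)
  then have "p \<le> i * ram Q0 + p - 1" by linarith
  then have "0 < ni i Q0" unfolding ni_def using p_gt_1 by (simp add: div_greater_zero_iff)
  also have "\<dots> \<le> M i" unfolding M_def using finite_ram Q0 by (intro member_le_sum) auto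
  finally show ?thesis by simp
 qed
 have M0: "M 0 = 0" unfolding M_def ni_def using p_gt_1 by simp
 have "card JJ = (\<Sum>i<p. M i - 1)" by (simp add: JJ_def)
 also have "\<dots> = (\<Sum>i\<in>{1..<p}. M i - 1)"
 proof -
  have "{..<p} = insert 0 {1..<p}" using p_gt_1 by auto
  then show ?thesis by (simp add: M0)
 qed
 finally have "card JJ + (p - 1) = (\<Sum>i\<in>{1..<p}. M i - 1) + (\<Sum>i\<in>{1..<p}. 1)" by simp
 also have "\<dots> = (\<Sum>i\<in>{1..<p}. M i)"
  unfolding sum.distrib[symmetric] by (rule sum.cong[OF refl]) (rule le_add_diff_inverse2[OF M1])
 finally have c: "card JJ + (p - 1) = (\<Sum>i\<in>{1..<p}. M i)" .
 have "(\<Sum>i\<in>{1..<p}. M i) = (\<Sum>i\<in>{1..<p}. M (p - i))"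
  by (rule sum.reindex_bij_witness[of _ "\<lambda>i. p - i" "\<lambda>i. p - i"]) auto
 then have "2 * (\<Sum>i\<in>{1..<p}. M i) = (\<Sum>i\<in>{1..<p}. M i + M (p - i))" by (simp add: sum.distrib)
 also have "\<dots> = (\<Sum>i\<in>{1..<p}. \<Sum>Q\<in>?S. ram Q + 1)"
  unfolding M_def sum.distrib[symmetric] using ni_pair by (intro sum.cong) auto
 also have "\<dots> = (p - 1) * (\<Sum>Q\<in>?S. ram Q + 1)" by simp
 also have "(\<Sum>Q\<in>?S. ram Q + 1) = sum_mset (ram_type d)"
  unfolding S ram_type_def sum_unfold_sum_mset by (simp only: ram_def)
 finally show ?thesis using c by simp
qed

end

section \<open>The genus\<close>

lemma ex1_transfer:
 assumes "\<exists>!c. c \<in> A \<and> P c" "\<And>c. c \<in> A \<Longrightarrow> \<tau> c \<in> B" "\<And>c. c \<in> A \<Longrightarrow> R (\<tau> c) \<longleftrightarrow> P c"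
  and "\<And>c. c \<in> B \<Longrightarrow> \<exists>c'\<in>A. c = \<tau> c'"
 shows "\<exists>!c. c \<in> B \<and> R c"
proof -
 obtain c0 where c0: "c0 \<in> A" "P c0" "\<And>c. c \<in> A \<Longrightarrow> P c \<Longrightarrow> c = c0" using assms(1) by blast
 show ?thesis
 proof (rule ex1I[of _ "\<tau> c0"])
  show "\<tau> c0 \<in> B \<and> R (\<tau> c0)" using c0 assms(2,3) by blast
  fix c assume c: "c \<in> B \<and> R c"
  then obtain c' where "c' \<in> A" "c = \<tau> c'" using assms(4) by blast
  then show "c = \<tau> c0" using c c0 assms(3) by blast
 qed
qed

context ring
begin

lemma subring_minus: "subring V R \<Longrightarrow> a \<in> V \<Longrightarrow> b \<in> V \<Longrightarrow> a \<ominus> b \<in> V"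
 unfolding a_minus_def by (intro subringE(7) subringE(5))

lemma subring_finsum:
 assumes V: "subring V R" and f: "\<And>i. i \<in> A \<Longrightarrow> f i \<in> V"
 shows "finsum R f A \<in> V" using f
proof (induction A rule: infinite_finite_induct)
 case (insert x A)
 then have "f \<in> insert x A \<rightarrow> carrier R" using subringE(1)[OF V] by blast
 then have "finsum R f (insert x A) = f x \<oplus> finsum R f A" using insert by (intro finsum_insert) auto
 then show ?case using insert subringE(7)[OF V] by simp
qed (use subringE(2)[OF V] in simp_all)

end

lemma (in cring) diff_diff_diff:
 assumes "a \<in> carrier R" "b \<in> carrier R" "e \<in> carrier R" "f \<in> carrier R" "g \<in> carrier R"
 shows "a \<ominus> b \<ominus> (f \<ominus> g) = (a \<ominus> e \<ominus> f) \<ominus> (b \<ominus> e \<ominus> g)"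
 using assms by algebra

text \<open>Expanding combinations of the first basis in the second gives an injection of
  coefficient vectors. As the constants \<open>C\<close> form a finite set, this yields
  \<open>card C ^ g1 \<le> card C ^ g2\<close>, and comparing exponents gives the claim.\<close>

lemma genus_le:
 assumes "cring K" and C: "finite C" "card C > 1" "C \<subseteq> carrier K"
  and g1: "has_genus C K g1" and g2: "has_genus C K g2"
 shows "g1 \<le> g2"
proof -
 interpret cring K by fact
 define R where "R \<omega> g r c \<longleftrightarrow> (\<exists>f\<in>carrier K. \<forall>V\<in>closed_points C K.
   r V \<ominus>\<^bsub>K\<^esub> (\<Oplus>\<^bsub>K\<^esub>i\<in>{..<g::nat}. c i \<otimes>\<^bsub>K\<^esub> \<omega> i V) \<ominus>\<^bsub>K\<^esub> f \<in> V)" for \<omega> g r c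
 obtain \<omega>1 where w1: "\<forall>i<g1. \<omega>1 i \<in> repartitions C K"
  "\<forall>r\<in>repartitions C K. \<exists>!c. c \<in> {..<g1} \<rightarrow>\<^sub>E C \<and> R \<omega>1 g1 r c"
  using g1 unfolding has_genus_def R_def by blast
 obtain \<omega>2 where w2: "\<forall>i<g2. \<omega>2 i \<in> repartitions C K"
  "\<forall>r\<in>repartitions C K. \<exists>!c. c \<in> {..<g2} \<rightarrow>\<^sub>E C \<and> R \<omega>2 g2 r c"
  using g2 unfolding has_genus_def R_def by blast
 have P: "subring V K" "C \<subseteq> V" if "V \<in> closed_points C K" for V using that by (auto simp: closed_points_def)
 have wc: "\<omega> i V \<in> carrier K" if "\<forall>i<g. \<omega> i \<in> repartitions C K" "i < g" "V \<in> closed_points C K" for \<omega> :: "nat \<Rightarrow> _" and g i V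
  using that unfolding repartitions_def by blast
 have Sc: "(\<Oplus>\<^bsub>K\<^esub>i\<in>{..<g}. c i \<otimes>\<^bsub>K\<^esub> \<omega> i V) \<in> carrier K"
  if "\<forall>i<g. \<omega> i \<in> repartitions C K" "c \<in> {..<g} \<rightarrow>\<^sub>E C" "V \<in> closed_points C K" for \<omega> :: "nat \<Rightarrow> _" and g c V
 proof (rule finsum_closed, rule Pi_I)
  fix i assume i: "i \<in> {..<g}"
  then have "c i \<in> carrier K" using that(2) C(3) by blast
  then show "c i \<otimes>\<^bsub>K\<^esub> \<omega> i V \<in> carrier K" using wc[OF that(1) _ that(3), of i] i by simp
 qed
 define S where "S c V = (\<Oplus>\<^bsub>K\<^esub>i\<in>{..<g1}. c i \<otimes>\<^bsub>K\<^esub> \<omega>1 i V)" for c V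
 have S: "S c V \<in> carrier K" if "c \<in> {..<g1} \<rightarrow>\<^sub>E C" "V \<in> closed_points C K" for c V
  unfolding S_def by (rule Sc[OF w1(1) that])
 have Srep: "S c \<in> repartitions C K" if c: "c \<in> {..<g1} \<rightarrow>\<^sub>E C" for c
 proof -
  have "{V \<in> closed_points C K. S c V \<notin> V} \<subseteq> (\<Union>i<g1. {V \<in> closed_points C K. \<omega>1 i V \<notin> V})"
  proof
   fix V assume V: "V \<in> {V \<in> closed_points C K. S c V \<notin> V}"
   then have V': "V \<in> closed_points C K" "S c V \<notin> V" by auto
   show "V \<in> (\<Union>i<g1. {V \<in> closed_points C K. \<omega>1 i V \<notin> V})"
   proof (rule ccontr)
    assume "V \<notin> (\<Union>i<g1. {V \<in> closed_points C K. \<omega>1 i V \<notin> V})"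
    then have "\<omega>1 i V \<in> V" if "i < g1" for i using V' that by blast
    moreover have "c i \<in> V" if "i < g1" for i using P(2)[OF V'(1)] c that by blast
    ultimately have "S c V \<in> V" unfolding S_def
     using subringE(6)[OF P(1)[OF V'(1)]] by (intro subring_finsum[OF P(1)[OF V'(1)]]) auto
    then show False using V' by blast
   qed
  qed
  moreover have "finite (\<Union>i<g1. {V \<in> closed_points C K. \<omega>1 i V \<notin> V})"
   using w1(1) unfolding repartitions_def by blast
  ultimately have "finite {V \<in> closed_points C K. S c V \<notin> V}" by (rule finite_subset)
  then show ?thesis using S[OF c] unfolding repartitions_def by blast
 qed
 define \<Phi> where "\<Phi> c = (THE e. e \<in> {..<g2} \<rightarrow>\<^sub>E C \<and> R \<omega>2 g2 (S c) e)" for c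
 have Phi: "\<Phi> c \<in> {..<g2} \<rightarrow>\<^sub>E C \<and> R \<omega>2 g2 (S c) (\<Phi> c)" if "c \<in> {..<g1} \<rightarrow>\<^sub>E C" for c
  unfolding \<Phi>_def by (rule theI'[OF bspec[OF w2(2) Srep[OF that]]])
 have "inj_on \<Phi> ({..<g1} \<rightarrow>\<^sub>E C)"
 proof (rule inj_onI)
  fix c e assume c: "c \<in> {..<g1} \<rightarrow>\<^sub>E C" and e: "e \<in> {..<g1} \<rightarrow>\<^sub>E C" and eq: "\<Phi> c = \<Phi> e"
  define T where "T V = (\<Oplus>\<^bsub>K\<^esub>i\<in>{..<g2}. \<Phi> c i \<otimes>\<^bsub>K\<^esub> \<omega>2 i V)" for V
  have T: "T V \<in> carrier K" if "V \<in> closed_points C K" for V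
   unfolding T_def using Sc[OF w2(1) _ that] Phi[OF c] by blast
  obtain f where f: "f \<in> carrier K" "\<forall>V\<in>closed_points C K. S c V \<ominus>\<^bsub>K\<^esub> T V \<ominus>\<^bsub>K\<^esub> f \<in> V"
   using Phi[OF c] unfolding R_def T_def by blast
  obtain f' where f': "f' \<in> carrier K" "\<forall>V\<in>closed_points C K. S e V \<ominus>\<^bsub>K\<^esub> T V \<ominus>\<^bsub>K\<^esub> f' \<in> V"
   using Phi[OF e] unfolding R_def T_def eq by blast
  have "R \<omega>1 g1 (S c) c" unfolding R_def S_def[symmetric]
  proof (intro bexI[of _ "\<zero>\<^bsub>K\<^esub>"] ballI)
   fix V assume V: "V \<in> closed_points C K"
   have "S c V \<ominus>\<^bsub>K\<^esub> S c V \<ominus>\<^bsub>K\<^esub> \<zero>\<^bsub>K\<^esub> = \<zero>\<^bsub>K\<^esub>" using S[OF c V] by algebra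
   then show "S c V \<ominus>\<^bsub>K\<^esub> S c V \<ominus>\<^bsub>K\<^esub> \<zero>\<^bsub>K\<^esub> \<in> V" using subringE(2)[OF P(1)[OF V]] by simp
  qed simp
  moreover have "R \<omega>1 g1 (S c) e" unfolding R_def S_def[symmetric]
  proof (intro bexI[of _ "f \<ominus>\<^bsub>K\<^esub> f'"] ballI)
   fix V assume V: "V \<in> closed_points C K"
   show "S c V \<ominus>\<^bsub>K\<^esub> S e V \<ominus>\<^bsub>K\<^esub> (f \<ominus>\<^bsub>K\<^esub> f') \<in> V"
    unfolding diff_diff_diff[OF S[OF c V] S[OF e V] T[OF V] f(1) f'(1)]
    by (rule subring_minus[OF P(1)[OF V] bspec[OF f(2) V] bspec[OF f'(2) V]])
  qed (use f f' in simp)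
  ultimately show "c = e" using w1(2) Srep[OF c] c e by blast
 qed
 moreover have "\<Phi> ` ({..<g1} \<rightarrow>\<^sub>E C) \<subseteq> {..<g2} \<rightarrow>\<^sub>E C" using Phi by blast
 ultimately have "card ({..<g1} \<rightarrow>\<^sub>E C) \<le> card ({..<g2} \<rightarrow>\<^sub>E C)"
  using C(1) by (intro card_inj_on_le) (auto intro: finite_PiE)
 then have "card C ^ g1 \<le> card C ^ g2" by (simp add: card_PiE)
 then show ?thesis using C(2) power_le_imp_le_exp by blast
qed

section \<open>Transport to an arbitrary equation of the curve\<close>

locale as_model = as_ext k p n q d e0 y for k :: "'k::{field,finite} itself" and p n q d e0 y +
 fixes u z :: "'k ratfun"
 assumes u_eq: "u = v + (z ^ p - z)"
begin

abbreviation "K \<equiv> AS_field u"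

text \<open>The equation for \<open>u\<close> has the root \<open>y + z\<close>, so evaluating
  \<open>Y\<close> there carries the function field realised on polynomials to
  \<open>E\<close>.\<close>

definition toE :: "'k ratfun poly \<Rightarrow> 'k ratfun alg_closure" where "toE F = ev (F \<circ>\<^sub>p [:z, 1:])"

sublocale K: cring K by (rule cring_AS_field)

lemma carrier_K: "carrier K = {F. degree F < p}" by (simp add: char_k)

lemma toE_simps: "toE (F + G) = toE F + toE G" "toE (F * G) = toE F * toE G" "toE (- F) = - toE F"
 "toE 1 = 1" "toE 0 = 0" "toE [:c:] = em c"
 by (simp_all add: toE_def pcompose_add pcompose_mult pcompose_uminus pcompose_1)

lemma toE_AS_poly: "toE (AS_poly u) = 0"
proof -
 have c: "CHAR('k ratfun alg_closure) = p" using em.char_eq by (simp add: char_k)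
 have "((y + em z) - em z) ^ p = (y + em z) ^ p - em z ^ p"
  using power_CHAR_diff[of "y + em z" "em z"] prime_p unfolding c by blast
 then have "(y + em z) ^ p = y + em v + em z ^ p" using y_p by simp
 moreover have "toE (AS_poly u) = (y + em z) ^ p - (y + em z) - em u"
  by (simp add: toE_def AS_poly_def pcompose_diff ev_def em.map_pcompose poly_pcompose poly_monom char_k pcompose_pCons add.commute)
 ultimately show ?thesis by (simp add: u_eq)
qed

lemma toE_mod: "toE (F mod AS_poly u) = toE F"
proof -
 have "toE F = toE (F div AS_poly u * AS_poly u + F mod AS_poly u)" by simp
 then show ?thesis by (simp only: toE_simps toE_AS_poly) simp
qed

lemma toE_inj: "inj_on toE (carrier K)"
proof (rule inj_onI)
 fix F G assume F: "F \<in> carrier K" and G: "G \<in> carrier K" and eq: "toE F = toE G"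
 have "toE (F - G) = 0" using eq toE_simps(1)[of F "- G"] toE_simps(3)[of G] by simp
 then have dv: "AS_poly v dvd (F - G) \<circ>\<^sub>p [:z, 1:]" using ev_eq_0_iff by (simp add: toE_def)
 have "degree ((F - G) \<circ>\<^sub>p [:z, 1:]) < p"
  using F G unfolding carrier_K by (simp add: degree_pcompose degree_diff_less)
 then have "(F - G) \<circ>\<^sub>p [:z, 1:] = 0"
  using dvd_imp_degree_le[OF dv] degree_AS_poly(1)[OF prime_CHAR_ratfun, of v] by (auto simp: char_k)
 then have "F - G = 0" by (rule pcompose_eq_0) simp
 then show "F = G" by simp
qed

lemma toE_image: "toE ` carrier K = E"
proof (intro equalityI subsetI)
 fix x assume "x \<in> E"
 then obtain F where F: "x = ev F" by (auto simp: E_def)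
 have "F \<circ>\<^sub>p [:- z, 1:] \<circ>\<^sub>p [:z, 1:] = F" by (simp add: pcompose_pCons pcompose_idR flip: pcompose_assoc)
 then have "x = toE (F \<circ>\<^sub>p [:- z, 1:] mod AS_poly u)" by (simp add: toE_mod F) (simp add: toE_def)
 moreover have "F \<circ>\<^sub>p [:- z, 1:] mod AS_poly u \<in> carrier K" using degree_mod_AS by simp
 ultimately show "x \<in> toE ` carrier K" by blast
qed (auto simp: toE_def E_def)

lemma toE_K: "toE (F \<oplus>\<^bsub>K\<^esub> G) = toE F + toE G" "toE (F \<otimes>\<^bsub>K\<^esub> G) = toE F * toE G"
 "F \<in> carrier K \<Longrightarrow> toE (\<ominus>\<^bsub>K\<^esub> F) = - toE F"
 "F \<in> carrier K \<Longrightarrow> G \<in> carrier K \<Longrightarrow> toE (F \<ominus>\<^bsub>K\<^esub> G) = toE F - toE G"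
proof -
 show a: "toE (F \<oplus>\<^bsub>K\<^esub> G) = toE F + toE G" for F G by (simp add: toE_simps)
 show "toE (F \<otimes>\<^bsub>K\<^esub> G) = toE F * toE G" by (simp add: toE_mod toE_simps)
 show m: "toE (\<ominus>\<^bsub>K\<^esub> F) = - toE F" if "F \<in> carrier K" for F
 proof -
  have "toE (\<ominus>\<^bsub>K\<^esub> F \<oplus>\<^bsub>K\<^esub> F) = toE \<zero>\<^bsub>K\<^esub>" using K.l_neg[OF that] by (simp only:)
  then have "toE (\<ominus>\<^bsub>K\<^esub> F) + toE F = 0" unfolding a by (simp add: toE_simps)
  then show ?thesis by (simp add: eq_neg_iff_add_eq_0)
 qed
 show "toE (F \<ominus>\<^bsub>K\<^esub> G) = toE F - toE G" if "F \<in> carrier K" "G \<in> carrier K"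
  unfolding a_minus_def a m[OF that(2)] by simp
qed

lemma toE_finsum: "finite A \<Longrightarrow> f \<in> A \<rightarrow> carrier K \<Longrightarrow> toE (finsum K f A) = (\<Sum>i\<in>A. toE (f i))"
proof (induction A rule: finite_induct)
 case empty
 then show ?case by (simp only: K.finsum_empty AS_field_simps toE_simps sum.empty)
next
 case (insert x A)
 then have "finsum K f (insert x A) = f x \<oplus>\<^bsub>K\<^esub> finsum K f A" by (intro K.finsum_insert) auto
 moreover have "toE (finsum K f A) = (\<Sum>i\<in>A. toE (f i))" using insert by auto
 ultimately show ?case by (simp only: toE_K sum.insert[OF insert(1,2)])
qed

lemma K_0_1: "(0 :: 'k ratfun poly) \<in> carrier K" "(1 :: 'k ratfun poly) \<in> carrier K"
 using K.zero_closed K.one_closed by simp_all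

lemma toE_eq_0: "F \<in> carrier K \<Longrightarrow> toE F = 0 \<longleftrightarrow> F = 0"
 using inj_onD[OF toE_inj, of F 0] K_0_1 toE_simps(5) by metis

lemma toE_inv:
 assumes "F \<in> carrier K" "F \<noteq> 0"
 shows "toE (inv\<^bsub>K\<^esub> F) = inverse (toE F)" "inv\<^bsub>K\<^esub> F \<in> carrier K"
proof -
 have "toE F \<in> E" using assms(1) toE_image by blast
 then have "inverse (toE F) \<in> toE ` carrier K" using E_field(4) toE_image by blast
 then obtain G where G: "G \<in> carrier K" "toE G = inverse (toE F)" by auto
 have "toE (F \<otimes>\<^bsub>K\<^esub> G) = toE 1" unfolding toE_K G toE_simps using toE_eq_0[OF assms(1)] assms(2) by simp
 then have "F \<otimes>\<^bsub>K\<^esub> G = 1" using inj_onD[OF toE_inj] K.m_closed[OF assms(1) G(1)] K_0_1 by blast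
 then have "inv\<^bsub>K\<^esub> F = G" using assms(1) G(1) by (intro K.comm_inv_char) (simp_all only: AS_field_simps)
 then show "toE (inv\<^bsub>K\<^esub> F) = inverse (toE F)" "inv\<^bsub>K\<^esub> F \<in> carrier K" using G by simp_all
qed

abbreviation "CP \<equiv> closed_points constants K"

lemma CP_D: "V \<in> CP \<Longrightarrow> subring V K" "V \<in> CP \<Longrightarrow> constants \<subseteq> V" "V \<in> CP \<Longrightarrow> V \<noteq> carrier K" "V \<in> CP \<Longrightarrow> V \<subseteq> carrier K"
 "V \<in> CP \<Longrightarrow> F \<in> carrier K \<Longrightarrow> F \<noteq> 0 \<Longrightarrow> F \<in> V \<or> inv\<^bsub>K\<^esub> F \<in> V"
 using subringE(1) unfolding closed_points_def AS_field_simps(4) by blast+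

lemma toE_mem: "V \<in> CP \<Longrightarrow> F \<in> carrier K \<Longrightarrow> toE F \<in> toE ` V \<longleftrightarrow> F \<in> V"
 using inj_on_image_mem_iff[OF toE_inj] CP_D(4) by blast

lemma place_image: assumes V: "V \<in> CP" shows "place (toE ` V)"
proof -
 note D = CP_D[OF V]
 have "vring E (toE ` V)"
 proof unfold_locales
  show "toE ` V \<subseteq> E" using D(4) toE_image by blast
  have "1 \<in> V" using subringE(3)[OF D(1)] by (simp only: AS_field_simps)
  then show "1 \<in> toE ` V" using toE_simps(4) by (metis imageI)
  show "x - w \<in> toE ` V" "x * w \<in> toE ` V" if xw: "x \<in> toE ` V" "w \<in> toE ` V" for x w
  proof -
   obtain F where F: "F \<in> V" "x = toE F" using xw(1) by blast
   obtain G where G: "G \<in> V" "w = toE G" using xw(2) by blast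
   have "F \<ominus>\<^bsub>K\<^esub> G \<in> V" using K.subring_minus[OF D(1) F(1) G(1)] .
   moreover have "toE (F \<ominus>\<^bsub>K\<^esub> G) = x - w" using toE_K(4)[of F G] F G D(4) by blast
   ultimately show "x - w \<in> toE ` V" by (metis imageI)
   have "F \<otimes>\<^bsub>K\<^esub> G \<in> V" using subringE(6)[OF D(1) F(1) G(1)] .
   moreover have "toE (F \<otimes>\<^bsub>K\<^esub> G) = x * w" using toE_K(2)[of F G] F G by simp
   ultimately show "x * w \<in> toE ` V" by (metis imageI)
  qed
  fix x assume "x \<in> E"
  then obtain F where F: "F \<in> carrier K" "x = toE F" using toE_image by blast
  show "x \<in> toE ` V \<or> inverse x \<in> toE ` V"
  proof (cases "F = 0")
   case True
   have "0 \<in> V" using subringE(2)[OF D(1)] by (simp only: AS_field_simps)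
   then show ?thesis using F True by blast
  next
   case False
   then have "F \<in> V \<or> inv\<^bsub>K\<^esub> F \<in> V" using D(5) F(1) by blast
   then show ?thesis using F(2) toE_inv(1)[OF F(1) False] by (metis imageI)
  qed
 qed (use E_field in blast)+
 moreover have "em (cst c) \<in> toE ` V" for c
 proof -
  have "[:cst c:] \<in> V" using D(2) unfolding constants_eq by blast
  then show ?thesis using toE_simps(6) by (metis imageI)
 qed
 moreover have "toE ` V \<noteq> E"
  using D(3,4) toE_image inj_on_image_eq_iff[OF toE_inj D(4) subset_refl] by metis
 ultimately show ?thesis unfolding place_def by blast
qed

definition preim :: "'k ratfun alg_closure set \<Rightarrow> 'k ratfun poly set" where
 "preim W = {F \<in> carrier K. toE F \<in> W}"

lemma place_preimage: assumes W: "place W" shows "preim W \<in> CP" "toE ` preim W = W"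
proof -
 interpret vring E W using W by (rule place_vring)
 show im: "toE ` preim W = W"
 proof (intro equalityI subsetI)
  fix x assume x: "x \<in> W"
  then have "x \<in> toE ` carrier K" unfolding toE_image by (rule V_E)
  then obtain F where "F \<in> carrier K" "x = toE F" by blast
  then show "x \<in> toE ` preim W" using x unfolding preim_def by blast
 qed (auto simp only: preim_def)
 have "subring (preim W) K"
 proof (rule K.subringI)
  show "preim W \<subseteq> carrier K" by (auto simp only: preim_def)
  show "\<one>\<^bsub>K\<^esub> \<in> preim W" unfolding preim_def AS_field_simps(3) using K_0_1 toE_simps(4) V_1 by simp
  fix F assume F: "F \<in> preim W"
  then have F': "F \<in> carrier K" "toE F \<in> W" by (auto simp only: preim_def)
  show "\<ominus>\<^bsub>K\<^esub> F \<in> preim W"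
   unfolding preim_def mem_Collect_eq toE_K(3)[OF F'(1)] using F' by (intro conjI K.a_inv_closed V_uminus)
  fix G assume "G \<in> preim W"
  then have G': "G \<in> carrier K" "toE G \<in> W" by (auto simp only: preim_def)
  show "F \<otimes>\<^bsub>K\<^esub> G \<in> preim W"
   unfolding preim_def mem_Collect_eq toE_K using F' G' by (intro conjI K.m_closed V_mult)
  show "F \<oplus>\<^bsub>K\<^esub> G \<in> preim W"
   unfolding preim_def mem_Collect_eq toE_K using F' G' by (intro conjI K.a_closed V_add)
 qed
 moreover have "constants \<subseteq> preim W"
 proof
  fix f :: "'k ratfun poly" assume "f \<in> constants"
  then obtain c where c: "f = [:cst (c :: 'k):]" unfolding constants_eq by blast
  have "em (cst c) \<in> W" using W unfolding place_def by blast
  then show "f \<in> preim W" unfolding preim_def c using p_gt_1 by (simp add: toE_simps char_k)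
 qed
 moreover have "preim W \<noteq> carrier K" using im toE_image W unfolding place_def by metis
 moreover have "f \<in> preim W \<or> inv\<^bsub>K\<^esub> f \<in> preim W" if f: "f \<in> carrier K - {0}" for f
 proof -
  have f': "f \<in> carrier K" "f \<noteq> 0" using f by auto
  have "toE f \<in> E" using f'(1) toE_image by blast
  then have "toE f \<in> W \<or> toE (inv\<^bsub>K\<^esub> f) \<in> W" unfolding toE_inv(1)[OF f'] by (rule V_val)
  then show ?thesis unfolding preim_def using f'(1) toE_inv(2)[OF f'] by blast
 qed
 ultimately show "preim W \<in> CP" unfolding closed_points_def AS_field_simps(4) by blast
qed

lemma preim_image: "V \<in> CP \<Longrightarrow> preim (toE ` V) = V"
 unfolding preim_def using toE_mem CP_D(4) by blast

lemma inj_on_CP: "inj_on (\<lambda>V. toE ` V) CP" by (rule inj_onI) (metis preim_image)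

text \<open>Under \<open>toE\<close> the closed points of \<open>K\<close> correspond to the places
  of \<open>E\<close>, so the adelic basis of \<open>E\<close> can be carried back to
  \<open>K\<close>.\<close>

theorem has_genus_card_JJ: "has_genus constants K (card JJ)"
proof -
 let ?g = "card JJ"
 have finJ: "finite JJ" by (simp add: JJ_def)
 obtain e where e: "bij_betw e {..<?g} JJ"
  using ex_bij_betw_nat_finite[OF finJ] by (auto simp: atLeast0LessThan)
 define \<omega> where "\<omega> i V = inv_into (carrier K) toE (bas (toE ` V) (e i))" for i V
 have w: "\<omega> i V \<in> carrier K" "toE (\<omega> i V) = bas (toE ` V) (e i)" for i V
 proof -
  have "bas (toE ` V) (e i) \<in> toE ` carrier K" using bas_E toE_image by blast
  then show "\<omega> i V \<in> carrier K" "toE (\<omega> i V) = bas (toE ` V) (e i)"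
   unfolding \<omega>_def by (rule inv_into_into, rule f_inv_into_f)
 qed
 \<comment> \<open>Each representative is nonzero only at the places above infinity, and these are
   finite in number.\<close>
 have rep: "\<omega> i \<in> repartitions constants K" for i
 proof -
  have "(\<lambda>V. toE ` V) ` {V \<in> CP. \<omega> i V \<notin> V} \<subseteq> {W. above None W}"
  proof
   fix W assume "W \<in> (\<lambda>V. toE ` V) ` {V \<in> CP. \<omega> i V \<notin> V}"
   then obtain V where V: "V \<in> CP" "\<omega> i V \<notin> V" "W = toE ` V" by blast
   have pl: "place W" using place_image[OF V(1)] V(3) by simp
   interpret vring E W using pl by (rule place_vring)
   have "bas W (e i) \<notin> W" using toE_mem[OF V(1) w(1)[of i V]] V w(2)[of i V] by simp
   then have "em ratX \<notin> W" by (auto simp: bas_def)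
   moreover obtain Q where Q: "above Q W" using above_exists[OF pl] by blast
   ultimately have "Q = None" using above_None_iff[OF Q] by simp
   then show "W \<in> {W. above None W}" using Q by simp
  qed
  then have "finite ((\<lambda>V. toE ` V) ` {V \<in> CP. \<omega> i V \<notin> V})" using finite_above finite_subset by blast
  moreover have "inj_on (\<lambda>V. toE ` V) {V \<in> CP. \<omega> i V \<notin> V}"
   using inj_on_CP by (rule inj_on_subset) blast
  ultimately have "finite {V \<in> CP. \<omega> i V \<notin> V}" by (rule finite_imageD)
  then show ?thesis using w(1) unfolding repartitions_def by blast
 qed
 define \<kappa> where "\<kappa> c = [:cst c:]" for c :: 'k
 have kap: "\<kappa> c \<in> carrier K" "toE (\<kappa> c) = em (cst c)" "\<kappa> c \<in> constants" for c
  unfolding constants_eq \<kappa>_def using p_gt_1 by (simp_all add: toE_simps char_k)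
 define \<tau> where "\<tau> c = (\<lambda>i\<in>{..<?g}. \<kappa> (c (e i)))" for c
 have main: "\<exists>!c. c \<in> {..<?g} \<rightarrow>\<^sub>E constants \<and>
   (\<exists>f\<in>carrier K. \<forall>V\<in>CP. r V \<ominus>\<^bsub>K\<^esub> (\<Oplus>\<^bsub>K\<^esub>i\<in>{..<?g}. c i \<otimes>\<^bsub>K\<^esub> \<omega> i V) \<ominus>\<^bsub>K\<^esub> f \<in> V)"
  if r: "r \<in> repartitions constants K" for r
 proof -
  have rc: "r V \<in> carrier K" if "V \<in> CP" for V using r that unfolding repartitions_def by blast
  define r' where "r' W = toE (r (preim W))" for W
  have r'E: "r' W \<in> E" if "place W" for W
   using rc[OF place_preimage(1)[OF that]] toE_image unfolding r'_def by blast
  have "{W. place W \<and> r' W \<notin> W} \<subseteq> (\<lambda>V. toE ` V) ` {V \<in> CP. r V \<notin> V}"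
  proof
   fix W assume "W \<in> {W. place W \<and> r' W \<notin> W}"
   then have W: "place W" "r' W \<notin> W" by auto
   note P = place_preimage[OF W(1)]
   have "r (preim W) \<notin> preim W" using toE_mem[OF P(1) rc[OF P(1)]] W(2) P(2) unfolding r'_def by simp
   then show "W \<in> (\<lambda>V. toE ` V) ` {V \<in> CP. r V \<notin> V}"
    using P by (intro image_eqI[of _ _ "preim W"]) auto
  qed
  moreover have "finite ((\<lambda>V. toE ` V) ` {V \<in> CP. r V \<notin> V})" using r unfolding repartitions_def by blast
  ultimately have r'fin: "finite {W. place W \<and> r' W \<notin> W}" by (rule finite_subset)
  have key: "toE (r V \<ominus>\<^bsub>K\<^esub> (\<Oplus>\<^bsub>K\<^esub>i\<in>{..<?g}. \<tau> c i \<otimes>\<^bsub>K\<^esub> \<omega> i V) \<ominus>\<^bsub>K\<^esub> f) =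
    r' (toE ` V) - (\<Sum>x\<in>JJ. em (cst (c x)) * bas (toE ` V) x) - toE f"
   and key': "r V \<ominus>\<^bsub>K\<^esub> (\<Oplus>\<^bsub>K\<^esub>i\<in>{..<?g}. \<tau> c i \<otimes>\<^bsub>K\<^esub> \<omega> i V) \<ominus>\<^bsub>K\<^esub> f \<in> carrier K"
   if V: "V \<in> CP" and f: "f \<in> carrier K" for V c f
  proof -
   have cl: "(\<lambda>i. \<tau> c i \<otimes>\<^bsub>K\<^esub> \<omega> i V) \<in> {..<?g} \<rightarrow> carrier K"
   proof (rule Pi_I)
    fix i assume i: "i \<in> {..<?g}"
    have "\<tau> c i = \<kappa> (c (e i))" unfolding \<tau>_def by (rule restrict_apply'[OF i])
    then show "\<tau> c i \<otimes>\<^bsub>K\<^esub> \<omega> i V \<in> carrier K" using K.m_closed[OF kap(1) w(1)] by (simp only:)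
   qed
   have fc: "(\<Oplus>\<^bsub>K\<^esub>i\<in>{..<?g}. \<tau> c i \<otimes>\<^bsub>K\<^esub> \<omega> i V) \<in> carrier K" using cl by (rule K.finsum_closed)
   have "toE (\<Oplus>\<^bsub>K\<^esub>i\<in>{..<?g}. \<tau> c i \<otimes>\<^bsub>K\<^esub> \<omega> i V) = (\<Sum>i<?g. toE (\<tau> c i \<otimes>\<^bsub>K\<^esub> \<omega> i V))"
    by (rule toE_finsum[OF _ cl]) simp
   also have "\<dots> = (\<Sum>i<?g. em (cst (c (e i))) * bas (toE ` V) (e i))"
   proof (rule sum.cong[OF refl])
    fix i assume i: "i \<in> {..<?g}"
    have "\<tau> c i = \<kappa> (c (e i))" unfolding \<tau>_def by (rule restrict_apply'[OF i])
    then show "toE (\<tau> c i \<otimes>\<^bsub>K\<^esub> \<omega> i V) = em (cst (c (e i))) * bas (toE ` V) (e i)"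
     by (simp only: toE_K kap w)
   qed
   also have "\<dots> = (\<Sum>x\<in>JJ. em (cst (c x)) * bas (toE ` V) x)"
    using e by (rule sum.reindex_bij_betw)
   finally have s: "toE (\<Oplus>\<^bsub>K\<^esub>i\<in>{..<?g}. \<tau> c i \<otimes>\<^bsub>K\<^esub> \<omega> i V) = (\<Sum>x\<in>JJ. em (cst (c x)) * bas (toE ` V) x)" .
   note d1 = K.minus_closed[OF rc[OF V] fc]
   show "toE (r V \<ominus>\<^bsub>K\<^esub> (\<Oplus>\<^bsub>K\<^esub>i\<in>{..<?g}. \<tau> c i \<otimes>\<^bsub>K\<^esub> \<omega> i V) \<ominus>\<^bsub>K\<^esub> f) =
    r' (toE ` V) - (\<Sum>x\<in>JJ. em (cst (c x)) * bas (toE ` V) x) - toE f"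
    unfolding toE_K(4)[OF d1 f] toE_K(4)[OF rc[OF V] fc] s r'_def preim_image[OF V] ..
   show "r V \<ominus>\<^bsub>K\<^esub> (\<Oplus>\<^bsub>K\<^esub>i\<in>{..<?g}. \<tau> c i \<otimes>\<^bsub>K\<^esub> \<omega> i V) \<ominus>\<^bsub>K\<^esub> f \<in> carrier K"
    by (rule K.minus_closed[OF d1 f])
  qed
  show ?thesis
  proof (rule ex1_transfer[where \<tau> = \<tau>])
   show "\<exists>!c. c \<in> JJ \<rightarrow>\<^sub>E UNIV \<and> (\<exists>f\<in>E. \<forall>W. place W \<longrightarrow> r' W - (\<Sum>x\<in>JJ. em (cst (c x)) * bas W x) - f \<in> W)"
    by (rule adelic_basis[OF r'E r'fin])
   show "\<tau> c \<in> {..<?g} \<rightarrow>\<^sub>E constants" for c unfolding \<tau>_def using kap(3) by auto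
   show "(\<exists>f\<in>carrier K. \<forall>V\<in>CP. r V \<ominus>\<^bsub>K\<^esub> (\<Oplus>\<^bsub>K\<^esub>i\<in>{..<?g}. \<tau> c i \<otimes>\<^bsub>K\<^esub> \<omega> i V) \<ominus>\<^bsub>K\<^esub> f \<in> V) \<longleftrightarrow>
    (\<exists>f\<in>E. \<forall>W. place W \<longrightarrow> r' W - (\<Sum>x\<in>JJ. em (cst (c x)) * bas W x) - f \<in> W)" (is "?L \<longleftrightarrow> ?R") for c
   proof
    assume ?L
    then obtain f where f: "f \<in> carrier K"
     "\<forall>V\<in>CP. r V \<ominus>\<^bsub>K\<^esub> (\<Oplus>\<^bsub>K\<^esub>i\<in>{..<?g}. \<tau> c i \<otimes>\<^bsub>K\<^esub> \<omega> i V) \<ominus>\<^bsub>K\<^esub> f \<in> V" by blast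
    have "r' W - (\<Sum>x\<in>JJ. em (cst (c x)) * bas W x) - toE f \<in> W" if W: "place W" for W
    proof -
     note P = place_preimage[OF W]
     have "toE (r (preim W) \<ominus>\<^bsub>K\<^esub> (\<Oplus>\<^bsub>K\<^esub>i\<in>{..<?g}. \<tau> c i \<otimes>\<^bsub>K\<^esub> \<omega> i (preim W)) \<ominus>\<^bsub>K\<^esub> f) \<in> toE ` preim W"
      using f(2) P(1) by blast
     then show ?thesis unfolding key[OF P(1) f(1)] P(2) .
    qed
    moreover have "toE f \<in> E" using f(1) toE_image by blast
    ultimately show ?R by blast
   next
    assume ?R
    then obtain x where x: "x \<in> E" "\<forall>W. place W \<longrightarrow> r' W - (\<Sum>x\<in>JJ. em (cst (c x)) * bas W x) - x \<in> W" by blast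
    obtain f where f: "f \<in> carrier K" "x = toE f" using x(1) toE_image by blast
    have "r V \<ominus>\<^bsub>K\<^esub> (\<Oplus>\<^bsub>K\<^esub>i\<in>{..<?g}. \<tau> c i \<otimes>\<^bsub>K\<^esub> \<omega> i V) \<ominus>\<^bsub>K\<^esub> f \<in> V" if V: "V \<in> CP" for V
     using x(2) place_image[OF V] key[OF V f(1), of c] toE_mem[OF V key'[OF V f(1), of c]] f(2) by auto
    then show ?L using f(1) by blast
   qed
   fix c :: "nat \<Rightarrow> 'k ratfun poly" assume c: "c \<in> {..<?g} \<rightarrow>\<^sub>E constants"
   define c' where "c' = (\<lambda>x\<in>JJ. inv_into UNIV \<kappa> (c (inv_into {..<?g} e x)))"
   have "c = \<tau> c'"
   proof (rule PiE_ext[OF c])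
    show "\<tau> c' \<in> {..<?g} \<rightarrow>\<^sub>E constants" unfolding \<tau>_def using kap(3) by auto
    fix i assume i: "i \<in> {..<?g}"
    have "e i \<in> JJ" "inv_into {..<?g} e (e i) = i" using e i unfolding bij_betw_def by (auto intro: inv_into_f_f)
    moreover have "c i \<in> range \<kappa>" using c i unfolding constants_eq \<kappa>_def by blast
    ultimately show "c i = \<tau> c' i" unfolding \<tau>_def c'_def using i by (simp add: f_inv_into_f)
   qed
   moreover have "c' \<in> JJ \<rightarrow>\<^sub>E UNIV" by (simp add: c'_def)
   ultimately show "\<exists>c'\<in>JJ \<rightarrow>\<^sub>E UNIV. c = \<tau> c'" by blast
  qed
 qed
 show ?thesis unfolding has_genus_def
 proof (rule exI[of _ \<omega>], rule conjI)
  show "\<forall>i<?g. \<omega> i \<in> repartitions constants K" by (intro allI impI rep)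
 qed (intro ballI main)
qed

end

context finite_base
begin

text \<open>The genus formula with its subtraction moved to the other side. Existence comes from the
  explicit basis, uniqueness from comparing any two bases.\<close>

theorem has_genus_iff:
 assumes "canon u \<noteq> (\<lambda>_. 0)"
 shows "has_genus constants (AS_field u) g \<longleftrightarrow> 2 * g + 2 * (p - 1) = (p - 1) * sum_mset (ram_type (canon u))"
proof -
 obtain e where e: "u - (cst e + rep (canon u)) \<in> AS" "canon u \<in> CR" by (rule canon)
 define c where "c = (to_ac (cst e + rep (canon u)) :: 'k ratfun alg_closure)"
 have ch: "CHAR('k ratfun alg_closure) = p" using fhom.char_eq[OF fhom_to_ac, where 'a = "'k ratfun"] by (simp add: char_k)
 then have pr: "prime CHAR('k ratfun alg_closure)" using prime_p by simp
 have "degree (AS_poly c) > 0" using degree_AS_poly(1)[OF pr, of c] p_gt_1 ch by simp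
 then obtain y where "poly (AS_poly c) y = 0" using alg_closed_imp_poly_has_root by blast
 then have y: "y ^ p - y = c" by (simp only: poly_AS_poly ch) simp
 interpret as_ext k p n q "canon u" e y
  by unfold_locales (use e(2) assms y in \<open>simp_all add: c_def\<close>)
 obtain z where z: "u - v = z ^ p - z" using e(1) by (auto simp: AS_def v_def char_k)
 interpret as_model k p n q "canon u" e y u z
  by unfold_locales (use z in \<open>simp add: algebra_simps\<close>)
 have inj: "inj (\<lambda>c. [:cst (c :: 'k):])" by (rule injI) simp
 have C: "finite (constants :: 'k ratfun poly set)" "card (constants :: 'k ratfun poly set) > 1" "constants \<subseteq> carrier (AS_field u)"
  unfolding constants_eq using card_image[OF inj] card_k q_gt_1 p_gt_1 by (auto simp: char_k)
 have "has_genus constants (AS_field u) g \<longleftrightarrow> g = card JJ"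
 proof
  assume "has_genus constants (AS_field u) g"
  then show "g = card JJ"
   using genus_le[OF cring_AS_field C _ has_genus_card_JJ] genus_le[OF cring_AS_field C has_genus_card_JJ] by (intro antisym) blast+
 qed (use has_genus_card_JJ in simp)
 then show ?thesis using card_JJ by linarith
qed

end

section \<open>Counting reduced principal parts\<close>

context finite_base
begin

definition fixed_field :: "nat \<Rightarrow> 'k alg_closure set" where "fixed_field m = {z. (frob ^^ m) z = z}"

lemma frob_funpow: "(frob ^^ m) z = z ^ (q ^ m)"
 by (induction m) (simp_all add: frob_def mult.commute flip: power_mult)

text \<open>The derivative of \<open>T ^ (q ^ m) - T\<close> is \<open>- 1\<close>, so all its roots are simple.\<close>

lemma card_fixed_field:
 assumes m: "m \<ge> 1" shows "finite (fixed_field m)" "card (fixed_field m) = q ^ m"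
proof -
 define N where "N = q ^ m"
 have N: "N > 1" using one_less_power[OF q_gt_1, of m] m by (simp add: N_def)
 define P where "P = monom (1 :: 'k alg_closure) N - monom 1 1"
 have cP: "coeff P N = 1" "\<And>i. i > N \<Longrightarrow> coeff P i = 0" using N by (simp_all add: P_def)
 have dP: "degree P = N" using cP by (intro antisym degree_le le_degree) auto
 then have P0: "P \<noteq> 0" using N by auto
 have root: "poly P z = 0 \<longleftrightarrow> z \<in> fixed_field m" for z
  by (simp add: P_def poly_monom fixed_field_def frob_funpow N_def)
 have "n > 0" using q_pow q_gt_1 by (cases n) auto
 then have "p dvd q" unfolding q_pow by (intro dvd_power) simp
 then have "p dvd N" unfolding N_def using m by (elim dvd_trans) (simp add: dvd_power)
 then have "of_nat N = (0 :: 'k alg_closure)" using ac.char_eq by (simp add: of_nat_eq_0_iff_char_dvd char_k)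
 then have dv: "pderiv P = - 1" by (simp add: P_def pderiv_diff pderiv_monom monom_0 one_pCons flip: One_nat_def)
 obtain A where A: "size A = degree P" "P = smult (lead_coeff P) (\<Prod>x\<in>#A. [:- x, 1:])"
  using alg_closed_imp_factorization[OF P0] by blast
 have l1: "lead_coeff P = 1" by (simp add: dP cP)
 have PA: "P = (\<Prod>x\<in>#A. [:- x, 1:])" using A(2) unfolding l1 by simp
 have set: "set_mset A = fixed_field m"
  using root unfolding PA by (auto simp: poly_prod_mset prod_mset_zero_iff image_iff)
 have "count A x = 1" if x: "x \<in># A" for x
 proof -
  obtain B where B: "A = add_mset x B" using x by (metis multi_member_split)
  have "x \<notin># B"
  proof
   assume "x \<in># B"
   then obtain C where C: "B = add_mset x C" by (metis multi_member_split)
   define L where "L = [:- x, 1:]"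
   have "P = L * (L * (\<Prod>x\<in>#C. [:- x, 1:]))"
    unfolding PA B C L_def by (simp only: image_mset_add_mset prod_mset.add_mset)
   moreover have "poly L x = 0" by (simp add: L_def)
   ultimately have "poly (pderiv P) x = 0" by (simp add: pderiv_mult)
   then show False unfolding dv by simp
  qed
  then show ?thesis by (simp add: B not_in_iff)
 qed
 then have "size A = card (set_mset A)" by (simp add: size_multiset_overloaded_eq)
 then show "finite (fixed_field m)" "card (fixed_field m) = q ^ m"
  using set A(1) dP by (metis finite_set_mset, metis N_def)
qed

lemma inj_funpow: "(frobQ ^^ i) P = (frobQ ^^ i) P' \<longleftrightarrow> P = P'"
 using inj_fn[OF bij_is_inj[OF bij_frobQ]] by (auto dest: injD)

lemma funpow_cancel: "i \<le> j \<Longrightarrow> (frobQ ^^ i) Q = (frobQ ^^ j) Q \<Longrightarrow> (frobQ ^^ (j - i)) Q = Q"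
proof -
 assume "i \<le> j" "(frobQ ^^ i) Q = (frobQ ^^ j) Q"
 then have "(frobQ ^^ i) Q = (frobQ ^^ i) ((frobQ ^^ (j - i)) Q)" by (simp flip: funpow_add comp_apply[of "frobQ ^^ i"])
 then show ?thesis unfolding inj_funpow by simp
qed

text \<open>The geometric points belonging to closed points of degree \<open>m\<close>; the
  condition \<open>m \<ge> 1\<close> makes \<open>Per 0\<close> empty.\<close>

definition Per :: "nat \<Rightarrow> 'k alg_closure option set" where
 "Per m = {Q. m \<ge> 1 \<and> (frobQ ^^ m) Q = Q \<and> (\<forall>j\<in>{1..<m}. (frobQ ^^ j) Q \<noteq> Q)}"

definition orb :: "'k alg_closure option \<Rightarrow> 'k alg_closure option set" where
 "orb Q = range (\<lambda>i. (frobQ ^^ i) Q)"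

lemma Per_unique: "Q \<in> Per m \<Longrightarrow> Q \<in> Per m' \<Longrightarrow> m = m'"
 by (cases m m' rule: linorder_cases) (auto simp: Per_def)

lemma Per_inj: "Q \<in> Per m \<Longrightarrow> inj_on (\<lambda>i. (frobQ ^^ i) Q) {..<m}"
proof (rule inj_onI)
 have *: False if Q: "Q \<in> Per m" and ij: "i < j" "j < m" "(frobQ ^^ i) Q = (frobQ ^^ j) Q" for i j
 proof -
  have "j - i \<in> {1..<m}" using ij by auto
  moreover have "(frobQ ^^ (j - i)) Q = Q" using funpow_cancel[of i j Q] ij by simp
  ultimately show False using Q unfolding Per_def by blast
 qed
 fix i j assume "Q \<in> Per m" "i \<in> {..<m}" "j \<in> {..<m}" "(frobQ ^^ i) Q = (frobQ ^^ j) Q"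
 then show "i = j" using *[of i j] *[of j i] by (cases i j rule: linorder_cases) auto
qed

lemma Per_mod: "Q \<in> Per m \<Longrightarrow> (frobQ ^^ (i mod m)) Q = (frobQ ^^ i) Q"
 by (rule funpow_mod_eq) (simp add: Per_def)

lemma orb_eq: "Q \<in> Per m \<Longrightarrow> orb Q = (\<lambda>i. (frobQ ^^ i) Q) ` {..<m}"
proof -
 assume Q: "Q \<in> Per m"
 have "(frobQ ^^ i) Q \<in> (\<lambda>i. (frobQ ^^ i) Q) ` {..<m}" for i
  using Per_mod[OF Q, of i] Q by (intro image_eqI[of _ _ "i mod m"]) (auto simp: Per_def)
 then show ?thesis unfolding orb_def by blast
qed

lemma card_orb: "Q \<in> Per m \<Longrightarrow> card (orb Q) = m" and finite_orb: "Q \<in> Per m \<Longrightarrow> finite (orb Q)"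
 using Per_inj by (simp_all add: orb_eq card_image)

lemma orb_self: "Q \<in> orb Q" unfolding orb_def by (rule range_eqI[of _ _ 0]) simp

lemma orb_frobQ: assumes Q: "Q \<in> Per m" shows "frobQ P \<in> orb Q \<longleftrightarrow> P \<in> orb Q"
proof
 assume "P \<in> orb Q"
 then obtain i where "P = (frobQ ^^ i) Q" by (auto simp: orb_def)
 then have "frobQ P = (frobQ ^^ Suc i) Q" by simp
 then show "frobQ P \<in> orb Q" unfolding orb_def by blast
next
 assume "frobQ P \<in> orb Q"
 then obtain i where "frobQ P = (frobQ ^^ i) Q" by (auto simp: orb_def)
 moreover have "(frobQ ^^ i) Q = (frobQ ^^ (i + m)) Q" using Q by (simp add: funpow_add Per_def)
 moreover have "i + m = Suc (i + m - 1)" using Q by (simp add: Per_def)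
 ultimately have "frobQ P = frobQ ((frobQ ^^ (i + m - 1)) Q)" by (metis comp_apply funpow.simps(2))
 then have "P = (frobQ ^^ (i + m - 1)) Q" using bij_frobQ by (auto dest: bij_is_inj injD)
 then show "P \<in> orb Q" unfolding orb_def by blast
qed

lemma Per_orb: assumes Q: "Q \<in> Per m" and P: "P \<in> orb Q" shows "P \<in> Per m"
proof -
 obtain i where i: "P = (frobQ ^^ i) Q" using P by (auto simp: orb_def)
 have c: "(frobQ ^^ j) P = (frobQ ^^ i) ((frobQ ^^ j) Q)" for j
  unfolding i by (metis add.commute comp_apply funpow_add)
 have "(frobQ ^^ j) P = P \<longleftrightarrow> (frobQ ^^ j) Q = Q" for j
  using c[of j] inj_funpow[of i "(frobQ ^^ j) Q" Q] i by simp
 then show ?thesis using Q by (simp add: Per_def)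
qed

lemma CR_iff: "c \<in> CR \<longleftrightarrow> finite {Q. c Q \<noteq> 0} \<and> (\<forall>Q. c Q \<in> no_p_terms) \<and> (\<forall>Q. c (frobQ Q) = map_poly frob (c Q))"
 using no_p_terms_coeff_0 by (auto simp: CR_def reduced_parts_def principal_parts_def equivariant_def)

lemma equivariant_funpow: "c \<in> CR \<Longrightarrow> c ((frobQ ^^ i) Q) = (map_poly frob ^^ i) (c Q)"
 by (induction i) (simp_all add: CR_iff)

section \<open>Splitting off one Frobenius orbit of poles\<close>

definition loc :: "nat \<Rightarrow> nat \<Rightarrow> 'k alg_closure poly set" where
 "loc e m = {f \<in> no_p_terms. degree f = e \<and> (map_poly frob ^^ m) f = f}"

definition CRW :: "nat multiset \<Rightarrow> 'k alg_closure option set \<Rightarrow> ('k alg_closure option \<Rightarrow> 'k alg_closure poly) set" where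
 "CRW R W = {c \<in> CR. {Q. c Q \<noteq> 0} \<subseteq> W \<and> ram_type c = R}"

lemma ram_split:
 assumes "finite {Q. c Q \<noteq> 0}" "finite S" "card S = m" "e \<ge> 1" "\<And>P. P \<in> S \<Longrightarrow> degree (c P) = e"
 shows "ram_type c = replicate_mset m (e + 1) + ram_type (\<lambda>P. if P \<in> S then 0 else c P)"
proof -
 let ?c = "\<lambda>P. if P \<in> S then 0 else c P"
 let ?T = "{Q. ?c Q \<noteq> 0}"
 have T: "finite ?T" using assms(1) by (rule rev_finite_subset) auto
 have "c P \<noteq> 0" if "P \<in> S" for P using assms(4) assms(5)[OF that] by auto
 then have "{Q. c Q \<noteq> 0} = S \<union> ?T" by auto
 then have "ram_type c = image_mset (\<lambda>Q. degree (c Q) + 1) (mset_set (S \<union> ?T))" by (simp only: ram_type_def)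
 also have "\<dots> = image_mset (\<lambda>Q. degree (c Q) + 1) (mset_set S) + image_mset (\<lambda>Q. degree (c Q) + 1) (mset_set ?T)"
  using assms(2) T by (subst mset_set_Union) auto
 also have "image_mset (\<lambda>Q. degree (c Q) + 1) (mset_set S) = image_mset (\<lambda>Q. e + 1) (mset_set S)"
  using assms(2,5) by (intro image_mset_cong) auto
 also have "\<dots> = replicate_mset m (e + 1)" using assms(3) by (simp add: image_mset_const_eq)
 also have "image_mset (\<lambda>Q. degree (c Q) + 1) (mset_set ?T) = ram_type ?c"
  unfolding ram_type_def using T by (intro image_mset_cong) auto
 finally show ?thesis .
qed

lemma funpow_map_frob: "degree ((map_poly frob ^^ i) f) = degree f"
 "coeff ((map_poly frob ^^ i) f) j = (frob ^^ i) (coeff f j)" by (induction i) simp_all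

lemma frob_funpow_0: "(frob ^^ i) 0 = 0" by (induction i) simp_all

lemma no_p_terms_map_frob: "f \<in> no_p_terms \<Longrightarrow> (map_poly frob ^^ i) f \<in> no_p_terms"
 by (simp add: no_p_terms_def funpow_map_frob frob_funpow_0)

text \<open>On the orbit of \<open>Q\<close> an equivariant family is determined by its value at
  \<open>Q\<close>, which may be any reduced polynomial of degree \<open>e\<close> fixed by the m-th
  power of Frobenius. This choice places no condition on the family off the orbit.\<close>

lemma peel_bij:
 assumes Q: "Q \<in> Per m" and e: "e \<ge> 1" and W: "orb Q \<subseteq> W"
 shows "bij_betw (\<lambda>c. (c Q, \<lambda>P. if P \<in> orb Q then 0 else c P))
   {c \<in> CRW (replicate_mset m (e + 1) + R) W. degree (c Q) = e} (loc e m \<times> CRW R (W - orb Q))"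
proof -
 \<comment> \<open>The least number of Frobenius steps from \<open>Q\<close> to \<open>P\<close>,
   along which \<open>glue\<close> transports the value at \<open>Q\<close>. Other step numbers
   agree with it modulo \<open>m\<close> and give the same value.\<close>
 define l where "l P = (LEAST i. (frobQ ^^ i) Q = P)" for P
 define glue where "glue fc = (\<lambda>P. if P \<in> orb Q then (map_poly frob ^^ l P) (fst fc) else snd fc P)"
  for fc :: "'k alg_closure poly \<times> ('k alg_closure option \<Rightarrow> 'k alg_closure poly)"
 have l: "(frobQ ^^ l P) Q = P" if P: "P \<in> orb Q" for P
 proof -
  obtain i where "(frobQ ^^ i) Q = P" using P unfolding orb_def by blast
  then show ?thesis unfolding l_def by (rule LeastI)
 qed
 have lQ: "l Q = 0" unfolding l_def by (rule Least_eq_0) simp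
 have m: "m \<ge> 1" "(frobQ ^^ m) Q = Q" using Q by (auto simp: Per_def)
 show ?thesis
 proof (rule bij_betw_byWitness[where f' = glue])
  show "\<forall>c\<in>{c \<in> CRW (replicate_mset m (e + 1) + R) W. degree (c Q) = e}.
    glue (c Q, \<lambda>P. if P \<in> orb Q then 0 else c P) = c"
  proof (intro ballI ext)
   fix c P assume "c \<in> {c \<in> CRW (replicate_mset m (e + 1) + R) W. degree (c Q) = e}"
   then have c: "c \<in> CR" by (simp add: CRW_def)
   show "glue (c Q, \<lambda>P. if P \<in> orb Q then 0 else c P) P = c P"
    using equivariant_funpow[OF c, of "l P" Q] l[of P] by (cases "P \<in> orb Q") (simp_all add: glue_def)
  qed
  show "\<forall>fc\<in>loc e m \<times> CRW R (W - orb Q). (glue fc Q, \<lambda>P. if P \<in> orb Q then 0 else glue fc P) = fc"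
   using lQ orb_self[of Q] by (auto simp: glue_def CRW_def fun_eq_iff)
  show "(\<lambda>c. (c Q, \<lambda>P. if P \<in> orb Q then 0 else c P)) `
    {c \<in> CRW (replicate_mset m (e + 1) + R) W. degree (c Q) = e} \<subseteq> loc e m \<times> CRW R (W - orb Q)"
  proof
   fix x assume "x \<in> (\<lambda>c. (c Q, \<lambda>P. if P \<in> orb Q then 0 else c P)) `
    {c \<in> CRW (replicate_mset m (e + 1) + R) W. degree (c Q) = e}"
   then obtain c where x: "x = (c Q, \<lambda>P. if P \<in> orb Q then 0 else c P)" and c: "c \<in> CR" "{P. c P \<noteq> 0} \<subseteq> W"
    "ram_type c = replicate_mset m (e + 1) + R" and dQ: "degree (c Q) = e" by (auto simp: CRW_def)
   let ?c = "\<lambda>P. if P \<in> orb Q then 0 else c P"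
   have c': "finite {P. c P \<noteq> 0}" "\<And>P. c P \<in> no_p_terms" "\<And>P. c (frobQ P) = map_poly frob (c P)"
    using c(1) by (auto simp: CR_iff)
   have "c Q \<in> loc e m" using c'(2) dQ equivariant_funpow[OF c(1), of m Q] m by (simp add: loc_def)
   moreover have "?c \<in> CR" unfolding CR_iff
   proof (intro conjI allI)
    show "finite {P. ?c P \<noteq> 0}" using c'(1) by (rule rev_finite_subset) auto
   qed (use c' orb_frobQ[OF Q] in auto)
   moreover have "degree (c P) = e" if "P \<in> orb Q" for P
    using equivariant_funpow[OF c(1), of "l P" Q] l[OF that] dQ funpow_map_frob(1) by simp
   then have "ram_type c = replicate_mset m (e + 1) + ram_type ?c"
    using e by (intro ram_split[OF c'(1) finite_orb[OF Q] card_orb[OF Q]]) auto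
   then have "ram_type ?c = R" using c(3) by simp
   moreover have "{P. ?c P \<noteq> 0} \<subseteq> W - orb Q" using c(2) by auto
   ultimately show "x \<in> loc e m \<times> CRW R (W - orb Q)" unfolding x CRW_def by blast
  qed
  show "glue ` (loc e m \<times> CRW R (W - orb Q)) \<subseteq> {c \<in> CRW (replicate_mset m (e + 1) + R) W. degree (c Q) = e}"
  proof
   fix x assume "x \<in> glue ` (loc e m \<times> CRW R (W - orb Q))"
   then obtain f c where x: "x = glue (f, c)" and f: "f \<in> no_p_terms" "degree f = e" "(map_poly frob ^^ m) f = f"
    and c: "c \<in> CR" "{P. c P \<noteq> 0} \<subseteq> W - orb Q" "ram_type c = R" by (auto simp: loc_def CRW_def)
   have c': "finite {P. c P \<noteq> 0}" "\<And>P. c P \<in> no_p_terms" "\<And>P. c (frobQ P) = map_poly frob (c P)"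
    using c(1) by (auto simp: CR_iff)
   have c0: "c P = 0" if "P \<in> orb Q" for P using c(2) that by auto
   have G: "x ((frobQ ^^ i) Q) = (map_poly frob ^^ i) f" for i
   proof -
    have o: "(frobQ ^^ i) Q \<in> orb Q" unfolding orb_def by blast
    define j where "j = l ((frobQ ^^ i) Q)"
    have "(frobQ ^^ (j mod m)) Q = (frobQ ^^ (i mod m)) Q" unfolding Per_mod[OF Q] j_def by (rule l[OF o])
    then have "j mod m = i mod m" using inj_onD[OF Per_inj[OF Q]] m(1) by simp
    then have "(map_poly frob ^^ j) f = (map_poly frob ^^ i) f"
     using funpow_mod_eq[OF f(3), of j] funpow_mod_eq[OF f(3), of i] by simp
    then show ?thesis using o unfolding x glue_def j_def by simp
   qed
   have G': "x P = c P" if "P \<notin> orb Q" for P using that by (simp add: x glue_def)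
   have xc: "(\<lambda>P. if P \<in> orb Q then 0 else x P) = c" using G' c0 by auto
   have dx: "degree (x P) = e" if "P \<in> orb Q" for P
    using G[of "l P"] l[OF that] f(2) funpow_map_frob(1) by simp
   have "{P. x P \<noteq> 0} \<subseteq> orb Q \<union> {P. c P \<noteq> 0}" using G' by auto
   then have fin: "finite {P. x P \<noteq> 0}" using finite_orb[OF Q] c'(1) finite_subset by blast
   have "x \<in> CR" unfolding CR_iff
   proof (intro conjI allI)
    show "finite {P. x P \<noteq> 0}" by (rule fin)
    fix P
    show "x P \<in> no_p_terms"
     using G[of "l P"] l[of P] G'[of P] c'(2) no_p_terms_map_frob[OF f(1)] by (cases "P \<in> orb Q") auto
    show "x (frobQ P) = map_poly frob (x P)"
    proof (cases "P \<in> orb Q")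
     case True
     have "x ((frobQ ^^ Suc (l P)) Q) = map_poly frob (x ((frobQ ^^ l P) Q))" unfolding G by simp
     then show ?thesis using l[OF True] by simp
    next
     case False
     then show ?thesis using G' c'(3) orb_frobQ[OF Q] by simp
    qed
   qed
   moreover have "ram_type x = replicate_mset m (e + 1) + R"
    using ram_split[OF fin finite_orb[OF Q] card_orb[OF Q] e dx] unfolding xc c(3) .
   moreover have "{P. x P \<noteq> 0} \<subseteq> W"
   proof
    fix P assume "P \<in> {P. x P \<noteq> 0}"
    then show "P \<in> W" using W c(2) G'[of P] by (cases "P \<in> orb Q") auto
   qed
   ultimately show "x \<in> {c \<in> CRW (replicate_mset m (e + 1) + R) W. degree (c Q) = e}"
    using dx[OF orb_self] by (simp add: CRW_def)
  qed
 qed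
qed

lemma count_ram_type:
 assumes "finite {Q. c Q \<noteq> 0}"
 shows "count (ram_type c) (e + 1) = card {Q. c Q \<noteq> 0 \<and> degree (c Q) = e}"
proof -
 have "count (ram_type c) (e + 1) = (\<Sum>Q | Q \<in> {Q. c Q \<noteq> 0} \<and> degree (c Q) = e. 1)"
  unfolding ram_type_def count_image_mset using assms by (intro sum.cong) auto
 then show ?thesis by simp
qed

text \<open>All conjugates of \<open>Q\<close> are poles of the same order \<open>e\<close>, and
  only \<open>t\<close> points are; the pigeonhole principle bounds the period by
  \<open>t\<close>.\<close>

lemma short_period:
 assumes c: "c \<in> CR" and t: "count (ram_type c) (e + 1) = t" and Q: "degree (c Q) = e" "e \<ge> 1"
 obtains m where "m \<in> {1..t}" "Q \<in> Per m"
proof -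
 let ?S = "{Q. c Q \<noteq> 0 \<and> degree (c Q) = e}"
 have fin: "finite {Q. c Q \<noteq> 0}" using c by (simp add: CR_iff)
 have S: "finite ?S" "card ?S = t" using count_ram_type[OF fin, of e] t fin by auto
 have "(frobQ ^^ i) Q \<in> ?S" for i
 proof -
  have "degree (c ((frobQ ^^ i) Q)) = e"
   unfolding equivariant_funpow[OF c] using Q funpow_map_frob(1) by simp
  then show ?thesis using Q(2) by auto
 qed
 then have "(\<lambda>i. (frobQ ^^ i) Q) ` {..t} \<subseteq> ?S" by blast
 then have "card ((\<lambda>i. (frobQ ^^ i) Q) ` {..t}) \<le> t" using card_mono[OF S(1)] unfolding S(2) by blast
 then have "card ((\<lambda>i. (frobQ ^^ i) Q) ` {..t}) < card {..t}" by simp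
 then have "\<not> inj_on (\<lambda>i. (frobQ ^^ i) Q) {..t}" by (rule pigeonhole)
 then obtain i j where ij: "i < j" "j \<le> t" "(frobQ ^^ i) Q = (frobQ ^^ j) Q"
  unfolding inj_on_def by (metis atMost_iff linorder_neqE_nat)
 define P where "P m \<longleftrightarrow> m \<ge> 1 \<and> (frobQ ^^ m) Q = Q" for m
 have Pij: "P (j - i)" using ij funpow_cancel[of i j Q] by (simp add: P_def)
 define m where "m = (LEAST m. P m)"
 have m: "P m" "m \<le> j - i" unfolding m_def using Pij by (auto intro: LeastI Least_le)
 have "\<not> P m'" if "m' < m" for m' using that not_less_Least unfolding m_def by blast
 then have "Q \<in> Per m" using m(1) by (auto simp: Per_def P_def)
 moreover have "m \<in> {1..t}" using m ij by (auto simp: P_def)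
 ultimately show ?thesis using that by blast
qed

lemma CRW_sub: assumes "Q \<in> Per m" "m \<le> count R (e + 1)"
 shows "R = replicate_mset m (e + 1) + (R - replicate_mset m (e + 1))"
 using assms(2) by (simp add: count_le_replicate_mset_subset_eq)

lemma card_peel:
 assumes "Q \<in> Per m" "m \<le> count R (e + 1)" "e \<ge> 1" "orb Q \<subseteq> W"
 shows "card {c \<in> CRW R W. degree (c Q) = e} = card (loc e m) * card (CRW (R - replicate_mset m (e + 1)) (W - orb Q))"
  and "finite {c \<in> CRW R W. degree (c Q) = e} \<longleftrightarrow> finite (loc e m \<times> CRW (R - replicate_mset m (e + 1)) (W - orb Q))"
 using bij_betw_same_card[OF peel_bij[OF assms(1,3,4), of "R - replicate_mset m (e + 1)"]]
  bij_betw_finite[OF peel_bij[OF assms(1,3,4), of "R - replicate_mset m (e + 1)"]]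
 unfolding CRW_sub[OF assms(1,2), symmetric] card_cartesian_product by simp_all

text \<open>The free data are the coefficients at exponents up to \<open>e\<close> not divisible by
  p, each in the field of q^m elements, with the top one nonzero.\<close>

lemma bij_loc:
 assumes "e \<ge> 1" "\<not> p dvd e" "m \<ge> 1"
 defines "I \<equiv> {i \<in> {1..e}. \<not> p dvd i}"
 shows "bij_betw (\<lambda>f. \<lambda>i\<in>I. coeff f i) (loc e m)
  (PiE I (\<lambda>i. if i = e then fixed_field m - {0} else fixed_field m))"
proof -
 have eI: "e \<in> I" and finI: "finite I" using assms by auto
 have ch: "CHAR('k alg_closure) = p" using ac.char_eq by (simp add: char_k)
 define mk where "mk g = (\<Sum>i\<in>I. monom (g i) i)" for g :: "nat \<Rightarrow> 'k alg_closure"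
 have mk: "coeff (mk g) i = (if i \<in> I then g i else 0)" for g i
  using finI by (simp add: mk_def coeff_sum if_distrib cong: if_cong)
 have out: "coeff f i = 0" if "f \<in> loc e m" "i \<notin> I" for f i
 proof (cases "p dvd i")
  case True
  then show ?thesis using that by (simp add: loc_def no_p_terms_def char_k)
 next
  case False
  then have "i > e" using that(2) by (cases "i = 0") (auto simp: I_def)
  then show ?thesis using that(1) by (simp add: loc_def coeff_eq_0)
 qed
 show ?thesis
 proof (rule bij_betw_byWitness[where f' = mk])
  show "\<forall>f\<in>loc e m. mk (\<lambda>i\<in>I. coeff f i) = f"
   using out by (auto simp: poly_eq_iff mk)
  show "\<forall>g\<in>PiE I (\<lambda>i. if i = e then fixed_field m - {0} else fixed_field m). (\<lambda>i\<in>I. coeff (mk g) i) = g"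
   by (auto simp: fun_eq_iff mk PiE_def extensional_def)
  show "(\<lambda>f. \<lambda>i\<in>I. coeff f i) ` loc e m \<subseteq> PiE I (\<lambda>i. if i = e then fixed_field m - {0} else fixed_field m)"
  proof (intro image_subsetI PiE_I)
   fix f i assume f: "f \<in> loc e m" and i: "i \<in> I"
   have "(frob ^^ m) (coeff f i) = coeff f i" using f funpow_map_frob(2)[of m f i] by (simp add: loc_def)
   moreover have "coeff f e \<noteq> 0" using f assms(1) leading_coeff_neq_0[of f] by (auto simp: loc_def)
   ultimately show "(\<lambda>i\<in>I. coeff f i) i \<in> (if i = e then fixed_field m - {0} else fixed_field m)"
    using i by (auto simp: fixed_field_def)
  qed auto
  show "mk ` PiE I (\<lambda>i. if i = e then fixed_field m - {0} else fixed_field m) \<subseteq> loc e m"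
  proof (rule image_subsetI)
   fix g assume g: "g \<in> PiE I (\<lambda>i. if i = e then fixed_field m - {0} else fixed_field m)"
   have gi: "(frob ^^ m) (g i) = g i" if "i \<in> I" for i
    using PiE_mem[OF g that] by (auto simp: fixed_field_def split: if_splits)
   have ge: "g e \<noteq> 0" using PiE_mem[OF g eI] by simp
   have "degree (mk g) = e"
   proof (rule antisym)
    show "degree (mk g) \<le> e" by (rule degree_le) (auto simp: mk I_def)
    show "e \<le> degree (mk g)" using ge eI by (intro le_degree) (simp add: mk)
   qed
   moreover have "mk g \<in> no_p_terms" by (auto simp: no_p_terms_def char_k mk I_def)
   moreover have "(map_poly frob ^^ m) (mk g) = mk g"
    using gi by (auto simp: poly_eq_iff funpow_map_frob mk frob_funpow_0)
   ultimately show "mk g \<in> loc e m" by (simp add: loc_def)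
  qed
 qed
qed

lemma card_loc:
 assumes "e \<ge> 1" "\<not> p dvd e" "m \<ge> 1"
 shows "finite (loc e m)" "card (loc e m) = (q ^ m - 1) * (q ^ m) ^ (card {i \<in> {1..e}. \<not> p dvd i} - 1)"
proof -
 define I where "I = {i \<in> {1..e}. \<not> p dvd i}"
 note b = bij_loc[OF assms, folded I_def]
 have eI: "e \<in> I" and finI: "finite I" using assms by (auto simp: I_def)
 note F = card_fixed_field[OF assms(3)]
 have "0 \<in> fixed_field m" by (simp add: fixed_field_def frob_funpow_0)
 then have F1: "card (fixed_field m - {0}) = q ^ m - 1" using F by simp
 show "finite (loc e m)" using bij_betw_finite[OF b] F(1) finI by (auto intro!: finite_PiE)
 have "card (loc e m) = (\<Prod>i\<in>I. card (if i = e then fixed_field m - {0} else fixed_field m))"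
  using bij_betw_same_card[OF b] by (simp add: card_PiE finI)
 also have "\<dots> = (q ^ m - 1) * (\<Prod>i\<in>I - {e}. card (if i = e then fixed_field m - {0} else fixed_field m))"
  using eI finI F1 by (simp add: prod.remove[of I e])
 also have "(\<Prod>i\<in>I - {e}. card (if i = e then fixed_field m - {0} else fixed_field m)) = (\<Prod>i\<in>I - {e}. q ^ m)"
  using F(2) by (intro prod.cong) auto
 also have "\<dots> = (q ^ m) ^ (card I - 1)" using eI finI by simp
 finally show "card (loc e m) = (q ^ m - 1) * (q ^ m) ^ (card {i \<in> {1..e}. \<not> p dvd i} - 1)" unfolding I_def .
qed

lemma loc_empty: "e \<ge> 1 \<Longrightarrow> p dvd e \<Longrightarrow> loc e m = {}"
proof -
 assume e: "e \<ge> 1" "p dvd e"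
 have ch: "CHAR('k alg_closure) = p" using ac.char_eq by (simp add: char_k)
 have "f \<notin> loc e m" for f
 proof
  assume "f \<in> loc e m"
  then have "f \<in> no_p_terms" "degree f = e" by (auto simp: loc_def)
  then show False using no_p_terms_degree[of f] e ch by (cases "f = 0") auto
 qed
 then show ?thesis by blast
qed

lemma finite_loc: "e \<ge> 1 \<Longrightarrow> m \<ge> 1 \<Longrightarrow> finite (loc e m)"
 using card_loc(1) loc_empty by (cases "p dvd e") auto

lemma finite_Fix: "m \<ge> 1 \<Longrightarrow> finite {Q. (frobQ ^^ m) Q = Q}" "m \<ge> 1 \<Longrightarrow> card {Q. (frobQ ^^ m) Q = Q} = q ^ m + 1"
proof -
 assume m: "m \<ge> 1"
 have N: "(frobQ ^^ i) None = None" for i by (induction i) simp_all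
 have S: "(frobQ ^^ i) (Some z) = Some ((frob ^^ i) z)" for i z by (induction i) simp_all
 have "{Q. (frobQ ^^ m) Q = Q} = insert None (Some ` fixed_field m)"
 proof (rule Set.set_eqI)
  fix Q show "Q \<in> {Q. (frobQ ^^ m) Q = Q} \<longleftrightarrow> Q \<in> insert None (Some ` fixed_field m)"
   by (cases Q) (auto simp: N S fixed_field_def)
 qed
 then show "finite {Q. (frobQ ^^ m) Q = Q}" "card {Q. (frobQ ^^ m) Q = Q} = q ^ m + 1"
  using card_fixed_field[OF m] by (simp_all add: card_image)
qed

lemma finite_Per: "finite (Per m)"
 by (cases "m \<ge> 1") (auto simp: Per_def intro: finite_subset[OF _ finite_Fix(1)])

text \<open>A proper divisor of 2 or 3 is 1, so the points of exact period 2 or 3 are those fixed by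
  that power of Frobenius and not rational. Infinity is rational and drops out of the
  differences.\<close>

lemma card_Per: "card (Per 1) = q + 1" "card (Per 2) = q ^ 2 - q" "card (Per 3) = q ^ 3 - q"
proof -
 let ?F = "\<lambda>m. {Q. (frobQ ^^ m) Q = Q}"
 have 1: "Per 1 = ?F 1" by (auto simp: Per_def)
 have 2: "Per 2 = ?F 2 - ?F 1"
 proof -
  have "{1..<2::nat} = {1}" by auto
  then show ?thesis by (auto simp: Per_def)
 qed
 have 3: "Per 3 = ?F 3 - ?F 1"
 proof -
  have s: "{1..<3::nat} = {1, 2}" by auto
  have "(frobQ ^^ 1) Q = Q" if "(frobQ ^^ 3) Q = Q" "(frobQ ^^ 2) Q = Q" for Q
   using funpow_cancel[of 2 3 Q] that by simp
  then show ?thesis unfolding Per_def s by auto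
 qed
 have sub: "?F 1 \<subseteq> ?F 2" "?F 1 \<subseteq> ?F 3" by (auto simp: numeral_eq_Suc)
 show "card (Per 1) = q + 1" unfolding 1 using finite_Fix(2)[of 1] by simp
 show "card (Per 2) = q ^ 2 - q" unfolding 2 using finite_Fix[of 1] finite_Fix[of 2] sub by (subst card_Diff_subset) simp_all
 show "card (Per 3) = q ^ 3 - q" unfolding 3 using finite_Fix[of 1] finite_Fix[of 3] sub by (subst card_Diff_subset) simp_all
qed

lemma CRW_empty: "CRW {#} W = {\<lambda>_. 0}"
proof -
 have "c = (\<lambda>_. 0)" if "c \<in> CRW {#} W" for c
 proof -
  have "finite {Q. c Q \<noteq> 0}" "ram_type c = {#}" using that by (auto simp: CRW_def CR_iff)
  then show ?thesis by (auto simp: ram_type_def mset_set_empty_iff)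
 qed
 moreover have "(\<lambda>_. 0) \<in> CRW {#} W" by (simp add: CRW_def CR_iff ram_type_def)
 ultimately show ?thesis by blast
qed

lemma CRW_parts: assumes "c \<in> CRW R W" "x \<in># R" obtains Q where "Q \<in> W" "c Q \<noteq> 0" "x = degree (c Q) + 1" "x \<ge> 2"
proof -
 have c: "c \<in> CR" "finite {Q. c Q \<noteq> 0}" "ram_type c = R" "{Q. c Q \<noteq> 0} \<subseteq> W" using assms(1) by (auto simp: CRW_def CR_iff)
 obtain Q where Q: "c Q \<noteq> 0" "x = degree (c Q) + 1" using assms(2) c by (auto simp: ram_type_def)
 then have "degree (c Q) > 0" using degree_pos_pp[OF CR_D(2)[OF c(1)]] by blast
 then show ?thesis using that[of Q] Q c(4) by auto
qed

definition stable :: "'k alg_closure option set \<Rightarrow> bool" where "stable W \<longleftrightarrow> (\<forall>Q\<in>W. orb Q \<subseteq> W)"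

lemma stable_UNIV: "stable UNIV" by (simp add: stable_def)

lemma stable_Diff: assumes W: "stable W" and Q: "Q \<in> Per m" shows "stable (W - orb Q)"
 unfolding stable_def
proof (intro ballI subsetI)
 fix P P' assume P: "P \<in> W - orb Q" and P': "P' \<in> orb P"
 have inv: "(frobQ ^^ i) P \<in> orb Q \<longleftrightarrow> P \<in> orb Q" for i
  by (induction i) (simp_all add: orb_frobQ[OF Q])
 obtain i where "P' = (frobQ ^^ i) P" using P' by (auto simp: orb_def)
 then show "P' \<in> W - orb Q" using W P P' inv[of i] unfolding stable_def by blast
qed

lemma CRW_cover:
 assumes e: "e \<ge> 1" and c: "c \<in> CRW R W" and t: "count R (e + 1) = t"
 shows "{Q. c Q \<noteq> 0 \<and> degree (c Q) = e} = {Q \<in> (\<Union>m\<in>{1..t}. W \<inter> Per m). degree (c Q) = e}"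
proof -
 have c': "c \<in> CR" "{Q. c Q \<noteq> 0} \<subseteq> W" "ram_type c = R" using c by (auto simp: CRW_def)
 have "Q \<in> (\<Union>m\<in>{1..t}. W \<inter> Per m)" if Q: "c Q \<noteq> 0" "degree (c Q) = e" for Q
 proof -
  obtain m where "m \<in> {1..t}" "Q \<in> Per m" using short_period[OF c'(1) _ Q(2) e] c'(3) t by blast
  then show ?thesis using c'(2) Q by blast
 qed
 then show ?thesis using e by auto
qed

text \<open>Induction on the number of poles: a given part of \<open>R\<close> can be realised only
  at finitely many points of small period, and splitting off the orbit of such a point leaves a
  smaller multiset.\<close>

lemma finite_CRW: "stable W \<Longrightarrow> finite (CRW R W)"
proof (induction "size R" arbitrary: R W rule: less_induct)
 case less
 show ?case
 proof (cases "CRW R W = {} \<or> R = {#}")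
  case True
  then show ?thesis using CRW_empty by auto
 next
  case False
  then obtain c0 x where c0: "c0 \<in> CRW R W" "x \<in># R" by blast
  obtain Q0 where "x \<ge> 2" "Q0 \<in> W" using CRW_parts[OF c0] by blast
  then obtain e where e: "x = e + 1" "e \<ge> 1" by (metis Suc_eq_plus1 Suc_le_D Suc_le_mono numeral_2_eq_2 One_nat_def)
  define t where "t = count R (e + 1)"
  have t: "t \<ge> 1" using c0(2) e by (simp add: t_def Suc_le_eq)
  have "CRW R W \<subseteq> (\<Union>Q\<in>(\<Union>m\<in>{1..t}. W \<inter> Per m). {c \<in> CRW R W. degree (c Q) = e})"
  proof
   fix c assume c: "c \<in> CRW R W"
   obtain Q where Q: "c Q \<noteq> 0" "degree (c Q) = e" using CRW_parts[OF c c0(2)] e(1) by (metis add_right_cancel)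
   then have "Q \<in> (\<Union>m\<in>{1..t}. W \<inter> Per m)" using CRW_cover[OF e(2) c, of t] t_def by blast
   then show "c \<in> (\<Union>Q\<in>(\<Union>m\<in>{1..t}. W \<inter> Per m). {c \<in> CRW R W. degree (c Q) = e})" using c Q by blast
  qed
  moreover have "finite {c \<in> CRW R W. degree (c Q) = e}" if "Q \<in> (\<Union>m\<in>{1..t}. W \<inter> Per m)" for Q
  proof -
   obtain m where m: "m \<in> {1..t}" "Q \<in> W" "Q \<in> Per m" using \<open>Q \<in> _\<close> by blast
   have mt: "m \<le> count R (e + 1)" using m t_def by simp
   have "size (R - replicate_mset m (e + 1)) < size R"
    using CRW_sub[OF m(3) mt] m(1) by (metis add_diff_cancel_left' atLeastAtMost_iff less_add_same_cancel2 size_replicate_mset size_union zero_less_one order_less_le_trans)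
   then have "finite (CRW (R - replicate_mset m (e + 1)) (W - orb Q))"
    using less.hyps stable_Diff[OF less.prems m(3)] by blast
   then show ?thesis using card_peel(2)[OF m(3) mt e(2)] finite_loc[OF e(2)] m less.prems unfolding stable_def by auto
  qed
  moreover have "finite (\<Union>m\<in>{1..t}. W \<inter> Per m)" using finite_Per by blast
  ultimately show ?thesis by (meson finite_UN_I finite_subset)
 qed
qed

text \<open>Pairs of a family and one of its poles of order \<open>e\<close> are counted in two
  ways. Each family has \<open>t\<close> such poles, hence the factor \<open>t\<close>; with the
  pole fixed, of period \<open>m\<close>, its orbit can be split off.\<close>

theorem peel:
 assumes W: "stable W" and e: "e \<ge> 1" and t: "count R (e + 1) = t"
  and N: "\<And>m Q. m \<in> {1..t} \<Longrightarrow> Q \<in> W \<Longrightarrow> Q \<in> Per m \<Longrightarrow> card (CRW (R - replicate_mset m (e + 1)) (W - orb Q)) = N m"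
 shows "t * card (CRW R W) = (\<Sum>m=1..t. card (W \<inter> Per m) * card (loc e m) * N m)"
proof -
 let ?U = "\<Union>m\<in>{1..t}. W \<inter> Per m"
 have finU: "finite ?U" using finite_Per by blast
 have fin: "finite (CRW R W)" using W by (rule finite_CRW)
 have "t * card (CRW R W) = (\<Sum>c\<in>CRW R W. t)" by simp
 also have "\<dots> = (\<Sum>c\<in>CRW R W. \<Sum>Q | Q \<in> ?U \<and> degree (c Q) = e. 1)"
 proof (rule sum.cong[OF refl])
  fix c assume c: "c \<in> CRW R W"
  then have c': "finite {Q. c Q \<noteq> 0}" "ram_type c = R" by (auto simp: CRW_def CR_iff)
  show "t = (\<Sum>Q | Q \<in> ?U \<and> degree (c Q) = e. 1)"
   using count_ram_type[OF c'(1), of e] CRW_cover[OF e c t] c'(2) t by simp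
 qed
 also have "\<dots> = (\<Sum>Q\<in>?U. \<Sum>c | c \<in> CRW R W \<and> degree (c Q) = e. 1)"
  by (rule sum.swap_restrict[OF fin finU])
 also have "\<dots> = (\<Sum>Q\<in>?U. card {c \<in> CRW R W. degree (c Q) = e})" by simp
 also have "\<dots> = (\<Sum>m\<in>{1..t}. \<Sum>Q\<in>W \<inter> Per m. card {c \<in> CRW R W. degree (c Q) = e})"
  using finite_Per Per_unique by (intro sum.UNION_disjoint) blast+
 also have "\<dots> = (\<Sum>m\<in>{1..t}. \<Sum>Q\<in>W \<inter> Per m. card (loc e m) * N m)"
 proof (intro sum.cong refl)
  fix m Q assume m: "m \<in> {1..t}" and Q: "Q \<in> W \<inter> Per m"
  show "card {c \<in> CRW R W. degree (c Q) = e} = card (loc e m) * N m"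
   using card_peel(1)[of Q m R e W] N[of m Q] m Q W e t unfolding stable_def by auto
 qed
 also have "\<dots> = (\<Sum>m=1..t. card (W \<inter> Per m) * card (loc e m) * N m)" by (simp add: mult.assoc)
 finally show ?thesis .
qed

section \<open>Recursion in the numbers of points of each period\<close>

definition pts :: "'k alg_closure option set \<Rightarrow> (nat \<Rightarrow> nat) \<Rightarrow> bool" where
 "pts W w \<longleftrightarrow> stable W \<and> (\<forall>m. card (W \<inter> Per m) = w m)"

lemma pts_UNIV: "pts UNIV (\<lambda>m. card (Per m))" by (simp add: pts_def stable_UNIV)

text \<open>All points of the removed orbit have period \<open>m\<close> and there are
  \<open>m\<close> of them. The counts below depend on \<open>W\<close> only through the numbers
  \<open>w\<close>.\<close>

lemma pts_Diff: assumes W: "pts W w" and Q: "Q \<in> W" "Q \<in> Per m" shows "pts (W - orb Q) (w(m := w m - m))"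
proof -
 have sub: "orb Q \<subseteq> W" using W Q(1) by (simp add: pts_def stable_def)
 have "card ((W - orb Q) \<inter> Per m') = (w(m := w m - m)) m'" for m'
 proof (cases "m' = m")
  case True
  have "(W - orb Q) \<inter> Per m = W \<inter> Per m - orb Q" by blast
  moreover have "orb Q \<subseteq> W \<inter> Per m" using sub Per_orb[OF Q(2)] by blast
  ultimately show ?thesis using True W card_orb[OF Q(2)] finite_orb[OF Q(2)] by (simp add: card_Diff_subset pts_def)
 next
  case False
  have "P \<notin> Per m'" if "P \<in> orb Q" for P using Per_orb[OF Q(2) that] Per_unique False by blast
  then have "(W - orb Q) \<inter> Per m' = W \<inter> Per m'" by blast
  then show ?thesis using False W by (simp add: pts_def)
 qed
 then show ?thesis using W stable_Diff[OF _ Q(2)] by (simp add: pts_def)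
qed

lemma peel_pts:
 assumes W: "pts W w" and e: "e \<ge> 1" and t: "count R (e + 1) = t"
  and N: "\<And>m W'. m \<in> {1..t} \<Longrightarrow> pts W' (w(m := w m - m)) \<Longrightarrow> card (CRW (R - replicate_mset m (e + 1)) W') = N m"
 shows "t * card (CRW R W) = (\<Sum>m=1..t. w m * card (loc e m) * N m)"
 using peel[of W e R t N] W e t N pts_Diff[OF W] by (simp add: pts_def)

lemma count_one:
 assumes W: "pts W w" and e: "e \<ge> 1"
 shows "card (CRW {#e + 1#} W) = w 1 * card (loc e 1)"
 using peel_pts[OF W e, of "{#e + 1#}" 1 "\<lambda>_. 1"] by (simp add: CRW_empty)

text \<open>Conjugate poles have equal order, so a pole order that occurs only once belongs to a
  rational point; thus only period 1 contributes.\<close>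

lemma count_insert:
 assumes W: "pts W w" and e: "e \<ge> 1" "e + 1 \<notin># R"
  and N: "\<And>W'. pts W' (w(1 := w 1 - 1)) \<Longrightarrow> card (CRW R W') = N"
 shows "card (CRW (add_mset (e + 1) R) W) = w 1 * card (loc e 1) * N"
proof -
 have "1 * card (CRW (add_mset (e + 1) R) W) = (\<Sum>m=1..1. w m * card (loc e m) * N)"
 proof (rule peel_pts[OF W e(1), where N = "\<lambda>_. N"])
  show "count (add_mset (e + 1) R) (e + 1) = 1" using e(2) by (simp add: not_in_iff)
  fix m W' assume "m \<in> {1..1::nat}" "pts W' (w(m := w m - m))"
  then show "card (CRW (add_mset (e + 1) R - replicate_mset m (e + 1)) W') = N" using N[of W'] by simp
 qed
 then show ?thesis by simp
qed

text \<open>Either two rational poles, taken in both orders, or one conjugate pair, counted at both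
  its members: \<open>w 2\<close> is a number of points, not of pairs.\<close>

lemma count_two_equal:
 assumes W: "pts W w" and e: "e \<ge> 1"
 shows "2 * card (CRW {#e + 1, e + 1#} W) = w 1 * card (loc e 1) * ((w 1 - 1) * card (loc e 1)) + w 2 * card (loc e 2)"
proof -
 have "2 * card (CRW {#e + 1, e + 1#} W) =
   (\<Sum>m=1..2. w m * card (loc e m) * (if m = 1 then (w 1 - 1) * card (loc e 1) else 1))"
 proof (rule peel_pts[OF W e])
  show "count {#e + 1, e + 1#} (e + 1) = 2" by simp
  fix m W' assume m: "m \<in> {1..2::nat}" "pts W' (w(m := w m - m))"
  have "m = 1 \<or> m = 2" using m(1) by auto
  then show "card (CRW ({#e + 1, e + 1#} - replicate_mset m (e + 1)) W') = (if m = 1 then (w 1 - 1) * card (loc e 1) else 1)"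
  proof
   assume "m = 1"
   then show ?thesis using count_one[OF m(2) e] by simp
  next
   assume "m = 2"
   then show ?thesis by (simp add: CRW_empty numeral_2_eq_2)
  qed
 qed
 moreover have "{1..2::nat} = {1, 2}" by auto
 ultimately show ?thesis by simp
qed

text \<open>The summands come from a rational pole followed by two rational ones or by a conjugate
  pair, a conjugate pair followed by a rational pole, and a conjugate triple. The factor 6 combines
  the 3 choices of the first pole with the factor 2 of \<open>count_two_equal\<close>.\<close>

lemma count_three_equal:
 assumes W: "pts W w" and e: "e \<ge> 1"
 shows "6 * card (CRW {#e + 1, e + 1, e + 1#} W) =
  w 1 * card (loc e 1) * ((w 1 - 1) * card (loc e 1) * ((w 1 - 2) * card (loc e 1)) + w 2 * card (loc e 2)) +
  2 * (w 2 * card (loc e 2) * (w 1 * card (loc e 1))) + 2 * (w 3 * card (loc e 3))"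
proof -
 define T where "T = card (CRW {#e + 1, e + 1#} W)"
 \<comment> \<open>The number of families left after removing one rational pole. The halving is
   exact whenever some set realises the reduced numbers of points; if there is no rational point,
   the summand containing \<open>N1\<close> vanishes.\<close>
 define N1 where "N1 = ((w 1 - 1) * card (loc e 1) * ((w 1 - 2) * card (loc e 1)) + w 2 * card (loc e 2)) div 2"
 define N where "N m = (if m = 1 then N1 else if m = 2 then w 1 * card (loc e 1) else 1)" for m :: nat
 have two: "2 * card (CRW {#e + 1, e + 1#} W') = (w 1 - 1) * card (loc e 1) * ((w 1 - 2) * card (loc e 1)) + w 2 * card (loc e 2)"
  if "pts W' (w(1 := w 1 - 1))" for W' using count_two_equal[OF that e] by (simp add: numeral_2_eq_2)
 have "3 * card (CRW {#e + 1, e + 1, e + 1#} W) = (\<Sum>m=1..3. w m * card (loc e m) * N m)"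
 proof (rule peel_pts[OF W e])
  show "count {#e + 1, e + 1, e + 1#} (e + 1) = 3" by simp
  fix m W' assume m: "m \<in> {1..3::nat}" "pts W' (w(m := w m - m))"
  have "m = 1 \<or> m = 2 \<or> m = 3" using m(1) by auto
  then show "card (CRW ({#e + 1, e + 1, e + 1#} - replicate_mset m (e + 1)) W') = N m"
  proof (elim disjE)
   assume m1: "m = 1"
   then have "2 * card (CRW {#e + 1, e + 1#} W') = 2 * N1 \<or> True" by simp
   have "card (CRW {#e + 1, e + 1#} W') = N1" unfolding N1_def two[OF m(2)[unfolded m1], symmetric] by simp
   then show ?thesis using m1 by (simp add: N_def)
  next
   assume "m = 2"
   then show ?thesis using count_one[OF m(2) e] by (simp add: N_def numeral_2_eq_2)
  next
   assume "m = 3"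
   then show ?thesis by (simp add: CRW_empty N_def numeral_3_eq_3)
  qed
 qed
 moreover have "{1..3::nat} = {1, 2, 3}" by auto
 ultimately have s: "3 * card (CRW {#e + 1, e + 1, e + 1#} W) =
   w 1 * card (loc e 1) * N1 + w 2 * card (loc e 2) * (w 1 * card (loc e 1)) + w 3 * card (loc e 3)"
  by (simp add: N_def)
 show ?thesis
 proof (cases "w 1 = 0")
  case True
  then show ?thesis using s by simp
 next
  case False
  then obtain Q where "Q \<in> W" "Q \<in> Per 1" using W unfolding pts_def by (metis IntE card.empty ex_in_conv)
  then have "pts (W - orb Q) (w(1 := w 1 - 1))" by (rule pts_Diff[OF W])
  then have n: "2 * N1 = (w 1 - 1) * card (loc e 1) * ((w 1 - 2) * card (loc e 1)) + w 2 * card (loc e 2)"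
   unfolding N1_def using two by (metis dvd_mult_div_cancel dvd_triv_left)
  have "6 * card (CRW {#e + 1, e + 1, e + 1#} W) = w 1 * card (loc e 1) * (2 * N1) +
    2 * (w 2 * card (loc e 2) * (w 1 * card (loc e 1))) + 2 * (w 3 * card (loc e 3))" using s by simp
  then show ?thesis unfolding n .
 qed
qed

end

section \<open>Weighted counts\<close>

text \<open>Four parts would already add up to at least 8; sorting normalises the order of the
  parts.\<close>

lemma multiset_parts_cases:
 assumes "\<forall>x\<in>#R. x \<ge> (2::nat)" "sum_mset R \<le> 7"
 obtains "R = {#}" | x where "R = {#x#}" | x y where "R = {#x, y#}" "2 \<le> x" "x \<le> y"
  | x y z where "R = {#x, y, z#}" "2 \<le> x" "x \<le> y" "y \<le> z"
proof -
 define xs where "xs = sorted_list_of_multiset R"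
 have R: "R = mset xs" by (simp add: xs_def)
 have s: "sorted xs" by (simp add: xs_def)
 show ?thesis
 proof (cases xs)
  case Nil
  then show ?thesis using that(1) R by simp
 next
  case xs: (Cons x xs1)
  show ?thesis
  proof (cases xs1)
   case Nil
   then show ?thesis using that(2) R xs by simp
  next
   case xs1: (Cons y xs2)
   show ?thesis
   proof (cases xs2)
    case Nil
    then show ?thesis using that(3)[of x y] R xs xs1 s assms(1) by simp
   next
    case xs2: (Cons z xs3)
    show ?thesis
    proof (cases xs3)
     case Nil
     then show ?thesis using that(4)[of x y z] R xs xs1 xs2 s assms(1) by simp
    next
     case (Cons w ws)
     then have "R = mset ws + {#x, y, z, w#}" using R xs xs1 xs2 by simp
     then show ?thesis using assms by simp
    qed
   qed
  qed
 qed
qed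

context finite_base
begin

lemma canon_CR: "canon u \<in> CR" using canon[of u] by blast

lemma canon_surj: assumes "d \<in> CR" obtains u where "canon u = d"
 using canon_eqI[OF assms, of "cst 0 + rep d" 0] AS_0[OF prime_CHAR_ratfun] by simp

lemma ram_type_eq_empty: "c \<in> CR \<Longrightarrow> ram_type c = {#} \<longleftrightarrow> c = (\<lambda>_. 0)"
 using CRW_empty[of UNIV] unfolding CRW_def by auto

lemma union_counts:
 assumes "finite Rs" "{#} \<notin> Rs"
 shows "weighted_count (AS_curve ` {u. ram_type (canon u) \<in> Rs}) = (\<Sum>R\<in>Rs. real (card (CRW R UNIV)) / real (q ^ 3 - q))"
proof -
 define D where "D = (\<Union>R\<in>Rs. CRW R UNIV)"
 have fin: "finite (CRW R UNIV)" for R using stable_UNIV by (rule finite_CRW)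
 have D: "canon u \<in> D \<longleftrightarrow> ram_type (canon u) \<in> Rs" for u using canon_CR by (auto simp: D_def CRW_def)
 have "weighted_count (AS_curve ` {u. canon u \<in> D}) = real (card D) / real (q ^ 3 - q)"
 proof (rule mass_formula)
  show "finite D" using assms(1) fin by (simp add: D_def)
  show "D \<subseteq> CR - {\<lambda>_. 0}"
  proof
   fix c assume "c \<in> D"
   then have c: "c \<in> CR" "ram_type c \<in> Rs" by (auto simp: D_def CRW_def)
   then have "ram_type c \<noteq> {#}" using assms(2) by metis
   then show "c \<in> CR - {\<lambda>_. 0}" using ram_type_eq_empty[OF c(1)] c(1) by blast
  qed
  show "canon u \<in> D" if "equivalent u v" "canon v \<in> D" for u v
   using that ram_type_equivalent[OF that(1)] unfolding D by simp
 qed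
 moreover have "card D = (\<Sum>R\<in>Rs. card (CRW R UNIV))"
  unfolding D_def using assms(1) fin by (intro card_UN_disjoint) (auto simp: CRW_def)
 ultimately show ?thesis unfolding D by (simp add: sum_divide_distrib)
qed

lemma Z_ram_eq: "R \<noteq> {#} \<Longrightarrow> Z_ram k R = real (card (CRW R UNIV)) / real (q ^ 3 - q)"
proof -
 assume R: "R \<noteq> {#}"
 have "{C \<in> (AS_curves :: 'k ratfun poly curve_aut set). has_ramification_data C R} = AS_curve ` {u. ram_type (canon u) \<in> {R}}"
 proof (intro equalityI subsetI)
  fix C assume "C \<in> {C \<in> (AS_curves :: 'k ratfun poly curve_aut set). has_ramification_data C R}"
  then obtain u where "C = AS_curve u" "has_ramification_data (AS_curve u) R" by (auto simp: AS_curves_def)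
  then show "C \<in> AS_curve ` {u. ram_type (canon u) \<in> {R}}" by (auto simp: has_ramification_data_iff)
 next
  fix C assume "C \<in> AS_curve ` {u. ram_type (canon u) \<in> {R}}"
  then obtain u where u: "C = AS_curve u" "ram_type (canon u) = R" by auto
  then have "canon u \<noteq> (\<lambda>_. 0)" using R ram_type_eq_empty[OF canon_CR] by metis
  then show "C \<in> {C \<in> (AS_curves :: 'k ratfun poly curve_aut set). has_ramification_data C R}"
   using u by (simp add: AS_curves_iff has_ramification_data_iff)
 qed
 then show ?thesis unfolding Z_ram_def using union_counts[of "{R}"] R by simp
qed

lemma genus_sum:
 assumes g: "2 * g = (p - 1) * m" and u: "canon u \<noteq> (\<lambda>_. 0)"
 shows "has_genus constants (AS_field u) g \<longleftrightarrow> sum_mset (ram_type (canon u)) = m + 2"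
proof -
 have "2 * g + 2 * (p - 1) = (p - 1) * (m + 2)" unfolding g by (simp only: distrib_left mult.commute)
 then have "has_genus constants (AS_field u) g \<longleftrightarrow> (p - 1) * (m + 2) = (p - 1) * sum_mset (ram_type (canon u))"
  unfolding has_genus_iff[OF u] by (simp only:)
 moreover have "p - 1 \<noteq> 0" using p_gt_1 by simp
 ultimately show ?thesis unfolding mult_cancel1 by auto
qed

text \<open>In units of \<open>(p - 1) / 2\<close> the genus is \<open>m\<close>, and the
  ramification data add up to \<open>m + 2\<close>. \<open>Rs\<close> lists all candidates; one of
  them occurs iff its count is nonzero, which later removes \<open>{#6#}\<close> when
  \<open>p = 5\<close>.\<close>

lemma genus_class:
 assumes g: "2 * g = (p - 1) * m"
  and Rs: "\<And>c. c \<in> CR \<Longrightarrow> c \<noteq> (\<lambda>_. 0) \<Longrightarrow> sum_mset (ram_type c) = m + 2 \<Longrightarrow> ram_type c \<in> Rs"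
  and Rs': "\<And>R. R \<in> Rs \<Longrightarrow> R \<noteq> {#} \<and> sum_mset R = m + 2" and fin: "finite Rs"
 shows "Z_genus k g = (\<Sum>R\<in>Rs. Z_ram k R)" "ramification_data_of_genus k g = {R \<in> Rs. Z_ram k R \<noteq> 0}"
proof -
 have iff: "canon u \<noteq> (\<lambda>_. 0) \<and> has_genus constants (AS_field u) g \<longleftrightarrow> ram_type (canon u) \<in> Rs" for u
 proof
  assume "canon u \<noteq> (\<lambda>_. 0) \<and> has_genus constants (AS_field u) g"
  then show "ram_type (canon u) \<in> Rs" using genus_sum[OF g, of u] Rs[OF canon_CR] by blast
 next
  assume R: "ram_type (canon u) \<in> Rs"
  then have u: "canon u \<noteq> (\<lambda>_. 0)" using Rs' ram_type_eq_empty[OF canon_CR] by blast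
  then show "canon u \<noteq> (\<lambda>_. 0) \<and> has_genus constants (AS_field u) g" using genus_sum[OF g u] Rs'[OF R] by simp
 qed
 have fst: "fst (AS_curve u) = AS_field u" for u :: "'k ratfun" by (simp add: AS_curve_def)
 have set: "{C \<in> (AS_curves :: 'k ratfun poly curve_aut set). has_genus constants (fst C) g} = AS_curve ` {u. ram_type (canon u) \<in> Rs}"
 proof (intro equalityI subsetI)
  fix C assume C: "C \<in> {C \<in> (AS_curves :: 'k ratfun poly curve_aut set). has_genus constants (fst C) g}"
  then obtain u where u: "C = AS_curve u" by (auto simp: AS_curves_def)
  then have "canon u \<noteq> (\<lambda>_. 0) \<and> has_genus constants (AS_field u) g" using C fst by (simp add: AS_curves_iff)
  then show "C \<in> AS_curve ` {u. ram_type (canon u) \<in> Rs}" using iff u by blast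
 next
  fix C assume "C \<in> AS_curve ` {u. ram_type (canon u) \<in> Rs}"
  then obtain u where u: "C = AS_curve u" "ram_type (canon u) \<in> Rs" by auto
  then have "canon u \<noteq> (\<lambda>_. 0) \<and> has_genus constants (AS_field u) g" using iff by blast
  then show "C \<in> {C \<in> (AS_curves :: 'k ratfun poly curve_aut set). has_genus constants (fst C) g}"
   using u fst by (simp add: AS_curves_iff)
 qed
 have ne: "{#} \<notin> Rs" using Rs' by blast
 have "Z_genus k g = (\<Sum>R\<in>Rs. real (card (CRW R UNIV)) / real (q ^ 3 - q))"
  unfolding Z_genus_def set by (rule union_counts[OF fin ne])
 also have "\<dots> = (\<Sum>R\<in>Rs. Z_ram k R)" using Rs' by (intro sum.cong refl) (simp add: Z_ram_eq)
 finally show "Z_genus k g = (\<Sum>R\<in>Rs. Z_ram k R)" .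
 have "q ^ 1 < q ^ 3" using q_gt_1 by (intro power_strict_increasing) auto
 then have q3: "real (q ^ 3 - q) \<noteq> 0" by simp
 have Z: "Z_ram k R \<noteq> 0 \<longleftrightarrow> CRW R UNIV \<noteq> {}" if "R \<in> Rs" for R
  using Z_ram_eq[of R] Rs'[OF that] q3 finite_CRW[OF stable_UNIV, of R] by simp
 have "R \<in> ramification_data_of_genus k g \<longleftrightarrow> R \<in> Rs \<and> CRW R UNIV \<noteq> {}" for R
 proof
  assume "R \<in> ramification_data_of_genus k g"
  then obtain C where C: "C \<in> {C \<in> (AS_curves :: 'k ratfun poly curve_aut set). has_genus constants (fst C) g}"
   "has_ramification_data C R" unfolding ramification_data_of_genus_def by blast
  then obtain u where u: "C = AS_curve u" "ram_type (canon u) \<in> Rs" unfolding set by blast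
  then have "R = ram_type (canon u)" using C(2) has_ramification_data_iff by blast
  moreover have "canon u \<in> CRW (ram_type (canon u)) UNIV" using canon_CR by (simp add: CRW_def)
  ultimately show "R \<in> Rs \<and> CRW R UNIV \<noteq> {}" using u by blast
 next
  assume R: "R \<in> Rs \<and> CRW R UNIV \<noteq> {}"
  then obtain c where c: "c \<in> CR" "ram_type c = R" unfolding CRW_def by blast
  obtain u where u: "canon u = c" using canon_surj[OF c(1)] .
  have "AS_curve u \<in> {C \<in> (AS_curves :: 'k ratfun poly curve_aut set). has_genus constants (fst C) g}"
   unfolding set using u c R by blast
  moreover have "has_ramification_data (AS_curve u) R" using u c by (simp add: has_ramification_data_iff)
  ultimately show "R \<in> ramification_data_of_genus k g" unfolding ramification_data_of_genus_def by blast
 qed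
 then show "ramification_data_of_genus k g = {R \<in> Rs. Z_ram k R \<noteq> 0}" using Z by blast
qed

lemma ram_type_parts: "c \<in> CR \<Longrightarrow> \<forall>x\<in>#ram_type c. x \<ge> 2"
proof
 fix x assume c: "c \<in> CR" and x: "x \<in># ram_type c"
 have "c \<in> CRW (ram_type c) UNIV" using c by (simp add: CRW_def)
 then show "x \<ge> 2" using CRW_parts[OF _ x] by blast
qed

section \<open>Explicit counts for small ramification data\<close>

lemma card_loc_small: "1 \<le> e \<Longrightarrow> e < p \<Longrightarrow> m \<ge> 1 \<Longrightarrow> card (loc e m) = (q ^ m - 1) * (q ^ m) ^ (e - 1)"
proof -
 assume e: "1 \<le> e" "e < p" "m \<ge> 1"
 have "{i \<in> {1..e}. \<not> p dvd i} = {1..e}" using e by (auto dest: dvd_imp_le)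
 moreover have "\<not> p dvd e" using e by (auto dest: dvd_imp_le)
 ultimately show ?thesis using card_loc(2)[of e m] e by simp
qed

lemma real_diffs: "real (q - 1) = real q - 1" "real (q ^ 2 - 1) = real q ^ 2 - 1" "real (q ^ 3 - 1) = real q ^ 3 - 1"
 "real (q ^ 2 - q) = real q ^ 2 - real q" "real (q ^ 3 - q) = real q ^ 3 - real q"
proof -
 have a: "1 \<le> q" "1 \<le> q ^ 2" "1 \<le> q ^ 3" using q_gt_1 by simp_all
 have b: "q \<le> q ^ 2" "q \<le> q ^ 3" using q_gt_1 by (simp_all add: self_le_power)
 show "real (q - 1) = real q - 1" "real (q ^ 2 - 1) = real q ^ 2 - 1" "real (q ^ 3 - 1) = real q ^ 3 - 1"
  "real (q ^ 2 - q) = real q ^ 2 - real q" "real (q ^ 3 - q) = real q ^ 3 - real q"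
  using of_nat_diff[OF a(1), where 'a = real] of_nat_diff[OF a(2), where 'a = real] of_nat_diff[OF a(3), where 'a = real]
   of_nat_diff[OF b(1), where 'a = real] of_nat_diff[OF b(2), where 'a = real] by simp_all
qed

lemma real_loc: "1 \<le> e \<Longrightarrow> e < p \<Longrightarrow> real (card (loc e 1)) = (real q - 1) * real q ^ (e - 1)"
 "1 \<le> e \<Longrightarrow> e < p \<Longrightarrow> real (card (loc e 2)) = (real q ^ 2 - 1) * (real q ^ 2) ^ (e - 1)"
 "1 \<le> e \<Longrightarrow> e < p \<Longrightarrow> real (card (loc e 3)) = (real q ^ 3 - 1) * (real q ^ 3) ^ (e - 1)"
 by (simp_all only: card_loc_small one_le_numeral order_refl of_nat_mult of_nat_power real_diffs power_one_right)

lemma count_pair: assumes "1 \<le> a" "1 \<le> b" "a \<noteq> b"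
 shows "card (CRW {#a + 1, b + 1#} UNIV) = (q + 1) * card (loc a 1) * (q * card (loc b 1))"
proof -
 have "card (CRW {#b + 1#} W') = q * card (loc b 1)" if "pts W' ((\<lambda>m. card (Per m))(1 := card (Per 1) - 1))" for W'
  using count_one[OF that assms(2)] card_Per(1) by simp
 then have "card (CRW {#a + 1, b + 1#} UNIV) = card (Per 1) * card (loc a 1) * (q * card (loc b 1))"
  using assms by (intro count_insert[OF pts_UNIV]) auto
 then show ?thesis by (simp only: card_Per)
qed

lemma Z_ram_eqI:
 assumes "R \<noteq> {#}" "real (card (CRW R UNIV)) = (real q ^ 3 - real q) * z"
 shows "Z_ram k R = z"
proof -
 have "q ^ 1 < q ^ 3" using q_gt_1 by (intro power_strict_increasing) auto
 then have "real (q ^ 3 - q) \<noteq> 0" by simp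
 then show ?thesis using Z_ram_eq[OF assms(1)] assms(2) unfolding real_diffs by simp
qed

text \<open>The pole is one of the \<open>q + 1\<close> rational points and carries one of
  \<open>(q - 1) q^(e - 1)\<close> principal parts, as no exponent is lost for \<open>e < p\<close>;
  dividing by \<open>q^3 - q\<close> leaves \<open>q^(e - 2)\<close>.\<close>

lemma Z_single:
 assumes "2 \<le> e" "e < p"
 shows "Z_ram k {#e + 1#} = real q ^ (e - 2)"
proof (rule Z_ram_eqI)
 obtain t where t: "e = Suc (Suc t)" using assms(1) by (metis Suc_le_D Suc_le_mono numeral_2_eq_2)
 have "real (card (CRW {#e + 1#} UNIV)) = (real q + 1) * real (card (loc e 1))"
 proof -
  have "1 \<le> e" using assms(1) by simp
  then have "card (CRW {#e + 1#} UNIV) = (q + 1) * card (loc e 1)"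
   using count_one[OF pts_UNIV] by (simp only: card_Per)
  then show ?thesis by (simp only: of_nat_mult of_nat_add of_nat_1)
 qed
 also have "\<dots> = (real q ^ 3 - real q) * real q ^ (e - 2)"
 proof -
  have l: "real (card (loc e 1)) = (real q - 1) * real q ^ Suc t" using real_loc(1)[of e] assms t by simp
  have "e - 2 = t" using t by simp
  then show ?thesis unfolding l by (simp add: algebra_simps power3_eq_cube)
 qed
 finally show "real (card (CRW {#e + 1#} UNIV)) = (real q ^ 3 - real q) * real q ^ (e - 2)" .
qed simp

text \<open>Different orders make both poles rational, which gives \<open>(q + 1) q\<close>
  positions and \<open>(q - 1)^2 q^(a + b - 2)\<close> principal parts.\<close>

lemma Z_pair:
 assumes "1 \<le> a" "a < b" "b < p"
 shows "Z_ram k {#a + 1, b + 1#} = real q ^ (a + b - 1) - real q ^ (a + b - 2)"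
proof (rule Z_ram_eqI)
 obtain s t where st: "a = Suc s" "b = Suc (Suc t)" using assms by (metis Suc_le_D One_nat_def less_imp_Suc_add add_Suc)
 have "real (card (CRW {#a + 1, b + 1#} UNIV)) = (real q + 1) * real (card (loc a 1)) * (real q * real (card (loc b 1)))"
 proof -
  have ab: "1 \<le> b" "a \<noteq> b" using assms by auto
  show ?thesis by (simp only: count_pair[OF assms(1) ab] of_nat_mult of_nat_add of_nat_1)
 qed
 also have "\<dots> = (real q ^ 3 - real q) * (real q ^ (a + b - 1) - real q ^ (a + b - 2))"
 proof -
  have l: "real (card (loc a 1)) = (real q - 1) * real q ^ s" "real (card (loc b 1)) = (real q - 1) * real q ^ Suc t"
   using real_loc(1)[of a] real_loc(1)[of b] assms st by simp_all
  have "a + b - 1 = Suc (Suc (s + t))" "a + b - 2 = Suc (s + t)" using st by simp_all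
  then show ?thesis unfolding l by (simp add: algebra_simps power3_eq_cube power_add)
 qed
 finally show "real (card (CRW {#a + 1, b + 1#} UNIV)) = (real q ^ 3 - real q) * (real q ^ (a + b - 1) - real q ^ (a + b - 2))" .
qed simp

text \<open>Rational pairs and conjugate pairs contribute equally to the doubled count, each
  \<open>(q^3 - q) (q - 1) q^(2 e - 2)\<close>.\<close>

lemma Z_equal_pair:
 assumes "1 \<le> e" "e < p"
 shows "Z_ram k {#e + 1, e + 1#} = real q ^ (2 * e - 1) - real q ^ (2 * e - 2)"
proof (rule Z_ram_eqI)
 obtain t where t: "e = Suc t" using assms(1) by (metis Suc_le_D One_nat_def)
 have "2 * card (CRW {#e + 1, e + 1#} UNIV) = (q + 1) * card (loc e 1) * ((q + 1 - 1) * card (loc e 1)) + (q ^ 2 - q) * card (loc e 2)"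
  using count_two_equal[OF pts_UNIV assms(1)] by (simp only: card_Per)
 then have "real (2 * card (CRW {#e + 1, e + 1#} UNIV)) = real ((q + 1) * card (loc e 1) * (q * card (loc e 1)) + (q ^ 2 - q) * card (loc e 2))"
  by simp
 then have "2 * real (card (CRW {#e + 1, e + 1#} UNIV)) =
   (real q + 1) * ((real q - 1) * real q ^ t) * (real q * ((real q - 1) * real q ^ t)) + (real q ^ 2 - real q) * ((real q ^ 2 - 1) * (real q ^ t * real q ^ t))"
 proof -
  have "(real q ^ 2) ^ t = real q ^ t * real q ^ t" by (simp add: power2_eq_square power_mult_distrib)
  then have l: "real (card (loc e 1)) = (real q - 1) * real q ^ t" "real (card (loc e 2)) = (real q ^ 2 - 1) * (real q ^ t * real q ^ t)"
   using real_loc(1,2)[OF assms] t by simp_all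
  then show ?thesis using \<open>real (2 * card (CRW {#e + 1, e + 1#} UNIV)) = _\<close>
   by (simp only: of_nat_mult of_nat_add of_nat_numeral of_nat_1 real_diffs l)
 qed
 also have "\<dots> = 2 * ((real q ^ 3 - real q) * (real q * (real q ^ t * real q ^ t) - real q ^ t * real q ^ t))"
  by (simp add: algebra_simps power2_eq_square power3_eq_cube)
 finally have *: "2 * real (card (CRW {#e + 1, e + 1#} UNIV)) =
  2 * ((real q ^ 3 - real q) * (real q * (real q ^ t * real q ^ t) - real q ^ t * real q ^ t))" .
 have "2 * e - 1 = Suc (t + t)" "2 * e - 2 = t + t" using t by simp_all
 then have pw: "real q ^ (2 * e - 1) = real q * (real q ^ t * real q ^ t)" "real q ^ (2 * e - 2) = real q ^ t * real q ^ t"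
  by (simp_all only: power_Suc power_add)
 show "real (card (CRW {#e + 1, e + 1#} UNIV)) = (real q ^ 3 - real q) * (real q ^ (2 * e - 1) - real q ^ (2 * e - 2))"
  unfolding pw using * by linarith
qed simp

text \<open>A simple pole carries just one nonzero coefficient. The three poles may all be rational,
  consist of a rational one and a conjugate pair, or form a conjugate triple.\<close>

lemma Z_222: "Z_ram k {#2, 2, 2#} = real q ^ 3 - real q ^ 2"
proof (rule Z_ram_eqI)
 have l: "real (card (loc 1 1)) = real q - 1" "real (card (loc 1 2)) = real q ^ 2 - 1" "real (card (loc 1 3)) = real q ^ 3 - 1"
  using real_loc[of 1] p_gt_1 by simp_all
 have "6 * card (CRW {#1 + 1, 1 + 1, 1 + 1#} UNIV) =
  (q + 1) * card (loc 1 1) * ((q + 1 - 1) * card (loc 1 1) * ((q + 1 - 2) * card (loc 1 1)) + (q ^ 2 - q) * card (loc 1 2)) +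
  2 * ((q ^ 2 - q) * card (loc 1 2) * ((q + 1) * card (loc 1 1))) + 2 * ((q ^ 3 - q) * card (loc 1 3))"
  using count_three_equal[OF pts_UNIV order_refl] by (simp only: card_Per)
 moreover have "q + 1 - 2 = q - 1" "q + 1 - 1 = q" by simp_all
 ultimately have "real (6 * card (CRW {#2, 2, 2#} UNIV)) = real (
  (q + 1) * card (loc 1 1) * (q * card (loc 1 1) * ((q - 1) * card (loc 1 1)) + (q ^ 2 - q) * card (loc 1 2)) +
  2 * ((q ^ 2 - q) * card (loc 1 2) * ((q + 1) * card (loc 1 1))) + 2 * ((q ^ 3 - q) * card (loc 1 3)))"
  by (simp only: one_add_one)
 then have "6 * real (card (CRW {#2, 2, 2#} UNIV)) =
  (real q + 1) * (real q - 1) * (real q * (real q - 1) * ((real q - 1) * (real q - 1)) + (real q ^ 2 - real q) * (real q ^ 2 - 1)) +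
  2 * ((real q ^ 2 - real q) * (real q ^ 2 - 1) * ((real q + 1) * (real q - 1))) + 2 * ((real q ^ 3 - real q) * (real q ^ 3 - 1))"
  by (simp only: of_nat_mult of_nat_add of_nat_numeral of_nat_1 real_diffs l)
 also have "\<dots> = 6 * ((real q ^ 3 - real q) * (real q ^ 3 - real q ^ 2))"
  by (simp add: algebra_simps power2_eq_square power3_eq_cube)
 finally show "real (card (CRW {#2, 2, 2#} UNIV)) = (real q ^ 3 - real q) * (real q ^ 3 - real q ^ 2)" by simp
qed simp

text \<open>The double pole is the only one of its order, hence rational. Splitting it off leaves q
  rational points and still \<open>q^2 - q\<close> points of period 2 for the two simple
  poles.\<close>

lemma Z_223: assumes "p > 2" shows "Z_ram k {#2, 2, 3#} = real q ^ 4 - 2 * real q ^ 3 + real q ^ 2"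
proof (rule Z_ram_eqI)
 have l: "real (card (loc 1 1)) = real q - 1" "real (card (loc 1 2)) = real q ^ 2 - 1" "real (card (loc 2 1)) = (real q - 1) * real q"
  using real_loc[of 1] real_loc(1)[of 2] assms by simp_all
 have "card (CRW {#2, 2#} W') = q ^ 2 * (q - 1) ^ 2" if W': "pts W' ((\<lambda>m. card (Per m))(1 := card (Per 1) - 1))" for W'
 proof -
  have "2 * card (CRW {#1 + 1, 1 + 1#} W') = q * card (loc 1 1) * ((q - 1) * card (loc 1 1)) + (q ^ 2 - q) * card (loc 1 2)"
   using count_two_equal[OF W' order_refl] card_Per by simp
  then have "2 * card (CRW {#2, 2#} W') = q * card (loc 1 1) * ((q - 1) * card (loc 1 1)) + (q ^ 2 - q) * card (loc 1 2)"
   by (simp only: one_add_one)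
  then have "real (2 * card (CRW {#2, 2#} W')) = real (q * card (loc 1 1) * ((q - 1) * card (loc 1 1)) + (q ^ 2 - q) * card (loc 1 2))"
   by (simp only:)
  also have "\<dots> = real q * (real q - 1) * ((real q - 1) * (real q - 1)) + (real q ^ 2 - real q) * (real q ^ 2 - 1)"
   by (simp only: of_nat_mult of_nat_add real_diffs l)
  also have "\<dots> = 2 * (real q ^ 2 * (real q - 1) ^ 2)" by (simp add: algebra_simps power2_eq_square)
  also have "\<dots> = real (2 * (q ^ 2 * (q - 1) ^ 2))" by (simp only: of_nat_mult of_nat_power real_diffs of_nat_numeral)
  finally have "2 * card (CRW {#2, 2#} W') = 2 * (q ^ 2 * (q - 1) ^ 2)" by (simp only: of_nat_eq_iff)
  then show ?thesis by simp
 qed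
 then have "card (CRW (add_mset (2 + 1) {#2, 2#}) UNIV) = card (Per 1) * card (loc 2 1) * (q ^ 2 * (q - 1) ^ 2)"
  by (intro count_insert[OF pts_UNIV]) auto
 moreover have "add_mset (2 + 1) {#2, 2#} = {#2, 2, 3 :: nat#}" by (simp add: add_mset_commute)
 ultimately have "real (card (CRW {#2, 2, 3#} UNIV)) = real ((q + 1) * card (loc 2 1) * (q ^ 2 * (q - 1) ^ 2))"
  by (simp only: card_Per)
 also have "\<dots> = (real q + 1) * ((real q - 1) * real q) * (real q ^ 2 * (real q - 1) ^ 2)"
  by (simp only: of_nat_mult of_nat_add of_nat_power of_nat_1 real_diffs l)
 also have "\<dots> = (real q ^ 3 - real q) * (real q ^ 4 - 2 * real q ^ 3 + real q ^ 2)"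
  by (simp add: algebra_simps power2_eq_square power3_eq_cube power4_eq_xxxx)
 finally show "real (card (CRW {#2, 2, 3#} UNIV)) = (real q ^ 3 - real q) * (real q ^ 4 - 2 * real q ^ 3 + real q ^ 2)" .
qed simp

lemma Z_values:
 assumes p: "p \<ge> 5"
 shows "Z_ram k {#3#} = 1" "Z_ram k {#4#} = real q" "Z_ram k {#5#} = real q ^ 2"
  "Z_ram k {#2, 2#} = real q - 1" "Z_ram k {#3, 3#} = real q ^ 3 - real q ^ 2"
  "Z_ram k {#2, 3#} = real q ^ 2 - real q" "Z_ram k {#2, 4#} = real q ^ 3 - real q ^ 2"
  "Z_ram k {#2, 5#} = real q ^ 4 - real q ^ 3" "Z_ram k {#3, 4#} = real q ^ 4 - real q ^ 3"
  "p \<ge> 7 \<Longrightarrow> Z_ram k {#6#} = real q ^ 3" "p \<ge> 7 \<Longrightarrow> Z_ram k {#7#} = real q ^ 4"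
  "p = 5 \<Longrightarrow> Z_ram k {#6#} = 0" "p = 5 \<Longrightarrow> Z_ram k {#7#} = real q ^ 3"
proof -
 show "Z_ram k {#3#} = 1" "Z_ram k {#4#} = real q" "Z_ram k {#5#} = real q ^ 2"
  using Z_single[of 2] Z_single[of 3] Z_single[of 4] p by simp_all
 show "Z_ram k {#2, 2#} = real q - 1" "Z_ram k {#3, 3#} = real q ^ 3 - real q ^ 2"
  using Z_equal_pair[OF order_refl p_gt_1, unfolded one_add_one] Z_equal_pair[of 2] p by simp_all
 show "Z_ram k {#2, 3#} = real q ^ 2 - real q" "Z_ram k {#2, 4#} = real q ^ 3 - real q ^ 2"
  "Z_ram k {#2, 5#} = real q ^ 4 - real q ^ 3" "Z_ram k {#3, 4#} = real q ^ 4 - real q ^ 3"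
  using Z_pair[of 1 2] Z_pair[of 1 3] Z_pair[of 1 4] Z_pair[of 2 3] p by (simp_all add: numeral_2_eq_2[symmetric])
 show "Z_ram k {#6#} = real q ^ 3" "Z_ram k {#7#} = real q ^ 4" if "p \<ge> 7"
  using Z_single[of 5] Z_single[of 6] that by simp_all
 \<comment> \<open>A reduced pole order is prime to p, so order 5 cannot occur.\<close>
 show "Z_ram k {#6#} = 0" if "p = 5"
  using count_one[OF pts_UNIV, of 5] loc_empty[of 5 1] that by (intro Z_ram_eqI) simp_all
 show "Z_ram k {#7#} = real q ^ 3" if p5: "p = 5"
 proof (rule Z_ram_eqI)
  \<comment> \<open>The exponent 5 is not free, so a pole of order 6 has five coefficients instead
    of six and one factor q is lost.\<close>
  have "{i \<in> {1..6::nat}. \<not> p dvd i} = {1, 2, 3, 4, 6}"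
  proof -
   have "{1..6::nat} = {1, 2, 3, 4, 5, 6}" by (auto simp: numeral_eq_Suc le_Suc_eq)
   then show ?thesis unfolding p5 by auto
  qed
  then have "card (loc 6 1) = (q - 1) * q ^ 4" using card_loc(2)[of 6 1] p5 by (simp add: power4_eq_xxxx)
  then have "real (card (CRW {#7#} UNIV)) = real ((q + 1) * ((q - 1) * q ^ 4))"
   using count_one[OF pts_UNIV, of 6] card_Per(1) by simp
  also have "\<dots> = (real q + 1) * ((real q - 1) * real q ^ 4)" by (simp only: of_nat_mult of_nat_add of_nat_1 of_nat_power real_diffs)
  also have "\<dots> = (real q ^ 3 - real q) * real q ^ 3"
   by (simp add: algebra_simps power3_eq_cube power4_eq_xxxx)
  finally show "real (card (CRW {#7#} UNIV)) = (real q ^ 3 - real q) * real q ^ 3" .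
 qed simp
qed

lemma multiset_neI: "count A x \<noteq> count B x \<Longrightarrow> A \<noteq> B" by auto

lemma multiset_ne:
 "{#2, 2, 2#} \<noteq> {#2, 4 :: nat#}" "{#2, 2, 2#} \<noteq> {#3, 3 :: nat#}" "{#2, 2, 2#} \<noteq> {#6 :: nat#}"
 "{#2, 4#} \<noteq> {#3, 3 :: nat#}" "{#2, 4#} \<noteq> {#6 :: nat#}" "{#3, 3#} \<noteq> {#6 :: nat#}"
 "{#2, 2, 3#} \<noteq> {#2, 5 :: nat#}" "{#2, 2, 3#} \<noteq> {#3, 4 :: nat#}" "{#2, 2, 3#} \<noteq> {#7 :: nat#}"
 "{#2, 5#} \<noteq> {#3, 4 :: nat#}" "{#2, 5#} \<noteq> {#7 :: nat#}" "{#3, 4#} \<noteq> {#7 :: nat#}"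
 by (rule multiset_neI[of _ 2], force | rule multiset_neI[of _ 3], force)+

lemma sum_four:
 fixes f :: "'a \<Rightarrow> real"
 assumes "a \<noteq> b" "a \<noteq> c" "a \<noteq> x" "b \<noteq> c" "b \<noteq> x" "c \<noteq> x"
 shows "sum f {a, b, c, x} = f a + f b + f c + f x" using assms by simp

text \<open>Partitions of 3, ..., 7 into parts at least 2. Parts congruent to 1 modulo p are kept at
  this stage; their counts turn out to be zero.\<close>

lemma types:
 assumes c: "c \<in> CR" "c \<noteq> (\<lambda>_. 0)"
 shows "sum_mset (ram_type c) = 3 \<Longrightarrow> ram_type c \<in> {{#3#}}"
  "sum_mset (ram_type c) = 4 \<Longrightarrow> ram_type c \<in> {{#2, 2#}, {#4#}}"
  "sum_mset (ram_type c) = 5 \<Longrightarrow> ram_type c \<in> {{#2, 3#}, {#5#}}"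
  "sum_mset (ram_type c) = 6 \<Longrightarrow> ram_type c \<in> {{#2, 2, 2#}, {#2, 4#}, {#3, 3#}, {#6#}}"
  "sum_mset (ram_type c) = 7 \<Longrightarrow> ram_type c \<in> {{#2, 2, 3#}, {#2, 5#}, {#3, 4#}, {#7#}}"
proof -
 have ne: "ram_type c \<noteq> {#}" using ram_type_eq_empty c by blast
 note parts = multiset_parts_cases[OF ram_type_parts[OF c(1)]]
 show "ram_type c \<in> {{#3#}}" if s: "sum_mset (ram_type c) = 3" by (rule parts) (use s ne in auto)
 show "ram_type c \<in> {{#2, 2#}, {#4#}}" if s: "sum_mset (ram_type c) = 4"
 proof (rule parts)
  fix x y assume "ram_type c = {#x, y#}" "2 \<le> x" "x \<le> y"
  moreover from this have "x = 2 \<and> y = 2" using s by simp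
  ultimately show ?thesis by simp
 qed (use s ne in auto)
 show "ram_type c \<in> {{#2, 3#}, {#5#}}" if s: "sum_mset (ram_type c) = 5"
 proof (rule parts)
  fix x y assume "ram_type c = {#x, y#}" "2 \<le> x" "x \<le> y"
  moreover from this have "x = 2 \<and> y = 3" using s by simp
  ultimately show ?thesis by simp
 qed (use s ne in auto)
 show "ram_type c \<in> {{#2, 2, 2#}, {#2, 4#}, {#3, 3#}, {#6#}}" if s: "sum_mset (ram_type c) = 6"
 proof (rule parts)
  fix x y assume xy: "ram_type c = {#x, y#}" "2 \<le> x" "x \<le> y"
  then have "x + y = 6" using s by simp
  then have "x = 2 \<and> y = 4 \<or> x = 3 \<and> y = 3" using xy by arith
  then show ?thesis using xy by auto
 next
  fix x y z assume "ram_type c = {#x, y, z#}" "2 \<le> x" "x \<le> y" "y \<le> z"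
  moreover from this have "x = 2 \<and> y = 2 \<and> z = 2" using s by simp
  ultimately show ?thesis by simp
 qed (use s ne in auto)
 show "ram_type c \<in> {{#2, 2, 3#}, {#2, 5#}, {#3, 4#}, {#7#}}" if s: "sum_mset (ram_type c) = 7"
 proof (rule parts)
  fix x y assume xy: "ram_type c = {#x, y#}" "2 \<le> x" "x \<le> y"
  then have "x + y = 7" using s by simp
  then have "x = 2 \<and> y = 5 \<or> x = 3 \<and> y = 4" using xy by arith
  then show ?thesis using xy by auto
 next
  fix x y z assume xyz: "ram_type c = {#x, y, z#}" "2 \<le> x" "x \<le> y" "y \<le> z"
  then have "x + y + z = 7" using s by simp
  then have "x = 2 \<and> y = 2 \<and> z = 3" using xyz by arith
  then show ?thesis using xyz by simp
 qed (use s ne in auto)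
qed

end

theorem theorem5p3:
  fixes k :: "'k::{field,finite} itself" and p n q g :: nat
  assumes "Factorial_Ring.prime p" and "p \<ge> 5"
    and "card (UNIV :: 'k set) = q" and "q = p ^ n"
    and "g \<ge> 1"
  shows
    "(g = 1 * (p - 1) div 2 \<longrightarrow>
        Z_genus k g = 1 \<and>
        ramification_data_of_genus k g = {{#3#}} \<and>
        Z_ram k {#3#} = 1) \<and>
     (g = 2 * (p - 1) div 2 \<longrightarrow>
        Z_genus k g = 2 * real q - 1 \<and>
        ramification_data_of_genus k g = {{#2, 2#}, {#4#}} \<and>
        Z_ram k {#2, 2#} = real q - 1 \<and>
        Z_ram k {#4#} = real q) \<and>
     (g = 3 * (p - 1) div 2 \<longrightarrow>
        Z_genus k g = 2 * real q ^ 2 - real q \<and>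
        ramification_data_of_genus k g = {{#2, 3#}, {#5#}} \<and>
        Z_ram k {#2, 3#} = real q ^ 2 - real q \<and>
        Z_ram k {#5#} = real q ^ 2) \<and>
     (g = 4 * (p - 1) div 2 \<longrightarrow>
        (p = 5 \<longrightarrow>
           Z_genus k g = 3 * real q ^ 3 - 3 * real q ^ 2 \<and>
           ramification_data_of_genus k g = {{#2, 2, 2#}, {#2, 4#}, {#3, 3#}}) \<and>
        (p \<ge> 7 \<longrightarrow>
           Z_genus k g = 4 * real q ^ 3 - 3 * real q ^ 2 \<and>
           ramification_data_of_genus k g = {{#2, 2, 2#}, {#2, 4#}, {#3, 3#}, {#6#}} \<and>
           Z_ram k {#6#} = real q ^ 3) \<and>
        Z_ram k {#2, 2, 2#} = real q ^ 3 - real q ^ 2 \<and>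
        Z_ram k {#2, 4#} = real q ^ 3 - real q ^ 2 \<and>
        Z_ram k {#3, 3#} = real q ^ 3 - real q ^ 2) \<and>
     (g = 5 * (p - 1) div 2 \<longrightarrow>
        (p = 5 \<longrightarrow>
           Z_genus k g = 3 * real q ^ 4 - 3 * real q ^ 3 + real q ^ 2 \<and>
           Z_ram k {#7#} = real q ^ 3) \<and>
        (p \<ge> 7 \<longrightarrow>
           Z_genus k g = 4 * real q ^ 4 - 4 * real q ^ 3 + real q ^ 2 \<and>
           Z_ram k {#7#} = real q ^ 4) \<and>
        ramification_data_of_genus k g = {{#2, 2, 3#}, {#2, 5#}, {#3, 4#}, {#7#}} \<and>
        Z_ram k {#2, 2, 3#} = real q ^ 4 - 2 * real q ^ 3 + real q ^ 2 \<and>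
        Z_ram k {#2, 5#} = real q ^ 4 - real q ^ 3 \<and>
        Z_ram k {#3, 4#} = real q ^ 4 - real q ^ 3)"
proof -
 interpret finite_base k p n q by unfold_locales (rule assms)+
 have "odd p" using assms(1,2) by (intro prime_odd_nat) auto
 \<comment> \<open>\<open>p - 1\<close> is even, so the division by 2 in the genus is exact.\<close>
 then have g: "2 * g = (p - 1) * m" if "g = m * (p - 1) div 2" for m using that by (simp add: mult.commute)
 have p: "p = 5 \<or> p \<ge> 7"
 proof -
  have "p \<noteq> 6" using \<open>odd p\<close> by auto
  then show ?thesis using assms(2) by linarith
 qed
 have q2: "real q \<ge> 2" using q_gt_1 by simp
 \<comment> \<open>Positive counts are what put the listed multisets among the ramification data
   that really occur.\<close>
 have pos: "real q - 1 > 0" "real q ^ 2 - real q > 0" "real q ^ 3 - real q ^ 2 > 0" "real q ^ 4 - real q ^ 3 > 0"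
  "real q ^ 4 - 2 * real q ^ 3 + real q ^ 2 > 0" "real q > 0"
 proof -
  show r: "real q - 1 > 0" "real q > 0" using q2 by simp_all
  have "real q ^ 2 - real q = real q * (real q - 1)" "real q ^ 3 - real q ^ 2 = real q ^ 2 * (real q - 1)"
   "real q ^ 4 - real q ^ 3 = real q ^ 3 * (real q - 1)" "real q ^ 4 - 2 * real q ^ 3 + real q ^ 2 = real q ^ 2 * (real q - 1) ^ 2"
   by (simp_all add: algebra_simps power2_eq_square power3_eq_cube power4_eq_xxxx)
  then show "real q ^ 2 - real q > 0" "real q ^ 3 - real q ^ 2 > 0" "real q ^ 4 - real q ^ 3 > 0"
   "real q ^ 4 - 2 * real q ^ 3 + real q ^ 2 > 0" using r by simp_all
 qed
 note Z = Z_values[OF assms(2)] Z_222 Z_223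
 have G1: "Z_genus k g = (\<Sum>R\<in>{{#3#}}. Z_ram k R)" "ramification_data_of_genus k g = {R \<in> {{#3#}}. Z_ram k R \<noteq> 0}"
  if "g = 1 * (p - 1) div 2" using genus_class[OF g[OF that], of "{{#3#}}"] types(1) by auto
 have G2: "Z_genus k g = (\<Sum>R\<in>{{#2, 2#}, {#4#}}. Z_ram k R)"
   "ramification_data_of_genus k g = {R \<in> {{#2, 2#}, {#4#}}. Z_ram k R \<noteq> 0}"
  if "g = 2 * (p - 1) div 2" by (rule genus_class[OF g[OF that]]; use types(2) in force)+
 have G3: "Z_genus k g = (\<Sum>R\<in>{{#2, 3#}, {#5#}}. Z_ram k R)"
   "ramification_data_of_genus k g = {R \<in> {{#2, 3#}, {#5#}}. Z_ram k R \<noteq> 0}"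
  if "g = 3 * (p - 1) div 2" by (rule genus_class[OF g[OF that]]; use types(3) in force)+
 have G4: "Z_genus k g = (\<Sum>R\<in>{{#2, 2, 2#}, {#2, 4#}, {#3, 3#}, {#6#}}. Z_ram k R)"
   "ramification_data_of_genus k g = {R \<in> {{#2, 2, 2#}, {#2, 4#}, {#3, 3#}, {#6#}}. Z_ram k R \<noteq> 0}"
  if "g = 4 * (p - 1) div 2" by (rule genus_class[OF g[OF that]]; use types(4) in force)+
 have G5: "Z_genus k g = (\<Sum>R\<in>{{#2, 2, 3#}, {#2, 5#}, {#3, 4#}, {#7#}}. Z_ram k R)"
   "ramification_data_of_genus k g = {R \<in> {{#2, 2, 3#}, {#2, 5#}, {#3, 4#}, {#7#}}. Z_ram k R \<noteq> 0}"
  if "g = 5 * (p - 1) div 2" by (rule genus_class[OF g[OF that]]; use types(5) in force)+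
 show ?thesis
 proof (intro conjI impI)
  assume "g = 1 * (p - 1) div 2"
  note G = G1[OF this]
  show "Z_genus k g = 1" "ramification_data_of_genus k g = {{#3#}}" "Z_ram k {#3#} = 1"
   unfolding G using Z by auto
 next
  assume "g = 2 * (p - 1) div 2"
  note G = G2[OF this]
  show "Z_genus k g = 2 * real q - 1" unfolding G using Z by simp
  show "ramification_data_of_genus k g = {{#2, 2#}, {#4#}}" unfolding G using Z pos by auto
  show "Z_ram k {#2, 2#} = real q - 1" "Z_ram k {#4#} = real q" using Z by simp_all
 next
  assume "g = 3 * (p - 1) div 2"
  note G = G3[OF this]
  show "Z_genus k g = 2 * real q ^ 2 - real q" unfolding G using Z by simp
  show "ramification_data_of_genus k g = {{#2, 3#}, {#5#}}" unfolding G using Z pos by auto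
  show "Z_ram k {#2, 3#} = real q ^ 2 - real q" "Z_ram k {#5#} = real q ^ 2" using Z by simp_all
 next
  assume "g = 4 * (p - 1) div 2"
  note G = G4[OF this]
  {
   assume p5: "p = 5"
   show "Z_genus k g = 3 * real q ^ 3 - 3 * real q ^ 2" unfolding G sum_four[OF multiset_ne(1-6)] using Z p5 by simp
   show "ramification_data_of_genus k g = {{#2, 2, 2#}, {#2, 4#}, {#3, 3#}}" unfolding G using Z p5 pos by auto
  }
  {
   assume p7: "p \<ge> 7"
   show "Z_genus k g = 4 * real q ^ 3 - 3 * real q ^ 2" unfolding G sum_four[OF multiset_ne(1-6)] using Z p7 by simp
   show "ramification_data_of_genus k g = {{#2, 2, 2#}, {#2, 4#}, {#3, 3#}, {#6#}}" unfolding G using Z p7 pos by auto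
   show "Z_ram k {#6#} = real q ^ 3" using Z p7 by simp
  }
  show "Z_ram k {#2, 2, 2#} = real q ^ 3 - real q ^ 2" "Z_ram k {#2, 4#} = real q ^ 3 - real q ^ 2"
   "Z_ram k {#3, 3#} = real q ^ 3 - real q ^ 2" using Z by simp_all
 next
  assume "g = 5 * (p - 1) div 2"
  note G = G5[OF this]
  have z223: "Z_ram k {#2, 2, 3#} = real q ^ 4 - 2 * real q ^ 3 + real q ^ 2" using Z_223 assms(2) by simp
  have z7: "Z_ram k {#7#} \<noteq> 0" using p Z pos by auto
  {
   assume p5: "p = 5"
   show "Z_genus k g = 3 * real q ^ 4 - 3 * real q ^ 3 + real q ^ 2" unfolding G sum_four[OF multiset_ne(7-12)] using Z z223 p5 by simp
   show "Z_ram k {#7#} = real q ^ 3" using Z p5 by simp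
  }
  {
   assume p7: "p \<ge> 7"
   show "Z_genus k g = 4 * real q ^ 4 - 4 * real q ^ 3 + real q ^ 2" unfolding G sum_four[OF multiset_ne(7-12)] using Z z223 p7 by simp
   show "Z_ram k {#7#} = real q ^ 4" using Z p7 by simp
  }
  show "ramification_data_of_genus k g = {{#2, 2, 3#}, {#2, 5#}, {#3, 4#}, {#7#}}" unfolding G using Z z223 z7 pos by auto
  show "Z_ram k {#2, 2, 3#} = real q ^ 4 - 2 * real q ^ 3 + real q ^ 2" by (rule z223)
  show "Z_ram k {#2, 5#} = real q ^ 4 - real q ^ 3" "Z_ram k {#3, 4#} = real q ^ 4 - real q ^ 3" using Z by simp_all
 qed
qed

end
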